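(* Let $\ell,m\ge1$ be integers, let $\mathfrak g=\mathfrak{sl}_{n+1}$, and suppose $\ell\le n$. Then: (a) For any right $\mathrm{Aff}^m(S_\ell)$-module $M$ there is a unique $L^m(\mathfrak g)$-module structure on $\mathcal F(M)=M\otimes_{\mathbb C[S_\ell]}V^{\otimes\ell}$ extending, for every $i\in\{1,\dots,m\}$, the $L_i(\mathfrak g)$-module structure given by $$(x\otimes t_i^{p})(w\otimes\mathbf v)=\sum_{j=1}^{\ell} w\,\mathbf y_{i,j}^{\,p}\otimes (x)_j\mathbf v\qquad (x\in\mathfrak g,\ p\in\mathbb Z,\ w\in M,\ \mathbf v\in V^{\otimes\ell}).$$ (b) $\mathcal F$, sending $M$ to $\mathcal F(M)$ with this structure and a morphism $f$ to $f\otimes 1$, is a fully faithful functor from the category of right $\mathrm{Aff}^m(S_\ell)$-modules to the category of left $L^m(\mathfrak g)$-modules. (c) Let $L^m(\mathfrak g)\text{-}\mathrm{Mod}^{\ell}$ be the full subcategory of all $L^m(\mathfrak g)$-modules whose restriction to $\mathfrak g$ (via $x\mapsto x\otimes1$) is locally finite dimensional and all of whose composition factors as $\mathfrak g$-modules are composition factors of $V^{\otimes\ell}$. Then $\mathcal F$ is an equivalence from the category of right $\mathrm{Aff}^m(S_\ell)$-modules to $L^m(\mathfrak g)\text{-}\mathrm{Mod}^{\ell}$.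
   Context: Everything is over $\mathbb C$. $L^m(\mathfrak g)=\mathfrak g\otimes\mathbb C[t_1^{\pm1},\dots,t_m^{\pm1}]$ with bracket $[a\otimes f,b\otimes g]=[a,b]\otimes fg$, and $L_i(\mathfrak g)=\mathfrak g\otimes\mathbb C[t_i^{\pm1}]\subset L^m(\mathfrak g)$. $V=\mathbb C^{n+1}$ is the natural representation of $\mathfrak{sl}_{n+1}$; $(x)_j$ denotes $x$ acting on the $j$-th tensor factor of $V^{\otimes\ell}$; $S_\ell$ acts on $V^{\otimes\ell}$ on the left by permuting tensor factors ($\sigma_k$ swaps the factors $k$ and $k+1$). $\mathrm{Aff}^m(S_\ell)$ is the unital associative $\mathbb C$-algebra generated by invertible elements $\sigma_k$ ($1\le k\le\ell-1$), $\mathbf y_{i,r}$ ($1\le i\le m$, $1\le r\le\ell$) with relations $\sigma_k\sigma_{k+1}\sigma_k=\sigma_{k+1}\sigma_k\sigma_{k+1}$; $\sigma_k\sigma_j=\sigma_j\sigma_k$ for $|k-j|>1$; $\sigma_k^2=1$; $\mathbf y_{i,s}\mathbf y_{i,p}=\mathbf y_{i,p}\mathbf y_{i,s}$; $\mathbf y_{i,s}\sigma_k=\sigma_k\mathbf y_{i,s}$ for $s\notin\{k,k+1\}$; $\sigma_k\mathbf y_{i,k}\sigma_k=\mathbf y_{i,k+1}$; $\mathbf y_{i,1}\cdots\mathbf y_{i,\ell}\,\mathbf y_{i',1}=\mathbf y_{i',1}\,\mathbf y_{i,1}\cdots\mathbf y_{i,\ell}$; $\mathbf y_{i',1}\mathbf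 y_{i,2}=\mathbf y_{i,2}\mathbf y_{i',1}$ (for all indices that make sense, $i,i'\in\{1,\dots,m\}$). It is isomorphic to the group algebra $\mathbb C[(\mathbb Z^\ell)^m\rtimes S_\ell]$, with $S_\ell$ acting diagonally by permuting coordinates. The subalgebra generated by the $\sigma_k$ is $\mathbb C[S_\ell]$. *)

theory Defs
  imports
    "HOL-Analysis.Determinants"
    "HOL-Algebra.QuotRing"
    "HOL-Algebra.Algebraic_Closure_Type"
    "HOL-Library.Poly_Mapping"
begin

section \<open>Vector spaces, modules and categories\<close>

abbreviation CC :: "complex ring"
  where "CC \<equiv> ring_of_type_algebra"

text \<open>A complex vector space is an \<open>N\<close> with \<open>module CC N\<close>. In records used as vector spaces
  the fields \<open>mult\<close> and \<open>one\<close> carry no information.\<close>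

definition quot_space :: "(complex, 'v) module \<Rightarrow> 'v set \<Rightarrow> (complex, 'v set) module"
  where "quot_space N B =
    \<lparr>carrier = a_rcosets\<^bsub>N\<^esub> B, mult = undefined, one = undefined, zero = B, add = set_add N,
     Module.module.smult = (\<lambda>c E. \<Union>((\<lambda>v. B +>\<^bsub>N\<^esub> (c \<odot>\<^bsub>N\<^esub> v)) ` E))\<rparr>"

text \<open>Unital right modules over a ring \<open>A\<close>, not necessarily commutative. When \<open>A\<close> is a complex
  algebra, the vector space structure of the module is the action of the scalars of \<open>A\<close>, and
  \<open>A\<close>-linear maps are automatically complex linear.\<close>

locale right_module = A?: ring A + M?: abelian_group M
  for A :: "'r ring" (structure) and M :: "'a ring" (structure)
    and r :: "'a \<Rightarrow> 'r \<Rightarrow> 'a" +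
  assumes ract_closed: "\<lbrakk>w \<in> carrier M; a \<in> carrier A\<rbrakk> \<Longrightarrow> r w a \<in> carrier M"
    and ract_l_distr: "\<lbrakk>w \<in> carrier M; w' \<in> carrier M; a \<in> carrier A\<rbrakk>
      \<Longrightarrow> r (w \<oplus>\<^bsub>M\<^esub> w') a = r w a \<oplus>\<^bsub>M\<^esub> r w' a"
    and ract_r_distr: "\<lbrakk>w \<in> carrier M; a \<in> carrier A; b \<in> carrier A\<rbrakk>
      \<Longrightarrow> r w (a \<oplus>\<^bsub>A\<^esub> b) = r w a \<oplus>\<^bsub>M\<^esub> r w b"
    and ract_assoc: "\<lbrakk>w \<in> carrier M; a \<in> carrier A; b \<in> carrier A\<rbrakk>
      \<Longrightarrow> r w (a \<otimes>\<^bsub>A\<^esub> b) = r (r w a) b"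
    and ract_one: "w \<in> carrier M \<Longrightarrow> r w \<one>\<^bsub>A\<^esub> = w"

text \<open>Homomorphisms are extensional functions, so that equality of morphisms is equality of
  functions.\<close>

definition rmod_hom ::
  "'r ring \<Rightarrow> 'a ring \<times> ('a \<Rightarrow> 'r \<Rightarrow> 'a) \<Rightarrow> 'b ring \<times> ('b \<Rightarrow> 'r \<Rightarrow> 'b) \<Rightarrow> ('a \<Rightarrow> 'b) set"
  where "rmod_hom A = (\<lambda>(M, r) (M', r').
    {f \<in> carrier M \<rightarrow>\<^sub>E carrier M'.
      (\<forall>u\<in>carrier M. \<forall>w\<in>carrier M. f (u \<oplus>\<^bsub>M\<^esub> w) = f u \<oplus>\<^bsub>M'\<^esub> f w) \<and>
      (\<forall>w\<in>carrier M. \<forall>a\<in>carrier A. f (r w a) = r' (f w) a)})"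

definition rmod_iso ::
  "'r ring \<Rightarrow> 'a ring \<times> ('a \<Rightarrow> 'r \<Rightarrow> 'a) \<Rightarrow> 'b ring \<times> ('b \<Rightarrow> 'r \<Rightarrow> 'b) \<Rightarrow> ('a \<Rightarrow> 'b) set"
  where "rmod_iso A P Q = {f \<in> rmod_hom A P Q. bij_betw f (carrier (fst P)) (carrier (fst Q))}"

text \<open>A Lie algebra is given by a vector space record in which \<open>mult\<close> is the Lie bracket
  (\<open>one\<close> carries no information).\<close>

locale lie_module = N?: Module.module CC N
  for L :: "(complex, 'x) module" and N :: "(complex, 'v) module" (structure)
    and \<rho> :: "'x \<Rightarrow> 'v \<Rightarrow> 'v" +
  assumes act_closed: "\<lbrakk>x \<in> carrier L; v \<in> carrier N\<rbrakk> \<Longrightarrow> \<rho> x v \<in> carrier N"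
    and act_r_add: "\<lbrakk>x \<in> carrier L; u \<in> carrier N; v \<in> carrier N\<rbrakk>
      \<Longrightarrow> \<rho> x (u \<oplus>\<^bsub>N\<^esub> v) = \<rho> x u \<oplus>\<^bsub>N\<^esub> \<rho> x v"
    and act_r_smult: "\<lbrakk>x \<in> carrier L; v \<in> carrier N\<rbrakk>
      \<Longrightarrow> \<rho> x (c \<odot>\<^bsub>N\<^esub> v) = c \<odot>\<^bsub>N\<^esub> \<rho> x v"
    and act_l_add: "\<lbrakk>x \<in> carrier L; y \<in> carrier L; v \<in> carrier N\<rbrakk>
      \<Longrightarrow> \<rho> (x \<oplus>\<^bsub>L\<^esub> y) v = \<rho> x v \<oplus>\<^bsub>N\<^esub> \<rho> y v"
    and act_l_smult: "\<lbrakk>x \<in> carrier L; v \<in> carrier N\<rbrakk>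
      \<Longrightarrow> \<rho> (c \<odot>\<^bsub>L\<^esub> x) v = c \<odot>\<^bsub>N\<^esub> \<rho> x v"
    and act_bracket: "\<lbrakk>x \<in> carrier L; y \<in> carrier L; v \<in> carrier N\<rbrakk>
      \<Longrightarrow> \<rho> (x \<otimes>\<^bsub>L\<^esub> y) v = \<rho> x (\<rho> y v) \<ominus>\<^bsub>N\<^esub> \<rho> y (\<rho> x v)"

type_synonym ('x, 'v) lmod = "(complex, 'v) module \<times> ('x \<Rightarrow> 'v \<Rightarrow> 'v)"

definition lie_hom ::
  "(complex, 'x) module \<Rightarrow> ('x, 'v) lmod \<Rightarrow> ('x, 'u) lmod \<Rightarrow> ('v \<Rightarrow> 'u) set"
  where "lie_hom L = (\<lambda>(N, \<rho>) (N', \<rho>').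
    {h \<in> carrier N \<rightarrow>\<^sub>E carrier N'.
      (\<forall>u\<in>carrier N. \<forall>v\<in>carrier N. h (u \<oplus>\<^bsub>N\<^esub> v) = h u \<oplus>\<^bsub>N'\<^esub> h v) \<and>
      (\<forall>c. \<forall>v\<in>carrier N. h (c \<odot>\<^bsub>N\<^esub> v) = c \<odot>\<^bsub>N'\<^esub> h v) \<and>
      (\<forall>x\<in>carrier L. \<forall>v\<in>carrier N. h (\<rho> x v) = \<rho>' x (h v))})"

definition lie_iso ::
  "(complex, 'x) module \<Rightarrow> ('x, 'v) lmod \<Rightarrow> ('x, 'u) lmod \<Rightarrow> ('v \<Rightarrow> 'u) set"
  where "lie_iso L P Q = {h \<in> lie_hom L P Q. bij_betw h (carrier (fst P)) (carrier (fst Q))}"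

definition lie_submodule :: "(complex, 'x) module \<Rightarrow> ('x, 'v) lmod \<Rightarrow> 'v set \<Rightarrow> bool"
  where "lie_submodule L = (\<lambda>(N, \<rho>) U.
    submodule U CC N \<and> (\<forall>x\<in>carrier L. \<forall>u\<in>U. \<rho> x u \<in> U))"

definition lie_simple :: "(complex, 'x) module \<Rightarrow> ('x, 'v) lmod \<Rightarrow> bool"
  where "lie_simple L = (\<lambda>(N, \<rho>). lie_module L N \<rho> \<and> carrier N \<noteq> {\<zero>\<^bsub>N\<^esub>} \<and>
    (\<forall>U. lie_submodule L (N, \<rho>) U \<longrightarrow> U = {\<zero>\<^bsub>N\<^esub>} \<or> U = carrier N))"

definition lie_subquotient :: "('x, 'v) lmod \<Rightarrow> 'v set \<Rightarrow> 'v set \<Rightarrow> ('x, 'v set) lmod"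
  where "lie_subquotient = (\<lambda>(N, \<rho>) U B.
    (quot_space (N\<lparr>carrier := U\<rparr>) B, \<lambda>x E. \<Union>((\<lambda>v. B +>\<^bsub>N\<^esub> \<rho> x v) ` E)))"

text \<open>For modules without a composition series, a composition factor is a simple module
  isomorphic to a subquotient.\<close>

definition composition_factor ::
  "(complex, 'x) module \<Rightarrow> ('x, 's) lmod \<Rightarrow> ('x, 'v) lmod \<Rightarrow> bool"
  where "composition_factor L S N \<longleftrightarrow> lie_simple L S \<and>
    (\<exists>U B. lie_submodule L N U \<and> lie_submodule L N B \<and> B \<subseteq> U \<and>
      lie_iso L S (lie_subquotient N U B) \<noteq> {})"

definition finite_dim :: "(complex, 'v) module \<Rightarrow> 'v set \<Rightarrow> bool"
  where "finite_dim N U \<longleftrightarrow> (\<exists>B. finite B \<and> B \<subseteq> U \<and>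
    (\<forall>u\<in>U. \<exists>c. u = (\<Oplus>\<^bsub>N\<^esub>b\<in>B. c b \<odot>\<^bsub>N\<^esub> b)))"

definition locally_finite_dim :: "(complex, 'x) module \<Rightarrow> ('x, 'v) lmod \<Rightarrow> bool"
  where "locally_finite_dim L N \<longleftrightarrow> (\<forall>v\<in>carrier (fst N).
    \<exists>U. lie_submodule L N U \<and> finite_dim (fst N) U \<and> v \<in> U)"

text \<open>Composition \<open>Comp P Q T g f\<close> is that of \<open>f : P \<rightarrow> Q\<close> followed by \<open>g : Q \<rightarrow> T\<close>.\<close>

record ('o, 'f) category =
  Ob :: "'o set"
  Hom :: "'o \<Rightarrow> 'o \<Rightarrow> 'f set"
  Ident :: "'o \<Rightarrow> 'f"
  Comp :: "'o \<Rightarrow> 'o \<Rightarrow> 'o \<Rightarrow> 'f \<Rightarrow> 'f \<Rightarrow> 'f"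

definition is_functor ::
  "('o, 'f) category \<Rightarrow> ('p, 'g) category \<Rightarrow> ('o \<Rightarrow> 'p) \<Rightarrow> ('o \<Rightarrow> 'o \<Rightarrow> 'f \<Rightarrow> 'g) \<Rightarrow> bool"
  where "is_functor C D Fo Fm \<longleftrightarrow>
    (\<forall>P\<in>Ob C. Fo P \<in> Ob D) \<and>
    (\<forall>P\<in>Ob C. \<forall>Q\<in>Ob C. \<forall>f\<in>Hom C P Q. Fm P Q f \<in> Hom D (Fo P) (Fo Q)) \<and>
    (\<forall>P\<in>Ob C. Fm P P (Ident C P) = Ident D (Fo P)) \<and>
    (\<forall>P\<in>Ob C. \<forall>Q\<in>Ob C. \<forall>T\<in>Ob C. \<forall>f\<in>Hom C P Q. \<forall>g\<in>Hom C Q T.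
      Fm P T (Comp C P Q T g f) = Comp D (Fo P) (Fo Q) (Fo T) (Fm Q T g) (Fm P Q f))"

definition fully_faithful ::
  "('o, 'f) category \<Rightarrow> ('p, 'g) category \<Rightarrow> ('o \<Rightarrow> 'p) \<Rightarrow> ('o \<Rightarrow> 'o \<Rightarrow> 'f \<Rightarrow> 'g) \<Rightarrow> bool"
  where "fully_faithful C D Fo Fm \<longleftrightarrow>
    (\<forall>P\<in>Ob C. \<forall>Q\<in>Ob C. bij_betw (Fm P Q) (Hom C P Q) (Hom D (Fo P) (Fo Q)))"


section \<open>The algebra \<open>Aff\<^sup>m(S\<^sub>l)\<close>\<close>

text \<open>The free monoid, written additively, so that \<open>'x fmon \<Rightarrow>\<^sub>0 complex\<close> with the library's
  convolution product is the free associative algebra on \<open>'x\<close>.\<close>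

datatype 'x fmon = FMon (letters: "'x list")

instantiation fmon :: (type) monoid_add
begin
definition "0 = FMon []"
definition "u + v = FMon (letters u @ letters v)"
instance by standard (auto simp: zero_fmon_def plus_fmon_def)
end

text \<open>The type \<open>'m\<close> is the index set \<open>{1,\<dots>,m}\<close>. Tensor positions are counted from \<open>0\<close>: the
  positions are \<open>{..<l}\<close>, and \<open>Sig k\<close> (with \<open>k + 1 < l\<close>) exchanges \<open>k\<close> and \<open>k + 1\<close>. No formal
  inverse of \<open>Sig k\<close> is needed because of the relation \<open>\<sigma>\<^sub>k\<^sup>2 = 1\<close>.\<close>

datatype 'm gen = Sig nat | Y 'm nat | Yinv 'm nat

type_synonym 'm free_alg = "'m gen fmon \<Rightarrow>\<^sub>0 complex"
type_synonym 'm aff = "'m free_alg set"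

fun valid_gen :: "nat \<Rightarrow> 'm gen \<Rightarrow> bool" where
  "valid_gen l (Sig k) \<longleftrightarrow> k + 1 < l"
| "valid_gen l (Y i s) \<longleftrightarrow> s < l"
| "valid_gen l (Yinv i s) \<longleftrightarrow> s < l"

definition free_alg :: "nat \<Rightarrow> 'm free_alg ring"
  where "free_alg l =
    \<lparr>carrier = {p. \<forall>u\<in>Poly_Mapping.keys p. \<forall>g\<in>set (letters u). valid_gen l g},
     mult = (*), one = 1, zero = 0, add = (+)\<rparr>"

definition word :: "'m gen list \<Rightarrow> 'm free_alg"
  where "word gs = Poly_Mapping.single (FMon gs) 1"

text \<open>The defining relations, as equalities of words.\<close>

inductive aff_rel :: "nat \<Rightarrow> 'm gen list \<Rightarrow> 'm gen list \<Rightarrow> bool" for l where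
  braid: "k + 2 < l \<Longrightarrow>
    aff_rel l [Sig k, Sig (k+1), Sig k] [Sig (k+1), Sig k, Sig (k+1)]"
| far: "\<lbrakk>k + 1 < j; j + 1 < l\<rbrakk> \<Longrightarrow> aff_rel l [Sig k, Sig j] [Sig j, Sig k]"
| invol: "k + 1 < l \<Longrightarrow> aff_rel l [Sig k, Sig k] []"
| y_inv_r: "s < l \<Longrightarrow> aff_rel l [Y i s, Yinv i s] []"
| y_inv_l: "s < l \<Longrightarrow> aff_rel l [Yinv i s, Y i s] []"
| y_comm: "\<lbrakk>s < l; p < l\<rbrakk> \<Longrightarrow> aff_rel l [Y i s, Y i p] [Y i p, Y i s]"
| y_sig_far: "\<lbrakk>s < l; k + 1 < l; s \<notin> {k, k+1}\<rbrakk> \<Longrightarrow> aff_rel l [Y i s, Sig k] [Sig k, Y i s]"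
| y_sig: "k + 1 < l \<Longrightarrow> aff_rel l [Sig k, Y i k, Sig k] [Y i (k+1)]"
| y_prod: "0 < l \<Longrightarrow>
    aff_rel l (map (Y i) [0..<l] @ [Y i' 0]) (Y i' 0 # map (Y i) [0..<l])"
| y_mixed: "1 < l \<Longrightarrow> aff_rel l [Y i' 0, Y i 1] [Y i 1, Y i' 0]"

definition aff_ideal :: "nat \<Rightarrow> 'm free_alg set"
  where "aff_ideal l = Idl\<^bsub>free_alg l\<^esub> {word u - word v | u v. aff_rel l u v}"

definition Aff :: "nat \<Rightarrow> 'm aff ring"
  where "Aff l = free_alg l Quot aff_ideal l"

definition aff_class :: "nat \<Rightarrow> 'm free_alg \<Rightarrow> 'm aff"
  where "aff_class l p = aff_ideal l +>\<^bsub>free_alg l\<^esub> p"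

definition y_el :: "nat \<Rightarrow> 'm \<Rightarrow> nat \<Rightarrow> 'm aff"
  where "y_el l i j = aff_class l (word [Y i j])"

text \<open>The free subalgebra on the \<open>\<sigma>\<^sub>k\<close>. Its image under \<^const>\<open>aff_class\<close> is the subalgebra
  \<open>\<complex>[S\<^sub>l]\<close> of \<^const>\<open>Aff\<close>.\<close>

definition sig_alg :: "nat \<Rightarrow> 'm free_alg set"
  where "sig_alg l = {p. \<forall>u\<in>Poly_Mapping.keys p. \<forall>g\<in>set (letters u). \<exists>k. k + 1 < l \<and> g = Sig k}"


section \<open>The space \<open>V\<^sup>\<otimes>\<^sup>l\<close> and the Lie algebras\<close>

text \<open>With \<open>V = complex ^ 'n\<close>, a tensor in \<open>V\<^sup>\<otimes>\<^sup>l\<close> is the function giving its coordinates: the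
  value at the list \<open>[a\<^sub>1,\<dots>,a\<^sub>l]\<close> is the coefficient of \<open>e\<^bsub>a\<^sub>1\<^esub> \<otimes> \<dots> \<otimes> e\<^bsub>a\<^sub>l\<^esub>\<close>.\<close>

type_synonym 'n tensor = "'n list \<Rightarrow> complex"

definition tpow :: "nat \<Rightarrow> (complex, 'n tensor) module"
  where "tpow l =
    \<lparr>carrier = {v. \<forall>a. length a \<noteq> l \<longrightarrow> v a = 0}, mult = undefined, one = undefined,
     zero = (\<lambda>a. 0), add = (\<lambda>u v a. u a + v a), Module.module.smult = (\<lambda>c v a. c * v a)\<rparr>"

definition pure_tensor :: "(complex ^ 'n) list \<Rightarrow> 'n tensor"
  where "pure_tensor vs = (\<lambda>a. if length a = length vs then \<Prod>i<length vs. vs ! i $ a ! i else 0)"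

text \<open>\<open>slot x j v\<close> is \<open>(x)\<^sub>j v\<close>, and \<open>swap k v\<close> is \<open>\<sigma>\<^sub>k v\<close>.\<close>

definition slot :: "complex ^ 'n ^ 'n \<Rightarrow> nat \<Rightarrow> 'n::finite tensor \<Rightarrow> 'n tensor"
  where "slot x j v = (\<lambda>a. \<Sum>b\<in>UNIV. x $ (a ! j) $ b * v (a[j := b]))"

definition swap :: "nat \<Rightarrow> 'n tensor \<Rightarrow> 'n tensor"
  where "swap k v = (\<lambda>a. v (a[k := a ! (k+1), k+1 := a ! k]))"

lemma slot_pure_tensor:
  assumes "j < length vs"
  shows "slot x j (pure_tensor vs) = pure_tensor (vs[j := x *v (vs ! j)])"
proof
  fix a :: "'a list"
  show "slot x j (pure_tensor vs) a = pure_tensor (vs[j := x *v (vs ! j)]) a"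
  proof (cases "length a = length vs")
    case True
    have split: "(\<Prod>i<length vs. f i) = f j * (\<Prod>i\<in>{..<length vs} - {j}. f i)"
      for f :: "nat \<Rightarrow> complex"
      using assms by (simp add: prod.remove)
    have rest: "(\<Prod>i\<in>{..<length vs} - {j}. vs ! i $ a[j := b] ! i) =
      (\<Prod>i\<in>{..<length vs} - {j}. vs ! i $ a ! i)" for b
      by (rule prod.cong) auto
    have rest': "(\<Prod>i\<in>{..<length vs} - {j}. vs[j := x *v vs ! j] ! i $ a ! i) =
      (\<Prod>i\<in>{..<length vs} - {j}. vs ! i $ a ! i)"
      by (rule prod.cong) auto
    show ?thesis
      using True assms
      by (simp add: slot_def pure_tensor_def split rest rest' matrix_vector_mult_def
          sum_distrib_right mult.assoc)
  qed (simp add: slot_def pure_tensor_def)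
qed

lemma swap_pure_tensor:
  assumes "k + 1 < length vs"
  shows "swap k (pure_tensor vs) = pure_tensor (vs[k := vs ! (k+1), k+1 := vs ! k])"
proof
  fix a :: "'a list"
  show "swap k (pure_tensor vs) a = pure_tensor (vs[k := vs ! (k+1), k+1 := vs ! k]) a"
  proof (cases "length a = length vs")
    case True
    have split: "(\<Prod>i<length vs. f i) = f k * f (k+1) * (\<Prod>i\<in>{..<length vs} - {k, k+1}. f i)"
      for f :: "nat \<Rightarrow> complex"
    proof -
      have "(\<Prod>i<length vs. f i) = prod f ({..<length vs} - {k, k+1}) * prod f {k, k+1}"
        using assms by (intro prod.subset_diff) auto
      then show ?thesis by (simp add: mult_ac)
    qed
    have rest: "(\<Prod>i\<in>{..<length vs} - {k, k+1}. vs ! i $ a[k := a ! (k+1), k+1 := a ! k] ! i) =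
      (\<Prod>i\<in>{..<length vs} - {k, k+1}. vs[k := vs ! (k+1), k+1 := vs ! k] ! i $ a ! i)"
      by (rule prod.cong) auto
    show ?thesis
      unfolding swap_def pure_tensor_def
      using True assms by (simp add: split rest[simplified])
  qed (simp add: swap_def pure_tensor_def)
qed

fun gen_op :: "'m gen \<Rightarrow> 'n tensor \<Rightarrow> 'n tensor" where
  "gen_op (Sig k) v = swap k v"
| "gen_op _ v = v"

text \<open>The left action of \<^const>\<open>sig_alg\<close> on \<open>V\<^sup>\<otimes>\<^sup>l\<close>, with \<open>\<sigma>\<^sub>k\<close> acting by \<^const>\<open>swap\<close> (the second
  equation of \<^const>\<open>gen_op\<close> plays no role).\<close>

definition sig_act :: "'m free_alg \<Rightarrow> 'n tensor \<Rightarrow> 'n tensor"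
  where "sig_act p v =
    (\<lambda>a. \<Sum>u\<in>Poly_Mapping.keys p. Poly_Mapping.lookup p u * foldr gen_op (letters u) v a)"

definition sl :: "(complex, complex ^ 'n ^ 'n::finite) module"
  where "sl =
    \<lparr>carrier = {x. trace x = 0}, mult = (\<lambda>x y. x ** y - y ** x), one = undefined, zero = 0,
     add = (+), Module.module.smult = (\<lambda>c x. \<chi> a b. c * x $ a $ b)\<rparr>"

text \<open>The group algebra of \<open>\<int>\<^sup>m\<close> is the ring of Laurent polynomials in \<open>m\<close> variables, and
  \<open>sl\<^bsub>n+1\<^esub> \<otimes> R\<close> for a commutative algebra \<open>R\<close> is the algebra of traceless matrices over \<open>R\<close>, with
  \<open>x \<otimes> f\<close> having the entries \<open>x\<^bsub>ab\<^esub> f\<close>.\<close>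

type_synonym 'm laurent = "(int ^ 'm) \<Rightarrow>\<^sub>0 complex"
type_synonym ('m, 'n) loop = "'m laurent ^ 'n ^ 'n"

definition loop_alg :: "(complex, ('m::finite, 'n::finite) loop) module"
  where "loop_alg =
    \<lparr>carrier = {A. trace A = 0}, mult = (\<lambda>A B. A ** B - B ** A), one = undefined, zero = 0,
     add = (+), Module.module.smult = (\<lambda>c A. \<chi> a b. Poly_Mapping.single 0 c * A $ a $ b)\<rparr>"

definition loop_tensor :: "complex ^ 'n ^ 'n \<Rightarrow> 'm::finite laurent \<Rightarrow> ('m, 'n::finite) loop"
  where "loop_tensor x f = (\<chi> a b. Poly_Mapping.single 0 (x $ a $ b) * f)"

definition tvar :: "'m \<Rightarrow> int \<Rightarrow> 'm::finite laurent"
  where "tvar i p = Poly_Mapping.single (axis i p) 1"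

lemma single_0_sum:
  "Poly_Mapping.single 0 (\<Sum>i\<in>I. f i) = (\<Sum>i\<in>I. Poly_Mapping.single 0 (f i))"
  by (induction I rule: infinite_finite_induct) (simp_all add: single_add)

lemma loop_bracket_tensor:
  fixes x y :: "complex ^ 'n ^ 'n::finite" and f g :: "'m::finite laurent"
  shows "loop_tensor x f \<otimes>\<^bsub>loop_alg\<^esub> loop_tensor y g = loop_tensor (x \<otimes>\<^bsub>sl\<^esub> y) (f * g)"
proof -
  have single_0_mult: "Poly_Mapping.single 0 (c * d) =
      Poly_Mapping.single 0 c * (Poly_Mapping.single 0 d :: 'm laurent)" for c d :: complex
    by (simp add: mult_single)
  have "loop_tensor x f ** loop_tensor y g = loop_tensor (x ** y) (f * g)"
    for x y :: "complex ^ 'n ^ 'n" and f g :: "'m laurent"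
    by (simp add: loop_tensor_def matrix_matrix_mult_def vec_eq_iff single_0_sum
        sum_distrib_left single_0_mult mult_ac)
  moreover have "loop_tensor (x - y) f = loop_tensor x f - loop_tensor y f"
    for x y :: "complex ^ 'n ^ 'n" and f :: "'m laurent"
    by (simp add: loop_tensor_def vec_eq_iff single_diff left_diff_distrib)
  ultimately show ?thesis
    by (simp add: loop_alg_def sl_def mult.commute)
qed

definition nat_tensor_module :: "nat \<Rightarrow> (complex ^ 'n ^ 'n, 'n::finite tensor) lmod"
  where "nat_tensor_module l = (tpow l, \<lambda>x v a. \<Sum>j<l. slot x j v a)"


section \<open>The functor\<close>

text \<open>\<open>M \<otimes> V\<^sup>\<otimes>\<^sup>l\<close> over \<open>\<complex>[S\<^sub>l]\<close> is the quotient of the vector space with basis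
  \<open>M \<times> V\<^sup>\<otimes>\<^sup>l\<close> by the subspace \<open>tensor_null\<close> generated by the usual relations.\<close>

type_synonym ('a, 'n) free_tensor = "('a \<times> 'n tensor) \<Rightarrow>\<^sub>0 complex"
type_synonym ('a, 'n) bal_tensor = "('a, 'n) free_tensor set"
type_synonym ('a, 'm) affmod = "'a ring \<times> ('a \<Rightarrow> 'm aff \<Rightarrow> 'a)"

definition free_tensor :: "nat \<Rightarrow> 'a ring \<Rightarrow> (complex, ('a, 'n) free_tensor) module"
  where "free_tensor l M =
    \<lparr>carrier = {u. Poly_Mapping.keys u \<subseteq> carrier M \<times> carrier (tpow l)},
     mult = undefined, one = undefined, zero = 0, add = (+), Module.module.smult = (\<lambda>c. Poly_Mapping.map ((*) c))\<rparr>"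

abbreviation elt :: "'a \<Rightarrow> 'n tensor \<Rightarrow> ('a, 'n) free_tensor"
  where "elt w v \<equiv> Poly_Mapping.single (w, v) 1"

inductive_set tensor_null :: "nat \<Rightarrow> ('a, 'm) affmod \<Rightarrow> ('a, 'n) free_tensor set"
  for l and E :: "('a, 'm) affmod" where
  zero: "0 \<in> tensor_null l E"
| add: "\<lbrakk>u \<in> tensor_null l E; v \<in> tensor_null l E\<rbrakk> \<Longrightarrow> u + v \<in> tensor_null l E"
| smult: "u \<in> tensor_null l E \<Longrightarrow> Poly_Mapping.map ((*) c) u \<in> tensor_null l E"
| add_l: "\<lbrakk>w \<in> carrier (fst E); w' \<in> carrier (fst E); v \<in> carrier (tpow l)\<rbrakk>
    \<Longrightarrow> elt (w \<oplus>\<^bsub>fst E\<^esub> w') v - elt w v - elt w' v \<in> tensor_null l E"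
| add_r: "\<lbrakk>w \<in> carrier (fst E); v \<in> carrier (tpow l); v' \<in> carrier (tpow l)\<rbrakk>
    \<Longrightarrow> elt w (v \<oplus>\<^bsub>tpow l\<^esub> v') - elt w v - elt w v' \<in> tensor_null l E"
| scalar: "\<lbrakk>w \<in> carrier (fst E); v \<in> carrier (tpow l)\<rbrakk>
    \<Longrightarrow> elt w (c \<odot>\<^bsub>tpow l\<^esub> v) - Poly_Mapping.single (w, v) c \<in> tensor_null l E"
| balanced: "\<lbrakk>w \<in> carrier (fst E); v \<in> carrier (tpow l); p \<in> sig_alg l\<rbrakk>
    \<Longrightarrow> elt (snd E w (aff_class l p)) v - elt w (sig_act p v) \<in> tensor_null l E"

definition F_space :: "nat \<Rightarrow> ('a, 'm) affmod \<Rightarrow> (complex, ('a, 'n) bal_tensor) module"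
  where "F_space l E = quot_space (free_tensor l (fst E)) (tensor_null l E)"

definition tens :: "nat \<Rightarrow> ('a, 'm) affmod \<Rightarrow> 'a \<Rightarrow> 'n tensor \<Rightarrow> ('a, 'n) bal_tensor"
  where "tens l E w v = tensor_null l E +>\<^bsub>free_tensor l (fst E)\<^esub> elt w v"

text \<open>\<open>\<rho>\<close> is an \<open>L\<^sup>m(\<gg>)\<close>-module structure on \<open>\<F>(M)\<close> restricting to the prescribed structure over
  each \<open>L\<^sub>i(\<gg>)\<close>, which is spanned by the \<open>x \<otimes> t\<^sub>i\<^sup>p\<close>. Being extensional, it is determined by its
  values on the carriers.\<close>

definition loop_structure ::
  "nat \<Rightarrow> ('a, 'm) affmod \<Rightarrow>
    (('m::finite, 'n::finite) loop \<Rightarrow> ('a, 'n) bal_tensor \<Rightarrow> ('a, 'n) bal_tensor) \<Rightarrow> bool"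
  where "loop_structure l E \<rho> \<longleftrightarrow>
    \<rho> \<in> carrier loop_alg \<rightarrow>\<^sub>E carrier (F_space l E) \<rightarrow>\<^sub>E carrier (F_space l E) \<and>
    lie_module loop_alg (F_space l E) \<rho> \<and>
    (\<forall>i. \<forall>x\<in>carrier sl. \<forall>p. \<forall>w\<in>carrier (fst E). \<forall>v\<in>carrier (tpow l).
      \<rho> (loop_tensor x (tvar i p)) (tens l E w v) =
      (\<Oplus>\<^bsub>F_space l E\<^esub>j\<in>{..<l}. tens l E (snd E w (y_el l i j [^]\<^bsub>Aff l\<^esub> p)) (slot x j v)))"

definition F_obj ::
  "nat \<Rightarrow> ('a, 'm) affmod \<Rightarrow> (('m::finite, 'n::finite) loop, ('a, 'n) bal_tensor) lmod"
  where "F_obj l E = (F_space l E, THE \<rho>. loop_structure l E \<rho>)"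

text \<open>\<open>f \<otimes> 1\<close>, the additive map with \<open>w \<otimes> v \<mapsto> f w \<otimes> v\<close>. It depends on the source and target of
  \<open>f\<close>.\<close>

definition F_mor :: "nat \<Rightarrow> ('a, 'm) affmod \<Rightarrow> ('b, 'm) affmod \<Rightarrow> ('a \<Rightarrow> 'b) \<Rightarrow>
    ('a, 'n) bal_tensor \<Rightarrow> ('b, 'n) bal_tensor"
  where "F_mor l E E' f = (THE h.
    h \<in> carrier (F_space l E) \<rightarrow>\<^sub>E carrier (F_space l E') \<and>
    (\<forall>u\<in>carrier (F_space l E). \<forall>v\<in>carrier (F_space l E).
      h (u \<oplus>\<^bsub>F_space l E\<^esub> v) = h u \<oplus>\<^bsub>F_space l E'\<^esub> h v) \<and>
    (\<forall>w\<in>carrier (fst E). \<forall>v\<in>carrier (tpow l). h (tens l E w v) = tens l E' (f w) v))"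

text \<open>The type of the underlying sets plays the role of the universe of the category. As
  \<^const>\<open>F_obj\<close> changes this type from \<open>'a\<close> to \<open>('a, 'n) bal_tensor\<close>, a quasi-inverse starting
  from modules on the latter type returns modules on the same type, and the natural isomorphisms
  of an equivalence are then families of module isomorphisms between different types.\<close>

definition aff_cat :: "nat \<Rightarrow> (('a, 'm) affmod, 'a \<Rightarrow> 'a) category"
  where "aff_cat l =
    \<lparr>Ob = {(M, r). right_module (Aff l) M r}, Hom = rmod_hom (Aff l),
     Ident = (\<lambda>P. \<lambda>w\<in>carrier (fst P). w), Comp = (\<lambda>P Q T g f. compose (carrier (fst P)) g f)\<rparr>"

definition loop_cat :: "((('m::finite, 'n::finite) loop, 'v) lmod, 'v \<Rightarrow> 'v) category"
  where "loop_cat =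
    \<lparr>Ob = {(N, \<rho>). lie_module loop_alg N \<rho>}, Hom = lie_hom loop_alg,
     Ident = (\<lambda>P. \<lambda>v\<in>carrier (fst P). v), Comp = (\<lambda>P Q T g f. compose (carrier (fst P)) g f)\<rparr>"

definition res_sl ::
  "(('m::finite, 'n::finite) loop, 'v) lmod \<Rightarrow> (complex ^ 'n ^ 'n, 'v) lmod"
  where "res_sl N = (fst N, \<lambda>x. snd N (loop_tensor x 1))"

definition loop_cat_level ::
  "nat \<Rightarrow> ((('m::finite, 'n::finite) loop, 'v) lmod, 'v \<Rightarrow> 'v) category"
  where "loop_cat_level l = loop_cat\<lparr>Ob := {N \<in> Ob loop_cat.
    locally_finite_dim sl (res_sl N) \<and>
    (\<forall>S :: (complex ^ 'n ^ 'n, 'v set) lmod.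
      composition_factor sl S (res_sl N) \<longrightarrow> composition_factor sl S (nat_tensor_module l))}\<rparr>"

end

theory Submission
  imports Defs
begin

text \<open>The theorem is a multi-variable form of Schur-Weyl duality, and \<open>l \<le> n\<close> enters through one
choice: there are \<open>l + 1\<close> different basis indices, a word \<open>b\<close> of \<open>l\<close> of them and one more, \<open>z\<close>.
A module \<open>N\<close> of level \<open>l\<close> is recovered from its space \<open>W\<close> of vectors of the multilinear weight
\<open>b\<close>. On \<open>W\<close>, the transposition \<open>\<sigma>\<^sub>k\<close> acts as \<open>E\<^sub>c\<^sub>d E\<^sub>d\<^sub>c - 1\<close> for the letters \<open>c\<close>, \<open>d\<close> of \<open>b\<close> at \<open>k\<close> and \<open>k + 1\<close>, and \<open>y\<close> with indices \<open>i\<close>, \<open>j\<close> acts as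
\<open>(E\<^sub>c\<^sub>c - E\<^sub>z\<^sub>z) \<otimes> t\<^sub>i\<close> with \<open>c = b ! j\<close>. On \<open>\<F>(M)\<close> the space \<open>W\<close> consists of the vectors
\<open>w \<otimes> e\<^sub>b\<close>, so that \<open>w \<mapsto> w \<otimes> e\<^sub>b\<close> is the unit of the equivalence; the counit sends \<open>u \<otimes> e\<^sub>a\<close> to the
image of \<open>u\<close> under the operator that replaces the letters of \<open>b\<close> by those of \<open>a\<close>.

That operator is the normally ordered product \<open>nord\<close> of the \<open>E\<close> with rows \<open>a\<close> and columns \<open>b\<close>
(\<open>wordop\<close>). On a module of level \<open>l\<close> the family of all \<open>wordop e b a u\<close> transforms under \<open>gl\<close> like
the basis \<open>e\<^sub>a\<close> of the tensor power (\<open>wordop_equivariant\<close>), and such a family is determined by its value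
at one word without repetitions (\<open>equivariant_zero\<close>). Every relation on \<open>W\<close> is
proved by comparing two such families: the Coxeter relations, the relations of the \<open>y\<close>, and the formula
\<open>Z_wordop\<close> for the action of the loop algebra on words. They give a right module
(\<open>Gring_right_module\<close>). The unit is injective because a permutation can be sorted by a
normal form of adjacent transpositions, compatibly with the Coxeter relations (\<open>srt_swp\<close>,
\<open>tens_basis_inj\<close>), and surjective because a product of diagonal operators projects onto the weight \<open>b\<close>
(\<open>eta_surj\<close>). The counit is bijective because a module of level \<open>l\<close> is generated by \<open>W\<close>, and a submodule
that meets \<open>W\<close> trivially vanishes (\<open>eps_bij\<close>).

The hypothesis on composition factors has to be turned into level \<open>l\<close>, which is a polynomial
identity for the diagonal operators. Every vector of a locally finite module is reached by
finitely many simple subquotients, so each identity of the tensor power holds up to nilpotency (\<open>all_good\<close>);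
nilpotency is removed by the semisimplicity of \<open>h\<close> in a representation of \<open>sl\<^sub>2\<close> with locally nilpotent
\<open>e\<close> and \<open>f\<close> (\<open>level_of_good\<close>).

The action on \<open>\<F>(M)\<close> is constructed from the universal property \<open>tens_ext\<close>. It is unique because the
\<open>E\<^sub>p\<^sub>q \<otimes> t\<^sub>i\<^sup>a\<close> with \<open>p \<noteq> q\<close> generate the loop algebra (\<open>loop_generated\<close>); the same fact reduces the
verification that the counit and the maps \<open>f \<otimes> 1\<close> are homomorphisms to these elements.\<close>

no_notation vector_scalar_mult (infixl \<open>*s\<close> 70)
no_notation fps_nth (infixl \<open>$\<close> 75)

type_synonym 'v fvec = "'v \<Rightarrow>\<^sub>0 complex"
abbreviation "TP l == carrier (tpow l)"
abbreviation "FA l == carrier (free_alg l)"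
abbreviation "vsp == Module.module CC"
abbreviation "pmono == Poly_Mapping.single"
abbreviation "pcoef == Poly_Mapping.lookup"
abbreviation "psupp == Poly_Mapping.keys"

section \<open>Normally ordered products and equivariant families\<close>

text \<open>The operators satisfy \<open>E\<^sub>a\<^sub>b E\<^sub>c\<^sub>d = :E\<^sub>a\<^sub>b E\<^sub>c\<^sub>d: + (b = c) E\<^sub>a\<^sub>d\<close>, and \<open>nord\<close> is the
product \<open>:\<dots>:\<close> of a list of them, with all such contractions removed. On a tensor power
it is the sum over all ways to apply its factors at different positions.\<close>

function nord :: "('n => 'n => 'x => 'x::ab_group_add) => ('n \<times> 'n) list => 'x => 'x" where
 "nord e [] x = x"
| "nord e (p # ps) x = e (fst p) (snd p) (nord e ps x) -
  (\<Sum>i<length ps. if fst (ps ! i) = snd p then nord e (ps[i := (fst p, snd (ps ! i))]) x else 0)"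
 by pat_completeness auto
termination by (relation "measure (%(e, ps, x). length ps)") auto

definition equivariant ::
 "nat => ('n => 'n => 'y => 'y) => ('n list => 'y::ab_group_add) => bool"
 where "equivariant l op f \<longleftrightarrow> (ALL a c d. length a = l -->
  op c d (f a) = (\<Sum>i<l. if a ! i = d then f (a[i := c]) else 0))"

lemma equivariantD:
 "equivariant l op f ==> length a = l ==>
  op c d (f a) = (\<Sum>i<l. if a ! i = d then f (a[i := c]) else 0)" by (simp add: equivariant_def)

lemma equivariant_diff:
 assumes "!!c d x y. op c d (x - y) = op c d x - op c d y"
  and "equivariant l op f" "equivariant l op g"
 shows "equivariant l op (%a. f a - g a)"
 using assms by (auto simp: equivariant_def sum_subtractf[symmetric] intro!: sum.cong)

lemma equivariant_add:
 assumes "!!c d x y. op c d (x + y) = op c d x + op c d y"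
  and "equivariant l op f" "equivariant l op g"
 shows "equivariant l op (%a. f a + g a)"
 using assms by (auto simp: equivariant_def sum.distrib[symmetric] intro!: sum.cong)

text \<open>A letter of \<open>b\<close> occurs only once, so applying \<open>op (a ! j) (b ! j)\<close> changes the word at position \<open>j\<close>
alone. Changing the positions one after the other reaches every word \<open>a\<close> from \<open>b\<close>, from the last position down.\<close>

lemma equivariant_zero:
 assumes op0: "!!c d. op c d 0 = 0"
  and f: "equivariant l op f"
  and b: "distinct b" "length b = l" "f b = 0"
  and a: "length a = l"
 shows "f a = 0"
proof -
 have "ALL a. length a = l --> f (take (l - k) b @ drop (l - k) a) = 0" if "k <= l" for k using that
 proof (induction k)
  case 0
  thus ?case using b by simp
 next
  case (Suc k)
  define j where "j = l - Suc k"
  have j: "j < l" "l - k = Suc j" using Suc.prems by (auto simp: j_def)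
  have IH: "f (take (Suc j) b @ drop (Suc j) a) = 0" if "length a = l" for a using Suc that j by simp
  show ?case
  proof (intro allI impI)
  fix a :: "'a list" assume la: "length a = l"
  define a' where "a' = take (Suc j) b @ drop (Suc j) a"
  have la': "length a' = l" using la b j by (simp add: a'_def)
  have 0: "f a' = 0" using IH la by (simp add: a'_def)
  have nth: "a' ! i = (if i <= j then b ! i else a ! i)" if "i < l" for i
  using that la b j by (auto simp: a'_def nth_append min_def)
  have "0 = (\<Sum>i<l. if a' ! i = b ! j then f (a'[i := a ! j]) else 0)"
  using equivariantD[OF f la', of "a ! j" "b ! j"] 0 op0 by simp
  also have "... = (\<Sum>i<l. if i = j then f (a'[j := a ! j]) else 0)"
  proof (rule sum.cong[OF refl])
  fix i assume "i \<in> {..<l}"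
  hence i: "i < l" by simp
  consider "i < j" | "i = j" | "i > j" by linarith
  thus "(if a' ! i = b ! j then f (a'[i := a ! j]) else 0) =
  (if i = j then f (a'[j := a ! j]) else 0)"
  proof cases
  case 1
  thus ?thesis using nth[OF i] b j by (auto simp: nth_eq_iff_index_eq)
  next
  case 2
  thus ?thesis using nth[OF i] by simp
  next
  case 3
  have "a'[i := a ! j] = take (Suc j) b @ drop (Suc j) (a[i := a ! j])" by (rule nth_equalityI) (use 3 la la' b j i in
  \<open>auto simp: nth_append min_def nth_list_update nth nth_Cons' dest: le_neq_trans\<close>)
  hence "f (a'[i := a ! j]) = 0" using IH[of "a[i := a ! j]"] la by simp
  thus ?thesis using 3 by simp
  qed
  qed
  also have "... = f (a'[j := a ! j])" using j by simp
  also have "a'[j := a ! j] = take j b @ drop j a" by (rule nth_equalityI) (use la la' b j in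
  \<open>auto simp: nth_append min_def nth_list_update nth\<close>)
  finally show "f (take (l - Suc k) b @ drop (l - Suc k) a) = 0" by (simp add: j_def)
  qed
 qed
 from this[of l] show ?thesis using a by simp
qed

text \<open>Distinct roots of an annihilating product: \<open>h - r\<close> is invertible on the eigenspaces of the other roots.\<close>

lemma (in vector_space) eigen_decomposition:
 assumes h: "!!x y. h (x + y) = h x + h y" "!!c x. h (c *s x) = c *s h x"
  and P: "subspace P" "!!x. x \<in> P ==> h x \<in> P"
  and rs: "distinct rs" and x: "x \<in> P" "foldr (%r y. h y - r *s y) rs x = 0"
 shows "x \<in> span {y \<in> P. EX r:set rs. h y = r *s y}" using rs x
proof (induction rs arbitrary: x rule: rev_induct)
 case Nil
 thus ?case by (simp add: span_zero)
next
 case (snoc r rs)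
 define w where "w = h x - r *s x"
 let ?E = "{y \<in> P. EX s:set rs. h y = s *s y}"
 have hm: "h (x - y) = h x - h y" for x y
 proof -
  have "h (x - y) + h y = h x" by (simp add: h(1)[symmetric])
  thus ?thesis by (simp add: algebra_simps)
 qed
 have "w \<in> P" using P snoc.prems by (simp add: w_def subspace_diff subspace_scale)
 hence "w \<in> span ?E" using snoc by (simp add: w_def)
 moreover have "EX v:span ?E. h v - r *s v = w" if "w \<in> span ?E" for w using that
 proof (induction rule: span_induct_alt)
  case base
  show ?case using h(2)[of 0 0] by (intro bexI[of _ 0]) (auto simp: span_zero)
 next
  case (step c y w)
  then obtain s v where s: "s \<in> set rs" "h y = s *s y" and v: "v \<in> span ?E" "h v - r *s v = w" by auto
  have sr: "s ~= r" using s snoc.prems by auto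
  have "y \<in> span ?E" using step by (auto intro: span_base)
  moreover have "h ((c / (s - r)) *s y + v) - r *s ((c / (s - r)) *s y + v) = c *s y + w"
  proof -
  define k where "k = c / (s - r)"
  have eq: "k * s = c + r * k" using sr by (simp add: k_def field_simps)
  have "h (k *s y + v) = (k * s) *s y + h v" by (simp add: h s scale_scale)
  also have "... = c *s y + (r * k) *s y + h v" unfolding eq by (simp only: scale_left_distrib)
  finally show ?thesis using v unfolding k_def[symmetric] by (simp add: scale_right_distrib algebra_simps)
  qed
  ultimately show ?case using v by (intro bexI[of _ "(c / (s - r)) *s y + v"]) (auto intro: span_add span_scale)
 qed
 ultimately obtain v where v: "v \<in> span ?E" "h v - r *s v = w" by blast
 have "span ?E <= P" using P by (intro span_minimal) auto
 hence vP: "v \<in> P" using v by blast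
 have "h (x - v) = r *s (x - v)" using v by (simp add: hm w_def scale_right_diff_distrib algebra_simps)
 hence "x - v \<in> span {y \<in> P. EX r:set (rs @ [r]). h y = r *s y}"
  using P vP snoc.prems by (intro span_base) (auto simp: subspace_diff)
 moreover have "v \<in> span {y \<in> P. EX r:set (rs @ [r]). h y = r *s y}"
  using v(1) by (rule span_mono[THEN subsetD, rotated]) auto
 ultimately have "(x - v) + v \<in> span {y \<in> P. EX r:set (rs @ [r]). h y = r *s y}" by (rule span_add)
 thus ?case by simp
qed

locale gl_rep = vector_space scale
 for scale :: "complex => 'x::ab_group_add => 'x" (infixr "*s" 75) +
 fixes e :: "'n::finite => 'n => 'x => 'x"
 assumes e_add: "e a b (x + y) = e a b x + e a b y"
  and e_scale: "e a b (r *s x) = r *s e a b x"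
  and e_comm: "e a b (e c d x) - e c d (e a b x) =
  (if b = c then e a d x else 0) - (if d = a then e c b x else 0)"
begin

lemma e_zero [simp]: "e a b 0 = 0" using e_scale[of a b 0 0] by simp

lemma e_minus: "e a b (- x) = - e a b x" using e_scale[of a b "-1" x] by (simp add: scale_minus_left)

lemma e_diff: "e a b (x - y) = e a b x - e a b y" using e_add[of a b x "- y"] by (simp add: e_minus)

lemma e_sum: "e a b (\<Sum>i\<in>I. f i) = (\<Sum>i\<in>I. e a b (f i))"
 by (induction I rule: infinite_finite_induct) (auto simp: e_add)

lemma e_if: "e a b (if P then x else 0) = (if P then e a b x else 0)" by simp

abbreviation D :: "('n \<times> 'n) list => 'x => 'x" where "D \<equiv> nord e"

declare nord.simps(2) [simp del]

lemma D_Cons: "D ((a, b) # ps) x = e a b (D ps x) -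
  (\<Sum>i<length ps. if fst (ps ! i) = b then D (ps[i := (a, snd (ps ! i))]) x else 0)"
 by (simp only: nord.simps(2) fst_conv snd_conv)

lemma D_expand:
 "D ((a, b) # (c, d) # rs) x =
  e a b (e c d (D rs x)) - (if b = c then e a d (D rs x) else 0)
  - (\<Sum>i<length rs. if fst (rs ! i) = d then e a b (D (rs[i := (c, snd (rs ! i))]) x) else 0)
  - (\<Sum>i<length rs. if fst (rs ! i) = b then e c d (D (rs[i := (a, snd (rs ! i))]) x) else 0)
  + (if b = c then (\<Sum>i<length rs. if fst (rs ! i) = d then D (rs[i := (a, snd (rs ! i))]) x else 0) else 0)
  + (if d = a then (\<Sum>i<length rs. if fst (rs ! i) = b then D (rs[i := (c, snd (rs ! i))]) x else 0) else 0)
  + (\<Sum>i<length rs. \<Sum>j<length rs. if i ~= j & fst (rs ! i) = b & fst (rs ! j) = d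
  then D (rs[i := (a, snd (rs ! i)), j := (c, snd (rs ! j))]) x else 0)"
proof -
 define n where "n = length rs"
 have inner: "D ((c, d) # rs[i := (a, snd (rs ! i))]) x =
  e c d (D (rs[i := (a, snd (rs ! i))]) x)
  - (if d = a then D (rs[i := (c, snd (rs ! i))]) x else 0)
  - (\<Sum>j<n. if i ~= j & fst (rs ! j) = d then D (rs[i := (a, snd (rs ! i)), j := (c, snd (rs ! j))]) x else 0)"
  if "i < n" for i
 proof -
  have "(\<Sum>j<n. if fst (rs[i := (a, snd (rs ! i))] ! j) = d
  then D (rs[i := (a, snd (rs ! i)), j := (c, snd (rs[i := (a, snd (rs ! i))] ! j))]) x else 0) =
  (\<Sum>j<n. (if j = i then (if d = a then D (rs[i := (c, snd (rs ! i))]) x else 0) else 0) +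
  (if i ~= j & fst (rs ! j) = d then D (rs[i := (a, snd (rs ! i)), j := (c, snd (rs ! j))]) x else 0))"
  by (rule sum.cong) (use that in \<open>auto simp: n_def nth_list_update\<close>)
  also have "... = (if d = a then D (rs[i := (c, snd (rs ! i))]) x else 0) +
  (\<Sum>j<n. if i ~= j & fst (rs ! j) = d then D (rs[i := (a, snd (rs ! i)), j := (c, snd (rs ! j))]) x else 0)"
  using that by (simp add: sum.distrib)
  finally show ?thesis by (simp add: D_Cons n_def)
 qed
 have outer: "(\<Sum>i<n. if fst (rs ! i) = b then D ((c, d) # rs[i := (a, snd (rs ! i))]) x else 0) =
  (\<Sum>i<n. if fst (rs ! i) = b then e c d (D (rs[i := (a, snd (rs ! i))]) x) else 0)
  - (if d = a then (\<Sum>i<n. if fst (rs ! i) = b then D (rs[i := (c, snd (rs ! i))]) x else 0) else 0)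
  - (\<Sum>i<n. \<Sum>j<n. if i ~= j & fst (rs ! i) = b & fst (rs ! j) = d
  then D (rs[i := (a, snd (rs ! i)), j := (c, snd (rs ! j))]) x else 0)"
  (is "?L = ?A - ?B - ?C")
 proof -
  have B: "?B = (\<Sum>i<n. if d = a & fst (rs ! i) = b then D (rs[i := (c, snd (rs ! i))]) x else 0)" by simp
  show ?thesis unfolding B sum_subtractf[symmetric]
  proof (rule sum.cong[OF refl], goal_cases)
  case (1 i)
  hence "i < n" by simp
  show ?case by (simp only: inner[OF \<open>i < n\<close>]) (simp cong: conj_cong)
  qed
 qed
 have aux: "A - S1 - ((if c = b then E - T else 0) + (S2 - B - C)) =
  A - (if b = c then E else 0) - S1 - S2 + (if b = c then T else 0) + B + C"
  for A S1 E T S2 B C :: 'x by simp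
 show ?thesis unfolding D_Cons[of a b] length_Cons sum.lessThan_Suc_shift n_def[symmetric]
  nth_Cons_0 nth_Cons_Suc list_update_code fst_conv snd_conv outer
  unfolding D_Cons[of c d rs] D_Cons[of a d rs] n_def[symmetric] e_diff e_sum e_if by (rule aux)
qed

lemma D_swap: "D (p # q # rs) x = D (q # p # rs) x"
proof -
 obtain a b c d where pq: "p = (a, b)" "q = (c, d)" by (metis surj_pair)
 have aux: "A - E - S1 - S2 + T1 + T2 + W = A' - E' - S2 - S1 + T2 + T1 + W"
  if "A - E = A' - E'" for A A' E E' S1 S2 T1 T2 W :: 'x unfolding that by simp
 have aux2: "A - E = A' - E'" if "A - A' = E - E'" for A A' E E' :: 'x
 proof -
  have "A - E = (A - A') + A' - E" by simp
  also have "... = A' - E'" unfolding that by simp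
  finally show ?thesis .
 qed
 have dbl: "(\<Sum>i<length rs. \<Sum>j<length rs. if i ~= j & fst (rs ! i) = b & fst (rs ! j) = d
  then D (rs[i := (a, snd (rs ! i)), j := (c, snd (rs ! j))]) x else 0) =
  (\<Sum>i<length rs. \<Sum>j<length rs. if i ~= j & fst (rs ! i) = d & fst (rs ! j) = b
  then D (rs[i := (c, snd (rs ! i)), j := (a, snd (rs ! j))]) x else 0)"
  by (subst sum.swap) (auto intro!: sum.cong simp: list_update_swap)
 have "e a b (e c d (D rs x)) - (if b = c then e a d (D rs x) else 0) =
  e c d (e a b (D rs x)) - (if d = a then e c b (D rs x) else 0)" by (rule aux2[OF e_comm])
 thus ?thesis unfolding pq D_expand dbl by (rule aux)
qed

text \<open>Normal ordering makes the factors commute; adjacent ones by the expansion of \<open>D\<close> at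
two factors, where the commutator is absorbed by the contractions.\<close>

lemma D_perm: "mset ps = mset qs ==> D ps x = D qs x"
proof (induction "length ps" arbitrary: ps qs)
 case 0
 thus ?case by simp
next
 case (Suc k)
 have IH: "D ps x = D qs x" if "length ps = k" "mset ps = mset qs" for ps qs using Suc that by metis
 define Dm where "Dm M = D (SOME xs. mset xs = M) x" for M
 have Dm: "D ps x = Dm (mset ps)" if "length ps = k" for ps unfolding Dm_def
  by (rule IH[OF that]) (metis (mono_tags, lifting) someI)
 have same: "D (p # ps) x = D (p # qs) x" if "length ps = k" "mset ps = mset qs" for p ps qs
 proof -
  define h where "h M y = (if fst y = snd p then Dm (add_mset (fst p, snd y) (M - {#y#})) else 0)" for M y
  have "(\<Sum>i<length ps. if fst (ps ! i) = snd p then D (ps[i := (fst p, snd (ps ! i))]) x else 0) =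
  sum_mset (image_mset (h (mset ps)) (mset ps))" if "length ps = k" for ps
  proof -
  have "(\<Sum>i<length ps. if fst (ps ! i) = snd p then D (ps[i := (fst p, snd (ps ! i))]) x else 0) =
  (\<Sum>i<length ps. h (mset ps) (ps ! i))" using that by (intro sum.cong) (auto simp: h_def Dm mset_update)
  also have "... = sum_list (map (h (mset ps)) ps)" by (simp add: sum_list_sum_nth atLeast0LessThan)
  finally show ?thesis by (simp add: sum_mset_sum_list[symmetric])
  qed
  thus ?thesis using that IH[OF that] mset_eq_length[OF that(2)] by (simp add: nord.simps(2))
 qed
 obtain p ps' where ps: "ps = p # ps'" "length ps' = k" using Suc.hyps by (metis Suc_length_conv)
 then obtain q qs' where qs: "qs = q # qs'" "length qs' = k" using mset_eq_length[OF Suc.prems] by (metis Suc_length_conv)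
 show ?case
 proof (cases "p = q")
  case True
  thus ?thesis using same[OF ps(2), of qs' p] ps qs Suc.prems by simp
 next
  case False
  have "add_mset p (mset ps') = add_mset q (mset qs')" using ps qs Suc.prems by simp
  then obtain R where R: "mset ps' = add_mset q R" "mset qs' = add_mset p R" using False by (auto simp: add_eq_conv_ex)
  obtain rs where rs: "mset rs = R" using ex_mset by blast
  have "D ps x = D (p # q # rs) x" unfolding ps by (rule same) (use ps R rs in auto)
  also have "... = D (q # p # rs) x" by (rule D_swap)
  also have "... = D qs x" unfolding qs by (rule same[symmetric]) (use qs R rs in auto)
  finally show ?thesis .
 qed
qed

lemma D_closed:
 assumes "subspace U" "!!a b x. x \<in> U ==> e a b x \<in> U" "x \<in> U"
 shows "D ps x \<in> U"
proof (induction "length ps" arbitrary: ps)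
 case 0
 thus ?case using assms by simp
next
 case (Suc k)
 thus ?case by (cases ps) (auto simp: nord.simps(2) intro!: subspace_diff subspace_sum assms subspace_0)
qed

lemma D_add: "D ps (x + y) = D ps x + D ps y"
proof (induction "length ps" arbitrary: ps)
 case 0
 thus ?case by simp
next
 case (Suc k)
 then obtain p ps' where ps: "ps = p # ps'" "length ps' = k" by (metis Suc_length_conv)
 have IH: "D qs (x + y) = D qs x + D qs y" if "length qs = k" for qs using Suc that by simp
 have "(\<Sum>i<length ps'. if fst (ps' ! i) = snd p then D (ps'[i := (fst p, snd (ps' ! i))]) (x + y) else 0) =
  (\<Sum>i<length ps'. (if fst (ps' ! i) = snd p then D (ps'[i := (fst p, snd (ps' ! i))]) x else 0) +
  (if fst (ps' ! i) = snd p then D (ps'[i := (fst p, snd (ps' ! i))]) y else 0))" by (rule sum.cong) (auto simp: IH ps)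
 thus ?case using ps by (simp add: nord.simps(2) IH e_add sum.distrib)
qed

lemma D_scale: "D ps (c *s x) = c *s D ps x"
proof (induction "length ps" arbitrary: ps)
 case 0
 thus ?case by simp
next
 case (Suc k)
 then obtain p ps' where ps: "ps = p # ps'" "length ps' = k" by (metis Suc_length_conv)
 have IH: "D qs (c *s x) = c *s D qs x" if "length qs = k" for qs using Suc that by simp
 have "(\<Sum>i<length ps'. if fst (ps' ! i) = snd p then D (ps'[i := (fst p, snd (ps' ! i))]) (c *s x) else 0) =
  (\<Sum>i<length ps'. c *s (if fst (ps' ! i) = snd p then D (ps'[i := (fst p, snd (ps' ! i))]) x else 0))"
  by (rule sum.cong) (auto simp: IH ps)
 thus ?case using ps by (simp add: nord.simps(2) IH e_scale scale_sum_right scale_right_diff_distrib)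
qed

lemma D_zero [simp]: "D ps 0 = 0" using D_scale[of ps 0 0] by simp

lemma D_diag_Cons:
 assumes "ALL q:set ps. fst q = b --> snd q = b"
 shows "D ((b, b) # ps) x = e b b (D ps x) - of_nat (length (filter (%q. fst q = b) ps)) *s D ps x"
proof -
 have "(\<Sum>i<length ps. if fst (ps ! i) = b then D (ps[i := (b, snd (ps ! i))]) x else 0) =
  (\<Sum>i<length ps. if fst (ps ! i) = b then D ps x else 0)"
 proof (rule sum.cong[OF refl])
  fix i assume i: "i \<in> {..<length ps}"
  have "(b, snd (ps ! i)) = ps ! i" if "fst (ps ! i) = b" using that assms i by (metis lessThan_iff nth_mem prod.collapse)
  thus "(if fst (ps ! i) = b then D (ps[i := (b, snd (ps ! i))]) x else 0) =
  (if fst (ps ! i) = b then D ps x else 0)" by auto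
 qed
 also have "... = (\<Sum>i\<in>{i. i < length ps & fst (ps ! i) = b}. D ps x)"
  by (subst sum.inter_filter[symmetric]) (auto intro!: sum.cong)
 also have "... = of_nat (length (filter (%q. fst q = b) ps)) *s D ps x"
  by (simp add: length_filter_conv_card sum_constant_scale)
 finally show ?thesis by (simp add: D_Cons)
qed

end

section \<open>Representations of level \<open>l\<close>\<close>

definition wordop :: "('n => 'n => 'x => 'x::ab_group_add) => 'n list => 'n list => 'x => 'x"
 where "wordop e b a x = nord e (zip a b) x"

definition swp :: "nat => 'n list => 'n list"
 where "swp i a = a[i := a ! (i+1), i+1 := a ! i]"

lemma length_swp [simp]: "length (swp i a) = length a" by (simp add: swp_def)

lemma swp_swp [simp]: "i + 1 < length a ==> swp i (swp i a) = a"
 by (rule nth_equalityI) (auto simp: swp_def nth_list_update)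

lemma set_swp [simp]: "i + 1 < length a ==> set (swp i a) = set a" by (simp add: swp_def)

lemma distinct_swp [simp]: "i + 1 < length a ==> distinct (swp i a) = distinct a" by (simp add: swp_def)

definition tr :: "nat => nat => nat"
 where "tr i j = (if j = i then i + 1 else if j = i + 1 then i else j)"

lemma nth_swp: "i + 1 < length a ==> j < length a ==> swp i a ! j = a ! (tr i j)"
 by (auto simp: swp_def nth_list_update tr_def)

lemma swp_update:
 assumes "i + 1 < length a" "j < length a"
 shows "swp i (a[j := c]) = (swp i a)[tr i j := c]"
 by (rule nth_equalityI) (use assms in \<open>auto simp: swp_def nth_list_update tr_def\<close>)

lemma equivariant_swp:
 assumes "equivariant l op f" "i + 1 < l"
 shows "equivariant l op (%a. f (swp i a))" unfolding equivariant_def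
proof (intro allI impI)
 fix a :: "'a list" and c d assume a: "length a = l"
 have "op c d (f (swp i a)) = (\<Sum>j<l. if swp i a ! j = d then f ((swp i a)[j := c]) else 0)"
  using equivariantD[OF assms(1)] a by simp
 also have "... = (\<Sum>j<l. if a ! j = d then f (swp i (a[j := c])) else 0)"
 proof (rule sum.reindex_bij_witness[of _ "tr i" "tr i"])
  fix j assume j: "j \<in> {..<l}"
  thus "tr i (tr i j) = j" "tr i j \<in> {..<l}" "tr i (tr i j) = j" "tr i j \<in> {..<l}"
  using assms(2) by (auto simp: tr_def)
  have "swp i a ! j = a ! tr i j" "swp i (a[tr i j := c]) = (swp i a)[j := c]"
  using a assms(2) j \<open>tr i j \<in> _\<close> \<open>tr i (tr i j) = j\<close> by (simp_all add: nth_swp swp_update)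
  thus "(if a ! tr i j = d then f (swp i (a[tr i j := c])) else 0) =
  (if swp i a ! j = d then f ((swp i a)[j := c]) else 0)" by simp
 qed
 finally show "op c d (f (swp i a)) = (\<Sum>j<l. if a ! j = d then f (swp i (a[j := c])) else 0)" .
qed

context gl_rep
begin

lemma D_lower_weight:
 assumes v: "e b b v = of_nat m *s v" and ns: "ALL q:set ns. snd q = b & fst q ~= b"
 shows "e b b (D ns v) = (of_nat m - of_nat (length ns)) *s D ns v" using ns
proof (induction ns)
 case Nil
 thus ?case using v by simp
next
 case (Cons p ns)
 obtain a where p: "p = (a, b)" "a ~= b" using Cons.prems by (cases p) auto
 have "fst (ns ! i) ~= b" if "i < length ns" for i using Cons.prems nth_mem[OF that] by auto
 hence DC: "D (p # ns) v = e a b (D ns v)" by (simp add: p D_Cons)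
 have "e b b (e a b (D ns v)) = e a b (e b b (D ns v)) - e a b (D ns v)"
  using e_comm[of b b a b "D ns v"] p by (simp add: algebra_simps)
 also have "... = (of_nat m - of_nat (length (p # ns))) *s e a b (D ns v)"
  using Cons by (simp add: e_scale e_minus e_diff scale_left_diff_distrib scale_left_distrib)
 finally show ?case by (simp add: DC)
qed

text \<open>The columns of \<open>ps\<close> remove more letters \<open>b\<close> than the weight of \<open>v\<close> provides, as a differential operator
with too many derivatives in one variable does to a polynomial.\<close>

lemma D_vanish:
 assumes S: "subspace S" "!!a b x. x \<in> S ==> e a b x \<in> S"
  and neg: "!!y k. y \<in> S ==> e b b y = - (of_nat (Suc k) *s y) ==> y = 0"
  and v: "v \<in> S" "e b b v = of_nat m *s v"
  and ps: "m < count_list (map snd ps) b"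
 shows "D ps v = 0" using ps
proof (induction "length ps" arbitrary: ps)
 case 0
 thus ?case by simp
next
 case (Suc k)
 show ?case
 proof (cases "EX p:set ps. snd p ~= b")
  case True
  then obtain p ps' where p: "mset ps = mset (p # ps')" "snd p ~= b"
  by (metis ex_mset insert_DiffM mset.simps(2) set_mset_mset)
  have "count_list (map snd ps) b = count_list (map snd (p # ps')) b" using p(1) by (metis count_mset mset_map)
  hence c: "m < count_list (map snd ps') b" using Suc.prems p by simp
  have l: "length ps' = k" using mset_eq_length[OF p(1)] Suc.hyps by simp
  have "D (p # ps') v = 0"
  proof -
  have "D (ps'[i := (fst p, snd (ps' ! i))]) v = 0" if "i < length ps'" for i
  proof (rule Suc.hyps(1))
  have "map snd (ps'[i := (fst p, snd (ps' ! i))]) = map snd ps'" using that by (simp add: map_update)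
  (metis length_map list_update_id nth_map)
  thus "m < count_list (map snd (ps'[i := (fst p, snd (ps' ! i))])) b" using c by simp
  qed (simp add: l)
  moreover have "D ps' v = 0" using Suc.hyps(1) l c by simp
  ultimately show ?thesis by (simp add: nord.simps(2) cong: if_cong)
  qed
  thus ?thesis using D_perm[OF p(1)] by simp
 next
  case False
  define ns where "ns = filter (%q. fst q ~= b) ps"
  define s where "s = length (filter (%q. fst q = b) ps)"
  have ns: "ALL q:set ns. snd q = b & fst q ~= b" using False by (auto simp: ns_def)
  have rep: "filter (%q. fst q = b) ps = replicate s (b, b)"
  unfolding s_def by (rule replicate_length_same[symmetric]) (use False in auto)
  have "mset ps = mset (filter (%q. fst q = b) ps) + mset (filter (%q. fst q ~= b) ps)"
  by (simp add: mset_filter multiset_partition[symmetric])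
  hence mset: "mset ps = mset (replicate s (b, b) @ ns)" by (simp add: rep ns_def)
  have "map snd ps = replicate (length ps) b" by (rule nth_equalityI) (use False nth_mem in auto)
  hence "count_list (map snd ps) b = length ps" by (simp add: count_list_eq_length_filter)
  moreover have "length ps = s + length ns" using mset_eq_length[OF mset] by simp
  ultimately have len: "m < s + length ns" using Suc.prems by simp
  have aux: "P *s (q *s y) - t *s (P *s y) = (P * q - t * P) *s y" for P q t y
  by (simp only: scale_scale scale_left_diff_distrib)
  have diag: "D (replicate r (b, b) @ ns) v =
  (\<Prod>i<r. of_nat m - of_nat (length ns) - of_nat i) *s D ns v" for r
  proof (induction r)
  case 0
  thus ?case by simp
  next
  case (Suc r)
  have "filter (%q. fst q = b) (replicate r (b, b) @ ns) = replicate r (b, b)"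
  using ns by (auto simp: filter_empty_conv filter_replicate)
  hence "D ((b, b) # (replicate r (b, b) @ ns)) v =
  e b b (D (replicate r (b, b) @ ns) v) - of_nat r *s D (replicate r (b, b) @ ns) v" using ns by (subst D_diag_Cons) auto
  also have "... = ((\<Prod>i<r. of_nat m - of_nat (length ns) - of_nat i) * (of_nat m - of_nat (length ns))
  - of_nat r * (\<Prod>i<r. of_nat m - of_nat (length ns) - of_nat i)) *s D ns v"
  unfolding Suc e_scale D_lower_weight[OF v(2) ns] by (rule aux)
  also have "(\<Prod>i<r. of_nat m - of_nat (length ns) - of_nat i) * (of_nat m - of_nat (length ns))
  - of_nat r * (\<Prod>i<r. of_nat m - of_nat (length ns) - of_nat i) =
  (\<Prod>i<Suc r. of_nat m - of_nat (length ns) - of_nat i :: complex)" by (simp add: algebra_simps)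
  finally show ?case by simp
  qed
  have "D (replicate s (b, b) @ ns) v = 0"
  proof (cases "length ns <= m")
  case True
  hence "(\<Prod>i<s. of_nat m - of_nat (length ns) - of_nat i :: complex) = 0"
  using len by (intro prod_zero) (auto intro!: bexI[of _ "m - length ns"] simp: of_nat_diff)
  thus ?thesis by (simp add: diag)
  next
  case False
  have "D ns v = 0"
  proof (rule neg)
  show "D ns v \<in> S" using D_closed S v by blast
  obtain d where "length ns = m + Suc d" using False less_imp_Suc_add[of m "length ns"] by auto
  hence "of_nat m - of_nat (length ns) = - (of_nat (Suc (length ns - m - 1)) :: complex)" by simp
  thus "e b b (D ns v) = - (of_nat (Suc (length ns - m - 1)) *s D ns v)"
  unfolding D_lower_weight[OF v(2) ns] by (simp only: scale_minus_left)
  qed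
  thus ?thesis by (simp add: diag)
  qed
  thus ?thesis using D_perm[OF mset] by simp
 qed
qed

end

text \<open>On \<open>V\<^sup>\<otimes>\<^sup>l\<close>, \<open>E\<^sub>c\<^sub>c\<close> counts the letters \<open>c\<close>: the last two axioms say that there are \<open>l\<close> letters, and that the
weights have entries in \<open>{0..l}\<close>.\<close>

locale gl_level = gl_rep scale e
 for scale :: "complex => 'x::ab_group_add => 'x" (infixr "*s" 75)
  and e :: "'n::finite => 'n => 'x => 'x" +
 fixes S :: "'x set" and l :: nat
 assumes S_subspace: "subspace S"
  and S_e: "x \<in> S ==> e a b x \<in> S"
  and S_sum: "x \<in> S ==> (\<Sum>c\<in>UNIV. e c c x) = of_nat l *s x"
  and S_weights: "x \<in> S ==> foldr (%j y. e c c y - of_nat j *s y) [0..<Suc l] x = 0"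
begin

lemmas S_closed [simp] = subspace_0[OF S_subspace] subspace_add[OF S_subspace]
 subspace_diff[OF S_subspace] subspace_scale[OF S_subspace] subspace_neg[OF S_subspace] S_e
lemmas S_sum_closed = subspace_sum[OF S_subspace]

lemma D_S: "x \<in> S ==> D ps x \<in> S" by (rule D_closed[OF S_subspace S_e])

lemma eigen_foldr:
 assumes "e c c y = r *s y"
 shows "foldr (%j y. e c c y - of_nat j *s y) js y = (\<Prod>j\<leftarrow>js. r - of_nat j) *s y"
 by (induction js) (simp_all add: e_scale assms left_diff_distrib scale_left_diff_distrib mult.commute)

lemma eigenvalue_bound:
 assumes "y \<in> S" "e c c y = r *s y" "!!j. j <= l ==> r ~= of_nat j"
 shows "y = 0"
proof -
 have "(\<Prod>j\<leftarrow>[0..<Suc l]. r - of_nat j) *s y = 0"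
  using S_weights[OF assms(1), of c] unfolding eigen_foldr[OF assms(2)] .
 moreover have "(\<Prod>j\<leftarrow>[0..<Suc l]. r - of_nat j) ~= 0"
  using assms(3) by (auto simp: prod_list_zero_iff less_Suc_eq_le dest!: assms(3) simp del: upt_Suc)
 ultimately show ?thesis by (simp del: upt_Suc)
qed

lemma negative_weight:
 assumes "y \<in> S" "e b b y = - (of_nat (Suc k) *s y)"
 shows "y = 0"
proof (rule eigenvalue_bound[OF assms(1)])
 show "e b b y = (- of_nat (Suc k)) *s y" using assms(2) by (simp del: of_nat_Suc)
 fix j :: nat assume "j <= l"
 show "- of_nat (Suc k) ~= (of_nat j :: complex)"
 proof
  assume "- of_nat (Suc k) = (of_nat j :: complex)"
  hence "of_nat (Suc k) + of_nat j = (0 :: complex)" by (metis add.right_inverse)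
  hence "of_nat (Suc k + j) = (0 :: complex)" by (simp only: of_nat_add)
  then show False unfolding of_nat_eq_0_iff by simp
 qed
qed

definition wt :: "('n => nat) => 'x => bool"
 where "wt m v \<longleftrightarrow> (ALL c. e c c v = of_nat (m c) *s v)"

lemma S_span_weights: "x \<in> S ==> x \<in> span {v \<in> S. EX m. wt m v}"
proof -
 assume x: "x \<in> S"
 have "x \<in> span {v \<in> S. ALL c:A. EX k. e c c v = of_nat k *s v}" if "finite A" for A using that
 proof induction
  case empty
  thus ?case using x by (auto intro: span_base)
 next
  case (insert d A)
  have "v \<in> span {v \<in> S. ALL c:insert d A. EX k. e c c v = of_nat k *s v}"
  if v: "v \<in> S" "ALL c:A. EX k. e c c v = of_nat k *s v" for v
  proof -
  obtain k where k: "!!c. c \<in> A ==> e c c v = of_nat (k c) *s v" using v(2) by metis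
  define P where "P = {w \<in> S. ALL c:A. e c c w = of_nat (k c) *s w}"
  have comm: "e c c (e d d w) = e d d (e c c w)" for c w using e_comm[of c c d d w] by (auto split: if_splits)
  have P: "subspace P" unfolding P_def subspace_def by (auto simp: e_add e_scale scale_right_distrib mult.commute)
  have "v \<in> span {y \<in> P. EX r:set (map of_nat [0..<Suc l]). e d d y = r *s y}"
  proof (rule eigen_decomposition[OF e_add e_scale P])
  show "e d d w \<in> P" if "w \<in> P" for w using that by (auto simp: P_def comm e_scale)
  show "foldr (%r y. e d d y - r *s y) (map of_nat [0..<Suc l]) v = 0"
  using S_weights[OF v(1), of d] by (simp add: foldr_map o_def del: upt_Suc)
  show "distinct (map of_nat [0..<Suc l] :: complex list)" by (auto simp: distinct_map inj_on_def simp del: upt_Suc)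
  show "v \<in> P" using v k by (auto simp: P_def)
  qed
  thus ?thesis by (rule span_mono[THEN subsetD, rotated])
  (auto simp: P_def simp del: upt_Suc)
  qed
  hence "span {v \<in> S. ALL c:A. EX k. e c c v = of_nat k *s v}
  <= span {v \<in> S. ALL c:insert d A. EX k. e c c v = of_nat k *s v}" by (intro span_minimal) auto
  thus ?case using insert.IH by blast
 qed
 from this[OF finite[of UNIV]] have "x \<in> span {v \<in> S. ALL c. EX k. e c c v = of_nat k *s v}" unfolding ball_UNIV .
 thus ?thesis unfolding wt_def by (rule span_mono[THEN subsetD, rotated]) (auto simp: choice_iff)
qed

lemma wt_sum:
 assumes "v \<in> S" "wt m v" "v ~= 0"
 shows "(\<Sum>c\<in>UNIV. m c) = l"
proof -
 have "of_nat (\<Sum>c\<in>UNIV. m c) *s v = of_nat l *s v"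
  using S_sum[OF assms(1)] assms(2) by (simp add: wt_def scale_sum_left)
 hence "(of_nat (\<Sum>c\<in>UNIV. m c) :: complex) = of_nat l" using assms(3) scale_right_imp_eq by blast
 thus ?thesis using of_nat_eq_iff by blast
qed

text \<open>A normally ordered product of \<open>l + 1\<close> factors vanishes, as its columns need more letters than a weight of level \<open>l\<close>
has. Hence only the contractions of a further factor with \<open>wordop\<close> remain.\<close>

lemma wordop_equivariant:
 assumes v: "v \<in> S" "wt m v" and c: "length c = l"
 shows "equivariant l e (%a. wordop e c a v)"
proof (cases "v = 0")
 case True
 thus ?thesis by (simp add: equivariant_def wordop_def cong: if_cong)
next
 case False
 show ?thesis unfolding equivariant_def
 proof (intro allI impI)
  fix a :: "'n list" and p q assume a: "length a = l"
  have "EX b. m b < count_list (map snd ((p, q) # zip a c)) b"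
  proof (rule ccontr)
  assume "\<not> ?thesis"
  hence "(\<Sum>b\<in>UNIV. count_list (q # c) b) <= (\<Sum>b\<in>UNIV. m b)"
  using a c by (intro sum_mono) (simp add: not_less)
  moreover have "(\<Sum>b\<in>UNIV. count_list (q # c) b) = length (q # c)" using sum_count_set[of "q # c" UNIV] by simp
  ultimately show False using wt_sum[OF v False] c by simp
  qed
  then obtain b where "m b < count_list (map snd ((p, q) # zip a c)) b" ..
  hence "D ((p, q) # zip a c) v = 0" using D_vanish[OF S_subspace, of b v "m b"] negative_weight v by (simp add: wt_def)
  hence "e p q (D (zip a c) v) =
  (\<Sum>i<l. if fst (zip a c ! i) = q then D ((zip a c)[i := (p, snd (zip a c ! i))]) v else 0)"
  using a c by (simp add: D_Cons)
  also have "... = (\<Sum>i<l. if a ! i = q then D (zip (a[i := p]) c) v else 0)"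
  using a c by (intro sum.cong) (auto simp: update_zip[symmetric] nth_zip
  list_update_id simp flip: zip_update)
  finally show "e p q (wordop e c a v) =
  (\<Sum>i<l. if a ! i = q then wordop e c (a[i := p]) v else 0)" unfolding wordop_def .
 qed
qed

definition J :: "'n list => 'x set"
 where "J b = {u \<in> S. ALL c. e c c u = (if c \<in> set b then u else 0)}"

lemma wordop_S: "x \<in> S ==> wordop e b a x \<in> S" unfolding wordop_def by (rule D_S)

lemma J_S: "u \<in> J b ==> u \<in> S" by (simp add: J_def)

lemma subspace_J: "subspace (J b)" by (auto simp: subspace_def J_def e_add e_scale)

lemma J_wt: "u \<in> J b ==> wt (%c. if c \<in> set b then 1 else 0) u" by (simp add: J_def wt_def)

lemma J_equivariant:
 assumes "u \<in> J b" "length b = l"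
 shows "equivariant l e (%a. wordop e b a u)" using wordop_equivariant[OF J_S[OF assms(1)] J_wt[OF assms(1)] assms(2)] .

lemma wordop_self:
 assumes "u \<in> J b" "distinct b"
 shows "wordop e b b u = u"
proof -
 have "D (zip xs xs) u = u" if "distinct xs" "set xs <= set b" for xs using that
 proof (induction xs)
  case (Cons x xs)
  have "D ((x, x) # zip xs xs) u = e x x (D (zip xs xs) u) -
  of_nat (length (filter (%q. fst q = x) (zip xs xs))) *s D (zip xs xs) u" by (rule D_diag_Cons) (auto simp: set_zip)
  moreover have "filter (%q. fst q = x) (zip xs xs) = []" using Cons.prems by (auto simp: filter_empty_conv set_zip)
  ultimately show ?case using Cons assms by (simp add: J_def)
 qed simp
 thus ?thesis using assms by (simp add: wordop_def)
qed

lemma J_of_equivariant: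
 assumes f: "equivariant l e f" "f b \<in> S" and b: "distinct b" "length b = l"
 shows "f b \<in> J b" unfolding J_def
proof (intro CollectI conjI allI)
 fix c
 have "e c c (f b) = (\<Sum>i<l. if b ! i = c then f (b[i := c]) else 0)" using equivariantD[OF f(1) b(2)] .
 also have "... = (\<Sum>i<l. if b ! i = c then f b else 0)" by (intro sum.cong) auto
 also have "... = (if c \<in> set b then f b else 0)"
 proof (cases "c \<in> set b")
  case True
  then obtain k where k: "k < l" "b ! k = c" using b by (metis in_set_conv_nth)
  hence "(\<Sum>i<l. if b ! i = c then f b else 0) = (\<Sum>i<l. if i = k then f b else 0)"
  using b by (intro sum.cong) (auto simp: nth_eq_iff_index_eq)
  thus ?thesis using True k by simp
 next
  case False
  hence "b ! i ~= c" if "i < l" for i using b that nth_mem by blast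
  thus ?thesis using False by (auto intro!: sum.neutral)
 qed
 finally show "e c c (f b) = (if c \<in> set b then f b else 0)" .
qed (rule f)

lemma equivariant_determined:
 assumes f: "equivariant l e f" "f b \<in> S" and b: "distinct b" "length b = l" and a: "length a = l"
 shows "f a = wordop e b a (f b)"
proof -
 have fb: "f b \<in> J b" by (rule J_of_equivariant[OF f b])
 have "equivariant l e (%a. f a - wordop e b a (f b))"
  using f(1) J_equivariant[OF fb b(2)] by (intro equivariant_diff) (auto simp: e_diff)
 hence "f a - wordop e b a (f b) = 0" by (rule equivariant_zero[where op = e and b = b and l = l, rotated])
  (use b a wordop_self[OF fb b(1)] in auto)
 thus ?thesis by simp
qed

theorem S_span_words:
 assumes b: "distinct b" "length b = l" and x: "x \<in> S"
 shows "x \<in> span {wordop e b a u | a u. length a = l & u \<in> J b}"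
proof -
 let ?T = "{wordop e b a u | a u. length a = l & u \<in> J b}"
 have "v \<in> span ?T" if v: "v \<in> S" "wt m v" for m v
 proof (cases "v = 0")
  case False
  define M where "M = (\<Sum>c\<in>UNIV. replicate_mset (m c) c)"
  obtain a where "mset a = M" using ex_mset by blast
  hence "count_list a c = count M c" for c by (metis count_mset)
  moreover have "count M c = m c" for c by (simp add: M_def count_sum if_distrib cong: if_cong)
  ultimately have ca: "count_list a c = m c" for c by simp
  have la: "length a = l" using wt_sum[OF v False] sum_count_set[of a UNIV] by (simp add: ca)
  have "EX k. k ~= 0 & D (zip xs xs) v = k *s v" if "!!c. count_list xs c <= m c" for xs using that
  proof (induction xs)
  case Nil
  show ?case by (intro exI[of _ 1]) simp
  next
  case (Cons x xs)
  have "count_list xs c <= m c" for c using Cons.prems[of c] by (auto split: if_splits)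
  then obtain k where k: "k ~= 0" "D (zip xs xs) v = k *s v" using Cons.IH by blast
  have *: "length (filter (%q. fst q = x) (zip xs xs)) = count_list xs x" by (induction xs) auto
  have "D ((x, x) # zip xs xs) v = ((of_nat (m x) - of_nat (count_list xs x)) * k) *s v" using k v(2) by (subst D_diag_Cons)
  (auto simp: set_zip * e_scale wt_def algebra_simps scale_left_diff_distrib)
  moreover have "(of_nat (m x) - of_nat (count_list xs x) :: complex) ~= 0" using Cons.prems[of x] by auto
  ultimately show ?case using k by (intro exI[of _ "(of_nat (m x) - of_nat (count_list xs x)) * k"]) auto
  qed
  then obtain k where k: "k ~= 0" "wordop e a a v = k *s v" unfolding wordop_def using ca by (metis order_refl)
  have eq: "equivariant l e (%c. wordop e a c v)" by (rule wordop_equivariant[OF v la])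
  have S: "wordop e a b v \<in> S" using D_S v by (simp add: wordop_def)
  have "wordop e a a v = wordop e b a (wordop e a b v)" by (rule equivariant_determined[OF eq S b la])
  moreover have "wordop e a b v \<in> J b" by (rule J_of_equivariant[OF eq S b])
  ultimately have "k *s v \<in> ?T" using k la by auto
  hence "(1 / k) *s (k *s v) \<in> span ?T" by (intro span_scale span_base)
  thus ?thesis using k by simp
 qed (simp add: span_zero)
 hence "span {v \<in> S. EX m. wt m v} <= span ?T" by (intro span_minimal) auto
 thus ?thesis using S_span_weights[OF x] by blast
qed

lemma generated_by_J:
 assumes "distinct b" "length b = l"
  and "subspace U" "!!a b x. x \<in> U ==> e a b x \<in> U" "J b <= U"
 shows "S <= U"
proof
 fix x assume "x \<in> S"
 hence "x \<in> span {wordop e b a u | a u. length a = l & u \<in> J b}" by (rule S_span_words[OF assms(1,2)])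
 moreover have "span {wordop e b a u | a u. length a = l & u \<in> J b} <= U"
 proof (rule span_minimal[OF _ assms(3)], clarify)
  fix a u assume "u \<in> J b"
  thus "wordop e b a u \<in> U" unfolding wordop_def using D_closed[OF assms(3,4)] assms(5) by blast
 qed
 ultimately show "x \<in> U" by blast
qed

lemma J_trivial:
 assumes "distinct b" "length b = l" "J b <= {0}"
 shows "S <= {0}" by (rule generated_by_J[OF assms(1,2) _ _ assms(3)]) (auto simp: subspace_def)

lemma J_weight_zero:
 assumes "x \<in> S" "e c c x = - x"
 shows "x = 0" using negative_weight[OF assms(1), of c 0] assms(2) by simp

lemma J_annihilated:
 assumes "u \<in> J b" "z \<notin> set b" "length b = l"  "c ~= z"
 shows "e c z u = 0"
proof (rule J_weight_zero[of _ z])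
 show "e c z u \<in> S" using J_S[OF assms(1)] by (rule S_e)
 show "e z z (e c z u) = - e c z u" using e_comm[of z z c z u] assms by (simp add: J_def)
qed

text \<open>The adjacent transposition, through the weight in which \<open>b ! (i+1)\<close> occurs twice; there the two
ways to return to a multilinear weight give \<open>u\<close> and its transpose.\<close>

definition sg :: "'n list => nat => 'x => 'x"
 where "sg b i u = e (b ! i) (b ! (i+1)) (e (b ! (i+1)) (b ! i) u) - u"

lemma wordop_e_distinct:
 assumes u: "u \<in> J b" "length b = l" and a: "length a = l" "j < l" "!!i. i < l ==> i ~= j ==> a ! i ~= a ! j"
 shows "e c (a ! j) (wordop e b a u) = wordop e b (a[j := c]) u"
proof -
 have "e c (a ! j) (wordop e b a u) = (\<Sum>i<l. if i = j then wordop e b (a[j := c]) u else 0)"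
  unfolding equivariantD[OF J_equivariant[OF u] a(1)] using a by (intro sum.cong) auto
 thus ?thesis using a by simp
qed

context
 fixes b :: "'n list" assumes b: "distinct b" "length b = l"
begin

lemma sg_eq:
 assumes "u \<in> J b" "i + 1 < l"
 shows "sg b i u = wordop e b (swp i b) u"
proof -
 have 1: "e (b ! (i+1)) (b ! i) u = wordop e b (b[i := b ! (i+1)]) u"
  using wordop_e_distinct[OF assms(1) b(2) b(2), of i "b ! (i+1)"] wordop_self[OF assms(1) b(1)] b assms
  by (simp add: nth_eq_iff_index_eq)
 let ?a = "b[i := b ! (i+1)]"
 have "e (b ! i) (b ! (i+1)) (wordop e b ?a u) =
  (\<Sum>j<l. if ?a ! j = b ! (i+1) then wordop e b (?a[j := b ! i]) u else 0)"
  using equivariantD[OF J_equivariant[OF assms(1) b(2)], of ?a] b by simp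
 also have "... = (\<Sum>j\<in>{i, i+1}. wordop e b (?a[j := b ! i]) u)"
  using assms b by (intro sum.mono_neutral_cong_right)
  (auto simp: nth_list_update nth_eq_iff_index_eq split: if_splits)
 also have "... = wordop e b b u + wordop e b (swp i b) u" by (simp add: swp_def)
 finally show ?thesis using 1 wordop_self[OF assms(1) b(1)] by (simp add: sg_def)
qed

lemma swp_equivariant:
 assumes "u \<in> J b" "i + 1 < l"
 shows "equivariant l e (%a. wordop e b (swp i a) u)" by (rule equivariant_swp[OF J_equivariant[OF assms(1) b(2)] assms(2)])

lemma sg_J: "u \<in> J b ==> i + 1 < l ==> sg b i u \<in> J b"
 using J_of_equivariant[OF swp_equivariant wordop_S[OF J_S] b] sg_eq by metis

lemma wordop_sg:
 assumes "u \<in> J b" "i + 1 < l" "length a = l"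
 shows "wordop e b a (sg b i u) = wordop e b (swp i a) u"
 using equivariant_determined[OF swp_equivariant[OF assms(1,2)] wordop_S[OF J_S[OF assms(1)]] b assms(3)]
 by (simp add: sg_eq[OF assms(1,2)])

lemma wordop_inj:
 assumes u: "u \<in> J b" "v \<in> J b" and a: "distinct a" "length a = l"
  and eq: "wordop e b a u = wordop e b a v"
 shows "u = v"
proof -
 have "equivariant l e (%a. wordop e b a u - wordop e b a v)"
  using u b by (intro equivariant_diff J_equivariant) (auto simp: e_diff)
 hence "wordop e b b u - wordop e b b v = 0" by (rule equivariant_zero[where op = e and b = a and l = l, rotated])
  (use eq a b in auto)
 thus ?thesis using u b by (simp add: wordop_self)
qed

lemma sg_sg: "u \<in> J b ==> i + 1 < l ==> sg b i (sg b i u) = u"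
 by (rule wordop_inj[of _ _ b]) (simp_all add: sg_J[of _ i] b wordop_sg)

lemma sg_far:
 assumes "u \<in> J b" "k + 1 < j" "j + 1 < l"
 shows "sg b k (sg b j u) = sg b j (sg b k u)"
proof (rule wordop_inj[of _ _ b])
 have "swp j (swp k b) = swp k (swp j b)"
  by (rule nth_equalityI) (use assms b in \<open>auto simp: swp_def nth_list_update\<close>)
 thus "wordop e b b (sg b k (sg b j u)) = wordop e b b (sg b j (sg b k u))" using assms by (simp add: wordop_sg sg_J b)
qed (use assms in \<open>auto simp: sg_J b\<close>)

text \<open>Both sides give, after \<open>wordop e b a\<close>, the family \<open>wordop e b\<close> at the same permuted word.\<close>

lemma sg_braid:
 assumes "u \<in> J b" "k + 2 < l"
 shows "sg b k (sg b (k+1) (sg b k u)) = sg b (k+1) (sg b k (sg b (k+1) u))"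
proof (rule wordop_inj[of _ _ b])
 have "swp k (swp (k+1) (swp k b)) = swp (k+1) (swp k (swp (k+1) b))"
  by (rule nth_equalityI) (use assms b in \<open>auto simp: swp_def nth_list_update\<close>)
 thus "wordop e b b (sg b k (sg b (k+1) (sg b k u))) =
  wordop e b b (sg b (k+1) (sg b k (sg b (k+1) u)))" using assms by (simp add: wordop_sg sg_J b)
qed (use assms in \<open>auto simp: sg_J b\<close>)

end

end

section \<open>The loop operators on words\<close>

text \<open>\<open>Z a b k\<close> stands for \<open>E\<^sub>a\<^sub>b \<otimes> t\<^sup>k\<close>, made traceless; the scalar \<open>r\<close> is the difference between \<open>E\<^sub>a\<^sub>b\<close>
and its traceless part on level \<open>l\<close>.\<close>

locale loop_level = gl_level scale e S l
 for scale :: "complex => 'x::ab_group_add => 'x" (infixr "*s" 75)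
  and e :: "'n::finite => 'n => 'x => 'x" and S l +
 fixes Z :: "'n => 'n => 'k::comm_monoid_add => 'x => 'x" and r :: complex
 assumes Z_add: "Z a b k (x + y) = Z a b k x + Z a b k y"
  and Z_scale: "Z a b k (t *s x) = t *s Z a b k x"
  and Z_S: "x \<in> S ==> Z a b k x \<in> S"
  and Z_comm: "Z a b k (Z c d k' x) - Z c d k' (Z a b k x) =
  (if b = c then Z a d (k + k') x else 0) - (if d = a then Z c b (k + k') x else 0)"
  and e_Z: "e a b x = Z a b 0 x + (if a = b then r *s x else 0)"
begin

lemma Z_zero [simp]: "Z a b k 0 = 0" using Z_scale[of a b k 0 0] by simp

lemma Z_minus: "Z a b k (- x) = - Z a b k x" using Z_scale[of a b k "-1" x] by (simp add: scale_minus_left)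

lemma Z_diff: "Z a b k (x - y) = Z a b k x - Z a b k y" using Z_add[of a b k x "- y"] by (simp add: Z_minus)

lemma Z_sum: "Z a b k (\<Sum>i\<in>I. f i) = (\<Sum>i\<in>I. Z a b k (f i))"
 by (induction I rule: infinite_finite_induct) (auto simp: Z_add)

lemma e_Z_comm: "e a b (Z c d k x) - Z c d k (e a b x) =
  (if b = c then Z a d k x else 0) - (if d = a then Z c b k x else 0)"
 using Z_comm[of a b 0 c d k x] by (auto simp: e_Z Z_add Z_scale algebra_simps)

lemma e_Z_swap: "e a b (Z c d k x) = Z c d k (e a b x) +
  (if b = c then Z a d k x else 0) - (if d = a then Z c b k x else 0)"
proof -
 have "e a b (Z c d k x) = (e a b (Z c d k x) - Z c d k (e a b x)) + Z c d k (e a b x)" by simp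
 thus ?thesis unfolding e_Z_comm by simp
qed

definition Y :: "'n list => 'n => nat => 'k => 'x => 'x"
 where "Y b z j k u = Z (b ! j) (b ! j) k u - Z z z k u"

lemma Y_comm: "Y b z i k (Y b z j k' u) = Y b z j k' (Y b z i k u)"
proof -
 have "Z a a k (Z c c k' u) = Z c c k' (Z a a k u)" for a c using Z_comm[of a a k c c k' u] by (auto split: if_splits)
 thus ?thesis by (simp add: Y_def Z_diff)
qed

context
 fixes b :: "'n list" and z :: 'n
 assumes b: "distinct b" "length b = l" and z: "z \<notin> set b"
begin

lemma Z_diag_J: "u \<in> J b ==> Z a a k u \<in> J b" by (auto simp: J_def Z_S e_Z_swap)

lemma Y_J: "u \<in> J b ==> Y b z j k u \<in> J b" unfolding Y_def by (rule subspace_diff[OF subspace_J Z_diag_J Z_diag_J])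

lemma Z_annihilated:
 assumes "u \<in> J b" "c ~= q" "q \<notin> set b"
 shows "Z c q k u = 0"
proof (rule J_weight_zero[of _ q])
 show "Z c q k u \<in> S" using J_S[OF assms(1)] by (rule Z_S)
 show "e q q (Z c q k u) = - Z c q k u" unfolding e_Z_swap using assms by (auto simp: J_def)
qed

text \<open>Through \<open>z\<close>, a letter that does not occur in \<open>b\<close>, the loop variable can be applied to the letter \<open>b ! j\<close> only.\<close>

lemma Y_eq:
 assumes u: "u \<in> J b" and j: "j < l"
 shows "e (b ! j) z (Z z (b ! j) k u) = Y b z j k u"
proof -
 have "b ! j ~= z" using b z j nth_mem by metis
 hence "e (b ! j) z u = 0" using J_annihilated[OF u z b(2)] by blast
 thus ?thesis unfolding e_Z_swap Y_def by simp
qed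

lemma e_Y:
 assumes u: "u \<in> J b" and j: "j < l"
 shows "e z (b ! j) (Y b z j k u) = Z z (b ! j) k u"
proof -
 let ?q = "b ! j" and ?y = "Z z (b ! j) k u"
 have q: "?q ~= z" "?q \<in> set b" using b z j nth_mem by metis+
 have zu: "e z z u = 0" "e ?q ?q u = u" using u z q by (auto simp: J_def)
 have "e z ?q ?y = 0"
 proof (rule J_weight_zero[of _ "?q"])
  show "e z ?q ?y \<in> S" using J_S[OF u] by (intro S_e Z_S)
  have "e ?q ?q ?y = 0" unfolding e_Z_swap using zu q by simp
  thus "e ?q ?q (e z ?q ?y) = - e z ?q ?y" using e_comm[of ?q ?q z ?q ?y] q by simp
 qed
 moreover have "e z z ?y = ?y" "e ?q ?q ?y = 0" unfolding e_Z_swap using zu q by simp_all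
 ultimately have "e z ?q (e ?q z ?y) = ?y" using e_comm[of z ?q ?q z ?y] by simp
 thus ?thesis using Y_eq[OF u j] by simp
qed

text \<open>Let \<open>p\<close> and the word \<open>a\<close> form a word of length \<open>l + 1\<close>, and consider both sides as families of
vectors indexed by \<open>q\<close>. They are equivariant for the action on \<open>X \<otimes> V\<close>, hence it suffices to compare them at the
word \<open>z # b\<close>, which has no repetitions.\<close>

lemma Z_wordop_all:
 assumes u: "u \<in> J b" and a: "length a = l"
 shows "Z p q k (wordop e b a u) = (if p = q then wordop e b a (Z z z k u) else 0) +
  (\<Sum>j<l. if a ! j = q then wordop e b (a[j := p]) (Y b z j k u) else 0)"
proof -
 let ?\<Phi> = "wordop e b"
 define op :: "'n => 'n => 'x ^ 'n => 'x ^ 'n"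
  where "op c d v = (\<chi> q. e c d (v $ q) + (if q = c then v $ d else 0))" for c d v
 have op0: "op c d 0 = 0" for c d by (simp add: op_def vec_eq_iff)
 have op_diff: "op c d (x - y) = op c d x - op c d y" for c d x y by (simp add: op_def vec_eq_iff e_diff)
 have op_add: "op c d (x + y) = op c d x + op c d y" for c d x y by (simp add: op_def vec_eq_iff e_add add_ac)
 have eq: "equivariant l e (%a. ?\<Phi> a v)" if "v \<in> J b" for v by (rule J_equivariant[OF that b(2)])
 have Zu: "Z z z k u \<in> J b" by (rule Z_diag_J[OF u])
 have Yu: "Y b z j k u \<in> J b" for j by (rule Y_J[OF u])
 define A where "A w = (\<chi> q. Z (hd w) q k (?\<Phi> (tl w) u))" for w
 define B where "B w = (\<chi> q. if hd w = q then ?\<Phi> (tl w) (Z z z k u) else 0)" for w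
 define C where "C w = (\<chi> q. \<Sum>j<l. if tl w ! j = q then ?\<Phi> ((tl w)[j := hd w]) (Y b z j k u) else 0)" for w
 have C_Cons: "C (p # a) $ q = (\<Sum>j<l. if a ! j = q then ?\<Phi> (a[j := p]) (Y b z j k u) else 0)" for p q a
  unfolding C_def vec_lambda_beta list.sel ..
 have A: "equivariant (Suc l) op A" unfolding equivariant_def
 proof (intro allI impI)
  fix w :: "'n list" and c d assume w: "length w = Suc l"
  then obtain p a where pa: "w = p # a" "length a = l" by (cases w) auto
  show "op c d (A w) = (\<Sum>i<Suc l. if w ! i = d then A (w[i := c]) else 0)"
  proof (subst vec_eq_iff, intro allI)
  fix q
  have "op c d (A w) $ q = Z p q k (e c d (?\<Phi> a u)) + (if d = p then Z c q k (?\<Phi> a u) else 0)"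
  by (simp add: op_def A_def pa e_Z_swap)
  also have "Z p q k (e c d (?\<Phi> a u)) = (\<Sum>i<l. if a ! i = d then Z p q k (?\<Phi> (a[i := c]) u) else 0)"
  unfolding equivariantD[OF eq[OF u] pa(2)] Z_sum by (intro sum.cong) auto
  finally show "op c d (A w) $ q = (\<Sum>i<Suc l. if w ! i = d then A (w[i := c]) else 0) $ q"
  by (auto simp: pa sum.lessThan_Suc_shift A_def if_distrib[of "%v. v $ q"]
  simp del: sum.lessThan_Suc cong: if_cong)
  qed
 qed
 have B: "equivariant (Suc l) op B" unfolding equivariant_def
 proof (intro allI impI)
  fix w :: "'n list" and c d assume w: "length w = Suc l"
  then obtain p a where pa: "w = p # a" "length a = l" by (cases w) auto
  show "op c d (B w) = (\<Sum>i<Suc l. if w ! i = d then B (w[i := c]) else 0)"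
  proof (subst vec_eq_iff, intro allI)
  fix q
  have "op c d (B w) $ q = (if p = q then e c d (?\<Phi> a (Z z z k u)) else 0) +
  (if q = c & p = d then ?\<Phi> a (Z z z k u) else 0)" by (auto simp: op_def B_def pa)
  also have "e c d (?\<Phi> a (Z z z k u)) = (\<Sum>i<l. if a ! i = d then ?\<Phi> (a[i := c]) (Z z z k u) else 0)"
  by (rule equivariantD[OF eq[OF Zu] pa(2)])
  finally show "op c d (B w) $ q = (\<Sum>i<Suc l. if w ! i = d then B (w[i := c]) else 0) $ q"
  by (auto simp: pa sum.lessThan_Suc_shift B_def if_distrib[of "%v. v $ q"]
  simp del: sum.lessThan_Suc cong: if_cong)
  qed
 qed
 have C: "equivariant (Suc l) op C" unfolding equivariant_def
 proof (intro allI impI)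
  fix w :: "'n list" and c d assume w: "length w = Suc l"
  then obtain p a where pa: "w = p # a" "length a = l" by (cases w) auto
  let ?W = "%i j. ?\<Phi> (a[j := p, i := c]) (Y b z j k u)"
  show "op c d (C w) = (\<Sum>i<Suc l. if w ! i = d then C (w[i := c]) else 0)"
  proof (subst vec_eq_iff, intro allI)
  fix q
  have row: "e c d (if a ! j = q then ?\<Phi> (a[j := p]) (Y b z j k u) else 0) =
  (if p = d & a ! j = q then ?\<Phi> (a[j := c]) (Y b z j k u) else 0) +
  (\<Sum>i<l. if i ~= j & a ! i = d & a ! j = q then ?W i j else 0)" if "j < l" for j
  proof (cases "a ! j = q")
  case True
  have "e c d (?\<Phi> (a[j := p]) (Y b z j k u)) =
  (\<Sum>i<l. if a[j := p] ! i = d then ?W i j else 0)" using equivariantD[OF eq[OF Yu]] pa by simp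
  also have "... = (\<Sum>i<l. (if i = j then (if p = d then ?\<Phi> (a[j := c]) (Y b z j k u) else 0) else 0)
  + (if i ~= j & a ! i = d then ?W i j else 0))" using pa that by (intro sum.cong) (auto simp: nth_list_update)
  also have "... = (if p = d then ?\<Phi> (a[j := c]) (Y b z j k u) else 0) +
  (\<Sum>i<l. if i ~= j & a ! i = d then ?W i j else 0)" using that by (simp add: sum.distrib)
  finally show ?thesis using True by (simp cong: conj_cong if_cong)
  qed simp
  have "op c d (C w) $ q = (\<Sum>j<l. e c d (if a ! j = q then ?\<Phi> (a[j := p]) (Y b z j k u) else 0)) +
  (if q = c then (\<Sum>j<l. if a ! j = d then ?\<Phi> (a[j := p]) (Y b z j k u) else 0) else 0)"
  by (simp add: op_def C_Cons pa e_sum)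
  also have "(\<Sum>j<l. e c d (if a ! j = q then ?\<Phi> (a[j := p]) (Y b z j k u) else 0)) =
  (\<Sum>j<l. if p = d & a ! j = q then ?\<Phi> (a[j := c]) (Y b z j k u) else 0) +
  (\<Sum>i<l. \<Sum>j<l. if i ~= j & a ! i = d & a ! j = q then ?W i j else 0)"
  by (subst sum.swap) (simp add: row sum.distrib)
  finally have L: "op c d (C w) $ q =
  (\<Sum>j<l. if p = d & a ! j = q then ?\<Phi> (a[j := c]) (Y b z j k u) else 0) +
  (\<Sum>i<l. \<Sum>j<l. if i ~= j & a ! i = d & a ! j = q then ?W i j else 0) +
  (\<Sum>j<l. if q = c & a ! j = d then ?\<Phi> (a[j := p]) (Y b z j k u) else 0)" by (cases "q = c") simp_all
  have col: "(if a ! i = d then C (p # a[i := c]) $ q else 0) =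
  (\<Sum>j<l. if i ~= j & a ! i = d & a ! j = q then ?W i j else 0) +
  (if q = c & a ! i = d then ?\<Phi> (a[i := p]) (Y b z i k u) else 0)" if "i < l" for i
  proof (cases "a ! i = d")
  case True
  have "C (p # a[i := c]) $ q = (\<Sum>j<l. if a[i := c] ! j = q then ?\<Phi> (a[i := c, j := p]) (Y b z j k u) else 0)"
  by (simp add: C_Cons)
  also have "... = (\<Sum>j<l. (if i ~= j & a ! j = q then ?W i j else 0) +
  (if j = i then (if q = c then ?\<Phi> (a[i := p]) (Y b z i k u) else 0) else 0))"
  using pa that by (intro sum.cong) (auto simp: nth_list_update list_update_swap)
  also have "... = (\<Sum>j<l. if i ~= j & a ! j = q then ?W i j else 0) +
  (if q = c then ?\<Phi> (a[i := p]) (Y b z i k u) else 0)" using that by (simp add: sum.distrib)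
  finally show ?thesis using True by (simp cong: conj_cong if_cong)
  qed simp
  have "(\<Sum>i<Suc l. if w ! i = d then C (w[i := c]) else 0) $ q =
  (if p = d then C (c # a) $ q else 0) + (\<Sum>i<l. if a ! i = d then C (p # a[i := c]) $ q else 0)"
  by (simp add: pa sum.lessThan_Suc_shift if_distrib[of "%v. v $ q"] del: sum.lessThan_Suc cong: if_cong)
  also have "(\<Sum>i<l. if a ! i = d then C (p # a[i := c]) $ q else 0) =
  (\<Sum>i<l. \<Sum>j<l. if i ~= j & a ! i = d & a ! j = q then ?W i j else 0) +
  (\<Sum>i<l. if q = c & a ! i = d then ?\<Phi> (a[i := p]) (Y b z i k u) else 0)" by (simp add: col sum.distrib)
  also have "(if p = d then C (c # a) $ q else 0) =
  (\<Sum>j<l. if p = d & a ! j = q then ?\<Phi> (a[j := c]) (Y b z j k u) else 0)" by (cases "p = d") (simp_all add: C_Cons)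
  finally show "op c d (C w) $ q = (\<Sum>i<Suc l. if w ! i = d then C (w[i := c]) else 0) $ q"
  unfolding L by (simp add: add_ac)
  qed
 qed
 define F where "F w = A w - (B w + C w)" for w
 have F: "equivariant (Suc l) op F" unfolding F_def using A B C op_add op_diff by (intro equivariant_diff equivariant_add)
 have "F (z # b) = 0"
 proof (subst vec_eq_iff, intro allI)
  fix q
  show "F (z # b) $ q = 0 $ q"
  proof (cases "q \<in> set b")
  case True
  then obtain j where j: "j < l" "b ! j = q" using b by (metis in_set_conv_nth)
  have "C (z # b) $ q = (\<Sum>i<l. if i = j then ?\<Phi> (b[j := z]) (Y b z j k u) else 0)"
  unfolding C_def vec_lambda_beta list.sel by (rule sum.cong) (use b j in \<open>auto simp: nth_eq_iff_index_eq\<close>)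
  also have "... = ?\<Phi> (b[j := z]) (Y b z j k u)" using j by simp
  also have "... = e z (b ! j) (?\<Phi> b (Y b z j k u))"
  by (rule wordop_e_distinct[OF Yu b(2) b(2), symmetric]) (use b j in \<open>auto simp: nth_eq_iff_index_eq\<close>)
  also have "... = Z z q k u" using e_Y[OF u j(1)] by (simp add: wordop_self[OF Yu b(1)] j)
  finally have "C (z # b) $ q = Z z q k u" .
  moreover have "z ~= q" using True z by blast
  ultimately show ?thesis by (simp add: F_def A_def B_def wordop_self[OF u b(1)])
  next
  case False
  have "C (z # b) $ q = 0" unfolding C_def vec_lambda_beta list.sel by (rule sum.neutral) (use False b nth_mem in auto)
  moreover have "A (z # b) $ q = B (z # b) $ q" using Z_annihilated[OF u _ False] wordop_self[OF Zu b(1)]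
  by (cases "z = q") (simp_all add: A_def B_def wordop_self[OF u b(1)])
  ultimately show ?thesis by (simp add: F_def)
  qed
 qed
 hence "F (p # a) = 0" by (rule equivariant_zero[OF op0 F, of "z # b", rotated 2]) (use b z a in auto)
 hence "F (p # a) $ q = 0" by simp
 thus ?thesis by (simp add: F_def A_def B_def C_Cons)
qed

lemma Z_wordop:
 assumes "u \<in> J b" "length a = l" "p ~= q"
 shows "Z p q k (wordop e b a u) = (\<Sum>j<l. if a ! j = q then wordop e b (a[j := p]) (Y b z j k u) else 0)"
 using Z_wordop_all[OF assms(1,2)] assms(3) by simp

lemma Z_wordop_distinct:
 assumes u: "u \<in> J b" and a: "length a = l" "j < l" "!!i. i < l ==> i ~= j ==> a ! i ~= a ! j" and p: "p ~= a ! j"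
 shows "Z p (a ! j) k (wordop e b a u) = wordop e b (a[j := p]) (Y b z j k u)"
proof -
 have "Z p (a ! j) k (wordop e b a u) =
  (\<Sum>i<l. if i = j then wordop e b (a[j := p]) (Y b z j k u) else 0)"
  unfolding Z_wordop[OF u a(1) p] using a by (intro sum.cong) auto
 thus ?thesis using a by simp
qed

lemma Y_mult:
 assumes u: "u \<in> J b" and j: "j < l"
 shows "Y b z j k (Y b z j k' u) = Y b z j (k + k') u"
proof -
 let ?q = "b ! j"
 have q: "?q ~= z" using b z j nth_mem by metis
 have Yu: "Y b z j k' u \<in> J b" by (rule Y_J[OF u])
 have "Z z ?q k' u = wordop e b (b[j := z]) (Y b z j k' u)"
  using Z_wordop_distinct[OF u b(2) j, of z k'] wordop_self[OF u b(1)] b j q by (auto simp: nth_eq_iff_index_eq)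
 moreover have "Z ?q z k (wordop e b (b[j := z]) (Y b z j k' u)) =
  wordop e b (b[j := z, j := ?q]) (Y b z j k (Y b z j k' u))"
  using Z_wordop_distinct[OF Yu, of "b[j := z]" j ?q k] b j q z nth_mem[of _ b] by (fastforce simp: nth_list_update)
 moreover have "... = Y b z j k (Y b z j k' u)" using wordop_self[OF Y_J[OF Yu] b(1)] by simp
 moreover have "Z ?q z k (Z z ?q k' u) = Y b z j (k + k') u"
 proof -
  have "Z ?q z k u = 0" using Z_annihilated[OF u q z] .
  thus ?thesis using Z_comm[of ?q z k z ?q k' u] by (simp add: Y_def)
 qed
 ultimately show ?thesis by simp
qed

lemma Y_zero: "u \<in> J b ==> j < l ==> Y b z j 0 u = u"
proof -
 assume "u \<in> J b" "j < l"
 hence "e (b ! j) (b ! j) u - e z z u = u" using b z by (simp add: J_def)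
 thus ?thesis by (simp add: e_Z Y_def)
qed

lemma Y_sg:
 assumes u: "u \<in> J b" and i: "i + 1 < l" and j: "j < l"
 shows "Y b z j k (sg b i u) = sg b i (Y b z (tr i j) k u)"
proof (rule wordop_inj[OF b])
 have su: "sg b i u \<in> J b" by (rule sg_J[OF b u i])
 show "Y b z j k (sg b i u) \<in> J b" by (rule Y_J[OF su])
 show "sg b i (Y b z (tr i j) k u) \<in> J b" by (intro sg_J[OF b] Y_J u i)
 show "distinct (b[j := z])" using b z by (simp add: distinct_list_update)
 show "length (b[j := z]) = l" using b by simp
 let ?q = "b ! j"
 have q: "z ~= ?q" using b z j nth_mem by metis
 have "swp i b ! i' ~= swp i b ! tr i j" if "i' < l" "i' ~= tr i j" for i'
  using that b i j distinct_swp[of i b] by (subst nth_eq_iff_index_eq) (auto simp: tr_def)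
 note dist = this
 have tr: "tr i j < l" "swp i b ! tr i j = ?q" "tr i (tr i j) = j"
  using i j b nth_swp[of i b "tr i j"] by (auto simp: tr_def)
 have "wordop e b (b[j := z]) (Y b z j k (sg b i u)) = Z z ?q k (wordop e b b (sg b i u))"
  by (rule Z_wordop_distinct[symmetric]) (use su b j q in \<open>auto simp: nth_eq_iff_index_eq\<close>)
 also have "wordop e b b (sg b i u) = wordop e b (swp i b) u" by (rule wordop_sg[OF b u i b(2)])
 also have "Z z ?q k ... = wordop e b ((swp i b)[tr i j := z]) (Y b z (tr i j) k u)" unfolding tr(2)[symmetric]
  by (rule Z_wordop_distinct) (use u b i tr q dist in auto)
 also have "(swp i b)[tr i j := z] = swp i (b[j := z])" by (rule swp_update[symmetric]) (use b i j in auto)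
 also have "wordop e b ... (Y b z (tr i j) k u) = wordop e b (b[j := z]) (sg b i (Y b z (tr i j) k u))"
  by (rule wordop_sg[OF b Y_J[OF u] i, symmetric]) (use b in simp)
 finally show "wordop e b (b[j := z]) (Y b z j k (sg b i u)) = ..." .
qed

end

end

section \<open>Semisimplicity in representations of \<open>sl\<^sub>2\<close>\<close>

locale sl2_rep = vector_space scale
 for scale :: "complex => 'x::ab_group_add => 'x" (infixr "*s" 75) +
 fixes e f h :: "'x => 'x" and P :: "'x set"
 assumes lin: "e (x + y) = e x + e y" "f (x + y) = f x + f y" "h (x + y) = h x + h y"
  "e (c *s x) = c *s e x" "f (c *s x) = c *s f x" "h (c *s x) = c *s h x"
  and he: "h (e x) - e (h x) = 2 *s e x"
  and hf: "h (f x) - f (h x) = - (2 *s f x)"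
  and ef: "e (f x) - f (e x) = h x"
  and P: "subspace P" "x \<in> P ==> e x \<in> P" "x \<in> P ==> f x \<in> P" "x \<in> P ==> h x \<in> P"
  and nil: "x \<in> P ==> EX k. (e ^^ k) x = 0" "x \<in> P ==> EX k. (f ^^ k) x = 0"
begin

lemma zero [simp]: "e 0 = 0" "f 0 = 0" "h 0 = 0" using lin(4)[of 0 0] lin(5)[of 0 0] lin(6)[of 0 0] by simp_all

lemma pow_zero [simp]: "(e ^^ k) 0 = 0" "(f ^^ k) 0 = 0" by (induction k) auto

lemma neg: "e (- x) = - e x" "f (- x) = - f x" "h (- x) = - h x"
 using lin(4)[of "-1" x] lin(5)[of "-1" x] lin(6)[of "-1" x] by (simp_all add: scale_minus_left)

lemma diff: "e (x - y) = e x - e y" "f (x - y) = f x - f y" "h (x - y) = h x - h y"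
 using lin(1)[of x "-y"] lin(2)[of x "-y"] lin(3)[of x "-y"] by (simp_all add: neg)

lemma pow_lin: "(e ^^ k) (x + y) = (e ^^ k) x + (e ^^ k) y" "(e ^^ k) (c *s x) = c *s (e ^^ k) x"
  "(f ^^ k) (x + y) = (f ^^ k) x + (f ^^ k) y" "(f ^^ k) (c *s x) = c *s (f ^^ k) x" by (induction k) (auto simp: lin)

lemma pow_P: "x \<in> P ==> (e ^^ k) x \<in> P" "x \<in> P ==> (f ^^ k) x \<in> P" by (induction k) (auto simp: P)

lemma one_plus: "y + c *s y = (1 + c) *s y" by (simp add: scale_left_distrib)

lemma he': "h (e x) = e (h x) + 2 *s e x" using he[of x] by (metis add.commute diff_add_cancel)

lemma hf': "h (f x) = f (h x) - 2 *s f x" using hf[of x] by (metis add.commute diff_add_cancel uminus_add_conv_diff)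

lemma ef': "e (f x) = f (e x) + h x" using ef[of x] by (metis add.commute diff_add_cancel)

lemma h_pow_e: "h ((e ^^ k) x) = (e ^^ k) (h x) + (2 * of_nat k) *s (e ^^ k) x"
 by (induction k) (simp_all add: he' lin scale_left_distrib distrib_left)

lemma e_pow_f: "(e ^^ Suc k) (f x) = f ((e ^^ Suc k) x) + of_nat (Suc k) *s ((e ^^ k) (h x) + of_nat k *s (e ^^ k) x)"
proof (induction k)
 case 0
 thus ?case by (simp add: ef')
next
 case (Suc k)
 have "(e ^^ Suc (Suc k)) (f x) = e (f ((e ^^ Suc k) x)) + of_nat (Suc k) *s ((e ^^ Suc k) (h x) + of_nat k *s (e ^^ Suc k) x)"
  using Suc by (simp add: lin)
 also have "e (f ((e ^^ Suc k) x)) = f ((e ^^ Suc (Suc k)) x) + ((e ^^ Suc k) (h x) + (2 * of_nat (Suc k)) *s (e ^^ Suc k) x)"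
  unfolding ef' h_pow_e by simp
 finally have "(e ^^ Suc (Suc k)) (f x) = f ((e ^^ Suc (Suc k)) x) +
  (((e ^^ Suc k) (h x) + of_nat (Suc k) *s (e ^^ Suc k) (h x)) +
  ((2 * of_nat (Suc k)) *s (e ^^ Suc k) x + (of_nat (Suc k) * of_nat k) *s (e ^^ Suc k) x))"
  by (simp only: scale_right_distrib scale_scale add_ac)
 also have "(e ^^ Suc k) (h x) + of_nat (Suc k) *s (e ^^ Suc k) (h x) =
  of_nat (Suc (Suc k)) *s (e ^^ Suc k) (h x)" unfolding one_plus by simp
 also have "(2 * of_nat (Suc k)) *s (e ^^ Suc k) x + (of_nat (Suc k) * of_nat k) *s (e ^^ Suc k) x =
  (of_nat (Suc (Suc k)) * of_nat (Suc k)) *s (e ^^ Suc k) x"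
  unfolding scale_left_distrib[symmetric] by (simp add: algebra_simps)
 finally show ?case by (simp only: scale_right_distrib scale_scale)
qed

lemma f_pow_e: "e ((f ^^ Suc k) x) = (f ^^ Suc k) (e x) + of_nat (Suc k) *s ((f ^^ k) (h x) - of_nat k *s (f ^^ k) x)"
proof (induction k arbitrary: x)
 case 0
 thus ?case by (simp add: ef')
next
 case (Suc k)
 have "e ((f ^^ Suc (Suc k)) x) = e ((f ^^ Suc k) (f x))" by (simp add: funpow_swap1)
 also have "... = (f ^^ Suc k) (f (e x) + h x) + of_nat (Suc k) *s ((f ^^ k) (f (h x) - 2 *s f x) - of_nat k *s (f ^^ k) (f x))"
  unfolding Suc ef' hf' ..
 also have "(f ^^ k) (f (h x) - 2 *s f x) = (f ^^ Suc k) (h x) - 2 *s (f ^^ Suc k) x"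
  using pow_lin(3)[of k "f (h x)" "- (2 *s f x)"] pow_lin(4)[of k "-2" "f x"] by (simp add: scale_minus_left funpow_swap1)
 also have "(f ^^ Suc k) (f (e x) + h x) = (f ^^ Suc (Suc k)) (e x) + (f ^^ Suc k) (h x)"
  unfolding pow_lin by (simp add: funpow_swap1)
 also have "(f ^^ k) (f x) = (f ^^ Suc k) x" by (simp add: funpow_swap1)
 finally have "e ((f ^^ Suc (Suc k)) x) = (f ^^ Suc (Suc k)) (e x) +
  (((f ^^ Suc k) (h x) + of_nat (Suc k) *s (f ^^ Suc k) (h x)) -
  ((of_nat (Suc k) * 2) *s (f ^^ Suc k) x + (of_nat (Suc k) * of_nat k) *s (f ^^ Suc k) x))"
  by (simp only: scale_right_diff_distrib scale_scale) (simp only: add_ac diff_diff_eq add_diff_eq)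
 also have "(f ^^ Suc k) (h x) + of_nat (Suc k) *s (f ^^ Suc k) (h x) =
  of_nat (Suc (Suc k)) *s (f ^^ Suc k) (h x)" unfolding one_plus by simp
 also have "(of_nat (Suc k) * 2) *s (f ^^ Suc k) x + (of_nat (Suc k) * of_nat k) *s (f ^^ Suc k) x =
  (of_nat (Suc (Suc k)) * of_nat (Suc k)) *s (f ^^ Suc k) x"
  unfolding scale_left_distrib[symmetric] by (simp add: algebra_simps)
 finally show ?case by (simp only: scale_right_diff_distrib scale_scale)
qed

fun Q :: "nat => 'x => 'x" where
 "Q 0 x = x"
| "Q (Suc k) x = Q k (h x - of_nat k *s x)"

declare Q.simps(2) [simp del]

lemma Q_lin: "Q k (x + y) = Q k x + Q k y" "Q k (c *s x) = c *s Q k x"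
proof -
 show "Q k (x + y) = Q k x + Q k y"
 proof (induction k arbitrary: x y)
  case (Suc k)
  have "h (x + y) - of_nat k *s (x + y) = (h x - of_nat k *s x) + (h y - of_nat k *s y)"
  by (simp add: lin scale_right_distrib)
  thus ?case by (simp only: Q.simps Suc)
 qed simp
 show "Q k (c *s x) = c *s Q k x"
 proof (induction k arbitrary: x)
  case (Suc k)
  have "h (c *s x) - of_nat k *s (c *s x) = c *s (h x - of_nat k *s x)"
  by (simp add: lin scale_right_diff_distrib mult.commute)
  thus ?case by (simp only: Q.simps Suc)
 qed simp
qed

text \<open>\<open>Q k\<close> is the falling factorial \<open>h (h - 1) \<dots> (h - k + 1)\<close>.\<close>

lemma e_f_highest: "e x = 0 ==> (e ^^ k) ((f ^^ k) x) = fact k *s Q k x"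
proof (induction k arbitrary: x)
 case (Suc k)
 define y where "y = h x - of_nat k *s x"
 have "e (h x) = 0" using he'[of x] Suc.prems by simp
 hence y: "e y = 0" using Suc.prems by (simp add: y_def diff lin)
 have fy: "(f ^^ k) (h x) - of_nat k *s (f ^^ k) x = (f ^^ k) y"
  using pow_lin(3)[of k y "of_nat k *s x"] by (simp add: y_def pow_lin)
 have "(e ^^ Suc k) ((f ^^ Suc k) x) = (e ^^ k) (e ((f ^^ Suc k) x))" by (simp only: funpow_Suc_right o_apply)
 also have "... = of_nat (Suc k) *s (e ^^ k) ((f ^^ k) y)"
  unfolding f_pow_e Suc.prems fy by (simp only: pow_zero add_0_left pow_lin)
 also have "... = fact (Suc k) *s Q (Suc k) x" unfolding Suc.IH[OF y] by (simp add: y_def Q.simps)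
 finally show ?case .
qed simp

text \<open>On the vectors killed by \<open>e ^^ Suc K\<close>, the operator \<open>e f\<close> is the nonzero scalar \<open>c\<close> modulo those killed by \<open>e ^^ K\<close>.\<close>

lemma raise_surj:
 assumes "(e ^^ K) x = 0" "h x = of_nat (n + 2) *s x" "x \<in> P"
 shows "EX y:P. h y = of_nat (n + 2) *s y & e (f y) = x" using assms
proof (induction K arbitrary: x)
 case 0
 thus ?case by (intro bexI[of _ 0]) (auto simp: subspace_0[OF P(1)])
next
 case (Suc K)
 define c :: complex where "c = of_nat (Suc K * (n + 2 + K))"
 have c: "c ~= 0" unfolding c_def of_nat_eq_0_iff by simp
 define x2 where "x2 = e (f x) - c *s x"
 have "(e ^^ K) (e (f x)) = c *s (e ^^ K) x"
 proof -
  have "(e ^^ K) (e (f x)) = (e ^^ Suc K) (f x)" by (simp only: funpow_Suc_right o_apply)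
  also have "... = of_nat (Suc K) *s (of_nat (n + 2) *s (e ^^ K) x + of_nat K *s (e ^^ K) x)"
  unfolding e_pow_f using Suc.prems by (simp add: pow_lin)
  also have "... = c *s (e ^^ K) x"
  unfolding c_def by (simp only: scale_left_distrib[symmetric] scale_scale of_nat_add[symmetric] of_nat_mult[symmetric])
  finally show ?thesis .
 qed
 hence 1: "(e ^^ K) x2 = 0" using pow_lin(1)[of K x2 "c *s x"] by (simp add: x2_def pow_lin)
 have "h (e (f x)) = of_nat (n + 2) *s e (f x)" using Suc.prems(2) by (simp add: he' hf' diff lin)
 hence 2: "h x2 = of_nat (n + 2) *s x2"
  using Suc.prems(2) by (simp add: x2_def diff lin scale_right_diff_distrib mult.commute)
 have 3: "x2 \<in> P" unfolding x2_def using Suc.prems P by (intro subspace_diff subspace_scale P)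
 obtain y2 where y2: "y2 \<in> P" "h y2 = of_nat (n + 2) *s y2" "e (f y2) = x2" using Suc.IH[OF 1 2 3] by blast
 have "e (f ((1 / c) *s (x - y2))) = (1 / c) *s (c *s x)" using y2 by (simp add: lin diff x2_def)
 hence "e (f ((1 / c) *s (x - y2))) = x" using c by simp
 moreover have "h ((1 / c) *s (x - y2)) = of_nat (n + 2) *s ((1 / c) *s (x - y2))"
  using y2 Suc.prems(2) by (simp add: lin diff scale_right_diff_distrib mult.commute)
 moreover have "(1 / c) *s (x - y2) \<in> P" using y2 Suc.prems by (intro subspace_scale subspace_diff P)
 ultimately show ?case by blast
qed

text \<open>A Jordan block of \<open>h\<close> can be moved by powers of \<open>e\<close> to a highest weight vector \<open>w1\<close>, whose weight is then a
natural number \<open>n\<close>, and corrected to \<open>v2\<close> with \<open>e v2 = 0\<close>. The polynomial \<open>h (h - 1) \<dots>\<close> has a simple zero at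
\<open>n\<close>, so \<open>e\<^sup>k f\<^sup>k v2\<close> is a nonzero multiple of \<open>w1\<close> for all large \<open>k\<close>, against the nilpotency of \<open>f\<close>.\<close>

theorem h_semisimple:
 assumes v: "v \<in> P" and 2: "h (h v - s *s v) = s *s (h v - s *s v)"
 shows "h v = s *s v"
proof (rule ccontr)
 assume "h v ~= s *s v"
 define w where "w = h v - s *s v"
 have w: "w \<in> P" "w ~= 0" "h w = s *s w" "h v = s *s v + w"
  using \<open>h v ~= s *s v\<close> v 2 by (auto simp: w_def intro!: subspace_diff subspace_scale P)
 define k where "k = (LEAST k. (e ^^ k) w = 0)"
 have k: "(e ^^ k) w = 0" unfolding k_def using nil(1)[OF w(1)] by (rule LeastI_ex)
 have "k ~= 0" using k w by (cases k) auto
 then obtain i where i: "k = Suc i" by (cases k) auto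
 have ei: "(e ^^ i) w ~= 0" using not_less_Least[of i "%k. (e ^^ k) w = 0"] i k_def by auto
 define v1 w1 s1 where "v1 = (e ^^ i) v" and "w1 = (e ^^ i) w" and "s1 = s + 2 * of_nat i"
 have w1: "w1 ~= 0" "e w1 = 0" "h w1 = s1 *s w1" "w1 \<in> P"
  using ei k i w by (auto simp: w1_def s1_def h_pow_e pow_lin scale_left_distrib pow_P)
 have v1: "h v1 = s1 *s v1 + w1" "v1 \<in> P"
  using w v by (auto simp: v1_def w1_def s1_def h_pow_e pow_lin scale_left_distrib pow_P add_ac)
 have Qw1: "Q k w1 = (\<Prod>i<k. s1 - of_nat i) *s w1" for k
 proof (induction k)
  case (Suc k)
  have "h w1 - of_nat k *s w1 = (s1 - of_nat k) *s w1" by (simp add: w1 scale_left_diff_distrib)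
  thus ?case by (simp add: Q.simps Q_lin Suc mult.commute)
 qed simp
 obtain k where "(f ^^ k) w1 = 0" using nil(2)[OF w1(4)] by blast
 hence "fact k *s Q k w1 = 0" using e_f_highest[OF w1(2), of k] by simp
 hence "(\<Prod>i<k. s1 - of_nat i) = 0" using w1 by (simp add: Qw1)
 then obtain n where n: "s1 = of_nat n" by auto
 have "h (e v1) = of_nat (n + 2) *s e v1" by (simp add: he' v1 lin w1 n scale_left_distrib)
 moreover have ev1: "e v1 \<in> P" using v1 by (intro P)
 moreover obtain K where "(e ^^ K) (e v1) = 0" using nil(1)[OF ev1] by blast
 ultimately obtain y where y: "y \<in> P" "h y = of_nat (n + 2) *s y" "e (f y) = e v1" using raise_surj by blast
 define v2 where "v2 = v1 - f y"
 have v2: "e v2 = 0" "v2 \<in> P" using y v1 by (auto simp: v2_def diff intro!: subspace_diff P)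
 have "h (f y) = of_nat n *s f y" using y by (simp add: hf' lin scale_left_distrib)
 hence hv2: "h v2 = of_nat n *s v2 + w1" using v1 by (simp add: v2_def diff n scale_right_diff_distrib)
 have step: "Q (Suc k) v2 = (of_nat n - of_nat k) *s Q k v2 + (\<Prod>i<k. of_nat n - of_nat i) *s w1" for k
 proof -
  have "h v2 - of_nat k *s v2 = (of_nat n - of_nat k) *s v2 + w1" by (simp add: hv2 scale_left_diff_distrib)
  thus ?thesis using Qw1[of k] by (simp add: Q.simps Q_lin n)
 qed
 have nz: "EX c. c ~= 0 & Q (Suc (n + j)) v2 = c *s w1" for j
 proof (induction j)
  case 0
  have "(\<Prod>i<n. of_nat n - of_nat i :: complex) ~= 0" by auto
  thus ?case using step[of n] by (intro exI[of _ "\<Prod>i<n. of_nat n - of_nat i"]) simp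
 next
  case (Suc j)
  then obtain c where c: "c ~= 0" "Q (Suc (n + j)) v2 = c *s w1" by blast
  have "(\<Prod>i<Suc (n + j). of_nat n - of_nat i :: complex) = 0" by (rule prod_zero) auto
  hence "Q (Suc (n + Suc j)) v2 = ((of_nat n - of_nat (Suc (n + j))) * c) *s w1" using step[of "Suc (n + j)"] c by simp
  moreover have "(of_nat n - of_nat (Suc (n + j)) :: complex) * c ~= 0"
  using c of_nat_eq_iff[of n "Suc (n + j)", where 'a = complex] by (simp del: of_nat_Suc of_nat_add)
  ultimately show ?case by blast
 qed
 obtain k where k: "(f ^^ k) v2 = 0" using nil(2)[OF v2(2)] by blast
 hence "(f ^^ (Suc (n + k))) v2 = 0" using funpow_add[of "Suc n" k f] by simp
 hence "fact (Suc (n + k)) *s Q (Suc (n + k)) v2 = 0" using e_f_highest[OF v2(1), of "Suc (n + k)"] by simp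
 hence "Q (Suc (n + k)) v2 = 0" by (simp del: fact_Suc)
 then show False using nz[of k] w1 by auto
qed

end

lemma (in vector_space) foldr_commute_eigen:
 assumes h: "!!x y. h (x + y) = h x + h y" "!!c x. h (c *s x) = c *s h x"
 shows "foldr (%r y. h y - r *s y) rs (h x - t *s x) = h (foldr (%r y. h y - r *s y) rs x) - t *s foldr (%r y. h y - r *s y) rs x"
proof (induction rs)
 case (Cons r rs)
 have hm: "h (x - y) = h x - h y" for x y using h(1)[of "x - y" y] by simp
 show ?case by (simp add: Cons hm h scale_right_diff_distrib mult.commute)
qed simp

lemma (in vector_space) semisimple_remdups:
 assumes h: "!!x y. h (x + y) = h x + h y" "!!c x. h (c *s x) = c *s h x"
  and P: "subspace P" "!!x. x \<in> P ==> h x \<in> P"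
  and ss: "!!v s. v \<in> P ==> h (h v - s *s v) = s *s (h v - s *s v) ==> h v = s *s v"
  and x: "x \<in> P" and rs: "foldr (%r y. h y - r *s y) rs x = 0"
 shows "foldr (%r y. h y - r *s y) (remdups rs) x = 0" using x rs
proof (induction rs arbitrary: x)
 case (Cons r rs)
 let ?K = "%rs. foldr (%r y. h y - r *s y) rs"
 note comm = foldr_commute_eigen[of h, OF h]
 have KP: "?K rs y \<in> P" if "y \<in> P" for rs y
  using that by (induction rs) (auto intro!: subspace_diff subspace_scale P)
 have "h x - r *s x \<in> P" using Cons.prems by (auto intro!: subspace_diff subspace_scale P)
 moreover have "?K rs (h x - r *s x) = 0" using Cons.prems comm[of rs x r] by simp
 ultimately have IH: "?K (remdups rs) (h x - r *s x) = 0" by (rule Cons.IH)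
 show ?case
 proof (cases "r \<in> set rs")
  case False
  thus ?thesis using IH comm[of "remdups rs" x r] by simp
 next
  case True
  then obtain ys zs where yz: "remdups rs = ys @ r # zs" by (metis set_remdups split_list)
  define u where "u = ?K ys (?K zs x)"
  have u: "?K (remdups rs) x = h u - r *s u" unfolding yz u_def using comm[of ys "?K zs x" r] by simp
  have "h (?K (remdups rs) x) - r *s ?K (remdups rs) x = 0" using IH comm[of "remdups rs" x r] by simp
  hence "h u = r *s u" unfolding u by (intro ss[of u r]) (auto simp: u_def intro!: KP Cons.prems(1))
  thus ?thesis using True u by simp
 qed
qed simp

section \<open>Vector spaces on a carrier as subspaces of a free vector space\<close>

text \<open>A module \<open>N\<close> over the complex numbers embeds linearly into the free vector space on its elements, as a
complement of the kernel of the evaluation \<open>ev\<close>. Arguments of linear algebra then use the type class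
operations. The embedding is extended to operators by composing with \<open>ev\<close>, which makes them linear on the whole type.\<close>

abbreviation psc :: "complex => 'v fvec => 'v fvec"
 where "psc c p \<equiv> Poly_Mapping.map ((*) c) p"

lemma lookup_psc [simp]: "pcoef (psc c p) k = c * pcoef p k" by (simp add: Poly_Mapping.map.rep_eq when_def)

lemma psc_vector_space: "vector_space psc" by unfold_locales (auto intro!: poly_mapping_eqI simp: lookup_add algebra_simps)

interpretation psc: vector_space psc by (rule psc_vector_space)

lemma CC_simps [simp]: "carrier CC = UNIV" "x \<oplus>\<^bsub>CC\<^esub> y = x + y" "x \<otimes>\<^bsub>CC\<^esub> y = x * y"
  "\<one>\<^bsub>CC\<^esub> = 1" "\<zero>\<^bsub>CC\<^esub> = 0" by (simp_all add: ring_of_type_algebra_def)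

lemma cring_CC [simp]: "cring CC" by (rule cring_from_type_algebra)

lemma CC_neg [simp]: "\<ominus>\<^bsub>CC\<^esub> c = - c"
proof -
 interpret cring CC by simp
 show ?thesis by (rule minus_equality) auto
qed

definition lin_ext :: "(complex, 'v) module => ('k => 'v) => 'k fvec => 'v"
 where "lin_ext N f p = (\<Oplus>\<^bsub>N\<^esub>k\<in>psupp p. pcoef p k \<odot>\<^bsub>N\<^esub> f k)"

context
 fixes N :: "(complex, 'v) module" (structure)
 assumes N: "vsp N"
begin

interpretation Module.module CC N by (rule N)

lemma lin_ext_superset:
 assumes "finite K" "psupp p <= K" "!!k. k \<in> K ==> f k \<in> carrier N"
 shows "lin_ext N f p = (\<Oplus>k\<in>K. pcoef p k \<odot> f k)" unfolding lin_ext_def using assms smult_l_null[simplified]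
 by (intro add.finprod_mono_neutral_cong_left) (auto simp: in_keys_iff)

lemma lin_ext_closed:
 assumes "!!k. k \<in> psupp p ==> f k \<in> carrier N"
 shows "lin_ext N f p \<in> carrier N" unfolding lin_ext_def using assms by (intro finsum_closed) auto

lemma lin_ext_add:
 assumes "!!k. k \<in> psupp p \<union> psupp q ==> f k \<in> carrier N"
 shows "lin_ext N f (p + q) = lin_ext N f p \<oplus> lin_ext N f q"
proof -
 let ?K = "psupp p \<union> psupp q"
 have "lin_ext N f (p + q) = (\<Oplus>k\<in>?K. pcoef (p + q) k \<odot> f k)"
  by (rule lin_ext_superset) (use assms Poly_Mapping.keys_add[of p q] in auto)
 also have "... = (\<Oplus>k\<in>?K. pcoef p k \<odot> f k \<oplus> pcoef q k \<odot> f k)"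
  using assms smult_l_distr by (intro finsum_cong') (auto simp: lookup_add)
 also have "... = (\<Oplus>k\<in>?K. pcoef p k \<odot> f k) \<oplus> (\<Oplus>k\<in>?K. pcoef q k \<odot> f k)"
  using assms by (intro finsum_addf) auto
 also have "(\<Oplus>k\<in>?K. pcoef p k \<odot> f k) = lin_ext N f p"
  by (rule lin_ext_superset[symmetric]) (use assms in auto)
 also have "(\<Oplus>k\<in>?K. pcoef q k \<odot> f k) = lin_ext N f q"
  by (rule lin_ext_superset[symmetric]) (use assms in auto)
 finally show ?thesis .
qed

lemma lin_ext_psc:
 assumes "!!k. k \<in> psupp p ==> f k \<in> carrier N"
 shows "lin_ext N f (psc c p) = c \<odot> lin_ext N f p"
proof -
 let ?K = "psupp p"
 have "lin_ext N f (psc c p) = (\<Oplus>k\<in>?K. pcoef (psc c p) k \<odot> f k)"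
  by (rule lin_ext_superset) (use assms in \<open>auto simp: in_keys_iff\<close>)
 also have "... = (\<Oplus>k\<in>?K. c \<odot> (pcoef p k \<odot> f k))"
  using assms smult_assoc1 by (intro finsum_cong') auto
 also have "... = c \<odot> (\<Oplus>k\<in>?K. pcoef p k \<odot> f k)"
  using assms by (intro finsum_smult_ldistr[symmetric]) auto
 finally show ?thesis by (simp add: lin_ext_def)
qed

lemma lin_ext_single:
 assumes "f k \<in> carrier N"
 shows "lin_ext N f (pmono k c) = c \<odot> f k"
proof -
 have "lin_ext N f (pmono k c) =
  (\<Oplus>i\<in>{k}. pcoef (pmono k c) i \<odot> f i)" by (rule lin_ext_superset) (use assms in auto)
 thus ?thesis using assms by simp
qed

lemma lin_ext_zero: "lin_ext N f 0 = \<zero>" by (simp add: lin_ext_def)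

end

definition ev :: "(complex, 'v) module => 'v fvec => 'v"
 where "ev N = lin_ext N (%v. if v \<in> carrier N then v else \<zero>\<^bsub>N\<^esub>)"

definition is_section :: "(complex, 'v) module => ('v => 'v fvec) => bool"
 where "is_section N i \<longleftrightarrow> (ALL u:carrier N. ALL v:carrier N. i (u \<oplus>\<^bsub>N\<^esub> v) = i u + i v) &
  (ALL c. ALL v:carrier N. i (c \<odot>\<^bsub>N\<^esub> v) = psc c (i v)) & (ALL v:carrier N. ev N (i v) = v)"

context
 fixes N :: "(complex, 'v) module" (structure)
 assumes N: "vsp N"
begin

interpretation Module.module CC N by (rule N)

lemma ev_closed [simp]: "ev N p \<in> carrier N" unfolding ev_def by (rule lin_ext_closed[OF N]) auto

lemma ev_add: "ev N (p + q) = ev N p \<oplus> ev N q" unfolding ev_def by (rule lin_ext_add[OF N]) auto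

lemma ev_psc: "ev N (psc c p) = c \<odot> ev N p" unfolding ev_def by (rule lin_ext_psc[OF N]) auto

lemma ev_single: "v \<in> carrier N ==> ev N (pmono v c) = c \<odot> v"
 unfolding ev_def by (subst lin_ext_single[OF N]) auto

lemma ev_zero: "ev N 0 = \<zero>" unfolding ev_def by (rule lin_ext_zero[OF N])

lemma minus_smult: "v \<in> carrier N ==> \<ominus> v = (-1) \<odot> v"
 using smult_l_minus[of 1 v] by (simp add: smult_one[simplified])

lemma ev_diff: "ev N (p - q) = ev N p \<ominus> ev N q"
proof -
 have "ev N (p + psc (-1) q) = ev N p \<oplus> (-1) \<odot> ev N q" by (simp only: ev_add ev_psc)
 moreover have "p + psc (-1) q = p - q" by (rule poly_mapping_eqI) (simp add: lookup_add lookup_minus)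
 ultimately show ?thesis by (simp only: minus_eq minus_smult[OF ev_closed])
qed

text \<open>A linear projection \<open>g\<close> onto the kernel of \<open>ev\<close> turns \<open>v\<close> into \<open>x - g x\<close> for the basis element \<open>x\<close> of \<open>v\<close>.\<close>

lemma section_exists: "EX i. is_section N i"
proof -
 interpret vector_space_pair psc psc ..
 define K where "K = {p. ev N p = \<zero>}"
 have K: "psc.subspace K" unfolding psc.subspace_def K_def by (auto simp: ev_zero ev_add ev_psc)
 have "Vector_Spaces.linear psc psc id" by (rule psc.linear_id)
 then obtain g where g: "range g <= K" "Vector_Spaces.linear psc psc g" "!!v. v \<in> K ==> g v = v"
  using linear_exists_left_inverse_on[of id K, OF _ K] by auto
 interpret g: Vector_Spaces.linear psc psc g by (rule g)
 define i where "i v = (let x = pmono v 1 in x - g x)" for v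
 have key: "x - g x = y - g y" if "x - y \<in> K" for x y using g(3)[OF that] by (simp add: g.diff algebra_simps)
 have gz: "ev N (g x) = \<zero>" for x using g(1) by (auto simp: K_def)
 have "i (u \<oplus> v) = i u + i v" if "u \<in> carrier N" "v \<in> carrier N" for u v
 proof -
  have "pmono (u \<oplus> v) 1 - (pmono u 1 + pmono v 1) \<in> K"
  using that by (simp add: K_def ev_diff ev_add ev_single smult_one[simplified] minus_eq r_neg)
  from key[OF this] show ?thesis by (simp add: i_def Let_def g.add algebra_simps)
 qed
 moreover have "i (c \<odot> v) = psc c (i v)" if "v \<in> carrier N" for c v
 proof -
  have "pmono (c \<odot> v) 1 - psc c (pmono v 1) \<in> K"
  using that by (simp add: K_def ev_diff ev_psc ev_single smult_one[simplified] minus_eq r_neg)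
  from key[OF this] show ?thesis by (simp add: i_def Let_def g.scale psc.scale_right_diff_distrib del: map_single)
 qed
 moreover have "ev N (i v) = v" if "v \<in> carrier N" for v
  using that by (simp add: i_def Let_def ev_diff gz ev_single smult_one[simplified] minus_eq)
 ultimately show ?thesis unfolding is_section_def by blast
qed

end

section \<open>Lie submodules, quotients and composition factors\<close>

lemma module_image:
 fixes N :: "(complex, 'v) module" and Q :: "(complex, 'w) module"
 assumes N: "vsp N" and q: "q ` carrier N = carrier Q"
  and add: "!!u v. u \<in> carrier N ==> v \<in> carrier N ==> q (u \<oplus>\<^bsub>N\<^esub> v) = q u \<oplus>\<^bsub>Q\<^esub> q v"
  and sm: "!!c v. v \<in> carrier N ==> q (c \<odot>\<^bsub>N\<^esub> v) = c \<odot>\<^bsub>Q\<^esub> q v"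
  and zero: "q \<zero>\<^bsub>N\<^esub> = \<zero>\<^bsub>Q\<^esub>"
 shows "vsp Q"
proof -
 interpret N: Module.module CC N by (rule N)
 have cl: "q v \<in> carrier Q" if "v \<in> carrier N" for v using that q by blast
 have ex: "EX v:carrier N. y = q v" if "y \<in> carrier Q" for y using that q by blast
 have "abelian_group Q"
 proof (rule abelian_groupI)
  fix x y z assume "x \<in> carrier Q" "y \<in> carrier Q" "z \<in> carrier Q"
  then obtain u v w where "u \<in> carrier N" "v \<in> carrier N" "w \<in> carrier N"
  "x = q u" "y = q v" "z = q w" using ex by metis
  thus "x \<oplus>\<^bsub>Q\<^esub> y \<in> carrier Q" "x \<oplus>\<^bsub>Q\<^esub> y \<oplus>\<^bsub>Q\<^esub> z = x \<oplus>\<^bsub>Q\<^esub> (y \<oplus>\<^bsub>Q\<^esub> z)"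
  "x \<oplus>\<^bsub>Q\<^esub> y = y \<oplus>\<^bsub>Q\<^esub> x" by (simp_all add: add[symmetric] cl N.a_ac)
 next
  show "\<zero>\<^bsub>Q\<^esub> \<in> carrier Q" using cl[OF N.zero_closed] zero by simp
 next
  fix x assume "x \<in> carrier Q"
  then obtain u where u: "u \<in> carrier N" "x = q u" using ex by metis
  thus "\<zero>\<^bsub>Q\<^esub> \<oplus>\<^bsub>Q\<^esub> x = x" by (simp add: add[symmetric] zero[symmetric])
  have "q (\<ominus>\<^bsub>N\<^esub> u) \<oplus>\<^bsub>Q\<^esub> x = \<zero>\<^bsub>Q\<^esub>" using u by (simp add: add[symmetric] zero[symmetric] N.l_neg)
  thus "EX y:carrier Q. y \<oplus>\<^bsub>Q\<^esub> x = \<zero>\<^bsub>Q\<^esub>" using u cl by blast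
 qed
 thus ?thesis
 proof (rule moduleI[OF cring_CC], goal_cases)
  case (1 a x)
  then obtain u where u: "u \<in> carrier N" "x = q u" using ex by metis
  thus ?case using cl[of "a \<odot>\<^bsub>N\<^esub> u"] by (simp add: sm)
 next
  case (2 a b x)
  then obtain u where u: "u \<in> carrier N" "x = q u" using ex by metis
  thus ?case using N.smult_l_distr[of a b u] by (simp add: add[symmetric] sm[symmetric])
 next
  case (3 a x y)
  then obtain u v where u: "u \<in> carrier N" "x = q u" "v \<in> carrier N" "y = q v" using ex by metis
  thus ?case using N.smult_r_distr[of a u v] by (simp add: add[symmetric] sm[symmetric])
 next
  case (4 a b x)
  then obtain u where u: "u \<in> carrier N" "x = q u" using ex by metis
  thus ?case using N.smult_assoc1[of a b u] by (simp add: sm[symmetric])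
 next
  case (5 x)
  then obtain u where u: "u \<in> carrier N" "x = q u" using ex by metis
  thus ?case using N.smult_one[of u] by (simp add: sm[symmetric])
 qed
qed

definition lie_closed :: "(complex, 'x) module => bool"
 where "lie_closed L \<longleftrightarrow> (ALL x:carrier L. ALL y:carrier L.
  x \<oplus>\<^bsub>L\<^esub> y \<in> carrier L & x \<otimes>\<^bsub>L\<^esub> y \<in> carrier L & (ALL c. c \<odot>\<^bsub>L\<^esub> x \<in> carrier L))"

lemma lie_module_image:
 fixes N :: "(complex, 'v) module" and Q :: "(complex, 'w) module"
 assumes L: "lie_closed L" and N: "lie_module L N \<rho>" and q: "q ` carrier N = carrier Q"
  and add: "!!u v. u \<in> carrier N ==> v \<in> carrier N ==> q (u \<oplus>\<^bsub>N\<^esub> v) = q u \<oplus>\<^bsub>Q\<^esub> q v"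
  and sm: "!!c v. v \<in> carrier N ==> q (c \<odot>\<^bsub>N\<^esub> v) = c \<odot>\<^bsub>Q\<^esub> q v"
  and zero: "q \<zero>\<^bsub>N\<^esub> = \<zero>\<^bsub>Q\<^esub>"
  and act: "!!x v. x \<in> carrier L ==> v \<in> carrier N ==> \<sigma> x (q v) = q (\<rho> x v)"
 shows "lie_module L Q \<sigma>"
proof -
 interpret N: lie_module L N \<rho> by (rule N)
 have Q: "vsp Q" by (rule module_image[OF N.module_axioms q add sm zero])
 interpret Q: Module.module CC Q by (rule Q)
 have cl: "q v \<in> carrier Q" if "v \<in> carrier N" for v using that q by blast
 have ex: "EX v:carrier N. y = q v" if "y \<in> carrier Q" for y using that q by blast
 have mi: "q (u \<ominus>\<^bsub>N\<^esub> v) = q u \<ominus>\<^bsub>Q\<^esub> q v" if "u \<in> carrier N" "v \<in> carrier N" for u v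
  using that cl by (simp add: N.minus_eq Q.minus_eq minus_smult[OF N.module_axioms] minus_smult[OF Q] add sm
  N.smult_closed[simplified])
 show ?thesis
 proof (unfold_locales, goal_cases)
  case (1 x v)
  then obtain u where u: "u \<in> carrier N" "v = q u" using ex by metis
  thus ?case using 1 N.act_closed by (simp add: act cl)
 next
  case (2 x u v)
  then obtain u' v' where u: "u' \<in> carrier N" "u = q u'" "v' \<in> carrier N" "v = q v'" using ex by metis
  thus ?case using 2 N.act_closed by (simp add: act cl add[symmetric] N.act_r_add)
 next
  case (3 x v c)
  then obtain u where u: "u \<in> carrier N" "v = q u" using ex by metis
  thus ?case using 3 N.act_closed N.smult_closed[of c u] by (simp add: act sm[symmetric] N.act_r_smult)
 next
  case (4 x y v)
  then obtain u where u: "u \<in> carrier N" "v = q u" using ex by metis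
  thus ?case using 4 L N.act_closed by (simp add: act add[symmetric] N.act_l_add lie_closed_def)
 next
  case (5 x v c)
  then obtain u where u: "u \<in> carrier N" "v = q u" using ex by metis
  thus ?case using 5 L N.act_closed by (simp add: act sm[symmetric] N.act_l_smult lie_closed_def)
 next
  case (6 x y v)
  then obtain u where u: "u \<in> carrier N" "v = q u" using ex by metis
  thus ?case using 6 L N.act_closed by (simp add: act mi[symmetric] N.act_bracket lie_closed_def)
 qed
qed

lemma minus_zero_iff:
 assumes "abelian_group G" "a \<in> carrier G" "b \<in> carrier G"
 shows "a \<ominus>\<^bsub>G\<^esub> b = \<zero>\<^bsub>G\<^esub> \<longleftrightarrow> a = b"
proof -
 interpret abelian_group G by (rule assms)
 have "a \<ominus>\<^bsub>G\<^esub> b \<oplus>\<^bsub>G\<^esub> b = a" using assms(2,3) by (simp add: minus_eq a_assoc l_neg)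
 thus ?thesis using assms(2,3) by (auto simp: minus_eq r_neg)
qed

context
 fixes N :: "(complex, 'v) module" (structure) and B :: "'v set"
 assumes N: "vsp N" and B: "submodule B CC N"
begin

interpretation Module.module CC N by (rule N)

lemma sub_abelian: "abelian_subgroup B N"
proof -
 have "subgroup B (add_monoid N)" using B by (simp add: submodule_def)
 thus ?thesis by (intro abelian_subgroupI3 additive_subgroupI abelian_group_axioms)
qed

interpretation abelian_subgroup B N by (rule sub_abelian)

lemma sub_smult: "v \<in> B ==> c \<odot> v \<in> B" using B submodule.smult_closed[of B CC N c v] by simp

lemma quot_carrier: "carrier (quot_space N B) = (%v. B +> v) ` carrier N" by (auto simp: quot_space_def A_RCOSETS_def')

lemma quot_zero: "B +> \<zero> = \<zero>\<^bsub>quot_space N B\<^esub>"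
 using a_coset_add_zero[of B] a_subset by (simp add: quot_space_def)

lemma quot_add:
 "u \<in> carrier N ==> v \<in> carrier N ==> B +> (u \<oplus> v) = (B +> u) \<oplus>\<^bsub>quot_space N B\<^esub> (B +> v)"
 by (simp add: quot_space_def a_rcos_sum)

lemma coset_eq_iff:
 assumes "u \<in> carrier N" "v \<in> carrier N"
 shows "B +> u = B +> v \<longleftrightarrow> u \<ominus> v \<in> B"
proof -
 have "u \<ominus> v \<in> B \<longleftrightarrow> u \<in> B +> v"
  using a_rcos_module[of v u] assms is_abelian_group by (simp add: minus_eq abelian_group.axioms)
 also have "... \<longleftrightarrow> B +> u = B +> v"
  using a_repr_independence[of u B v] a_rcos_self[of u] assms a_subgroup by auto
 finally show ?thesis by simp
qed

lemma coset_union_const: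
 assumes v: "v \<in> carrier N" and f: "!!u. u \<in> B +> v ==> f u = D"
 shows "\<Union> (f ` (B +> v)) = D"
proof -
 have "v \<in> B +> v" by (rule a_rcos_self[OF v])
 thus ?thesis using f by auto
qed

lemma quot_smult:
 assumes v: "v \<in> carrier N"
 shows "B +> (c \<odot> v) = c \<odot>\<^bsub>quot_space N B\<^esub> (B +> v)"
proof -
 have "B +> (c \<odot> u) = B +> (c \<odot> v)" if u: "u \<in> B +> v" for u
 proof -
  have uc: "u \<in> carrier N" using a_elemrcos_carrier[OF v u] .
  have "u \<ominus> v \<in> B" using u uc v coset_eq_iff[OF uc v] a_repr_independence[OF u v a_subgroup] by simp
  hence "c \<odot> (u \<ominus> v) \<in> B" by (rule sub_smult)
  moreover have "c \<odot> (u \<ominus> v) = c \<odot> u \<ominus> c \<odot> v"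
  using uc v smult_r_distr[of c u "\<ominus> v"] smult_r_minus[of c v] by (simp add: minus_eq)
  ultimately show ?thesis using coset_eq_iff[of "c \<odot> u" "c \<odot> v"] uc v smult_closed by simp
 qed
 hence "\<Union> ((%u. B +> (c \<odot> u)) ` (B +> v)) = B +> (c \<odot> v)" by (intro coset_union_const[OF v])
 thus ?thesis by (simp add: quot_space_def)
qed

lemma quot_module: "vsp (quot_space N B)" by (rule module_image[OF N, of "%v. B +> v"])
  (simp_all add: quot_carrier quot_add quot_smult quot_zero)

lemma sub_module: "vsp (N\<lparr>carrier := B\<rparr>)" using submodule.submodule_is_module[OF B N] .

end

lemma coset_restrict [simp]: "B +>\<^bsub>N\<lparr>carrier := U\<rparr>\<^esub> v = B +>\<^bsub>N\<^esub> v"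
 by (simp add: a_r_coset_def r_coset_def)

lemma lie_submoduleD:
 assumes "lie_submodule L (N, \<rho>) U"
 shows "submodule U CC N" "!!x u. x \<in> carrier L ==> u \<in> U ==> \<rho> x u \<in> U"
 using assms by (auto simp: lie_submodule_def)

lemma submodule_closed:
 fixes N :: "(complex, 'v) module"
 assumes "vsp N" "submodule U CC N"
 shows "u \<in> U ==> v \<in> U ==> u \<oplus>\<^bsub>N\<^esub> v \<in> U" "u \<in> U ==> c \<odot>\<^bsub>N\<^esub> u \<in> U" "\<zero>\<^bsub>N\<^esub> \<in> U"
  "u \<in> U ==> v \<in> U ==> u \<ominus>\<^bsub>N\<^esub> v \<in> U" "U <= carrier N"
proof -
 interpret Module.module CC N by (rule assms)
 interpret abelian_subgroup U N by (rule sub_abelian[OF assms])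
 show "u \<in> U ==> v \<in> U ==> u \<oplus>\<^bsub>N\<^esub> v \<in> U" "\<zero>\<^bsub>N\<^esub> \<in> U" "U <= carrier N"
  "u \<in> U ==> c \<odot>\<^bsub>N\<^esub> u \<in> U" using a_subset sub_smult[OF assms] by auto
 show "u \<in> U ==> v \<in> U ==> u \<ominus>\<^bsub>N\<^esub> v \<in> U" by (simp add: minus_eq a_inv_closed)
qed

lemma submoduleI':
 fixes N :: "(complex, 'v) module"
 assumes N: "vsp N" and U: "U <= carrier N" "\<zero>\<^bsub>N\<^esub> \<in> U"
  and add: "!!u v. u \<in> U ==> v \<in> U ==> u \<oplus>\<^bsub>N\<^esub> v \<in> U" and sm: "!!c u. u \<in> U ==> c \<odot>\<^bsub>N\<^esub> u \<in> U"
 shows "submodule U CC N"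
proof -
 interpret Module.module CC N by (rule N)
 have "\<ominus>\<^bsub>N\<^esub> u \<in> U" if "u \<in> U" for u using that U sm[of u "-1"] minus_smult[OF N, of u] by auto
 thus ?thesis using U add sm by (intro submoduleI) (auto simp: U)
qed

lemma lie_sub_module:
 assumes L: "lie_closed L" and N: "lie_module L N \<rho>" and U: "lie_submodule L (N, \<rho>) U"
 shows "lie_module L (N\<lparr>carrier := U\<rparr>) \<rho>"
proof -
 interpret N: lie_module L N \<rho> by (rule N)
 note U' = lie_submoduleD[OF U]
 note cl = submodule_closed[OF N.module_axioms U'(1)]
 have m: "vsp (N\<lparr>carrier := U\<rparr>)" by (rule sub_module[OF N.module_axioms U'(1)])
 interpret U: Module.module CC "N\<lparr>carrier := U\<rparr>" by (rule m)
 have *: "u \<ominus>\<^bsub>N\<lparr>carrier := U\<rparr>\<^esub> v = u \<ominus>\<^bsub>N\<^esub> v" if "u \<in> U" "v \<in> U" for u v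
 proof -
  have "u \<ominus>\<^bsub>N\<lparr>carrier := U\<rparr>\<^esub> v = u \<oplus>\<^bsub>N\<^esub> (-1) \<odot>\<^bsub>N\<^esub> v"
  using minus_smult[OF m, of v] that by (simp add: U.minus_eq)
  thus ?thesis using that cl(5) minus_smult[OF N.module_axioms, of v] by (auto simp: N.minus_eq)
 qed
 show ?thesis by unfold_locales (use U' cl in \<open>auto simp: * N.act_r_add N.act_r_smult N.act_l_add N.act_l_smult
  N.act_bracket subset_iff\<close>)
qed

text \<open>Homomorphisms from a submodule \<open>U\<close>, not required to be extensional.\<close>

definition lhom ::
 "(complex, 'x) module => ('x, 'v) lmod => 'v set => ('x, 's) lmod => ('v => 's) => bool"
 where "lhom L P U T g \<longleftrightarrow> (ALL u:U. g u \<in> carrier (fst T)) &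
  (ALL u:U. ALL v:U. g (u \<oplus>\<^bsub>fst P\<^esub> v) = g u \<oplus>\<^bsub>fst T\<^esub> g v) &
  (ALL c. ALL u:U. g (c \<odot>\<^bsub>fst P\<^esub> u) = c \<odot>\<^bsub>fst T\<^esub> g u) &
  (ALL x:carrier L. ALL u:U. g (snd P x u) = snd T x (g u))"

lemma lhom_zero:
 assumes "vsp (fst P)" "vsp (fst T)" "submodule U CC (fst P)" "lhom L P U T g"
 shows "g \<zero>\<^bsub>fst P\<^esub> = \<zero>\<^bsub>fst T\<^esub>"
proof -
 interpret P: Module.module CC "fst P" by (rule assms)
 interpret T: Module.module CC "fst T" by (rule assms)
 have z: "\<zero>\<^bsub>fst P\<^esub> \<in> U" by (rule submodule_closed(3)[OF assms(1,3)])
 hence "g (0 \<odot>\<^bsub>fst P\<^esub> \<zero>\<^bsub>fst P\<^esub>) = 0 \<odot>\<^bsub>fst T\<^esub> g \<zero>\<^bsub>fst P\<^esub>"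
  "g \<zero>\<^bsub>fst P\<^esub> \<in> carrier (fst T)" using assms(4) unfolding lhom_def by blast+
 thus ?thesis
  using T.smult_l_null[of "g \<zero>\<^bsub>fst P\<^esub>"] P.smult_l_null[of "\<zero>\<^bsub>fst P\<^esub>"] by (simp del: P.smult_r_null)
qed

lemma lhom_minus:
 assumes "vsp (fst P)" "vsp (fst T)" "submodule U CC (fst P)" "lhom L P U T g"
  and uv: "u \<in> U" "v \<in> U"
 shows "g (u \<ominus>\<^bsub>fst P\<^esub> v) = g u \<ominus>\<^bsub>fst T\<^esub> g v"
proof -
 interpret P: Module.module CC "fst P" by (rule assms)
 interpret T: Module.module CC "fst T" by (rule assms)
 note cl = submodule_closed[OF assms(1,3)]
 have "u \<ominus>\<^bsub>fst P\<^esub> v = u \<oplus>\<^bsub>fst P\<^esub> (-1) \<odot>\<^bsub>fst P\<^esub> v"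
  using uv cl minus_smult[OF assms(1), of v] by (auto simp: P.minus_eq)
 moreover have "g u \<ominus>\<^bsub>fst T\<^esub> g v = g u \<oplus>\<^bsub>fst T\<^esub> (-1) \<odot>\<^bsub>fst T\<^esub> g v"
  using uv assms(4) minus_smult[OF assms(2), of "g v"] by (auto simp: T.minus_eq lhom_def)
 ultimately show ?thesis using uv cl assms(4) by (simp add: lhom_def)
qed

lemma lie_subquotient_lhom:
 assumes L: "lie_closed L" and N: "lie_module L N \<rho>"
  and U: "lie_submodule L (N, \<rho>) U" and B: "lie_submodule L (N, \<rho>) B" and BU: "B <= U"
 defines "T \<equiv> lie_subquotient (N, \<rho>) U B"
 shows "lhom L (N, \<rho>) U T (%v. B +>\<^bsub>N\<^esub> v)" "(%v. B +>\<^bsub>N\<^esub> v) ` U = carrier (fst T)"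
  "lie_module L (fst T) (snd T)"
  "!!u v. u \<in> U ==> v \<in> U ==> B +>\<^bsub>N\<^esub> u = B +>\<^bsub>N\<^esub> v \<longleftrightarrow> u \<ominus>\<^bsub>N\<^esub> v \<in> B"
proof -
 interpret N: lie_module L N \<rho> by (rule N)
 note U' = lie_submoduleD[OF U] and B' = lie_submoduleD[OF B]
 let ?U = "N\<lparr>carrier := U\<rparr>"
 have mU: "lie_module L ?U \<rho>" by (rule lie_sub_module[OF L N U])
 interpret U: lie_module L ?U \<rho> by (rule mU)
 note cl = submodule_closed[OF N.module_axioms U'(1)]
 note clB = submodule_closed[OF N.module_axioms B'(1)]
 have B: "submodule B CC ?U" by (rule submoduleI'[OF U.module_axioms]) (use BU clB in auto)
 have T: "fst T = quot_space ?U B" "snd T = (%x E. \<Union>((%v. B +>\<^bsub>N\<^esub> \<rho> x v) ` E))"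
  by (simp_all add: T_def lie_subquotient_def)
 note M = U.module_axioms
 interpret BU: abelian_subgroup B ?U by (rule sub_abelian[OF M B])
 have minus: "u \<ominus>\<^bsub>?U\<^esub> v = u \<ominus>\<^bsub>N\<^esub> v" if "u \<in> U" "v \<in> U" for u v
 proof -
  have "u \<ominus>\<^bsub>?U\<^esub> v = u \<oplus>\<^bsub>N\<^esub> (-1) \<odot>\<^bsub>N\<^esub> v"
  using minus_smult[OF M, of v] that by (simp add: U.minus_eq)
  thus ?thesis using that cl(5) minus_smult[OF N.module_axioms, of v] by (auto simp: N.minus_eq)
 qed
 show eq: "B +>\<^bsub>N\<^esub> u = B +>\<^bsub>N\<^esub> v \<longleftrightarrow> u \<ominus>\<^bsub>N\<^esub> v \<in> B" if "u \<in> U" "v \<in> U" for u v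
  using coset_eq_iff[OF M B, of u v] that by (simp add: minus)
 have act: "snd T x (B +>\<^bsub>N\<^esub> v) = B +>\<^bsub>N\<^esub> \<rho> x v" if x: "x \<in> carrier L" and v: "v \<in> U" for x v
 proof -
  have "B +>\<^bsub>N\<^esub> \<rho> x u = B +>\<^bsub>N\<^esub> \<rho> x v" if u: "u \<in> B +>\<^bsub>N\<^esub> v" for u
  proof -
  have uU: "u \<in> U" using BU.a_elemrcos_carrier[of v u] u v by simp
  have "B +>\<^bsub>N\<^esub> u = B +>\<^bsub>N\<^esub> v" using U.a_repr_independence[of u B v] u v BU.a_subgroup by simp
  hence "u \<ominus>\<^bsub>N\<^esub> v \<in> B" using eq uU v by simp
  hence "\<rho> x (u \<ominus>\<^bsub>N\<^esub> v) \<in> B" using B' x by simp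
  moreover have "\<rho> x (u \<ominus>\<^bsub>N\<^esub> v) = \<rho> x u \<ominus>\<^bsub>N\<^esub> \<rho> x v"
  proof -
  have c: "u \<in> carrier N" "v \<in> carrier N" using uU v cl by auto
  have "\<rho> x (u \<oplus>\<^bsub>N\<^esub> (-1) \<odot>\<^bsub>N\<^esub> v) = \<rho> x u \<oplus>\<^bsub>N\<^esub> (-1) \<odot>\<^bsub>N\<^esub> \<rho> x v"
  using c x N.smult_closed[of "-1" v] by (simp add: N.act_r_add N.act_r_smult)
  thus ?thesis using c x N.act_closed minus_smult[OF N.module_axioms] by (simp add: N.minus_eq)
  qed
  ultimately show ?thesis using eq U' x uU v by simp
  qed
  hence "\<Union>((%v. B +>\<^bsub>N\<^esub> \<rho> x v) ` (B +>\<^bsub>N\<^esub> v)) = B +>\<^bsub>N\<^esub> \<rho> x v"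
  using coset_union_const[OF M B, of v "%v. B +>\<^bsub>N\<^esub> \<rho> x v"] v by simp
  thus ?thesis by (simp add: T)
 qed
 show img: "(%v. B +>\<^bsub>N\<^esub> v) ` U = carrier (fst T)" using quot_carrier[OF M B] by (simp add: T)
 have add: "B +>\<^bsub>N\<^esub> (u \<oplus>\<^bsub>N\<^esub> v) = (B +>\<^bsub>N\<^esub> u) \<oplus>\<^bsub>fst T\<^esub> (B +>\<^bsub>N\<^esub> v)" if "u \<in> U" "v \<in> U" for u v
  using quot_add[OF M B, of u v] that by (simp add: T)
 have sm: "B +>\<^bsub>N\<^esub> (c \<odot>\<^bsub>N\<^esub> v) = c \<odot>\<^bsub>fst T\<^esub> (B +>\<^bsub>N\<^esub> v)" if "v \<in> U" for c v
  using quot_smult[OF M B, of v c] that by (simp add: T)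
 have zero: "B +>\<^bsub>N\<^esub> \<zero>\<^bsub>N\<^esub> = \<zero>\<^bsub>fst T\<^esub>"
  using quot_zero[OF M B] by (simp add: T)
 show "lhom L (N, \<rho>) U T (%v. B +>\<^bsub>N\<^esub> v)" unfolding lhom_def using img add sm act by auto
 show "lie_module L (fst T) (snd T)"
  by (rule lie_module_image[OF L mU, of "%v. B +>\<^bsub>N\<^esub> v"]) (simp_all add: img add sm act zero)
qed

lemma composition_factor_surj:
 assumes L: "lie_closed L" and N: "lie_module L N \<rho>" and S: "composition_factor L S (N, \<rho>)"
 obtains U g where "lie_submodule L (N, \<rho>) U" "lhom L (N, \<rho>) U S g" "g ` U = carrier (fst S)"
proof -
 obtain U B h where UB: "lie_submodule L (N, \<rho>) U" "lie_submodule L (N, \<rho>) B" "B <= U"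
  and h: "h \<in> lie_iso L S (lie_subquotient (N, \<rho>) U B)" using S by (auto simp: composition_factor_def)
 define T where "T = lie_subquotient (N, \<rho>) U B"
 note T = lie_subquotient_lhom[OF L N UB, folded T_def]
 interpret S: lie_module L "fst S" "snd S" using S by (cases S) (simp add: composition_factor_def lie_simple_def)
 obtain N' \<rho>' where S_eq: "S = (N', \<rho>')" by (cases S)
 obtain N2 \<rho>2 where T_eq: "T = (N2, \<rho>2)" by (cases T)
 have hh: "bij_betw h (carrier (fst S)) (carrier (fst T))"
  "!!u v. u \<in> carrier (fst S) ==> v \<in> carrier (fst S) ==> h (u \<oplus>\<^bsub>fst S\<^esub> v) = h u \<oplus>\<^bsub>fst T\<^esub> h v"
  "!!c v. v \<in> carrier (fst S) ==> h (c \<odot>\<^bsub>fst S\<^esub> v) = c \<odot>\<^bsub>fst T\<^esub> h v"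
  "!!x v. x \<in> carrier L ==> v \<in> carrier (fst S) ==> h (snd S x v) = snd T x (h v)"
  using h unfolding T_def[symmetric] lie_iso_def lie_hom_def S_eq T_eq by auto
 define g where "g v = inv_into (carrier (fst S)) h (B +>\<^bsub>N\<^esub> v)" for v
 have g: "h (g v) = B +>\<^bsub>N\<^esub> v" "g v \<in> carrier (fst S)" if "v \<in> U" for v
  using that hh(1) T(2) unfolding g_def by (auto simp: bij_betw_def intro!: f_inv_into_f inv_into_into)
 have inj: "u = v" if "h u = h v" "u \<in> carrier (fst S)" "v \<in> carrier (fst S)" for u v
  using that hh(1) by (auto simp: bij_betw_def inj_on_def)
 interpret N: lie_module L N \<rho> by (rule N)
 note cl = submodule_closed[OF N.module_axioms lie_submoduleD(1)[OF UB(1)]]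
 have "lhom L (N, \<rho>) U S g" unfolding lhom_def
 proof (intro conjI ballI allI)
  show "g u \<in> carrier (fst S)" if "u \<in> U" for u using g that by simp
  fix u assume u: "u \<in> U"
  show "g (u \<oplus>\<^bsub>fst (N, \<rho>)\<^esub> v) = g u \<oplus>\<^bsub>fst S\<^esub> g v" if "v \<in> U" for v
  by (rule inj) (use u that cl T(1) in \<open>auto simp: g hh lhom_def\<close>)
  show "g (c \<odot>\<^bsub>fst (N, \<rho>)\<^esub> u) = c \<odot>\<^bsub>fst S\<^esub> g u" for c
  by (rule inj) (use u cl T(1) S.smult_closed[of c "g u"] in \<open>auto simp: g hh lhom_def\<close>)
  show "g (snd (N, \<rho>) x u) = snd S x (g u)" if "x \<in> carrier L" for x
  by (rule inj) (use u that lie_submoduleD[OF UB(1)] T(1) S.act_closed in \<open>auto simp: g hh lhom_def\<close>)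
 qed
 moreover have "g ` U = carrier (fst S)"
 proof
  show "g ` U <= carrier (fst S)" using g by auto
  show "carrier (fst S) <= g ` U"
  proof
  fix s assume s: "s \<in> carrier (fst S)"
  hence "h s \<in> carrier (fst T)" using hh(1) by (auto simp: bij_betw_def)
  then obtain u where u: "u \<in> U" "h s = B +>\<^bsub>N\<^esub> u" using T(2) by auto
  hence "s = g u" using g s by (intro inj) auto
  thus "s \<in> g ` U" using u by blast
  qed
 qed
 ultimately show ?thesis using that UB by blast
qed

lemma composition_factorI:
 assumes L: "lie_closed L" and N: "lie_module L N \<rho>" and S: "lie_simple L S"
  and U: "lie_submodule L (N, \<rho>) U" and g: "lhom L (N, \<rho>) U S g" "g ` U = carrier (fst S)"
 shows "composition_factor L S (N, \<rho>)"
proof -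
 interpret S: lie_module L "fst S" "snd S" using S by (cases S) (simp add: lie_simple_def)
 interpret N: lie_module L N \<rho> by (rule N)
 note U' = lie_submoduleD[OF U]
 note cl = submodule_closed[OF N.module_axioms U'(1)]
 have sU: "submodule U CC (fst (N, \<rho>))" and mN: "vsp (fst (N, \<rho>))" using U' N.module_axioms by simp_all
 note g0 = lhom_zero[OF mN S.module_axioms sU g(1), simplified]
 note gm = lhom_minus[OF mN S.module_axioms sU g(1), simplified]
 define B where "B = {u \<in> U. g u = \<zero>\<^bsub>fst S\<^esub>}"
 have act0: "snd S x \<zero>\<^bsub>fst S\<^esub> = \<zero>\<^bsub>fst S\<^esub>" if "x \<in> carrier L" for x
  using S.act_r_smult[OF that S.zero_closed, of 0] S.act_closed[OF that S.zero_closed]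
  S.smult_l_null[simplified] by simp
 have B: "lie_submodule L (N, \<rho>) B" unfolding lie_submodule_def prod.case
 proof (intro conjI ballI)
  show "submodule B CC N" by (rule submoduleI'[OF N.module_axioms])
  (use cl g g0 S.smult_r_null[simplified] in \<open>auto simp: B_def lhom_def subset_iff\<close>)
  show "\<rho> x u \<in> B" if "x \<in> carrier L" "u \<in> B" for x u using that U' g act0 by (auto simp: B_def lhom_def)
 qed
 have BU: "B <= U" by (auto simp: B_def)
 define T where "T = lie_subquotient (N, \<rho>) U B"
 note T = lie_subquotient_lhom[OF L N U B BU, folded T_def]
 have same: "B +>\<^bsub>N\<^esub> u = B +>\<^bsub>N\<^esub> v \<longleftrightarrow> g u = g v" if "u \<in> U" "v \<in> U" for u v
 proof -
  have "g u \<in> carrier (fst S)" "g v \<in> carrier (fst S)" using g that by (auto simp: lhom_def)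
  hence "g u \<ominus>\<^bsub>fst S\<^esub> g v = \<zero>\<^bsub>fst S\<^esub> \<longleftrightarrow> g u = g v"
  by (rule minus_zero_iff[OF S.abelian_group_axioms])
  thus ?thesis using T(4)[OF that] that gm cl by (simp add: B_def)
 qed
 define k where "k s = (if s \<in> carrier (fst S) then B +>\<^bsub>N\<^esub> (SOME u. u \<in> U & g u = s) else undefined)" for s
 have k: "k (g u) = B +>\<^bsub>N\<^esub> u" if u: "u \<in> U" for u
 proof -
  have "EX v. v \<in> U & g v = g u" using u by blast
  hence "(SOME v. v \<in> U & g v = g u) \<in> U & g (SOME v. v \<in> U & g v = g u) = g u" by (rule someI_ex)
  thus ?thesis using u g same by (simp add: k_def lhom_def)
 qed
 have ex: "EX u:U. s = g u" if "s \<in> carrier (fst S)" for s using that g by blast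
 have gU: "g u \<in> carrier (fst S)" if "u \<in> U" for u using g that by (auto simp: lhom_def)
 obtain N' \<rho>' where S_eq: "S = (N', \<rho>')" by (cases S)
 obtain N2 \<rho>2 where T_eq: "T = (N2, \<rho>2)" by (cases T)
 have "k \<in> lie_hom L S T" unfolding S_eq T_eq lie_hom_def prod.case
 proof (intro CollectI conjI ballI allI)
  show "k \<in> carrier N' \<rightarrow>\<^sub>E carrier N2"
  proof (rule PiE_I)
  fix s assume "s \<in> carrier N'"
  then obtain u where "u \<in> U" "s = g u" using ex S_eq by auto
  thus "k s \<in> carrier N2" using T(2) T_eq by (auto simp: k)
  qed (simp add: k_def S_eq)
  fix s assume "s \<in> carrier N'"
  then obtain u where u: "u \<in> U" "s = g u" using ex S_eq by auto
  show "k (s \<oplus>\<^bsub>N'\<^esub> t) = k s \<oplus>\<^bsub>N2\<^esub> k t" if "t \<in> carrier N'" for t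
  proof -
  have "t \<in> carrier (fst S)" using that S_eq by simp
  then obtain v where v: "v \<in> U" "t = g v" using ex by blast
  have "s \<oplus>\<^bsub>N'\<^esub> t = g (u \<oplus>\<^bsub>N\<^esub> v)" using g(1) u v S_eq by (simp add: lhom_def)
  thus ?thesis using u v cl T(1) T_eq by (simp add: k lhom_def)
  qed
  show "k (c \<odot>\<^bsub>N'\<^esub> s) = c \<odot>\<^bsub>N2\<^esub> k s" for c
  proof -
  have "c \<odot>\<^bsub>N'\<^esub> s = g (c \<odot>\<^bsub>N\<^esub> u)" using g(1) u S_eq by (simp add: lhom_def)
  thus ?thesis using u cl T(1) T_eq by (simp add: k lhom_def)
  qed
  show "k (\<rho>' x s) = \<rho>2 x (k s)" if "x \<in> carrier L" for x
  proof -
  have "\<rho>' x s = g (\<rho> x u)" using g(1) u S_eq that by (simp add: lhom_def)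
  thus ?thesis using u U' T(1) T_eq that by (simp add: k lhom_def)
  qed
 qed
 moreover have "bij_betw k (carrier (fst S)) (carrier (fst T))" unfolding bij_betw_def
 proof
  show "inj_on k (carrier (fst S))"
  proof (rule inj_onI)
  fix s t assume "s \<in> carrier (fst S)" "t \<in> carrier (fst S)" and kst: "k s = k t"
  then obtain u v where "u \<in> U" "s = g u" "v \<in> U" "t = g v" using ex by metis
  thus "s = t" using kst same by (simp add: k)
  qed
  have "k ` carrier (fst S) = (%u. B +>\<^bsub>N\<^esub> u) ` U"
  unfolding g(2)[symmetric] by (auto simp: k image_image intro!: image_cong)
  thus "k ` carrier (fst S) = carrier (fst T)" using T(2) by simp
 qed
 ultimately have "k \<in> lie_iso L S T" by (simp add: lie_iso_def)
 thus ?thesis using S U B BU by (auto simp: composition_factor_def T_def)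
qed

section \<open>Traceless matrices and tensor powers\<close>

definition eu :: "'n => 'n => complex ^ 'n ^ 'n::finite"
 where "eu a b = (\<chi> p q. if p = a & q = b then 1 else 0)"

text \<open>The traceless part of a matrix unit. The brackets of these elements are those of \<open>gl\<close>, since scalar matrices are central.\<close>

definition tl0 :: "'n => 'n => complex ^ 'n ^ 'n::finite"
 where "tl0 a b = (\<chi> p q. (if p = a & q = b then 1 else 0) -
  (if a = b & p = q then 1 / of_nat CARD('n) else 0))"

lemma trace_tl0: "trace (tl0 a b :: complex ^ 'n ^ 'n::finite) = 0"
proof (cases "a = b")
 case True
 have "trace (tl0 a b :: complex ^ 'n ^ 'n) = (\<Sum>i\<in>UNIV. (if i = a then 1 else 0) - 1 / of_nat CARD('n))"
  unfolding trace_def tl0_def using True by (intro sum.cong) auto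
 thus ?thesis by (simp add: sum_subtractf)
next
 case False
 thus ?thesis by (auto simp: trace_def tl0_def intro!: sum.neutral)
qed

lemma tl0_sl [simp]: "tl0 a b \<in> carrier sl" by (simp add: sl_def trace_tl0)

lemma sl_simps [simp]: "x \<oplus>\<^bsub>sl\<^esub> y = x + y" "x \<otimes>\<^bsub>sl\<^esub> y = x ** y - y ** x"
  "c \<odot>\<^bsub>sl\<^esub> x = (\<chi> a b. c * x $ a $ b)" "\<zero>\<^bsub>sl\<^esub> = 0" "x \<in> carrier sl \<longleftrightarrow> trace x = 0"
 by (simp_all add: sl_def)

lemma eu_mult: "eu a b ** eu c d = (if b = c then eu a d else 0)"
proof -
 have "(eu a b ** eu c d) $ p $ q =
  (\<Sum>k\<in>UNIV. if k = b then (if p = a & b = c & q = d then 1 else 0) else 0)" for p q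
  unfolding matrix_matrix_mult_def eu_def vec_lambda_beta by (intro sum.cong) auto
 thus ?thesis by (simp add: vec_eq_iff eu_def)
qed

lemma tl0_eu: "tl0 a b = eu a b - (if a = b then mat (1 / of_nat CARD('n)) else (0 :: complex ^ 'n ^ 'n::finite))"
 by (auto simp: tl0_def eu_def mat_def vec_eq_iff)

lemma mat_comm: "mat k ** A = A ** mat (k :: complex)" for A :: "complex ^ 'n ^ 'n::finite"
proof -
 have "(mat k ** A) $ i $ j = (\<Sum>p\<in>UNIV. if p = i then k * A $ i $ j else 0)" for i j
  unfolding matrix_matrix_mult_def mat_def vec_lambda_beta by (intro sum.cong) auto
 moreover have "(A ** mat k) $ i $ j = (\<Sum>p\<in>UNIV. if p = j then A $ i $ j * k else 0)" for i j
  unfolding matrix_matrix_mult_def mat_def vec_lambda_beta by (intro sum.cong) auto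
 ultimately show ?thesis by (simp add: vec_eq_iff)
qed

lemma matrix_diff_rdistrib: "(A - B) ** C = A ** C - B ** (C :: complex ^ 'n ^ 'n::finite)"
 by (simp add: matrix_matrix_mult_def vec_eq_iff sum_subtractf left_diff_distrib)

lemma matrix_diff_ldistrib: "A ** (B - C) = A ** B - A ** (C :: complex ^ 'n ^ 'n::finite)"
 by (simp add: matrix_matrix_mult_def vec_eq_iff sum_subtractf right_diff_distrib)

lemma tl0_bracket:
 "tl0 a b ** tl0 c d - tl0 c d ** tl0 a b = (if b = c then tl0 a d else 0) - (if d = a then tl0 c b else 0)"
proof -
 have "tl0 a b ** tl0 c d - tl0 c d ** tl0 a b = eu a b ** eu c d - eu c d ** eu a b"
  unfolding tl0_eu by (auto simp: matrix_diff_rdistrib matrix_diff_ldistrib mat_comm)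
 also have "... = (if b = c then tl0 a d else 0) - (if d = a then tl0 c b else 0)" unfolding eu_mult tl0_eu by auto
 finally show ?thesis .
qed

lemma trace_scale: "trace (\<chi> a b. c * x $ a $ b) = c * trace (x :: complex ^ 'n ^ 'n::finite)"
 by (simp add: trace_def sum_distrib_left)

lemma lie_closed_sl: "lie_closed (sl :: (complex, complex ^ 'n ^ 'n::finite) module)"
proof -
 have "trace (x ** y - y ** x) = 0" for x y :: "complex ^ 'n ^ 'n::finite"
  using trace_mul_sym[of x y] by (simp add: trace_sub)
 thus ?thesis by (simp add: lie_closed_def trace_add trace_scale)
qed

lemma sl_induct [consumes 1, case_names basis add smult]:
 fixes x :: "complex ^ 'n ^ 'n::finite"
 assumes x: "trace x = 0" and basis: "!!a b. P (tl0 a b)"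
  and add: "!!x y. trace x = 0 ==> trace y = 0 ==> P x ==> P y ==> P (x + y)"
  and sm: "!!c x. trace x = 0 ==> P x ==> P (\<chi> a b. c * x $ a $ b)"
 shows "P x"
proof -
 define y where "y p q = (\<chi> a b. x $ p $ q * (tl0 p q :: complex ^ 'n ^ 'n) $ a $ b)" for p q
 have y: "trace (y p q) = 0 & P (y p q)" for p q
  unfolding y_def using sm[OF trace_tl0 basis] by (simp add: trace_scale trace_tl0)
 have 0: "P 0" using sm[OF trace_tl0 basis, of 0] by (simp add: zero_vec_def)
 have sum: "trace (\<Sum>p\<in>A. f p) = 0 & P (\<Sum>p\<in>A. f p)" if "!!p. trace (f p) = 0 & P (f p)"
  for A and f :: "'n => complex ^ 'n ^ 'n"
  by (induction A rule: infinite_finite_induct) (auto simp: that 0 trace_add add trace_def[of 0])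
 have "(\<Sum>p\<in>UNIV. \<Sum>q\<in>UNIV. y p q) = x"
 proof -
  have "(\<Sum>p\<in>UNIV. \<Sum>q\<in>UNIV. y p q) $ a $ b = x $ a $ b" for a b
  proof -
  have "(\<Sum>p\<in>UNIV. \<Sum>q\<in>UNIV. y p q) $ a $ b =
  (\<Sum>p\<in>UNIV. \<Sum>q\<in>UNIV. (if q = b then (if p = a then x $ p $ q else 0) else 0) -
  (if q = p then (if a = b then x $ p $ p / of_nat CARD('n) else 0) else 0))"
  unfolding y_def tl0_def sum_component vec_lambda_beta by (intro sum.cong) (auto simp: right_diff_distrib)
  also have "... = x $ a $ b - (if a = b then trace x / of_nat CARD('n) else 0)"
  by (simp add: sum_subtractf trace_def sum_divide_distrib)
  finally show ?thesis using x by simp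
  qed
  thus ?thesis by (simp add: vec_eq_iff)
 qed
 moreover have "P (\<Sum>p\<in>UNIV. \<Sum>q\<in>UNIV. y p q)" by (intro sum[THEN conjunct2] sum y)
 ultimately show ?thesis by simp
qed

lemma tpow_simps [simp]: "v \<in> TP l \<longleftrightarrow> (ALL a. length a ~= l --> v a = 0)"
 "u \<oplus>\<^bsub>tpow l\<^esub> v = (%a. u a + v a)" "c \<odot>\<^bsub>tpow l\<^esub> v = (%a. c * v a)" "\<zero>\<^bsub>tpow l\<^esub> = (%a. 0)"
 by (simp_all add: tpow_def)

lemma tpow_module: "vsp (tpow l)"
proof (rule moduleI[OF cring_CC])
 show "abelian_group (tpow l)"
 proof (rule abelian_groupI, goal_cases)
  case (6 x)
  thus ?case by (intro bexI[of _ "%a. - x a"]) (auto simp: fun_eq_iff)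
 qed (auto simp: fun_eq_iff)
qed (auto simp: fun_eq_iff algebra_simps)

lemma tpow_minus:
 assumes "v \<in> TP l"
 shows "u \<ominus>\<^bsub>tpow l\<^esub> v = (%a. u a - v a)"
 using minus_smult[OF tpow_module assms] by (simp add: a_minus_def)

definition tact :: "nat => complex ^ 'n ^ 'n => 'n::finite tensor => 'n tensor"
 where "tact l x v = (%a. \<Sum>j<l. slot x j v a)"

lemma nat_tensor_module: "nat_tensor_module l = (tpow l, tact l)" by (simp add: nat_tensor_module_def tact_def fun_eq_iff)

lemma slot_lin: "slot x j (%a. u a + v a) = (%a. slot x j u a + slot x j v a)"
 "slot x j (%a. c * v a) = (%a. c * slot x j v a)"
 "slot x j (%a. \<Sum>i\<in>I. f i a) = (%a. \<Sum>i\<in>I. slot x j (f i) a)"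
 "slot (x + y) j v = (%a. slot x j v a + slot y j v a)"
 "slot (x - y) j v = (%a. slot x j v a - slot y j v a)"
 "slot (\<chi> a b. c * x $ a $ b) j v = (%a. c * slot x j v a)"
 "slot 0 j v = (%a. 0)" "slot x j (%a. 0) = (%a. 0)"
proof -
 show "slot x j (%a. \<Sum>i\<in>I. f i a) = (%a. \<Sum>i\<in>I. slot x j (f i) a)"
  unfolding slot_def sum_distrib_left by (subst sum.swap) simp
qed (simp_all add: slot_def fun_eq_iff sum.distrib sum_distrib_left sum_subtractf algebra_simps)

lemma slot_closed: "v \<in> TP l ==> slot x j v \<in> TP l" by (auto simp: slot_def intro!: sum.neutral)

lemma slot_slot_same: "slot x j (slot y j v) a = slot (x ** y) j v a" if "j < length a"
proof -
 have "slot x j (slot y j v) a = (\<Sum>b\<in>UNIV. \<Sum>c\<in>UNIV. x $ (a ! j) $ b * (y $ b $ c * v (a[j := c])))"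
  using that by (simp add: slot_def sum_distrib_left)
 also have "... = (\<Sum>c\<in>UNIV. \<Sum>b\<in>UNIV. x $ (a ! j) $ b * (y $ b $ c * v (a[j := c])))" by (rule sum.swap)
 also have "... = slot (x ** y) j v a" by (simp add: slot_def matrix_matrix_mult_def sum_distrib_right mult.assoc)
 finally show ?thesis .
qed

lemma slot_slot_comm: "i ~= j ==> slot x i (slot y j v) a = slot y j (slot x i v) a"
proof -
 assume ij: "i ~= j"
 have "slot x i (slot y j v) a = (\<Sum>b\<in>UNIV. \<Sum>c\<in>UNIV. y $ (a ! j) $ c * (x $ (a ! i) $ b * v (a[j := c, i := b])))"
  using ij by (simp add: slot_def sum_distrib_left mult_ac list_update_swap)
 also have "... = (\<Sum>c\<in>UNIV. \<Sum>b\<in>UNIV. y $ (a ! j) $ c * (x $ (a ! i) $ b * v (a[j := c, i := b])))"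
  by (rule sum.swap)
 also have "... = slot y j (slot x i v) a" using ij by (simp add: slot_def sum_distrib_left)
 finally show ?thesis .
qed

lemma tact_lin: "tact l x (%a. u a + v a) = (%a. tact l x u a + tact l x v a)"
 "tact l x (%a. c * v a) = (%a. c * tact l x v a)"
 "tact l (x + y) v = (%a. tact l x v a + tact l y v a)"
 "tact l (\<chi> a b. c * x $ a $ b) v = (%a. c * tact l x v a)"
 by (simp_all add: tact_def slot_lin sum.distrib sum_distrib_left)

lemma tact_closed: "v \<in> TP l ==> tact l x v \<in> TP l"
proof -
 assume v: "v \<in> TP l"
 have "slot x j v a = 0" if "length a ~= l" for j a using slot_closed[OF v, of x j] that by simp
 thus ?thesis by (simp add: tact_def)
qed

lemma tact_bracket:
 assumes v: "v \<in> TP l"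
 shows "tact l (x ** y - y ** x) v = (%a. tact l x (tact l y v) a - tact l y (tact l x v) a)"
proof
 fix a :: "'a list"
 have c: "tact l x v \<in> TP l" for x by (rule tact_closed[OF v])
 show "tact l (x ** y - y ** x) v a = tact l x (tact l y v) a - tact l y (tact l x v) a"
 proof (cases "length a = l")
  case True
  have exp: "tact l x (tact l y v) a = (\<Sum>i<l. \<Sum>j<l. slot x i (slot y j v) a)" for x y
  unfolding tact_def slot_lin ..
  have "tact l x (tact l y v) a - tact l y (tact l x v) a =
  (\<Sum>i<l. \<Sum>j<l. slot x i (slot y j v) a - slot y j (slot x i v) a)"
  unfolding exp sum_subtractf by (subst (4) sum.swap) simp
  also have "... = (\<Sum>i<l. \<Sum>j<l. if j = i then slot (x ** y - y ** x) i v a else 0)"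
  by (intro sum.cong refl) (use True in \<open>auto simp: slot_slot_comm slot_slot_same slot_lin\<close>)
  also have "... = tact l (x ** y - y ** x) v a" by (simp add: tact_def)
  finally show ?thesis by simp
 next
  case False
  thus ?thesis using tact_closed[OF c] c by (simp add: tact_closed)
 qed
qed

lemma tensor_lie_module: "lie_module sl (tpow l) (tact l)"
proof -
 interpret Module.module CC "tpow l" by (rule tpow_module)
 show ?thesis
 proof (unfold_locales, goal_cases)
  case (1 x v)
  thus ?case by (intro tact_closed)
 next
  case (6 x y v)
  hence "tact l y (tact l x v) \<in> TP l" by (intro tact_closed)
  thus ?case using 6 by (simp only: tpow_minus sl_simps tact_bracket)
 qed (simp_all only: tpow_simps sl_simps tact_lin)
qed

text \<open>The product of the operators \<open>x - c\<close>. Identities \<open>opl P xs = 0\<close> pass from a module to its subquotients.\<close>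

definition opl :: "('x, 'v) lmod => ('x \<times> complex) list => 'v => 'v"
 where "opl P xs v = foldr (%(x, c) v. snd P x v \<ominus>\<^bsub>fst P\<^esub> c \<odot>\<^bsub>fst P\<^esub> v) xs v"

lemma opl_simps [simp]: "opl P [] v = v"
 "opl P ((x, c) # xs) v = snd P x (opl P xs v) \<ominus>\<^bsub>fst P\<^esub> c \<odot>\<^bsub>fst P\<^esub> opl P xs v"
 by (simp_all add: opl_def)

lemma opl_closed:
 assumes "lie_module L N \<rho>" "lie_submodule L (N, \<rho>) U" "fst ` set xs <= carrier L" "u \<in> U"
 shows "opl (N, \<rho>) xs u \<in> U"
proof -
 interpret lie_module L N \<rho> by (rule assms)
 note cl = submodule_closed[OF module_axioms lie_submoduleD(1)[OF assms(2)]]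
 show ?thesis using assms(3) by (induction xs) (auto simp: assms(4) intro!: cl(4) cl(2) lie_submoduleD(2)[OF assms(2)])
qed

lemma lie_submodule_carrier:
 assumes "lie_module L N \<rho>"
 shows "lie_submodule L (N, \<rho>) (carrier N)"
proof -
 interpret lie_module L N \<rho> by (rule assms)
 show ?thesis unfolding lie_submodule_def prod.case
  using submoduleI'[OF module_axioms, of "carrier N"] smult_closed act_closed by simp
qed

lemma opl_lhom:
 assumes N: "lie_module L N \<rho>" and T: "lie_module L (fst T) (snd T)"
  and U: "lie_submodule L (N, \<rho>) U" and g: "lhom L (N, \<rho>) U T g"
  and xs: "fst ` set xs <= carrier L" and u: "u \<in> U"
 shows "g (opl (N, \<rho>) xs u) = opl T xs (g u)"
proof -
 interpret N: lie_module L N \<rho> by (rule N)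
 interpret T: lie_module L "fst T" "snd T" by (rule T)
 note cl = submodule_closed[OF N.module_axioms lie_submoduleD(1)[OF U]]
 show ?thesis using xs
 proof (induction xs)
  case (Cons y ys)
  obtain x c where y: "y = (x, c)" by (cases y)
  let ?w = "opl (N, \<rho>) ys u"
  have w: "?w \<in> U" using Cons.prems by (intro opl_closed[OF N U _ u]) auto
  have x: "x \<in> carrier L" using Cons.prems y by simp
  have "g (\<rho> x ?w \<ominus>\<^bsub>N\<^esub> c \<odot>\<^bsub>N\<^esub> ?w) = g (\<rho> x ?w) \<ominus>\<^bsub>fst T\<^esub> g (c \<odot>\<^bsub>N\<^esub> ?w)"
  using lhom_minus[OF _ T.module_axioms _ g, of "\<rho> x ?w" "c \<odot>\<^bsub>N\<^esub> ?w"]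
  N.module_axioms lie_submoduleD[OF U] w x cl by simp
  also have "... = snd T x (g ?w) \<ominus>\<^bsub>fst T\<^esub> c \<odot>\<^bsub>fst T\<^esub> g ?w"
  using g w x by (simp add: lhom_def)
  finally show ?case using Cons y by simp
 qed simp
qed

text \<open>Three products that vanish on \<open>V\<^sup>\<otimes>\<^sup>l\<close>: the weights of a letter are \<open>0, \<dots>, l\<close>, shifted by the scalar of the traceless
part; the eigenvalues of a coroot lie in \<open>-l, \<dots>, l\<close>; and \<open>E\<^sub>p\<^sub>q\<close> has nilpotency degree \<open>l + 1\<close>.\<close>

definition wlist :: "nat => 'n => ((complex ^ 'n ^ 'n::finite) \<times> complex) list"
 where "wlist l p = map (%j. (tl0 p p, of_nat j - of_nat l / of_nat CARD('n))) [0..<Suc l]"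

definition hlist :: "nat => 'n => 'n => ((complex ^ 'n ^ 'n::finite) \<times> complex) list"
 where "hlist l p q = map (%i. (tl0 p p - tl0 q q, of_int i)) [- int l..int l]"

definition elist :: "nat => 'n => 'n => ((complex ^ 'n ^ 'n::finite) \<times> complex) list"
 where "elist l p q = replicate (Suc l) (tl0 p q, 0)"

lemma lists_sl: "fst ` set (wlist l p) <= carrier sl" "fst ` set (hlist l p q) <= carrier sl"
  "fst ` set (elist l p q) <= carrier sl" by (auto simp: wlist_def hlist_def elist_def trace_tl0 trace_sub)

lemma tensor_opl_diag:
 fixes xs :: "((complex ^ 'n ^ 'n::finite) \<times> complex) list"
 assumes d: "!!y c p q. (y, c) \<in> set xs ==> p ~= q ==> y $ p $ q = 0"
  and v: "v \<in> TP l"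
 shows "opl (tpow l, tact l) xs v a = (\<Prod>(y, c)\<leftarrow>xs. (\<Sum>j<l. y $ (a ! j) $ (a ! j)) - c) * v a"
  and "opl (tpow l, tact l) xs v \<in> TP l"
proof -
 have "opl (tpow l, tact l) xs v a = (\<Prod>(y, c)\<leftarrow>xs. (\<Sum>j<l. y $ (a ! j) $ (a ! j)) - c) * v a &
  opl (tpow l, tact l) xs v \<in> TP l" for a using d
 proof (induction xs arbitrary: a)
  case Nil
  thus ?case using v by simp
 next
  case (Cons z xs)
  obtain y c where z: "z = (y, c)" by (cases z)
  let ?w = "opl (tpow l, tact l) xs v"
  have IH: "?w a = (\<Prod>(y, c)\<leftarrow>xs. (\<Sum>j<l. y $ (a ! j) $ (a ! j)) - c) * v a" "?w \<in> TP l" for a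
  proof -
  have "y $ p $ q = 0" if "(y, c) \<in> set xs" "p ~= q" for y c and p q :: 'n
  by (rule Cons.prems[of y c]) (use that in auto)
  thus "?w a = (\<Prod>(y, c)\<leftarrow>xs. (\<Sum>j<l. y $ (a ! j) $ (a ! j)) - c) * v a" "?w \<in> TP l"
  using Cons.IH by blast+
  qed
  have yd: "y $ p $ q = 0" if "p ~= q" for p q by (rule Cons.prems[of y c]) (use that z in auto)
  have cw: "(%a. c * ?w a) \<in> TP l" using IH(2) by simp
  have s: "slot y j ?w a = y $ (a ! j) $ (a ! j) * ?w a" for j
  proof -
  have "slot y j ?w a = (\<Sum>b\<in>UNIV. if b = a ! j then y $ (a ! j) $ (a ! j) * ?w a else 0)"
  unfolding slot_def using yd by (intro sum.cong) auto
  thus ?thesis by simp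
  qed
  have tc: "tact l y ?w \<in> TP l" by (rule tact_closed[OF IH(2)])
  have eq: "opl (tpow l, tact l) (z # xs) v = (%a. tact l y ?w a - c * ?w a)"
  by (simp only: z opl_simps fst_conv snd_conv tpow_simps tpow_minus[OF cw])
  have tw: "tact l y ?w a = (\<Sum>j<l. y $ (a ! j) $ (a ! j)) * ?w a" unfolding tact_def[of l y ?w] s sum_distrib_right ..
  have "opl (tpow l, tact l) (z # xs) v \<in> TP l" using tc IH(2) unfolding eq by simp
  moreover have "opl (tpow l, tact l) (z # xs) v a = ((\<Sum>j<l. y $ (a ! j) $ (a ! j)) - c) * ?w a"
  unfolding eq tw by (simp only: left_diff_distrib)
  ultimately show ?case unfolding IH(1) by (simp add: z mult.assoc)
 qed
 thus "opl (tpow l, tact l) xs v a = (\<Prod>(y, c)\<leftarrow>xs. (\<Sum>j<l. y $ (a ! j) $ (a ! j)) - c) * v a"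
  and "opl (tpow l, tact l) xs v \<in> TP l" by blast+
qed

lemma sum_count:
 assumes "length a = l"
 shows "(\<Sum>j<l. if a ! j = p then 1 else 0) = (of_nat (count_list a p) :: complex)"
proof -
 have "(\<Sum>j<l. if a ! j = p then 1 else 0 :: complex) = sum_list (map (%x. if x = p then 1 else 0) a)"
  using assms by (simp add: sum_list_sum_nth atLeast0LessThan)
 also have "... = of_nat (count_list a p)" by (induction a) auto
 finally show ?thesis .
qed

lemma sum_tl0: "length a = l ==>
  (\<Sum>j<l. tl0 p p $ (a ! j) $ (a ! j)) = of_nat (count_list a p) - of_nat l / of_nat CARD('n)"
 for a :: "'n::finite list" by (simp add: tl0_def sum_subtractf sum_count)

lemma tensor_wlist:
 assumes v: "v \<in> TP l"
 shows "opl (tpow l, tact l) (wlist l p) v = (%a. 0)"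
proof
 fix a :: "'a list"
 show "opl (tpow l, tact l) (wlist l p) v a = 0"
 proof (cases "length a = l")
  case True
  have "count_list a p <= l" using True count_le_length[of a p] by simp
  hence "(\<Prod>(y, c)\<leftarrow>wlist l p. (\<Sum>j<l. y $ (a ! j) $ (a ! j)) - c) = 0"
  unfolding wlist_def prod_list_zero_iff using sum_tl0[OF True, of p]
  by (auto simp: image_iff simp del: upt_Suc intro!: bexI[of _ "count_list a p"])
  thus ?thesis by (subst tensor_opl_diag[OF _ v]) (auto simp: wlist_def tl0_def)
 next
  case False
  thus ?thesis using v by (subst tensor_opl_diag[OF _ v]) (auto simp: wlist_def tl0_def)
 qed
qed

lemma tensor_hlist:
 assumes v: "v \<in> TP l"
 shows "opl (tpow l, tact l) (hlist l p q) v = (%a. 0)"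
proof
 fix a :: "'a list"
 show "opl (tpow l, tact l) (hlist l p q) v a = 0"
 proof (cases "length a = l")
  case True
  define i where "i = int (count_list a p) - int (count_list a q)"
  have i: "i \<in> set [- int l..int l]" using True count_le_length[of a p] count_le_length[of a q] by (auto simp: i_def)
  have "(\<Sum>j<l. (tl0 p p - tl0 q q) $ (a ! j) $ (a ! j)) = of_int i"
  using sum_tl0[OF True] by (simp add: sum_subtractf i_def)
  hence "(\<Prod>(y, c)\<leftarrow>hlist l p q. (\<Sum>j<l. y $ (a ! j) $ (a ! j)) - c) = 0"
  unfolding hlist_def prod_list_zero_iff using i by (auto simp: image_iff simp del: upto.simps intro!: bexI[of _ i])
  thus ?thesis by (subst tensor_opl_diag[OF _ v]) (auto simp: hlist_def tl0_def)
 next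
  case False
  thus ?thesis using v by (subst tensor_opl_diag[OF _ v]) (auto simp: hlist_def tl0_def)
 qed
qed

lemma tensor_elist:
 assumes v: "v \<in> TP l" and pq: "p ~= q"
 shows "opl (tpow l, tact l) (elist l p q) v = (%a. 0)"
proof -
 have "opl (tpow l, tact l) (replicate k (tl0 p q, 0)) v \<in> TP l &
  (ALL a. count_list a p < k --> opl (tpow l, tact l) (replicate k (tl0 p q, 0)) v a = 0)" for k
 proof (induction k)
  case 0
  thus ?case using v by simp
 next
  case (Suc k)
  let ?w = "opl (tpow l, tact l) (replicate k (tl0 p q, 0)) v"
  have w: "?w \<in> TP l" using Suc by blast
  have eq: "opl (tpow l, tact l) (replicate (Suc k) (tl0 p q, 0)) v = tact l (tl0 p q) ?w"
  using tpow_minus[of "%a. 0" l] by simp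
  have c: "tact l (tl0 p q) ?w \<in> TP l" by (rule tact_closed[OF w])
  have "tact l (tl0 p q) ?w a = 0" if "count_list a p < Suc k" for a
  proof (cases "length a = l")
  case True
  have "slot (tl0 p q) j ?w a = 0" if j: "j < l" for j
  proof (cases "a ! j = p")
  case True
  have "mset (a[j := q]) = add_mset q (mset a - {#p#})" using True j \<open>length a = l\<close> by (simp add: mset_update)
  moreover have "p \<in># mset a" using True j \<open>length a = l\<close> nth_mem by force
  ultimately have "count (mset (a[j := q])) p < count (mset a) p" using pq by simp
  hence "?w (a[j := q]) = 0" using \<open>count_list a p < Suc k\<close> Suc by (simp add: count_mset)
  thus ?thesis using pq by (auto simp: slot_def tl0_def intro!: sum.neutral)
  next
  case False
  thus ?thesis using pq by (auto simp: slot_def tl0_def intro!: sum.neutral)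
  qed
  thus ?thesis by (simp add: tact_def)
  next
  case False
  thus ?thesis using c by simp
  qed
  thus ?case using c unfolding eq by blast
 qed
 from this[of "Suc l"] have *: "elist l p q = replicate (Suc l) (tl0 p q, 0)"
  "opl (tpow l, tact l) (elist l p q) v \<in> TP l"
  "!!a. count_list a p < Suc l ==> opl (tpow l, tact l) (elist l p q) v a = 0" unfolding elist_def by auto
 show ?thesis
 proof
  fix a :: "'a list"
  show "opl (tpow l, tact l) (elist l p q) v a = 0" using * count_le_length[of a p] by (cases "length a = l") auto
 qed
qed

lemma trace_zero: "trace (0 :: complex ^ 'n ^ 'n::finite) = 0" by (simp add: trace_def)

section \<open>Modules of level \<open>l\<close> over \<open>sl\<close>\<close>

definition sect :: "(complex, 'v) module => 'v => 'v fvec"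
 where "sect N = (SOME i. is_section N i)"

context
 fixes N :: "(complex, 'v) module" (structure)
 assumes N: "vsp N"
begin

interpretation Module.module CC N by (rule N)

lemma sect_section: "is_section N (sect N)" unfolding sect_def using section_exists[OF N] by (rule someI_ex)

lemma sect_add: "u \<in> carrier N ==> v \<in> carrier N ==> sect N (u \<oplus> v) = sect N u + sect N v"
 and sect_smult: "v \<in> carrier N ==> sect N (c \<odot> v) = psc c (sect N v)"
 and ev_sect: "v \<in> carrier N ==> ev N (sect N v) = v" using sect_section by (auto simp: is_section_def)

lemma sect_zero: "sect N \<zero> = 0" using sect_add[of \<zero> \<zero>] by simp

lemma sect_minus:
 assumes "u \<in> carrier N" "v \<in> carrier N"
 shows "sect N (u \<ominus> v) = sect N u - sect N v"
proof -
 have "sect N (u \<ominus> v) = sect N u + psc (-1) (sect N v)"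
  using assms smult_closed[of "-1" v] by (simp add: minus_eq minus_smult[OF N] sect_add sect_smult)
 also have "psc (-1) (sect N v) = - sect N v" using psc.scale_minus_left[of 1] by simp
 finally show ?thesis by simp
qed

lemma sect_inj: "u \<in> carrier N ==> v \<in> carrier N ==> sect N u = sect N v \<longleftrightarrow> u = v"
 using ev_sect by metis

lemma subspace_sect:
 assumes "submodule U CC N"
 shows "psc.subspace (sect N ` U)"
proof -
 note cl = submodule_closed[OF N assms]
 show ?thesis unfolding psc.subspace_def
 proof (intro conjI ballI allI)
  show "0 \<in> sect N ` U" using cl(3) sect_zero by (metis imageI)
  fix x assume "x \<in> sect N ` U"
  then obtain u where u: "u \<in> U" "x = sect N u" by blast
  show "psc c x \<in> sect N ` U" for c using u cl by (auto simp: sect_smult[symmetric])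
  fix y assume "y \<in> sect N ` U"
  then obtain v where v: "v \<in> U" "y = sect N v" by blast
  hence "x + y = sect N (u \<oplus> v)" using u cl(5) sect_add[of u v] by (simp add: subset_iff)
  thus "x + y \<in> sect N ` U" using u v cl by blast
 qed
qed

lemma submodule_self: "submodule (carrier N) CC N" by (rule submoduleI'[OF N]) (auto simp: smult_closed)

end

context lie_module
begin

definition T :: "'x => 'v fvec => 'v fvec"
 where "T x y = sect N (\<rho> x (ev N y))"

lemmas m = module_axioms

lemma T_add: "x \<in> carrier L ==> T x (y + z) = T x y + T x z"
 by (simp add: T_def ev_add[OF m] act_r_add act_closed sect_add[OF m] ev_closed[OF m])

lemma T_psc: "x \<in> carrier L ==> T x (psc c y) = psc c (T x y)"
 by (simp add: T_def ev_psc[OF m] act_r_smult act_closed sect_smult[OF m] ev_closed[OF m])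

lemma T_l_add: "x \<in> carrier L ==> y \<in> carrier L ==> T (x \<oplus>\<^bsub>L\<^esub> y) z = T x z + T y z"
 by (simp add: T_def act_l_add act_closed sect_add[OF m] ev_closed[OF m])

lemma T_bracket: "x \<in> carrier L ==> y \<in> carrier L ==> T (x \<otimes>\<^bsub>L\<^esub> y) z = T x (T y z) - T y (T x z)"
 by (simp add: T_def act_bracket act_closed sect_minus[OF m] ev_closed[OF m] ev_sect[OF m])

lemma T_sect: "v \<in> carrier N ==> T x (sect N v) = sect N (\<rho> x v)" by (simp add: T_def ev_sect[OF m])

lemma ev_T: "x \<in> carrier L ==> ev N (T x y) = \<rho> x (ev N y)"
 by (simp add: T_def act_closed ev_sect[OF m] ev_closed[OF m])

end

definition level :: "nat => (complex ^ 'n ^ 'n::finite, 'v) lmod => bool"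
 where "level l P \<longleftrightarrow> (ALL p. ALL v:carrier (fst P). opl P (wlist l p) v = \<zero>\<^bsub>fst P\<^esub>)"

text \<open>The weight of \<open>e\<^sub>b\<close>, in terms of the traceless diagonal matrices.\<close>

definition wsp :: "nat => (complex ^ 'n ^ 'n::finite, 'v) lmod => 'n list => 'v set"
 where "wsp l P b = {u \<in> carrier (fst P). ALL c. snd P (tl0 c c) u =
  ((if c \<in> set b then 1 else 0) - of_nat l / of_nat CARD('n)) \<odot>\<^bsub>fst P\<^esub> u}"

locale sl_module = lie_module sl N \<rho>
 for N :: "(complex, 'v) module" (structure) and \<rho> :: "complex ^ 'n ^ 'n::finite => 'v => 'v" +
 fixes l :: nat
begin

definition rr :: complex where "rr = of_nat l / of_nat CARD('n)"

text \<open>The extension of the action to \<open>gl\<close> in which the identity matrix acts as \<open>l\<close>.\<close>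

definition eop :: "'n => 'n => 'v fvec => 'v fvec"
 where "eop a b y = T (tl0 a b) y + (if a = b then psc rr y else 0)"

lemma T_zero_l: "T 0 z = 0" using T_l_add[of 0 0 z] by (simp add: trace_zero)

lemma T_zero_r: "trace x = 0 ==> T x 0 = 0" using T_psc[of x 0 0] by simp

lemma sum_T_diag: "(\<Sum>c\<in>UNIV. T (tl0 c c) x) = 0"
proof -
 have z: "(\<Sum>c\<in>UNIV. tl0 c c) = (0 :: complex ^ 'n ^ 'n)"
 proof -
  have "(\<Sum>c\<in>UNIV. tl0 c c) $ p $ q = (0 :: complex)" for p q :: 'n
  proof -
  have "(\<Sum>c\<in>UNIV. tl0 c c) $ p $ q =
  (\<Sum>c\<in>UNIV. (if c = p then if p = q then 1 else 0 else 0) - (if p = q then 1 / of_nat CARD('n) else 0 :: complex))"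
  unfolding sum_component tl0_def vec_lambda_beta by (intro sum.cong) auto
  thus ?thesis by (simp add: sum_subtractf)
  qed
  thus ?thesis by (simp add: vec_eq_iff)
 qed
 have "trace (\<Sum>c\<in>A. tl0 c c :: complex ^ 'n ^ 'n) = 0 & T (\<Sum>c\<in>A. tl0 c c) x = (\<Sum>c\<in>A. T (tl0 c c) x)" for A
  by (induction A rule: infinite_finite_induct)
  (auto simp: T_zero_l trace_zero trace_add trace_tl0 T_l_add[simplified sl_simps])
 from this[of UNIV] show ?thesis by (simp add: z T_zero_l)
qed

lemma T_tl0_comm:
 "T (tl0 a b) (T (tl0 c d) y) - T (tl0 c d) (T (tl0 a b) y) =
  (if b = c then T (tl0 a d) y else 0) - (if d = a then T (tl0 c b) y else 0)"
proof -
 have neg: "T (- x) y = - T x y" if "trace x = 0" for x :: "complex ^ 'n ^ 'n"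
  using T_l_add[of x "- x" y] that trace_sub[of 0 x]
  by (simp add: trace_zero T_zero_l) (metis add.commute neg_eq_iff_add_eq_0)
 have "T (tl0 a b) (T (tl0 c d) y) - T (tl0 c d) (T (tl0 a b) y) =
  T ((if b = c then tl0 a d else 0) + - (if d = a then tl0 c b else 0)) y"
  using T_bracket[of "tl0 a b" "tl0 c d" y] by (simp add: trace_tl0 tl0_bracket)
 also have "... = T (if b = c then tl0 a d else 0) y + T (- (if d = a then tl0 c b else 0)) y"
  using trace_sub[of 0 "tl0 c b"] by (subst T_l_add[simplified sl_simps]) (auto simp: trace_tl0 trace_zero)
 also have "T (- (if d = a then tl0 c b else 0)) y = - T (if d = a then tl0 c b else 0) y"
  by (rule neg) (auto simp: trace_tl0 trace_zero)
 finally show ?thesis by (simp add: T_zero_l)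
qed

lemma gl_rep_eop: "gl_rep psc eop"
proof
 fix a b c d :: 'n and x y :: "'v \<Rightarrow>\<^sub>0 complex" and r :: complex
 show "eop a b (x + y) = eop a b x + eop a b y" by (auto simp: eop_def T_add trace_tl0 psc.scale_right_distrib)
 show "eop a b (psc r x) = psc r (eop a b x)" by (auto simp: eop_def T_psc trace_tl0 psc.scale_right_distrib mult.commute)
 have *: "eop a b (eop c d x) = T (tl0 a b) (T (tl0 c d) x) +
  (if c = d then psc rr (T (tl0 a b) x) else 0) + (if a = b then psc rr (T (tl0 c d) x) else 0) +
  (if a = b & c = d then psc rr (psc rr x) else 0)" for a b c d
  by (auto simp: eop_def T_add T_psc T_zero_r trace_tl0 psc.scale_right_distrib)
 have "eop a b (eop c d x) - eop c d (eop a b x) =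
  T (tl0 a b) (T (tl0 c d) x) - T (tl0 c d) (T (tl0 a b) x)" unfolding * by (cases "a = b"; cases "c = d") simp_all
 also have "... = (if b = c then T (tl0 a d) x else 0) - (if d = a then T (tl0 c b) x else 0)" by (rule T_tl0_comm)
 also have "... = (if b = c then eop a d x else 0) - (if d = a then eop c b x else 0)"
  unfolding eop_def by (cases "b = c"; cases "a = d") auto
 finally show "eop a b (eop c d x) - eop c d (eop a b x) = (if b = c then eop a d x else 0) - (if d = a then eop c b x else 0)" .
qed

sublocale E: gl_rep psc eop by (rule gl_rep_eop)

lemma eop_sect: "v \<in> carrier N ==>
  eop a b (sect N v) = sect N (\<rho> (tl0 a b) v \<oplus> (if a = b then rr \<odot> v else \<zero>))"
 using smult_closed[of rr v]
 by (auto simp: eop_def T_sect sect_add[OF m] sect_smult[OF m] sect_zero[OF m] act_closed trace_tl0)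

lemma sect_wlist:
 assumes "v \<in> carrier N"
 shows "foldr (%j y. eop c c y - psc (of_nat j) y) js (sect N v) =
  sect N (opl (N, \<rho>) (map (%j. (tl0 c c, of_nat j - of_nat l / of_nat CARD('n))) js) v)"
proof (induction js)
 case (Cons j js)
 let ?w = "opl (N, \<rho>) (map (%j. (tl0 c c, of_nat j - of_nat l / of_nat CARD('n))) js) v"
 have w: "?w \<in> carrier N" by (rule opl_closed[OF lie_module_axioms lie_submodule_carrier[OF lie_module_axioms] _ assms])
  (auto simp: trace_tl0)
 have "eop c c (sect N ?w) - psc (of_nat j) (sect N ?w) =
  sect N (\<rho> (tl0 c c) ?w) - psc (of_nat j - rr) (sect N ?w)"
  by (simp add: eop_def T_sect[OF w] psc.scale_left_diff_distrib)
 also have "... = sect N (\<rho> (tl0 c c) ?w \<ominus> (of_nat j - rr) \<odot> ?w)"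
  using w smult_closed[of "of_nat j - rr" ?w] act_closed[of "tl0 c c" ?w]
  by (simp add: sect_minus[OF m] sect_smult[OF m] trace_tl0)
 finally show ?case using Cons by (simp add: rr_def)
qed simp

end

locale sl_level = sl_module N \<rho> l
 for N :: "(complex, 'v) module" (structure) and \<rho> :: "complex ^ 'n ^ 'n::finite => 'v => 'v" and l +
 assumes level: "level l (N, \<rho>)"
begin

lemma gl_level_eop: "gl_level psc eop (sect N ` carrier N) l"
proof
 show "psc.subspace (sect N ` carrier N)" by (rule subspace_sect[OF m submodule_self[OF m]])
 fix x assume "x \<in> sect N ` carrier N"
 then obtain v where v: "v \<in> carrier N" "x = sect N v" by blast
 have "\<rho> (tl0 a b) v \<oplus> (if a = b then rr \<odot> v else \<zero>) \<in> carrier N" for a b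
  using v smult_closed[of rr v] act_closed[of "tl0 a b" v] by (simp add: trace_tl0)
 thus "eop a b x \<in> sect N ` carrier N" for a b using eop_sect[OF v(1)] v by simp
 from sum_T_diag show "(\<Sum>c\<in>UNIV. eop c c x) = psc (of_nat l) x"
  by (simp add: eop_def sum.distrib psc.sum_constant_scale rr_def)
 show "foldr (%j y. eop c c y - psc (of_nat j) y) [0..<Suc l] x = 0" for c
  using level v sect_wlist[OF v(1), of c "[0..<Suc l]"] sect_zero[OF m] by (simp add: level_def wlist_def del: upt_Suc)
qed

sublocale G: gl_level psc eop "sect N ` carrier N" l by (rule gl_level_eop)

lemma J_sect: "G.J b = sect N ` wsp l (N, \<rho>) b"
proof -
 have "(ALL c. eop c c (sect N v) = (if c \<in> set b then sect N v else 0)) \<longleftrightarrow> v \<in> wsp l (N, \<rho>) b"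
  if v: "v \<in> carrier N" for v
 proof -
  have "eop c c (sect N v) = (if c \<in> set b then sect N v else 0) \<longleftrightarrow>
  \<rho> (tl0 c c) v = ((if c \<in> set b then 1 else 0) - rr) \<odot> v" for c
  proof -
  have "eop c c (sect N v) = (if c \<in> set b then sect N v else 0) \<longleftrightarrow>
  sect N (\<rho> (tl0 c c) v) = psc ((if c \<in> set b then 1 else 0) - rr) (sect N v)"
  by (auto simp: eop_def T_sect[OF v] psc.scale_left_diff_distrib psc.scale_minus_left eq_diff_eq
  eq_neg_iff_add_eq_0)
  also have "psc ((if c \<in> set b then 1 else 0) - rr) (sect N v) = sect N (((if c \<in> set b then 1 else 0) - rr) \<odot> v)"
  by (rule sect_smult[OF m v, symmetric])
  finally show ?thesis using sect_inj[OF m, of "\<rho> (tl0 c c) v"] v act_closed smult_closed by (simp add: trace_tl0)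
  qed
  thus ?thesis using v by (simp add: wsp_def rr_def)
 qed
 note key = this
 show ?thesis
 proof (intro equalityI subsetI)
  fix x assume x: "x \<in> G.J b"
  then obtain v where v: "v \<in> carrier N" "x = sect N v" by (auto simp: G.J_def)
  hence "v \<in> wsp l (N, \<rho>) b" using key[OF v(1)] x unfolding G.J_def by blast
  thus "x \<in> sect N ` wsp l (N, \<rho>) b" using v by blast
 next
  fix x assume "x \<in> sect N ` wsp l (N, \<rho>) b"
  then obtain v where v: "v \<in> wsp l (N, \<rho>) b" "x = sect N v" by blast
  moreover have "v \<in> carrier N" using v by (simp add: wsp_def)
  ultimately show "x \<in> G.J b" using key[of v] unfolding G.J_def by blast
 qed
qed

lemma generated_by_wsp:
 assumes b: "distinct b" "length b = l" and U: "lie_submodule sl (N, \<rho>) U" "wsp l (N, \<rho>) b <= U"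
 shows "U = carrier N"
proof
 note cl = submodule_closed[OF m lie_submoduleD(1)[OF U(1)]]
 show "U <= carrier N" by (rule cl)
 have "sect N ` carrier N <= sect N ` U"
 proof (rule G.generated_by_J[OF b])
  show "psc.subspace (sect N ` U)" by (rule subspace_sect[OF m lie_submoduleD(1)[OF U(1)]])
  show "G.J b <= sect N ` U" unfolding J_sect using U(2) by blast
  fix a b x assume "x \<in> sect N ` U"
  then obtain u where u: "u \<in> U" "x = sect N u" by blast
  have "\<rho> (tl0 a b) u \<oplus> (if a = b then rr \<odot> u else \<zero>) \<in> U"
  using u cl lie_submoduleD(2)[OF U(1), of "tl0 a b" u] by (simp add: trace_tl0)
  thus "eop a b x \<in> sect N ` U" using eop_sect[of u a b] u cl by auto
 qed
 thus "carrier N <= U"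
 proof (intro subsetI)
  fix v assume v: "v \<in> carrier N"
  then obtain u where u: "u \<in> U" "sect N v = sect N u" using \<open>sect N ` carrier N <= sect N ` U\<close> by blast
  hence "v = u" using sect_inj[OF m v, of u] cl(5) by blast
  thus "v \<in> U" using u by simp
 qed
qed

lemma wsp_trivial:
 assumes b: "distinct b" "length b = l" and "wsp l (N, \<rho>) b <= {\<zero>}"
 shows "carrier N = {\<zero>}"
proof -
 have "sect N ` carrier N <= {0}"
  by (rule G.J_trivial[OF b]) (use assms(3) in \<open>auto simp: J_sect sect_zero[OF m]\<close>)
 hence "v = \<zero>" if "v \<in> carrier N" for v using sect_inj[OF m that zero_closed] sect_zero[OF m] that by auto
 thus ?thesis by auto
qed

end

definition (in vector_space) wsum :: "nat => ('n::finite list => 'a) => ('n list => 'b) => 'b"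
 where "wsum l v f = (\<Sum>a | length a = l. v a *s f a)"

lemma finite_words [simp]: "finite {a :: 'n::finite list. length a = l}"
 using finite_lists_length_eq[of "UNIV :: 'n set" l] by simp

context vector_space
begin

lemma wsum_add: "wsum l (%a. u a + v a) f = wsum l u f + wsum l v f" by (simp add: wsum_def scale_left_distrib sum.distrib)

lemma wsum_scale: "wsum l (%a. c * v a) f = c *s wsum l v f" by (simp add: wsum_def scale_sum_right)

lemma wsum_add_f: "wsum l v (%a. f a + g a) = wsum l v f + wsum l v g"
 by (simp add: wsum_def scale_right_distrib sum.distrib)

lemma wsum_scale_f: "wsum l v (%a. c *s f a) = c *s wsum l v f" by (simp add: wsum_def scale_sum_right mult.commute)

lemma wsum_sum: "wsum l (%a. \<Sum>i\<in>I. v i a) f = (\<Sum>i\<in>I. wsum l (v i) f)"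
 unfolding wsum_def scale_sum_left by (rule sum.swap)

lemma wsum_cong: "(!!a. length a = l ==> f a = g a) ==> wsum l v f = wsum l v g" by (simp add: wsum_def)

lemma wsum_basis: "length b = l ==> wsum l (%a. if a = b then 1 else 0) f = f b"
 by (simp add: wsum_def if_distrib[of "%c. c *s _"] cong: if_cong)

end

lemma slot_eu:
 "slot (eu p q) j v a = (if a ! j = p then v (a[j := q]) else 0)"
proof -
 have "slot (eu p q) j v a = (\<Sum>b\<in>UNIV. if b = q then if a ! j = p then v (a[j := q]) else 0 else 0)"
  unfolding slot_def eu_def vec_lambda_beta by (intro sum.cong) auto
 thus ?thesis by simp
qed

context gl_rep
begin

lemma wsum_swap:
 assumes "i + 1 < l"
 shows "wsum l (swap i v) f = wsum l v (%a. f (swp i a))"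
proof -
 have sw: "swap i v a = v (swp i a)" for a by (simp add: swap_def swp_def)
 show ?thesis unfolding wsum_def sw by (rule sum.reindex_bij_witness[of _ "swp i" "swp i"]) (use assms in auto)
qed

lemma wsum_diff: "wsum l (%a. u a - v a) f = wsum l u f - wsum l v f"
 by (simp add: wsum_def scale_left_diff_distrib sum_subtractf)

lemma wsum_slot:
 fixes p q :: 'n and v :: "'n tensor"
 assumes j: "j < l"
 shows "wsum l (slot (eu p q) j v) f = wsum l v (%a. if a ! j = q then f (a[j := p]) else 0)"
proof -
 have "wsum l (slot (eu p q) j v) f = (\<Sum>a | length a = l & a ! j = p. v (a[j := q]) *s f a)"
  unfolding wsum_def slot_eu by (intro sum.mono_neutral_cong_right) auto
 also have "... = (\<Sum>a | length a = l & a ! j = q. v a *s f (a[j := p]))"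
  by (rule sum.reindex_bij_witness[of _ "%a. a[j := p]" "%a. a[j := q]"]) (use j in auto)
 also have "... = wsum l v (%a. if a ! j = q then f (a[j := p]) else 0)"
  unfolding wsum_def by (intro sum.mono_neutral_cong_left) auto
 finally show ?thesis .
qed

lemma e_wsum: "e p q (wsum l v f) = wsum l v (%a. e p q (f a))" by (simp add: wsum_def e_sum e_scale)

lemma e_wsum_equivariant:
 assumes "equivariant l e f"
 shows "e p q (wsum l v f) = (\<Sum>j<l. wsum l (slot (eu p q) j v) f)"
proof -
 have "e p q (wsum l v f) = wsum l v (%a. \<Sum>j<l. if a ! j = q then f (a[j := p]) else 0)"
  unfolding e_wsum by (rule wsum_cong) (rule equivariantD[OF assms])
 also have "... = (\<Sum>j<l. wsum l v (%a. if a ! j = q then f (a[j := p]) else 0))"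
  unfolding wsum_def scale_sum_right by (rule sum.swap)
 also have "... = (\<Sum>j<l. wsum l (slot (eu p q) j v) f)" by (intro sum.cong refl wsum_slot[symmetric]) auto
 finally show ?thesis .
qed

end

lemma slot_mat: "slot (mat k) j v a = k * v a"
proof -
 have "slot (mat k) j v a = (\<Sum>b\<in>UNIV. if b = a ! j then k * v a else 0)"
  unfolding slot_def mat_def vec_lambda_beta by (intro sum.cong) auto
 thus ?thesis by simp
qed

lemma tact_tl0:
 "tact l (tl0 p q) v a = (\<Sum>j<l. slot (eu p q) j v a) -
  (if p = q then of_nat l / of_nat CARD('n) * v a else 0)" for p q :: "'n::finite"
 by (simp add: tact_def tl0_eu slot_lin slot_mat sum_subtractf)

lemma lhom_image:
 assumes N: "lie_module L N \<rho>" and T: "lie_module L K \<sigma>" and g: "lhom L (N, \<rho>) (carrier N) (K, \<sigma>) g"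
 shows "lie_submodule L (K, \<sigma>) (g ` carrier N)"
proof -
 interpret N: lie_module L N \<rho> by (rule N)
 interpret T: lie_module L K \<sigma> by (rule T)
 have g0: "g \<zero>\<^bsub>N\<^esub> = \<zero>\<^bsub>K\<^esub>"
  using lhom_zero[OF _ _ _ g] N.m T.m submodule_self[OF N.m] by simp
 show ?thesis unfolding lie_submodule_def prod.case
 proof (intro conjI ballI)
  show "submodule (g ` carrier N) CC K"
  proof (rule submoduleI'[OF T.m])
  show "g ` carrier N <= carrier K" using g by (auto simp: lhom_def)
  show "\<zero>\<^bsub>K\<^esub> \<in> g ` carrier N" using g0 by (metis N.zero_closed imageI)
  fix x assume "x \<in> g ` carrier N"
  then obtain u where u: "u \<in> carrier N" "x = g u" by blast
  have "c \<odot>\<^bsub>K\<^esub> x = g (c \<odot>\<^bsub>N\<^esub> u)" "c \<odot>\<^bsub>N\<^esub> u \<in> carrier N" for c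
  using u g N.smult_closed[of c u] by (simp_all add: lhom_def)
  thus "c \<odot>\<^bsub>K\<^esub> x \<in> g ` carrier N" for c by blast
  fix y assume "y \<in> g ` carrier N"
  then obtain v where v: "v \<in> carrier N" "y = g v" by blast
  hence "x \<oplus>\<^bsub>K\<^esub> y = g (u \<oplus>\<^bsub>N\<^esub> v)" using u g by (simp add: lhom_def)
  thus "x \<oplus>\<^bsub>K\<^esub> y \<in> g ` carrier N" using u v by blast
  qed
  fix x y assume x: "x \<in> carrier L" and "y \<in> g ` carrier N"
  then obtain u where u: "u \<in> carrier N" "y = g u" by blast
  hence "\<sigma> x y = g (\<rho> x u)" using x g by (simp add: lhom_def)
  thus "\<sigma> x y \<in> g ` carrier N" using N.act_closed[OF x u(1)] by blast
 qed
qed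

context sl_level
begin

text \<open>The map \<open>e\<^sub>a \<mapsto> wordop eop b a u\<close> from \<open>V\<^sup>\<otimes>\<^sup>l\<close>.\<close>

definition phi :: "'n list => 'v => 'n tensor => 'v"
 where "phi b u v = ev N (E.wsum l v (%a. wordop eop b a (sect N u)))"

lemma phi_closed: "phi b u v \<in> carrier N" unfolding phi_def by (rule ev_closed[OF m])

lemma phi_add: "phi b u (%a. v a + w a) = phi b u v \<oplus> phi b u w" unfolding phi_def E.wsum_add by (rule ev_add[OF m])

lemma phi_scale: "phi b u (%a. c * v a) = c \<odot> phi b u v" unfolding phi_def E.wsum_scale by (rule ev_psc[OF m])

lemma phi_add_u:
 assumes "u \<in> carrier N" "u' \<in> carrier N"
 shows "phi b (u \<oplus> u') v = phi b u v \<oplus> phi b u' v"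
 unfolding phi_def sect_add[OF m assms] wordop_def E.D_add E.wsum_add_f by (rule ev_add[OF m])

lemma phi_scale_u:
 assumes "u \<in> carrier N"
 shows "phi b (c \<odot> u) v = c \<odot> phi b u v"
 unfolding phi_def sect_smult[OF m assms] wordop_def E.D_scale E.wsum_scale_f by (rule ev_psc[OF m])

lemma sect_wsp: "u \<in> wsp l (N, \<rho>) b ==> sect N u \<in> G.J b" unfolding J_sect by blast

lemma wsp_carrier: "u \<in> wsp l (N, \<rho>) b ==> u \<in> carrier N" by (simp add: wsp_def)

context
 fixes b :: "'n list" assumes b: "distinct b" "length b = l"
begin

lemma phi_basis:
 assumes u: "u \<in> wsp l (N, \<rho>) b"
 shows "phi b u (%a. if a = b then 1 else 0) = u"
 unfolding phi_def E.wsum_basis[OF b(2)] G.wordop_self[OF sect_wsp[OF u] b(1)] by (rule ev_sect[OF m wsp_carrier[OF u]])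

lemma phi_act:
 assumes u: "u \<in> wsp l (N, \<rho>) b" and x: "trace x = 0"
 shows "\<rho> x (phi b u v) = phi b u (tact l x v)" using x
proof (induction x rule: sl_induct)
 case (basis p q)
 let ?f = "%a. wordop eop b a (sect N u)"
 let ?W = "E.wsum l v ?f"
 have "T (tl0 p q) ?W = eop p q ?W - (if p = q then psc rr ?W else 0)" by (simp add: eop_def)
 also have "eop p q ?W = E.wsum l (%a. \<Sum>j<l. slot (eu p q) j v a) ?f"
  unfolding E.e_wsum_equivariant[OF G.J_equivariant[OF sect_wsp[OF u] b(2)]] E.wsum_sum ..
 also have "... - (if p = q then psc rr ?W else 0) = E.wsum l (tact l (tl0 p q) v) ?f"
 proof (cases "p = q")
  case True
  have "tact l (tl0 p q) v = (%a. (\<Sum>j<l. slot (eu p q) j v a) - of_nat l / of_nat CARD('n) * v a)"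
  unfolding tact_tl0 using True by (simp add: fun_eq_iff)
  thus ?thesis using True by (simp only: if_True simp_thms E.wsum_diff E.wsum_scale rr_def)
 next
  case False
  thus ?thesis unfolding tact_tl0[abs_def] by simp
 qed
 finally show ?case unfolding phi_def using ev_T[of "tl0 p q" ?W] by (simp add: trace_tl0)
next
 case (add x y)
 thus ?case using act_l_add[of x y "phi b u v"] by (simp add: phi_closed tact_lin phi_add)
next
 case (smult c x)
 thus ?case using act_l_smult[of x "phi b u v" c] by (simp add: phi_closed tact_lin phi_scale)
qed

lemma phi_lhom:
 assumes u: "u \<in> wsp l (N, \<rho>) b"
 shows "lhom sl (tpow l, tact l) (TP l) (N, \<rho>) (phi b u)" unfolding lhom_def fst_conv snd_conv
proof (intro conjI ballI allI)
 fix v w x c assume "x \<in> carrier (sl :: (complex, complex ^ 'n ^ 'n) module)"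
 thus "phi b u (tact l x v) = \<rho> x (phi b u v)" using phi_act[OF u] by simp
qed (simp_all add: phi_closed phi_add phi_scale)

text \<open>For a nonzero weight vector \<open>u\<close> the map \<open>phi b u\<close> is a nonzero homomorphism from \<open>V\<^sup>\<otimes>\<^sup>l\<close>, hence onto.\<close>

lemma simple_composition_factor:
 assumes S: "lie_simple sl (N, \<rho>)"
 shows "composition_factor sl (N, \<rho>) (tpow l, tact l)"
proof -
 have "carrier N ~= {\<zero>}" using S by (simp add: lie_simple_def)
 then obtain u where u: "u \<in> wsp l (N, \<rho>) b" "u ~= \<zero>" using wsp_trivial[OF b] by blast
 let ?I = "phi b u ` TP l"
 have sub: "lie_submodule sl (N, \<rho>) ?I" by (rule lhom_image[OF tensor_lie_module lie_module_axioms phi_lhom[OF u(1)]])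
 have "(%a. if a = b then 1 else 0) \<in> TP l" using b by auto
 hence "u \<in> ?I" using phi_basis[OF u(1)] by (metis imageI)
 hence "?I = carrier N" using S sub u(2) by (auto simp: lie_simple_def)
 thus ?thesis using composition_factorI[OF lie_closed_sl tensor_lie_module S
  lie_submodule_carrier[OF tensor_lie_module] phi_lhom[OF u(1)]] by simp
qed

end

end

section \<open>Locally finite modules with the composition factors of the tensor power\<close>

lemma (in vector_space) joint_eigen_decomposition:
 assumes h: "!!q x y. h q (x + y) = h q x + h q y" "!!q c x. h q (c *s x) = c *s h q x"
  and comm: "!!p q x. h p (h q x) = h q (h p x)"
  and P: "subspace P" "!!q x. x \<in> P ==> h q x \<in> P"
  and diag: "!!q x. q \<in> A ==> x \<in> P ==> EX rs. distinct rs & foldr (%r y. h q y - r *s y) rs x = 0"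
  and A: "finite A" and x: "x \<in> P"
 shows "x \<in> span {v \<in> P. ALL q:A. EX r. h q v = r *s v}" using A diag
proof induction
 case empty
 thus ?case using x by (auto intro: span_base)
next
 case (insert d A)
 have "v \<in> span {v \<in> P. ALL q:insert d A. EX r. h q v = r *s v}"
  if v: "v \<in> P" "ALL q:A. EX r. h q v = r *s v" for v
 proof -
  obtain k where k: "!!q. q \<in> A ==> h q v = k q *s v" using v(2) by metis
  define P' where "P' = {w \<in> P. ALL q:A. h q w = k q *s w}"
  have P': "subspace P'" unfolding P'_def subspace_def
  proof (intro conjI ballI allI)
  have "h q 0 = 0" for q using h(2)[of q 0 0] by simp
  thus "0 \<in> {w \<in> P. ALL q:A. h q w = k q *s w}" using subspace_0[OF P(1)] by simp
  fix w assume w: "w \<in> {w \<in> P. ALL q:A. h q w = k q *s w}"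
  show "c *s w \<in> {w \<in> P. ALL q:A. h q w = k q *s w}" for c
  using w subspace_scale[OF P(1)] by (simp add: h mult.commute)
  show "w + w' \<in> {w \<in> P. ALL q:A. h q w = k q *s w}"
  if "w' \<in> {w \<in> P. ALL q:A. h q w = k q *s w}" for w'
  using w that subspace_add[OF P(1)] by (simp add: h scale_right_distrib)
  qed
  have hP': "h d w \<in> P'" if "w \<in> P'" for w using that P(2) by (simp add: P'_def comm[of _ d] h)
  obtain rs where rs: "distinct rs" "foldr (%r y. h d y - r *s y) rs v = 0" using insert.prems[of d v] v(1) by auto
  have "v \<in> P'" using v k by (simp add: P'_def)
  from eigen_decomposition[OF h P' hP' rs(1) this rs(2)]
  show ?thesis by (rule span_mono[THEN subsetD, rotated]) (auto simp: P'_def)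
 qed
 hence "span {v \<in> P. ALL q:A. EX r. h q v = r *s v} <= span {v \<in> P. ALL q:insert d A. EX r. h q v = r *s v}"
  by (intro span_minimal) auto
 thus ?case using insert.IH insert.prems by blast
qed

lemma (in vector_space) subspace_minimal:
 assumes F: "finite F" and X: "!!U. U \<in> C ==> subspace (g U) & g U <= span F" and U: "U0 \<in> C"
 shows "EX U:C. ALL W:C. g W <= g U --> g W = g U"
proof -
 define d where "d A = Max (card ` {I. I <= A & independent I})" for A
 have fin: "finite (card ` {I. I <= A & independent I})" and ne: "card ` {I. I <= A & independent I} ~= {}"
  and bd: "!!I. I <= A ==> independent I ==> finite I"
  if "A <= span F" for A
 proof -
  have "finite I & card I <= card F" if "I <= A" "independent I" for I
  using independent_span_bound[OF F that(2)] that \<open>A <= span F\<close> by blast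
  thus "!!I. I <= A ==> independent I ==> finite I" "finite (card ` {I. I <= A & independent I})"
  by (auto intro: finite_subset[of _ "{..card F}"])
  show "card ` {I. I <= A & independent I} ~= {}" using independent_empty by blast
 qed
 have mono: "d A < d B" if AB: "A \<subset> B" "subspace A" "subspace B" "B <= span F" for A B
 proof -
  have AF: "A <= span F" using AB by blast
  obtain I where I: "I <= A" "independent I" "card I = d A" using Max_in[OF fin[OF AF] ne[OF AF]] unfolding d_def by auto
  obtain y where y: "y \<in> B" "y \<notin> A" using AB by blast
  have "span I <= A" using I AB by (intro span_minimal) auto
  hence yI: "y \<notin> span I" using y by blast
  hence "independent (insert y I)" using I independent_insert by auto
  moreover have "insert y I <= B" using I y AB by blast
  ultimately have "card (insert y I) <= d B" unfolding d_def by (intro Max_ge fin[OF AB(4)]) auto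
  moreover have "finite I" using bd[OF AF] I by blast
  moreover have "y \<notin> I" using yI span_base by blast
  ultimately show ?thesis using I by simp
 qed
 obtain U where U: "U \<in> C" "!!W. W \<in> C ==> d (g U) <= d (g W)"
  using U ex_has_least_nat[of "%U. U \<in> C" U0 "%U. d (g U)"] by blast
 have "g W = g U" if W: "W \<in> C" "g W <= g U" for W
 proof (rule ccontr)
  assume "g W ~= g U"
  hence "d (g W) < d (g U)" using W X U(1) by (intro mono) auto
  then show False using U(2)[OF W(1)] by simp
 qed
 thus ?thesis using U(1) by blast
qed

definition killers :: "nat => ((complex ^ 'n ^ 'n::finite) \<times> complex) list set"
 where "killers l = range (wlist l) \<union> {hlist l p q | p q. True} \<union> {elist l p q | p q. p ~= q}"

lemma killers_cases:
 assumes "xs \<in> killers l"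
 obtains p where "xs = wlist l p" | p q where "xs = hlist l p q" | p q where "p ~= q" "xs = elist l p q"
 using assms by (auto simp: killers_def)

lemma killers_sl: "xs \<in> killers l ==> fst ` set xs <= carrier sl" by (erule killers_cases) (simp_all only: lists_sl)

lemma killers_tensor:
 assumes "xs \<in> killers l" "v \<in> TP l"
 shows "opl (tpow l, tact l) xs v = (%a. 0)" using assms(1)
proof (cases rule: killers_cases)
 case (1 p)
 show ?thesis unfolding 1 by (rule tensor_wlist[OF assms(2)])
next
 case (2 p q)
 show ?thesis unfolding 2 by (rule tensor_hlist[OF assms(2)])
next
 case (3 p q)
 show ?thesis unfolding 3(2) by (rule tensor_elist[OF assms(2) 3(1)])
qed

lemma killers_factor:
 assumes S: "composition_factor sl S (tpow l, tact l)" and xs: "xs \<in> killers l" and s: "s \<in> carrier (fst S)"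
 shows "opl S xs s = \<zero>\<^bsub>fst S\<^esub>"
proof -
 obtain U g where U: "lie_submodule sl (tpow l, tact l) U" and g: "lhom sl (tpow l, tact l) U S g" "g ` U = carrier (fst S)"
  using composition_factor_surj[OF lie_closed_sl tensor_lie_module S] by blast
 have mS: "lie_module sl (fst S) (snd S)" using S by (cases S) (simp add: composition_factor_def lie_simple_def)
 obtain u where u: "u \<in> U" "s = g u" using s g(2) by blast
 note cl = submodule_closed[OF tpow_module lie_submoduleD(1)[OF U]]
 have "opl S xs s = g (opl (tpow l, tact l) xs u)"
  unfolding u(2) by (rule opl_lhom[OF tensor_lie_module mS U g(1) killers_sl[OF xs] u(1), symmetric])
 also have "opl (tpow l, tact l) xs u = \<zero>\<^bsub>tpow l\<^esub>"
  unfolding tpow_simps by (rule killers_tensor[OF xs subsetD[OF cl(5) u(1)]])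
 also have "g \<zero>\<^bsub>tpow l\<^esub> = \<zero>\<^bsub>fst S\<^esub>"
  using lhom_zero[of "(tpow l, tact l)" S U sl g, simplified, OF tpow_module lie_module.m[OF mS]
  lie_submoduleD(1)[OF U] g(1)] by simp
 finally show ?thesis .
qed

lemma span_finite_dim:
 fixes N :: "(complex, 'v) module"
 assumes N: "vsp N" and U: "U <= carrier N"
 shows "finite_dim N U \<longleftrightarrow> (EX B. finite B & B <= U & sect N ` U <= psc.span (sect N ` B))"
proof -
 interpret Module.module CC N by (rule N)
 have eq: "(\<Sum>b\<in>B. psc (c b) (sect N b)) = sect N (\<Oplus>\<^bsub>N\<^esub>b\<in>B. c b \<odot>\<^bsub>N\<^esub> b)" if "B <= carrier N" for B c
  using that
 proof (induction B rule: infinite_finite_induct)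
  case (insert x F)
  have "(\<Oplus>\<^bsub>N\<^esub>b\<in>insert x F. c b \<odot>\<^bsub>N\<^esub> b) = c x \<odot>\<^bsub>N\<^esub> x \<oplus>\<^bsub>N\<^esub> (\<Oplus>\<^bsub>N\<^esub>b\<in>F. c b \<odot>\<^bsub>N\<^esub> b)"
  using insert by (intro finsum_insert) auto
  moreover have "(\<Oplus>\<^bsub>N\<^esub>b\<in>F. c b \<odot>\<^bsub>N\<^esub> b) \<in> carrier N" using insert by (intro finsum_closed) auto
  ultimately show ?case using insert by (simp add: sect_add[OF N] sect_smult[OF N])
 qed (auto simp: sect_zero[OF N])
 have key: "(EX c. u = (\<Oplus>\<^bsub>N\<^esub>b\<in>B. c b \<odot>\<^bsub>N\<^esub> b)) \<longleftrightarrow> sect N u \<in> psc.span (sect N ` B)"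
  if B: "finite B" "B <= U" and u: "u \<in> U" for B u
 proof
  have BN: "B <= carrier N" using B U by blast
  assume "EX c. u = (\<Oplus>\<^bsub>N\<^esub>b\<in>B. c b \<odot>\<^bsub>N\<^esub> b)"
  then obtain c where "u = (\<Oplus>\<^bsub>N\<^esub>b\<in>B. c b \<odot>\<^bsub>N\<^esub> b)" by blast
  hence "sect N u = (\<Sum>b\<in>B. psc (c b) (sect N b))" using eq[OF BN] by simp
  thus "sect N u \<in> psc.span (sect N ` B)" by (simp only:) (intro psc.span_sum psc.span_scale psc.span_base imageI)
 next
  have BN: "B <= carrier N" using B U by blast
  have inj: "inj_on (sect N) B" using sect_inj[OF N] BN by (auto intro!: inj_onI)
  assume "sect N u \<in> psc.span (sect N ` B)"
  then obtain g where "sect N u = (\<Sum>x\<in>sect N ` B. psc (g x) x)" using psc.span_finite[of "sect N ` B"] B by auto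
  hence "sect N u = (\<Sum>b\<in>B. psc (g (sect N b)) (sect N b))" using inj by (simp add: sum.reindex)
  hence s: "sect N u = sect N (\<Oplus>\<^bsub>N\<^esub>b\<in>B. g (sect N b) \<odot>\<^bsub>N\<^esub> b)" using eq[OF BN] by simp
  have uN: "u \<in> carrier N" and gN: "(\<Oplus>\<^bsub>N\<^esub>b\<in>B. g (sect N b) \<odot>\<^bsub>N\<^esub> b) \<in> carrier N"
  using u U BN by (auto intro!: finsum_closed)
  have "u = (\<Oplus>\<^bsub>N\<^esub>b\<in>B. g (sect N b) \<odot>\<^bsub>N\<^esub> b)" by (rule iffD1[OF sect_inj[OF N uN gN] s])
  thus "EX c. u = (\<Oplus>\<^bsub>N\<^esub>b\<in>B. c b \<odot>\<^bsub>N\<^esub> b)" by (rule exI[of _ "%b. g (sect N b)"])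
 qed
 show ?thesis unfolding finite_dim_def
 proof (intro iffI; elim exE conjE)
  fix B assume B: "finite B" "B <= U" and e: "ALL u:U. EX c. u = (\<Oplus>\<^bsub>N\<^esub>b\<in>B. c b \<odot>\<^bsub>N\<^esub> b)"
  have "sect N ` U <= psc.span (sect N ` B)"
  proof (rule image_subsetI)
  fix u assume u: "u \<in> U"
  show "sect N u \<in> psc.span (sect N ` B)" by (rule iffD1[OF key[OF B u] bspec[OF e u]])
  qed
  thus "EX B. finite B & B <= U & sect N ` U <= psc.span (sect N ` B)" by (intro exI[of _ B] conjI B)
 next
  fix B assume B: "finite B" "B <= U" and e: "sect N ` U <= psc.span (sect N ` B)"
  have "ALL u:U. EX c. u = (\<Oplus>\<^bsub>N\<^esub>b\<in>B. c b \<odot>\<^bsub>N\<^esub> b)"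
  proof
  fix u assume u: "u \<in> U"
  show "EX c. u = (\<Oplus>\<^bsub>N\<^esub>b\<in>B. c b \<odot>\<^bsub>N\<^esub> b)" by (rule iffD2[OF key[OF B u] subsetD[OF e imageI[OF u]]])
  qed
  thus "EX B. finite B & B <= U & (ALL u:U. EX c. u = (\<Oplus>\<^bsub>N\<^esub>b\<in>B. c b \<odot>\<^bsub>N\<^esub> b))"
  by (intro exI[of _ B] conjI B)
 qed
qed

context sl_module
begin

lemma minus_zero_r: "v \<in> carrier N ==> v \<ominus> \<zero> = v" by (simp add: minus_eq)

abbreviation "op xs \<equiv> opl (N, \<rho>) xs"

lemma op_closed: "fst ` set xs <= carrier sl ==> v \<in> carrier N ==> op xs v \<in> carrier N"
 by (rule opl_closed[OF lie_module_axioms lie_submodule_carrier[OF lie_module_axioms]])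

lemma op_sub: "lie_submodule sl (N, \<rho>) U ==> fst ` set xs <= carrier sl ==> v \<in> U ==> op xs v \<in> U"
 by (rule opl_closed[OF lie_module_axioms])

lemma sect_op:
 assumes "fst ` set xs <= carrier sl" "v \<in> carrier N"
 shows "sect N (op xs v) = foldr (%(x, c) y. T x y - psc c y) xs (sect N v)" using assms(1)
proof (induction xs)
 case (Cons z xs)
 obtain x c where z: "z = (x, c)" by (cases z)
 have w: "op xs v \<in> carrier N" using Cons.prems assms(2) by (intro op_closed) auto
 have x: "x \<in> carrier sl" using Cons.prems z by simp
 have "sect N (\<rho> x (op xs v) \<ominus> c \<odot> op xs v) = T x (sect N (op xs v)) - psc c (sect N (op xs v))"
  using w x act_closed[OF x w] smult_closed[of c "op xs v"]
  by (simp only: sect_minus[OF m] sect_smult[OF m] T_sect CC_simps UNIV_I)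
 thus ?case using Cons z by simp
qed simp

definition Top :: "((complex ^ 'n ^ 'n) \<times> complex) list => 'v fvec => 'v fvec"
 where "Top xs = foldr (%(x, c) y. T x y - psc c y) xs"

lemma Top_add: "fst ` set xs <= carrier sl ==> Top xs (y + z) = Top xs y + Top xs z"
 by (induction xs) (auto simp: Top_def T_add psc.scale_right_distrib)

lemma Top_psc: "fst ` set xs <= carrier sl ==> Top xs (psc c y) = psc c (Top xs y)"
 by (induction xs) (auto simp: Top_def T_psc psc.scale_right_diff_distrib mult.commute)

lemma Top_zero: "fst ` set xs <= carrier sl ==> Top xs 0 = 0" using Top_psc[of xs 0 0] by simp

text \<open>Nilpotency, vector by vector, of all the products that vanish on \<open>V\<^sup>\<otimes>\<^sup>l\<close>.\<close>

definition good :: "'v => bool"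
 where "good v \<longleftrightarrow> (ALL xs:killers l. EX k. (Top xs ^^ k) (sect N v) = 0)"

lemma Top_pow_add: "fst ` set xs <= carrier sl ==> (Top xs ^^ k) (y + z) = (Top xs ^^ k) y + (Top xs ^^ k) z"
 by (induction k) (auto simp: Top_add)

lemma Top_pow_zero: "fst ` set xs <= carrier sl ==> (Top xs ^^ k) 0 = 0" by (induction k) (auto simp: Top_zero)

lemma good_add:
 assumes "u \<in> carrier N" "v \<in> carrier N" "good u" "good v"
 shows "good (u \<oplus> v)" unfolding good_def
proof
 fix xs :: "((complex ^ 'n ^ 'n) \<times> complex) list" assume xs: "xs \<in> killers l"
 note s = killers_sl[OF xs]
 obtain j where j: "(Top xs ^^ j) (sect N u) = 0" using bspec[OF assms(3)[unfolded good_def] xs] by blast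
 obtain k where k: "(Top xs ^^ k) (sect N v) = 0" using bspec[OF assms(4)[unfolded good_def] xs] by blast
 have "(Top xs ^^ (k + j)) (sect N u) = 0" by (simp only: funpow_add o_apply j Top_pow_zero[OF s])
 hence u0: "(Top xs ^^ (j + k)) (sect N u) = 0" by (simp only: add.commute)
 have "(Top xs ^^ (j + k)) (sect N v) = 0" by (simp only: funpow_add o_apply k Top_pow_zero[OF s])
 hence "(Top xs ^^ (j + k)) (sect N (u \<oplus> v)) = 0" unfolding sect_add[OF m assms(1,2)] Top_pow_add[OF s] u0 by simp
 thus "EX k. (Top xs ^^ k) (sect N (u \<oplus> v)) = 0" by blast
qed

lemma good_step:
 assumes "v \<in> carrier N" "!!xs. xs \<in> killers l ==> good (op xs v)"
 shows "good v" unfolding good_def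
proof
 fix xs :: "((complex ^ 'n ^ 'n) \<times> complex) list" assume xs: "xs \<in> killers l"
 then obtain k where "(Top xs ^^ k) (sect N (op xs v)) = 0" using assms(2) good_def by blast
 hence "(Top xs ^^ k) (Top xs (sect N v)) = 0" unfolding sect_op[OF killers_sl[OF xs] assms(1)] Top_def .
 hence "(Top xs ^^ Suc k) (sect N v) = 0" by (simp only: funpow_Suc_right o_apply)
 thus "EX k. (Top xs ^^ k) (sect N v) = 0" by blast
qed

lemma sub_sum:
 assumes U: "lie_submodule sl (N, \<rho>) U" and V: "lie_submodule sl (N, \<rho>) V"
 shows "lie_submodule sl (N, \<rho>) {u \<oplus> v | u v. u \<in> U & v \<in> V}" unfolding lie_submodule_def prod.case
proof (intro conjI ballI)
 note clU = submodule_closed[OF m lie_submoduleD(1)[OF U]] and clV = submodule_closed[OF m lie_submoduleD(1)[OF V]]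
 let ?S = "{u \<oplus> v | u v. u \<in> U & v \<in> V}"
 show "submodule ?S CC N"
 proof (rule submoduleI'[OF m])
  show "?S <= carrier N" using clU(5) clV(5) by auto
  have "\<zero> = \<zero> \<oplus> \<zero>" by simp
  thus "\<zero> \<in> ?S" using clU(3) clV(3) by blast
  fix x assume "x \<in> ?S"
  then obtain u v where x: "x = u \<oplus> v" "u \<in> U" "v \<in> V" by blast
  have "c \<odot> x = c \<odot> u \<oplus> c \<odot> v" for c using x clU(5) clV(5) smult_r_distr[of c u v] by auto
  thus "c \<odot> x \<in> ?S" for c using clU(2)[OF x(2), of c] clV(2)[OF x(3), of c] by blast
  fix y assume "y \<in> ?S"
  then obtain u' v' where y: "y = u' \<oplus> v'" "u' \<in> U" "v' \<in> V" by blast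
  have c: "u \<in> carrier N" "v \<in> carrier N" "u' \<in> carrier N" "v' \<in> carrier N" using x y clU(5) clV(5) by auto
  have "x \<oplus> y = (u \<oplus> u') \<oplus> (v \<oplus> v')" unfolding x y using c by (simp add: a_ac)
  thus "x \<oplus> y \<in> ?S" using clU(1)[OF x(2) y(2)] clV(1)[OF x(3) y(3)] by blast
 qed
 fix x :: "complex ^ 'n ^ 'n" and y assume x: "x \<in> carrier sl" and "y \<in> ?S"
 then obtain u v where y: "y = u \<oplus> v" "u \<in> U" "v \<in> V" by blast
 hence "u \<in> carrier N" "v \<in> carrier N" using clU(5) clV(5) by auto
 hence "\<rho> x y = \<rho> x u \<oplus> \<rho> x v" unfolding y(1) by (rule act_r_add[OF x])
 thus "\<rho> x y \<in> ?S" using lie_submoduleD(2)[OF U x y(2)] lie_submoduleD(2)[OF V x y(3)] by blast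
qed

lemma sub_inter:
 assumes U: "lie_submodule sl (N, \<rho>) U" and V: "lie_submodule sl (N, \<rho>) V"
 shows "lie_submodule sl (N, \<rho>) (U \<inter> V)" unfolding lie_submodule_def prod.case
proof (intro conjI ballI)
 note clU = submodule_closed[OF m lie_submoduleD(1)[OF U]] and clV = submodule_closed[OF m lie_submoduleD(1)[OF V]]
 show "submodule (U \<inter> V) CC N" by (rule submoduleI'[OF m]) (use clU clV in auto)
 fix x :: "complex ^ 'n ^ 'n" and y assume "x \<in> carrier sl" "y \<in> U \<inter> V"
 thus "\<rho> x y \<in> U \<inter> V" using lie_submoduleD(2)[OF U, of x y] lie_submoduleD(2)[OF V, of x y] by blast
qed

lemma simple_quotient:
 assumes W: "lie_submodule sl (N, \<rho>) W" and U: "lie_submodule sl (N, \<rho>) U" and WU: "W \<subset> U"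
  and min: "!!V. lie_submodule sl (N, \<rho>) V ==> W <= V ==> V <= U ==> V = W \<or> V = U"
 shows "lie_simple sl (lie_subquotient (N, \<rho>) U W)"
proof -
 define Q where "Q = lie_subquotient (N, \<rho>) U W"
 note Q = lie_subquotient_lhom[OF lie_closed_sl lie_module_axioms U W psubset_imp_subset[OF WU], folded Q_def]
 note clU = submodule_closed[OF m lie_submoduleD(1)[OF U]] and clW = submodule_closed[OF m lie_submoduleD(1)[OF W]]
 interpret Q: lie_module sl "fst Q" "snd Q" by (rule Q(3))
 let ?q = "%v. W +>\<^bsub>N\<^esub> v"
 have q0: "?q \<zero> = \<zero>\<^bsub>fst Q\<^esub>" using lhom_zero[OF _ _ _ Q(1)] m Q.m lie_submoduleD(1)[OF U] by simp
 have ker: "?q u = \<zero>\<^bsub>fst Q\<^esub> \<longleftrightarrow> u \<in> W" if "u \<in> U" for u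
 proof -
  have "u \<ominus> \<zero> = u" using that clU(5) minus_zero_r by blast
  thus ?thesis using Q(4)[OF that clU(3)] unfolding q0 by simp
 qed
 obtain u where u: "u \<in> U" "u \<notin> W" using WU by blast
 have "?q u \<in> carrier (fst Q)" "?q u ~= \<zero>\<^bsub>fst Q\<^esub>" using u ker Q(2) by auto
 hence ne: "carrier (fst Q) ~= {\<zero>\<^bsub>fst Q\<^esub>}" by blast
 have "V = {\<zero>\<^bsub>fst Q\<^esub>} \<or> V = carrier (fst Q)" if V: "lie_submodule sl (fst Q, snd Q) V" for V
 proof -
  note clV = submodule_closed[OF Q.m lie_submoduleD(1)[OF V]]
  define V' where "V' = {u \<in> U. ?q u \<in> V}"
  have "lie_submodule sl (N, \<rho>) V'" unfolding lie_submodule_def prod.case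
  proof (intro conjI ballI)
  show "submodule V' CC N" by (rule submoduleI'[OF m]) (use clU clV q0 Q(1) in \<open>auto simp: V'_def lhom_def\<close>)
  fix x :: "complex ^ 'n ^ 'n" and y assume x: "x \<in> carrier sl" and y: "y \<in> V'"
  have "?q (\<rho> x y) = snd Q x (?q y)" using Q(1) x y by (simp add: lhom_def V'_def)
  thus "\<rho> x y \<in> V'"
  using lie_submoduleD(2)[OF V x, of "?q y"] lie_submoduleD(2)[OF U x, of y] y by (simp add: V'_def)
  qed
  moreover have "W <= V'"
  proof
  fix x assume x: "x \<in> W"
  hence "x \<in> U" using WU by blast
  thus "x \<in> V'" using ker[of x] x clV(3) by (simp add: V'_def)
  qed
  moreover have "V' <= U" by (auto simp: V'_def)
  ultimately consider "V' = W" | "V' = U" using min by blast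
  thus ?thesis
  proof cases
  case 1
  have "v = \<zero>\<^bsub>fst Q\<^esub>" if v: "v \<in> V" for v
  proof -
  obtain u where "u \<in> U" "v = ?q u" using v clV(5) Q(2) by blast
  thus ?thesis using 1 ker v by (auto simp: V'_def)
  qed
  thus ?thesis using clV(3) by blast
  next
  case 2
  have "carrier (fst Q) <= V" using 2 unfolding Q(2)[symmetric] by (auto simp: V'_def)
  thus ?thesis using clV(5) by blast
  qed
 qed
 thus ?thesis unfolding Q_def[symmetric] using ne Q.lie_module_axioms by (cases Q) (simp add: lie_simple_def)
qed

text \<open>If \<open>W\<close>, the largest submodule of good vectors, missed \<open>v\<close>, then a minimal submodule \<open>U\<close> strictly above \<open>W\<close> inside
\<open>W + U0\<close>, with \<open>U0\<close> finite dimensional, would have a simple quotient \<open>U / W\<close>. This is a composition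
factor of \<open>V\<^sup>\<otimes>\<^sup>l\<close>, so the products map \<open>U\<close> into \<open>W\<close>, and the vectors of \<open>U\<close> are good as well.\<close>

lemma all_good:
 assumes lf: "locally_finite_dim sl (N, \<rho>)"
  and cf: "!!S :: (complex ^ 'n ^ 'n, 'v set) lmod. composition_factor sl S (N, \<rho>) ==>
  composition_factor sl S (tpow l, tact l)"
  and v: "v \<in> carrier N"
 shows "good v"
proof -
 define W where "W = {w. EX U. lie_submodule sl (N, \<rho>) U & w \<in> U & (ALL u:U. good u)}"
 have Wc: "W <= carrier N"
 proof
  fix w assume "w \<in> W"
  then obtain U where "lie_submodule sl (N, \<rho>) U" "w \<in> U" unfolding W_def by blast
  thus "w \<in> carrier N" using submodule_closed(5)[OF m lie_submoduleD(1)] by blast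
 qed
 have good0: "good \<zero>" unfolding good_def sect_zero[OF m] by (intro ballI exI[of _ 0]) simp
 have W: "lie_submodule sl (N, \<rho>) W" unfolding lie_submodule_def prod.case
 proof (intro conjI ballI)
  show "submodule W CC N"
  proof (rule submoduleI'[OF m Wc])
  have "submodule {\<zero>} CC N" by (rule submoduleI'[OF m]) (auto simp: smult_r_null[simplified])
  moreover have "\<rho> x \<zero> = \<zero>" if "x \<in> carrier sl" for x
  using act_r_smult[OF that zero_closed, of 0] act_closed[OF that zero_closed] smult_l_null[simplified] by simp
  ultimately have "lie_submodule sl (N, \<rho>) {\<zero>}" by (simp add: lie_submodule_def)
  thus "\<zero> \<in> W" using good0 unfolding W_def by blast
  fix u assume "u \<in> W"
  then obtain U where U: "lie_submodule sl (N, \<rho>) U" "u \<in> U" "ALL u:U. good u" unfolding W_def by blast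
  note clU = submodule_closed[OF m lie_submoduleD(1)[OF U(1)]]
  show "c \<odot> u \<in> W" for c using U clU(2)[OF U(2), of c] unfolding W_def by blast
  fix v assume "v \<in> W"
  then obtain V where V: "lie_submodule sl (N, \<rho>) V" "v \<in> V" "ALL u:V. good u" unfolding W_def by blast
  note clV = submodule_closed[OF m lie_submoduleD(1)[OF V(1)]]
  have "ALL u:{u \<oplus> v | u v. u \<in> U & v \<in> V}. good u" using good_add U(3) V(3) clU(5) clV(5) by blast
  thus "u \<oplus> v \<in> W" using sub_sum[OF U(1) V(1)] U(2) V(2) unfolding W_def by blast
  qed
  fix x :: "complex ^ 'n ^ 'n" and y assume x: "x \<in> carrier sl" and "y \<in> W"
  then obtain U where U: "lie_submodule sl (N, \<rho>) U" "y \<in> U" "ALL u:U. good u" unfolding W_def by blast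
  thus "\<rho> x y \<in> W" using lie_submoduleD(2)[OF U(1) x U(2)] unfolding W_def by blast
 qed
 note clW = submodule_closed[OF m lie_submoduleD(1)[OF W]]
 have Wgood: "good w" if "w \<in> W" for w using that unfolding W_def by blast
 have "v \<in> W"
 proof (rule ccontr)
  assume vW: "v \<notin> W"
  obtain U0 where U0: "lie_submodule sl (N, \<rho>) U0" "finite_dim N U0" "v \<in> U0"
  using lf v unfolding locally_finite_dim_def by auto
  note clU0 = submodule_closed[OF m lie_submoduleD(1)[OF U0(1)]]
  obtain B where B: "finite B" and spanB: "sect N ` U0 <= psc.span (sect N ` B)"
  using U0(2) unfolding span_finite_dim[OF m clU0(5)] by blast
  define C where "C = {V. lie_submodule sl (N, \<rho>) V & W \<subset> V & V <= {w \<oplus> u | w u. w \<in> W & u \<in> U0}}"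
  have C0: "{w \<oplus> u | w u. w \<in> W & u \<in> U0} \<in> C"
  proof -
  have "W <= {w \<oplus> u | w u. w \<in> W & u \<in> U0}"
  proof
  fix w assume w: "w \<in> W"
  hence "w = w \<oplus> \<zero>" using Wc by auto
  thus "w \<in> {w \<oplus> u | w u. w \<in> W & u \<in> U0}" using w clU0(3) by blast
  qed
  moreover have "v \<in> {w \<oplus> u | w u. w \<in> W & u \<in> U0}"
  proof -
  have "v = \<zero> \<oplus> v" using v by simp
  thus ?thesis using clW(3) U0(3) by blast
  qed
  ultimately show ?thesis using sub_sum[OF W U0(1)] vW unfolding C_def by blast
  qed
  have "psc.subspace (sect N ` (V \<inter> U0)) & sect N ` (V \<inter> U0) <= psc.span (sect N ` B)" if "V \<in> C" for V
  proof
  have V: "lie_submodule sl (N, \<rho>) V" using that unfolding C_def by blast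
  show "psc.subspace (sect N ` (V \<inter> U0))" by (rule subspace_sect[OF m lie_submoduleD(1)[OF sub_inter[OF V U0(1)]]])
  show "sect N ` (V \<inter> U0) <= psc.span (sect N ` B)" using spanB by blast
  qed
  note sub = this
  have "EX U:C. ALL V:C. sect N ` (V \<inter> U0) <= sect N ` (U \<inter> U0) -->
  sect N ` (V \<inter> U0) = sect N ` (U \<inter> U0)"
  by (rule psc.subspace_minimal[where F = "sect N ` B" and C = C and g = "%V. sect N ` (V \<inter> U0)",
  OF finite_imageI[OF B] sub C0])
  then obtain U where U: "U \<in> C" and Um: "ALL V:C. sect N ` (V \<inter> U0) <= sect N ` (U \<inter> U0) -->
  sect N ` (V \<inter> U0) = sect N ` (U \<inter> U0)" by (rule bexE)
  note Umin = Um[rule_format]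
  have U': "lie_submodule sl (N, \<rho>) U" "W \<subset> U" "U <= {w \<oplus> u | w u. w \<in> W & u \<in> U0}"
  using U by (auto simp: C_def)
  note clU = submodule_closed[OF m lie_submoduleD(1)[OF U'(1)]]
  have "V = W \<or> V = U" if V: "lie_submodule sl (N, \<rho>) V" "W <= V" "V <= U" for V
  proof (rule disjCI)
  assume "V ~= U"
  show "V = W"
  proof (rule ccontr)
  assume "V ~= W"
  hence VC: "V \<in> C" using V U' unfolding C_def by blast
  note clV = submodule_closed[OF m lie_submoduleD(1)[OF V(1)]]
  have "V \<inter> U0 <= U \<inter> U0" using V(3) by blast
  hence eq: "sect N ` (V \<inter> U0) = sect N ` (U \<inter> U0)" by (intro Umin[OF VC] image_mono)
  have "U <= V"
  proof
  fix x assume x: "x \<in> U"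
  then obtain w u where wu: "x = w \<oplus> u" "w \<in> W" "u \<in> U0" using U'(3) by blast
  have c: "w \<in> carrier N" "u \<in> carrier N" using wu(2,3) Wc clU0(5) by blast+
  have "u = x \<ominus> w" unfolding wu using c by (simp add: minus_eq a_comm[of w u] a_assoc r_neg)
  moreover have "w \<in> U" using wu(2) U'(2) by blast
  ultimately have "u \<in> U" using clU(4)[OF x, of w] by simp
  hence "sect N u \<in> sect N ` (V \<inter> U0)" unfolding eq using wu(3) by (intro imageI IntI)
  then obtain u' where u': "u' \<in> V" "u' \<in> U0" "sect N u = sect N u'" by (elim imageE IntE)
  have "u' \<in> carrier N" using u'(2) clU0(5) by blast
  hence "u = u'" using sect_inj[OF m c(2), of u'] u'(3) by simp
  moreover have "w \<in> V" using wu(2) V(2) by blast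
  ultimately show "x \<in> V" unfolding wu(1) using clV(1)[of w u] u'(1) by simp
  qed
  then show False using V(3) \<open>V ~= U\<close> by blast
  qed
  qed
  hence simple: "lie_simple sl (lie_subquotient (N, \<rho>) U W)" by (rule simple_quotient[OF W U'(1,2)])
  define Q where "Q = lie_subquotient (N, \<rho>) U W"
  note Q = lie_subquotient_lhom[OF lie_closed_sl lie_module_axioms U'(1) W psubset_imp_subset[OF U'(2)], folded Q_def]
  have "composition_factor sl Q (N, \<rho>)"
  using composition_factorI[OF lie_closed_sl lie_module_axioms _ U'(1) Q(1) Q(2)] simple Q_def by simp
  hence cfQ: "composition_factor sl Q (tpow l, tact l)" by (rule cf)
  have "good u" if u: "u \<in> U" for u
  proof (rule good_step)
  show "u \<in> carrier N" using u clU(5) by blast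
  fix xs :: "((complex ^ 'n ^ 'n) \<times> complex) list" assume xs: "xs \<in> killers l"
  have opU: "op xs u \<in> U" by (rule op_sub[OF U'(1) killers_sl[OF xs] u])
  have "W +>\<^bsub>N\<^esub> op xs u = opl Q xs (W +>\<^bsub>N\<^esub> u)"
  by (rule opl_lhom[OF lie_module_axioms Q(3) U'(1) Q(1) killers_sl[OF xs] u])
  also have "... = \<zero>\<^bsub>fst Q\<^esub>" by (rule killers_factor[OF cfQ xs]) (use Q(2) u in blast)
  also have "... = W +>\<^bsub>N\<^esub> \<zero>"
  using lhom_zero[OF _ _ _ Q(1)] m lie_module.m[OF Q(3)] lie_submoduleD(1)[OF U'(1)] by simp
  finally have "op xs u \<ominus> \<zero> \<in> W" using Q(4)[OF opU clU(3)] by simp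
  moreover have "op xs u \<ominus> \<zero> = op xs u" using opU clU(5) minus_zero_r by blast
  ultimately show "good (op xs u)" using Wgood by simp
  qed
  hence "U <= W" using U'(1) unfolding W_def by blast
  then show False using U'(2) by blast
 qed
 thus ?thesis by (rule Wgood)
qed

lemma Top_elist: "Top (elist l p q) y = (T (tl0 p q) ^^ Suc l) y"
proof -
 have "Top (replicate k (tl0 p q, 0)) y = (T (tl0 p q) ^^ k) y" for k by (induction k) (simp_all add: Top_def)
 thus ?thesis unfolding elist_def .
qed

lemma foldr_Top: "(Top (map (%i. (x, c i)) js) ^^ k) y =
  foldr (%r y. T x y - psc r y) (concat (replicate k (map c js))) y"
proof (induction k)
 case (Suc k)
 have "Top (map (%i. (x, c i)) js) z = foldr (%r y. T x y - psc r y) (map c js) z" for z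
  by (induction js) (simp_all add: Top_def)
 thus ?case using Suc by simp
qed simp

text \<open>Nilpotent \<open>E\<^sub>p\<^sub>q\<close> make the coroots semisimple. These span the diagonal matrices, so every vector is a sum of joint
eigenvectors, on which a nilpotent product of factors \<open>x - c\<close> vanishes.\<close>

theorem level_of_good:
 assumes good: "!!v. v \<in> carrier N ==> good v"
 shows "level l (N, \<rho>)"
proof -
 let ?P = "sect N ` carrier N"
 have P: "psc.subspace ?P" by (rule subspace_sect[OF m submodule_self[OF m]])
 have TP: "T x y \<in> ?P" if "trace x = 0" for x y
  unfolding T_def using that by (intro imageI act_closed ev_closed[OF m]) simp
 define h where "h p q y = T (tl0 p p - tl0 q q) y" for p q y
 have th: "trace (tl0 p p - tl0 q q) = 0" for p q by (simp add: trace_sub trace_tl0)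
 have T_diff: "T (x - y) z = T x z - T y z" if "trace x = 0" "trace y = 0" for x y z
  using T_l_add[of "x - y" y z] that by (simp add: trace_sub)
 have h_eq: "h p q y = T (tl0 p p) y - T (tl0 q q) y" for p q y unfolding h_def by (rule T_diff) (simp_all add: trace_tl0)
 have ss: "h p q v = psc s v" if pq: "p ~= q" and v: "v \<in> ?P"
  and 2: "h p q (h p q v - psc s v) = psc s (h p q v - psc s v)" for p q v s
 proof -
  have nil: "EX k. (T (tl0 p q) ^^ k) y = 0" if y: "y \<in> ?P" and ne: "p ~= q" for p q y
  proof -
  obtain w where w: "w \<in> carrier N" "y = sect N w" using y by blast
  have "elist l p q \<in> killers l" using ne by (auto simp: killers_def)
  then obtain k where "(Top (elist l p q) ^^ k) y = 0" using good[OF w(1)] w(2) unfolding good_def by blast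
  hence "((T (tl0 p q) ^^ Suc l) ^^ k) y = 0" unfolding Top_elist[abs_def] by (simp only: eta_contract_eq)
  thus ?thesis unfolding funpow_mult by blast
  qed
  have ds: "psc 2 x = x + x" for x :: "'v \<Rightarrow>\<^sub>0 complex" using psc.scale_left_distrib[of 1 1 x] by simp
  have swap1: "T (tl0 a a) (T (tl0 a b) x) = T (tl0 a b) (T (tl0 a a) x) + T (tl0 a b) x"
  "T (tl0 b b) (T (tl0 a b) x) = T (tl0 a b) (T (tl0 b b) x) - T (tl0 a b) x" if "a ~= b" for a b x
  using T_tl0_comm[of a a a b x] T_tl0_comm[of b b a b x] that by (simp_all add: algebra_simps)
  have T_diff_r: "T (tl0 a b) (x - y) = T (tl0 a b) x - T (tl0 a b) y" for a b x y
  using T_add[of "tl0 a b" "x - y" y] by (simp add: trace_tl0)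
  interpret sl2_rep psc "T (tl0 p q)" "T (tl0 q p)" "h p q" ?P
  proof (unfold_locales, goal_cases)
  case (7 x)
  show ?case unfolding h_eq T_diff_r swap1[OF pq] ds by simp
  next
  case (8 x)
  show ?case unfolding h_eq T_diff_r swap1[OF pq[symmetric]] ds by simp
  next
  case (9 x)
  show ?case using T_tl0_comm[of p q q p x] pq by (simp add: h_eq)
  next
  case 10
  show ?case by (rule P)
  next
  case (14 x)
  thus ?case using nil[of x p q] pq by blast
  next
  case (15 x)
  thus ?case using nil[of x q p] pq by blast
  qed (simp_all only: h_def T_add T_psc TP trace_tl0 th sl_simps)
  show ?thesis by (rule h_semisimple[OF v 2])
 qed
 have hlin: "h p q (x + y) = h p q x + h p q y" "h p q (psc c x) = psc c (h p q x)" for p q x y c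
  unfolding h_def by (simp_all add: T_add T_psc th)
 have hP: "h p q x \<in> ?P" for p q x unfolding h_def by (rule TP[OF th])
 have hcomm: "h p q (h p q' x) = h p q' (h p q x)" for p q q' x
 proof -
  have "T (tl0 a a) (T (tl0 b b) y) = T (tl0 b b) (T (tl0 a a) y)" for a b y
  using T_tl0_comm[of a a b b y] by (auto split: if_splits)
  moreover have "T (tl0 a a) (x - y) = T (tl0 a a) x - T (tl0 a a) y" for a x y
  using T_add[of "tl0 a a" "x - y" y] by (simp add: trace_tl0)
  ultimately show ?thesis by (simp add: h_eq)
 qed
 have diag: "EX rs. distinct rs & foldr (%r y. h p q y - psc r y) rs x = 0" if x: "x \<in> ?P" for p q x
 proof (cases "p = q")
  case True
  thus ?thesis by (intro exI[of _ "[0]"]) (simp add: h_eq)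
 next
  case False
  obtain v where v: "v \<in> carrier N" "x = sect N v" using x by blast
  have "hlist l p q \<in> killers l" by (auto simp: killers_def)
  then obtain k where "(Top (hlist l p q) ^^ k) x = 0" using good[OF v(1)] v(2) unfolding good_def by blast
  hence "foldr (%r y. h p q y - psc r y) (concat (replicate k (map of_int [- int l..int l]))) x = 0"
  unfolding hlist_def foldr_Top h_def .
  note kill = this
  have "foldr (%r y. h p q y - psc r y) (remdups (concat (replicate k (map of_int [- int l..int l])))) x = 0"
  proof (rule psc.semisimple_remdups[where h = "h p q" and P = ?P])
  show "h p q v = psc s v" if "v \<in> ?P" "h p q (h p q v - psc s v) = psc s (h p q v - psc s v)" for v s
  by (rule ss[OF False that])
  qed (rule hlin P hP x kill)+
  thus ?thesis using distinct_remdups by blast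
 qed
 show ?thesis unfolding level_def fst_conv
 proof (intro allI ballI)
  fix p :: 'n and v assume v: "v \<in> carrier N"
  have w_sl: "fst ` set (wlist l p) <= carrier sl" by (rule lists_sl)
  have "sect N v \<in> psc.span {y \<in> ?P. ALL q:UNIV. EX r. h p q y = psc r y}"
  by (rule psc.joint_eigen_decomposition[where h = "h p" and P = ?P])
  (rule hlin hcomm P hP diag imageI v finite | assumption)+
  moreover have "psc.span {y \<in> ?P. ALL q:UNIV. EX r. h p q y = psc r y} <= {y. Top (wlist l p) y = 0}"
  proof (rule psc.span_minimal)
  show "psc.subspace {y. Top (wlist l p) y = 0}"
  unfolding psc.subspace_def using Top_add[OF w_sl] Top_psc[OF w_sl] Top_zero[OF w_sl] by simp
  show "{y \<in> ?P. ALL q:UNIV. EX r. h p q y = psc r y} <= {y. Top (wlist l p) y = 0}"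
  proof clarify
  fix w assume w: "w \<in> carrier N" and "ALL q:UNIV. EX r. h p q (sect N w) = psc r (sect N w)"
  hence "EX r. ALL q. h p q (sect N w) = psc (r q) (sect N w)" by (intro choice) simp
  then obtain r where r: "!!q. h p q (sect N w) = psc (r q) (sect N w)" by blast
  let ?y = "sect N w"
  have "(\<Sum>q\<in>UNIV. h p q ?y) = psc (of_nat CARD('n)) (T (tl0 p p) ?y) - (\<Sum>q\<in>UNIV. T (tl0 q q) ?y)"
  by (simp add: h_eq sum_subtractf psc.sum_constant_scale)
  hence "psc (of_nat CARD('n)) (T (tl0 p p) ?y) = psc (\<Sum>q\<in>UNIV. r q) ?y"
  by (simp add: sum_T_diag r psc.scale_sum_left)
  hence scaled: "psc (1 / of_nat CARD('n)) (psc (of_nat CARD('n)) (T (tl0 p p) ?y)) =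
  psc (1 / of_nat CARD('n)) (psc (\<Sum>q\<in>UNIV. r q) ?y)" by simp
  have one: "1 / of_nat CARD('n) * of_nat CARD('n) = (1 :: complex)" by simp
  define mu where "mu = 1 / of_nat CARD('n) * (\<Sum>q\<in>UNIV. r q)"
  have mu: "T (tl0 p p) ?y = psc mu ?y" using scaled unfolding psc.scale_scale one psc.scale_one mu_def .
  define c where "c = (\<Prod>(x, d)\<leftarrow>wlist l p. mu - d)"
  have Tw: "Top (wlist l p) ?y = psc c ?y"
  proof -
  have "Top (map (%j. (tl0 p p, f j)) js) ?y = psc (\<Prod>(x, d)\<leftarrow>map (%j. (tl0 p p, f j)) js. mu - d) ?y"
  for f and js :: "nat list"
  proof (induction js)
  case Nil
  show ?case by (simp only: Top_def list.map foldr.simps id_apply prod_list.Nil psc.scale_one)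
  next
  case (Cons j js)
  let ?P = "\<Prod>(x, d)\<leftarrow>map (%j. (tl0 p p, f j)) js. mu - d"
  have "Top (map (%j. (tl0 p p, f j)) (j # js)) ?y =
  T (tl0 p p) (Top (map (%j. (tl0 p p, f j)) js) ?y) - psc (f j) (Top (map (%j. (tl0 p p, f j)) js) ?y)"
  by (simp only: Top_def list.map foldr.simps o_apply prod.case)
  also have "... = psc (?P * mu - f j * ?P) ?y"
  unfolding Cons T_psc[OF tl0_sl] mu psc.scale_scale psc.scale_left_diff_distrib ..
  also have "?P * mu - f j * ?P = (\<Prod>(x, d)\<leftarrow>map (%j. (tl0 p p, f j)) (j # js). mu - d)"
  by (simp add: algebra_simps)
  finally show ?case .
  qed
  thus ?thesis unfolding c_def wlist_def .
  qed
  have "(Top (wlist l p) ^^ k) ?y = psc (c ^ k) ?y" for k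
  proof (induction k)
  case 0
  show ?case by (simp only: funpow_0 power_0 psc.scale_one)
  next
  case (Suc k)
  show ?case by (simp only: funpow.simps o_apply Suc Top_psc[OF w_sl] Tw psc.scale_scale power_Suc2)
  qed
  note pow = this
  have "wlist l p \<in> killers l" by (auto simp: killers_def)
  then obtain k where "(Top (wlist l p) ^^ k) ?y = 0" using good[OF w] unfolding good_def by blast
  hence "psc (c ^ k) ?y = 0" unfolding pow .
  hence "c = 0 \<or> ?y = 0" using psc.scale_eq_0_iff by auto
  thus "Top (wlist l p) ?y = 0" unfolding Tw using psc.scale_eq_0_iff by blast
  qed
  qed
  ultimately have "Top (wlist l p) (sect N v) = 0" by blast
  hence "sect N (op (wlist l p) v) = sect N \<zero>" unfolding sect_op[OF w_sl v] Top_def sect_zero[OF m] .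
  thus "op (wlist l p) v = \<zero>" using sect_inj[OF m op_closed[OF w_sl v] zero_closed] by simp
 qed
qed

end

section \<open>Words in the generators of the affine algebra\<close>

lemma free_alg_simps [simp]:
 "p \<oplus>\<^bsub>free_alg l\<^esub> q = p + q" "p \<otimes>\<^bsub>free_alg l\<^esub> q = p * q" "\<zero>\<^bsub>free_alg l\<^esub> = 0" "\<one>\<^bsub>free_alg l\<^esub> = 1"
 by (simp_all add: free_alg_def)

lemma free_alg_carrier: "p \<in> FA l \<longleftrightarrow>
  (ALL u:psupp p. ALL g:set (letters u). valid_gen l g)" by (simp add: free_alg_def)

lemma letters_plus: "letters (u + v) = letters u @ letters v" by (simp add: plus_fmon_def)

lemma fmon_zero: "(0 :: 'a fmon) = FMon []" by (simp add: zero_fmon_def)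

lemma free_alg_closed:
 assumes "p \<in> FA l" "q \<in> FA l"
 shows "p + q \<in> FA l" "p * q \<in> FA l" "- p \<in> FA l"
  "p - q \<in> FA l"
proof -
 show "p + q \<in> FA l" using assms Poly_Mapping.keys_add[of p q] unfolding free_alg_carrier by blast
 show "- p \<in> FA l" using assms unfolding free_alg_carrier by (simp add: in_keys_iff)
 show "p - q \<in> FA l" using assms unfolding free_alg_carrier by (auto simp: in_keys_iff lookup_minus)
 show "p * q \<in> FA l" unfolding free_alg_carrier
 proof (intro ballI)
  fix u g assume "u \<in> psupp (p * q)" and g: "g \<in> set (letters u)"
  then obtain a b where "u = a + b" "a \<in> psupp p" "b \<in> psupp q" using keys_mult[of p q] by blast
  thus "valid_gen l g" using assms g unfolding free_alg_carrier by (auto simp: letters_plus)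
 qed
qed

lemma free_alg_const: "pmono (FMon []) c \<in> FA l"
 "0 \<in> FA l" "1 \<in> FA l" by (auto simp: free_alg_carrier fmon_zero split: if_splits)

lemma free_alg_ring: "ring (free_alg l)"
proof (rule ringI)
 show "abelian_group (free_alg l)"
 proof (rule abelian_groupI, goal_cases)
  case (6 p)
  thus ?case by (intro bexI[of _ "- p"]) (auto intro: free_alg_closed)
 qed (auto intro: free_alg_closed free_alg_const simp: add_ac)
 show "monoid (free_alg l)" by (rule monoidI) (auto intro: free_alg_closed free_alg_const simp: mult.assoc)
qed (auto simp: algebra_simps)

lemma free_alg_minus:
 assumes "q \<in> FA l"
 shows "p \<ominus>\<^bsub>free_alg l\<^esub> q = p - q"
proof -
 interpret ring "free_alg l" by (rule free_alg_ring)
 have "\<ominus>\<^bsub>free_alg l\<^esub> q = - q" using assms by (intro minus_equality) (auto intro: free_alg_closed)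
 thus ?thesis by (simp add: a_minus_def)
qed

definition vw :: "nat => 'm gen list => bool"
 where "vw l u \<longleftrightarrow> (ALL g:set u. valid_gen l g)"

lemma vw_simps [simp]: "vw l []" "vw l (g # u) \<longleftrightarrow> valid_gen l g & vw l u" "vw l (u @ v) \<longleftrightarrow> vw l u & vw l v"
 by (auto simp: vw_def)

lemma word_carrier [simp]: "word u \<in> FA l \<longleftrightarrow> vw l u" by (simp add: free_alg_carrier word_def vw_def)

lemma word_append: "word (u @ v) = word u * word v" by (simp add: word_def mult_single plus_fmon_def)

lemma word_Nil: "word [] = 1" by (simp add: word_def fmon_zero flip: single_one)

lemma aff_rel_vw: "aff_rel l u v ==> vw l u & vw l v" by (induction rule: aff_rel.induct) (auto simp: vw_def)

lemma aff_gens_carrier: "{word u - word v | u v. aff_rel l u v} <= FA l"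
 using aff_rel_vw free_alg_closed(4) word_carrier by blast

lemma aff_ideal_ideal: "ideal (aff_ideal l) (free_alg l)"
 unfolding aff_ideal_def by (rule ring.genideal_ideal[OF free_alg_ring aff_gens_carrier])

lemma Aff_ring: "ring (Aff l)" unfolding Aff_def by (rule ideal.quotient_is_ring[OF aff_ideal_ideal])

lemma aff_class_hom: "aff_class l \<in> ring_hom (free_alg l) (Aff l)"
 unfolding Aff_def aff_class_def[abs_def] by (rule ideal.rcos_ring_hom[OF aff_ideal_ideal])

lemma aff_class_closed [simp]: "p \<in> FA l ==> aff_class l p \<in> carrier (Aff l)"
 by (rule ring_hom_closed[OF aff_class_hom])

lemma aff_class_add: "p \<in> FA l ==> q \<in> FA l ==>
  aff_class l (p + q) = aff_class l p \<oplus>\<^bsub>Aff l\<^esub> aff_class l q"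
 using ring_hom_add[OF aff_class_hom] by fastforce

lemma aff_class_mult: "p \<in> FA l ==> q \<in> FA l ==>
  aff_class l (p * q) = aff_class l p \<otimes>\<^bsub>Aff l\<^esub> aff_class l q"
 using ring_hom_mult[OF aff_class_hom] by fastforce

lemma aff_class_one: "aff_class l 1 = \<one>\<^bsub>Aff l\<^esub>" using ring_hom_one[OF aff_class_hom] by simp

lemma Aff_carrier: "a \<in> carrier (Aff l) ==> EX p:FA l. a = aff_class l p"
 unfolding Aff_def FactRing_def aff_class_def by (auto simp: A_RCOSETS_def')

lemma aff_class_eq_iff:
 assumes "p \<in> FA l" "q \<in> FA l"
 shows "aff_class l p = aff_class l q \<longleftrightarrow> p - q \<in> aff_ideal l"
 using ring.quotient_eq_iff_same_a_r_cos[OF free_alg_ring aff_ideal_ideal assms]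
 by (simp add: aff_class_def free_alg_minus[OF assms(2)])

lemma aff_class_rel: "aff_rel l u v ==> aff_class l (word u) = aff_class l (word v)"
 using aff_rel_vw[of l u v] ring.genideal_self[OF free_alg_ring aff_gens_carrier]
 by (subst aff_class_eq_iff) (auto simp: aff_ideal_def)

text \<open>Equality of the classes of two words. Computations in the algebra are congruences of words.\<close>

definition weq :: "nat => 'm gen list => 'm gen list => bool"
 where "weq l u v \<longleftrightarrow> vw l u & vw l v & aff_class l (word u) = aff_class l (word v)"

lemma weq_rel: "aff_rel l u v ==> weq l u v" unfolding weq_def using aff_rel_vw[of l u v] aff_class_rel[of l u v] by simp

lemma weq_refl: "vw l u ==> weq l u u" and weq_sym: "weq l u v ==> weq l v u"
 and weq_trans [trans]: "weq l u v ==> weq l v w ==> weq l u w" by (auto simp: weq_def)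

lemma weq_vw: "weq l u v ==> vw l u" "weq l u v ==> vw l v" by (auto simp: weq_def)

lemma weq_append: "weq l u u' ==> weq l v v' ==> weq l (u @ v) (u' @ v')" by (simp add: weq_def word_append aff_class_mult)

lemma weq_app_l: "weq l u v ==> vw l w ==> weq l (w @ u) (w @ v)"
 and weq_app_r: "weq l u v ==> vw l w ==> weq l (u @ w) (v @ w)" by (auto intro: weq_append weq_refl)

lemma weq_mid: "weq l u v ==> vw l a ==> vw l b ==> weq l (a @ u @ b) (a @ v @ b)" by (intro weq_append weq_refl)

definition commw :: "nat => 'm gen list => 'm gen list => bool"
 where "commw l u v \<longleftrightarrow> weq l (u @ v) (v @ u)"

lemma commw_sym: "commw l u v ==> commw l v u" by (auto simp: commw_def intro: weq_sym)

lemma commw_vw: "commw l u v ==> vw l u & vw l v" unfolding commw_def weq_def by simp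

lemma commw_append:
 assumes "commw l u v" "commw l u w"
 shows "commw l u (v @ w)"
proof -
 have vw: "vw l u" "vw l v" "vw l w" using commw_vw assms by blast+
 have "weq l (u @ v @ w) (v @ u @ w)" using weq_app_r[OF assms(1)[unfolded commw_def] vw(3)] by simp
 also have "weq l (v @ u @ w) (v @ w @ u)" by (rule weq_app_l[OF assms(2)[unfolded commw_def] vw(2)])
 finally show ?thesis by (simp add: commw_def)
qed

lemma commw_Nil: "vw l u ==> commw l u []" by (simp add: commw_def weq_refl)

lemma commw_letters:
 assumes "!!g h. g \<in> set u ==> h \<in> set v ==> commw l [g] [h]" "vw l u" "vw l v"
 shows "commw l u v"
proof -
 have 1: "commw l [g] v" if "g \<in> set u" for g using assms(1)[OF that] assms(3)
 proof (induction v)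
  case Nil
  thus ?case using that assms(2) by (intro commw_Nil) (auto simp: vw_def)
 next
  case (Cons h v)
  thus ?case using commw_append[of l "[g]" "[h]" v] by simp
 qed
 have "commw l v u" using 1 assms(2)
 proof (induction u)
  case Nil
  thus ?case using assms(3) by (intro commw_Nil)
 next
  case (Cons g u)
  thus ?case using commw_append[of l v "[g]" u] by (simp add: commw_sym)
 qed
 thus ?thesis by (rule commw_sym)
qed

lemma commw_inverse:
 assumes c: "commw l g h" and 1: "weq l (h @ h') []" and 2: "weq l (h' @ h) []"
 shows "commw l g h'"
proof -
 have v: "vw l g" "vw l h" "vw l h'" using commw_vw[OF c] weq_vw[OF 1] by auto
 have "weq l (g @ h') (h' @ h @ g @ h')" using weq_app_r[OF weq_sym[OF 2], of "g @ h'"] v by simp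
 also have "weq l (h' @ h @ g @ h') (h' @ g @ h @ h')"
  using weq_mid[OF commw_sym[OF c, unfolded commw_def], of h' h'] v by simp
 also have "weq l (h' @ g @ h @ h') (h' @ g)" using weq_app_l[OF 1, of "h' @ g"] v by simp
 finally show ?thesis by (simp add: commw_def)
qed

lemma tr_less: "k + 1 < l ==> s < l ==> tr k s < l" by (auto simp: tr_def)

lemma tr_tr [simp]: "tr k (tr k s) = s" by (auto simp: tr_def)

lemma sig_Y:
 assumes k: "k + 1 < l" and s: "s < l"
 shows "weq l [Sig k, Y i s] [Y i (tr k s), Sig k]"
proof -
 have inv: "weq l [Sig k, Sig k] []" by (rule weq_rel) (rule aff_rel.invol[OF k])
 have y: "weq l [Sig k, Y i k, Sig k] [Y i (k+1)]" by (rule weq_rel) (rule aff_rel.y_sig[OF k])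
 consider "s = k" | "s = k + 1" | "s \<notin> {k, k+1}" by auto
 thus ?thesis
 proof cases
  case 1
  have "weq l [Sig k, Y i k] [Sig k, Y i k, Sig k, Sig k]"
  using weq_app_l[OF weq_sym[OF inv], of "[Sig k, Y i k]"] k s by simp
  also have "weq l [Sig k, Y i k, Sig k, Sig k] [Y i (k+1), Sig k]" using weq_app_r[OF y, of "[Sig k]"] k by simp
  finally show ?thesis using 1 by (simp add: tr_def)
 next
  case 2
  have "weq l [Sig k, Y i (k+1)] [Sig k, Sig k, Y i k, Sig k]" using weq_app_l[OF weq_sym[OF y], of "[Sig k]"] k by simp
  also have "weq l [Sig k, Sig k, Y i k, Sig k] [Y i k, Sig k]" using weq_app_r[OF inv, of "[Y i k, Sig k]"] k by simp
  finally show ?thesis using 2 by (simp add: tr_def)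
 next
  case 3
  have "weq l [Y i s, Sig k] [Sig k, Y i s]" by (rule weq_rel) (rule aff_rel.y_sig_far[OF s k 3])
  thus ?thesis using 3 by (auto simp: tr_def intro: weq_sym)
 qed
qed

lemma Y_inv: "s < l ==> weq l ([Y i s] @ [Yinv i s]) []" "s < l ==> weq l ([Yinv i s] @ [Y i s]) []"
 by (auto intro!: weq_rel aff_rel.intros)

lemma sig_Yinv:
 assumes k: "k + 1 < l" and s: "s < l"
 shows "weq l [Sig k, Yinv i s] [Yinv i (tr k s), Sig k]"
proof -
 have t: "tr k s < l" by (rule tr_less[OF k s])
 have "weq l [Sig k, Yinv i s] [Yinv i (tr k s), Y i (tr k s), Sig k, Yinv i s]"
  using weq_app_r[OF weq_sym[OF Y_inv(2)[OF t]], of "[Sig k, Yinv i s]" i] k s by simp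
 also have "weq l [Yinv i (tr k s), Y i (tr k s), Sig k, Yinv i s] [Yinv i (tr k s), Sig k, Y i s, Yinv i s]"
  using weq_mid[OF weq_sym[OF sig_Y[OF k s]], of "[Yinv i (tr k s)]" "[Yinv i s]" i] s t by simp
 also have "weq l [Yinv i (tr k s), Sig k, Y i s, Yinv i s] [Yinv i (tr k s), Sig k]"
  using weq_app_l[OF Y_inv(1)[OF s], of "[Yinv i (tr k s), Sig k]" i] k t by simp
 finally show ?thesis .
qed

lemma commw_conj:
 assumes c: "commw l [Y i s] [Y i' p]" and k: "k + 1 < l"
 shows "commw l [Y i (tr k s)] [Y i' (tr k p)]"
proof -
 have s: "s < l" and p: "p < l" using commw_vw[OF c] by auto
 have move: "weq l [Y i (tr k s), Y i' (tr k p)] [Sig k, Y i s, Y i' p, Sig k]" if "s < l" "p < l" for i i' s p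
 proof -
  have inv: "weq l [Sig k, Sig k] []" by (rule weq_rel) (rule aff_rel.invol[OF k])
  note t = tr_less[OF k that(1)] tr_less[OF k that(2)]
  have "weq l [Y i (tr k s), Y i' (tr k p)] [Y i (tr k s), Y i' (tr k p), Sig k, Sig k]"
  using weq_app_l[OF weq_sym[OF inv], of "[Y i (tr k s), Y i' (tr k p)]"] t by simp
  also have "weq l ... [Y i (tr k s), Sig k, Y i' p, Sig k]"
  using weq_mid[OF weq_sym[OF sig_Y[OF k that(2)]], of "[Y i (tr k s)]" "[Sig k]" i'] t k by simp
  also have "weq l ... [Sig k, Y i s, Y i' p, Sig k]"
  using weq_app_r[OF weq_sym[OF sig_Y[OF k that(1)]], of "[Y i' p, Sig k]" i] that k by simp
  finally show ?thesis .
 qed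
 have "weq l [Sig k, Y i s, Y i' p, Sig k] [Sig k, Y i' p, Y i s, Sig k]"
  using weq_mid[OF c[unfolded commw_def], of "[Sig k]" "[Sig k]"] k by simp
 hence "weq l [Y i (tr k s), Y i' (tr k p)] [Sig k, Y i' p, Y i s, Sig k]" by (rule weq_trans[OF move[OF s p]])
 also have "weq l [Sig k, Y i' p, Y i s, Sig k] [Y i' (tr k p), Y i (tr k s)]" by (rule weq_sym[OF move[OF p s]])
 finally show ?thesis by (simp add: commw_def)
qed

text \<open>Conjugation by the \<open>\<sigma>\<close> moves the relation between the positions \<open>0\<close> and \<open>1\<close> to all pairs of different positions.\<close>

lemma commw_YY_less:
 assumes "s < p" "p < l"
 shows "commw l [Y i s] [Y i' p]"
proof -
 have l: "1 < l" using assms by simp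
 have 01: "commw l [Y i 0] [Y i' 1]" for i i'
  unfolding commw_def using weq_rel[OF aff_rel.y_mixed[OF l, where i = i' and i' = i]] by simp
 have base: "commw l [Y i 0] [Y i' (Suc q)]" if "Suc q < l" for q i i' using that
 proof (induction q)
  case 0
  thus ?case using 01 by simp
 next
  case (Suc q)
  have "commw l [Y i (tr (Suc q) 0)] [Y i' (tr (Suc q) (Suc q))]" by (rule commw_conj) (use Suc in auto)
  thus ?case by (simp add: tr_def)
 qed
 show ?thesis using assms(1)
 proof (induction s)
  case 0
  thus ?case using base[of "p - 1"] assms(2) by simp
 next
  case (Suc s)
  have "commw l [Y i (tr s s)] [Y i' (tr s p)]" by (rule commw_conj) (use Suc assms(2) in auto)
  thus ?case using Suc.prems by (simp add: tr_def)
 qed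
qed

text \<open>At position \<open>0\<close>, the relation for the product of all \<open>y\<close> is divided by the factors at the other positions.\<close>

lemma commw_YY_same:
 assumes "s < l"
 shows "commw l [Y i s] [Y i' s]" using assms
proof (induction s)
 case 0
 let ?R = "map (Y i) [1..<l]"
 let ?R' = "map (Yinv i) (rev [1..<l])"
 have vR: "vw l ?R" "vw l ?R'" by (auto simp: vw_def)
 have up: "[0..<l] = 0 # [1..<l]" using 0 by (simp add: upt_conv_Cons)
 have e: "weq l (([Y i 0] @ ?R) @ [Y i' 0]) ([Y i' 0] @ ([Y i 0] @ ?R))"
  using weq_rel[OF aff_rel.y_prod[OF 0, where i = i and i' = i']] unfolding up by simp
 have "commw l [Y i' 0] ?R" by (rule commw_letters) (use vR 0 in \<open>auto intro!: commw_YY_less\<close>)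
 hence c: "weq l ([Y i' 0] @ ?R) (?R @ [Y i' 0])" by (simp add: commw_def)
 have inv: "weq l (map (Y i) xs @ map (Yinv i) (rev xs)) []" if "set xs <= {..<l}" for xs using that
 proof (induction xs)
  case (Cons x xs)
  have "weq l ([Y i x] @ (map (Y i) xs @ map (Yinv i) (rev xs)) @ [Yinv i x]) ([Y i x] @ [] @ [Yinv i x])"
  by (rule weq_mid) (use Cons in auto)
  also have "weq l ([Y i x] @ [] @ [Yinv i x]) []" using Y_inv(1)[of x l i] Cons by simp
  finally show ?case by simp
 qed (simp add: weq_refl)
 have RR: "weq l (?R @ ?R') []" by (rule inv) auto
 have "weq l ([Y i 0] @ [Y i' 0]) (([Y i 0] @ [Y i' 0]) @ ?R @ ?R')"
  using weq_app_l[OF weq_sym[OF RR], of "[Y i 0] @ [Y i' 0]"] 0 by simp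
 also have "weq l (([Y i 0] @ [Y i' 0]) @ ?R @ ?R') ([Y i 0] @ (?R @ [Y i' 0]) @ ?R')"
  using weq_mid[OF c, of "[Y i 0]" ?R'] 0 vR by simp
 also have "weq l ([Y i 0] @ (?R @ [Y i' 0]) @ ?R') (([Y i' 0] @ ([Y i 0] @ ?R)) @ ?R')" using weq_app_r[OF e vR(2)] by simp
 also have "weq l (([Y i' 0] @ ([Y i 0] @ ?R)) @ ?R') ([Y i' 0] @ [Y i 0])"
  using weq_app_l[OF RR, of "[Y i' 0] @ [Y i 0]"] 0 by simp
 finally show ?case by (simp add: commw_def)
next
 case (Suc s)
 have "commw l [Y i (tr s s)] [Y i' (tr s s)]" by (rule commw_conj) (use Suc in auto)
 thus ?case by (simp add: tr_def)
qed

lemma commw_YY: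
 assumes "s < l" "p < l"
 shows "commw l [Y i s] [Y i' p]"
proof -
 consider "s < p" | "s = p" | "p < s" by linarith
 thus ?thesis
 proof cases
  case 1
  thus ?thesis using assms(2) by (rule commw_YY_less)
 next
  case 2
  thus ?thesis using commw_YY_same[OF assms(1)] by simp
 next
  case 3
  thus ?thesis using assms(1) by (intro commw_sym[OF commw_YY_less])
 qed
qed

fun ylet :: "'m gen => bool" where
 "ylet (Sig k) = False" | "ylet _ = True"

lemma commw_ylet:
 assumes "ylet g" "ylet h" "valid_gen l g" "valid_gen l h"
 shows "commw l [g] [h]"
proof -
 have 1: "commw l [Y i s] [h]" if "s < l" for i s
  using assms(2,4) that commw_inverse[OF commw_YY Y_inv(1) Y_inv(2)] commw_YY by (cases h) auto
 show ?thesis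
 proof (cases g)
  case (Yinv i s)
  thus ?thesis using 1[of s i] assms(3) commw_inverse[OF commw_sym[OF 1] Y_inv(1) Y_inv(2)] by (auto intro: commw_sym)
 qed (use assms 1 in auto)
qed

definition mlist :: "'m::finite list"
 where "mlist = (SOME xs. set xs = UNIV & distinct xs)"

lemma mlist: "set (mlist :: 'm::finite list) = UNIV" "distinct (mlist :: 'm list)"
proof -
 have "EX xs. set xs = (UNIV :: 'm set) & distinct xs" using finite_distinct_list[of "UNIV :: 'm set"] by auto
 from someI_ex[OF this] show "set (mlist :: 'm::finite list) = UNIV" "distinct (mlist :: 'm list)"
  unfolding mlist_def by blast+
qed

definition ypw :: "'m => nat => int => 'm gen list"
 where "ypw i j p = replicate (nat p) (Y i j) @ replicate (nat (- p)) (Yinv i j)"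

text \<open>The word for the monomial \<open>y\<^sub>j\<^sup>k\<close> with a multi-index \<open>k\<close>, in a fixed order of the variables.\<close>

definition ywd :: "nat => int ^ 'm => 'm::finite gen list"
 where "ywd j k = concat (map (%i. ypw i j (k $ i)) mlist)"

lemma ypw_letters: "g \<in> set (ypw i j p) ==> g = Y i j \<or> g = Yinv i j" by (auto simp: ypw_def split: if_splits)

lemma ywd_letters: "g \<in> set (ywd j k) ==> EX i. g = Y i j \<or> g = Yinv i j" by (auto simp: ywd_def dest!: ypw_letters)

lemma ypw_vw: "j < l ==> vw l (ypw i j p)" using ypw_letters unfolding vw_def by fastforce

lemma ywd_vw: "j < l ==> vw l (ywd j k)" using ywd_letters unfolding vw_def by fastforce

lemma commw_yw:
 assumes "!!g. g \<in> set u ==> ylet g" "!!g. g \<in> set v ==> ylet g" "vw l u" "vw l v"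
 shows "commw l u v" by (rule commw_letters) (use assms in \<open>auto intro!: commw_ylet simp: vw_def\<close>)

lemma ywd_comm:
 assumes "i < l" "j < l"
 shows "weq l (ywd i k @ ywd j k') (ywd j k' @ ywd i k)"
proof -
 have "ylet g" if "g \<in> set (ywd j k)" for g j and k :: "int ^ 'm::finite" using ywd_letters[OF that] by auto
 hence "commw l (ywd i k) (ywd j k')" using assms by (intro commw_yw ywd_vw)
 thus ?thesis by (simp add: commw_def)
qed

lemma ypw_step:
 assumes j: "j < l"
 shows "weq l (ypw i j p @ [Y i j]) (ypw i j (p + 1))" "weq l (ypw i j p @ [Yinv i j]) (ypw i j (p - 1))"
proof -
 note v = ypw_vw[OF j]
 have r: "replicate n (Y i j) @ [Y i j] = replicate (Suc n) (Y i j)"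
  "replicate n (Yinv i j) @ [Yinv i j] = replicate (Suc n) (Yinv i j)" for n by (simp_all add: replicate_append_same)
 show "weq l (ypw i j p @ [Y i j]) (ypw i j (p + 1))"
 proof (cases "p \<ge> 0")
  case True
  hence "ypw i j p @ [Y i j] = ypw i j (p + 1)" by (simp add: ypw_def r nat_add_distrib)
  thus ?thesis using v[of i "p + 1"] by (simp add: weq_refl)
 next
  case False
  define n where "n = nat (- (p + 1))"
  have n: "nat (- p) = Suc n" "nat p = 0" "nat (p + 1) = 0" using False by (auto simp: n_def)
  have "ypw i j p @ [Y i j] = replicate n (Yinv i j) @ ([Yinv i j] @ [Y i j])"
  by (simp add: ypw_def n replicate_append_same)
  moreover have "ypw i j (p + 1) = replicate n (Yinv i j) @ []" by (simp only: ypw_def n n_def) simp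
  ultimately show ?thesis using j by (simp only:) (intro weq_app_l Y_inv, auto simp: vw_def)
 qed
 show "weq l (ypw i j p @ [Yinv i j]) (ypw i j (p - 1))"
 proof (cases "p <= 0")
  case True
  hence "nat (- (p - 1)) = Suc (nat (- p))" "nat p = 0" "nat (p - 1) = 0" by auto
  hence "ypw i j p @ [Yinv i j] = ypw i j (p - 1)" by (simp add: ypw_def r del: replicate_Suc)
  thus ?thesis using v[of i "p - 1"] by (simp add: weq_refl)
 next
  case False
  define n where "n = nat (p - 1)"
  have n: "nat p = Suc n" "nat (- p) = 0" "nat (- (p - 1)) = 0" using False by (auto simp: n_def)
  have "ypw i j p @ [Yinv i j] = replicate n (Y i j) @ ([Y i j] @ [Yinv i j])"
  by (simp add: ypw_def n replicate_append_same)
  moreover have "ypw i j (p - 1) = replicate n (Y i j) @ []" by (simp only: ypw_def n n_def) simp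
  ultimately show ?thesis using j by (simp only:) (intro weq_app_l Y_inv, auto simp: vw_def)
 qed
qed

lemma ywd_step:
 fixes k :: "int ^ 'm::finite"
 assumes j: "j < l"
 shows "weq l (ywd j k @ [Y i j]) (ywd j (k + axis i 1))" "weq l (ywd j k @ [Yinv i j]) (ywd j (k - axis i 1))"
proof -
 have step: "weq l (ywd j k @ [g]) (ywd j k')"
  if g: "ylet g" "valid_gen l g" and st: "weq l (ypw i j (k $ i) @ [g]) (ypw i j (k' $ i))"
  and k': "!!i'. i' ~= i ==> k' $ i' = k $ i'" for g k'
 proof -
  have "i \<in> set mlist" unfolding mlist(1) by simp
  then obtain us vs where ms: "mlist = us @ i # vs" using split_list by fast
  have "distinct (mlist :: 'm list)" by (rule mlist(2))
  hence d: "i \<notin> set us" "i \<notin> set vs" unfolding ms by auto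
  define f where "f k xs = concat (map (%i. ypw i j (k $ i)) xs)" for k :: "int ^ 'm" and xs
  have fy: "ylet h" if "h \<in> set (f k xs)" for h k xs using that by (auto simp: f_def dest!: ypw_letters)
  have fv: "vw l (f k xs)" for k xs unfolding f_def by (induction xs) (auto simp: ypw_vw[OF j])
  have eqf: "f k' xs = f k xs" if "i \<notin> set xs" for xs using that by (induction xs) (auto simp: f_def k')
  note eq = eqf[OF d(1)] eqf[OF d(2)]
  have yw: "ywd j k = f k us @ ypw i j (k $ i) @ f k vs" for k by (simp add: ywd_def ms f_def)
  have "commw l (f k vs) [g]" by (rule commw_yw) (use fy fv g in auto)
  hence "weq l (f k vs @ [g]) ([g] @ f k vs)" by (simp add: commw_def)
  hence "weq l ((f k us @ ypw i j (k $ i)) @ (f k vs @ [g])) ((f k us @ ypw i j (k $ i)) @ ([g] @ f k vs))"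
  by (rule weq_app_l) (simp add: fv ypw_vw[OF j])
  also have "weq l ((f k us @ ypw i j (k $ i)) @ ([g] @ f k vs)) (f k us @ ypw i j (k' $ i) @ f k vs)"
  using weq_mid[OF st, of "f k us" "f k vs"] fv by simp
  finally show ?thesis unfolding yw eq by simp
 qed
 show "weq l (ywd j k @ [Y i j]) (ywd j (k + axis i 1))"
  by (rule step) (use j ypw_step(1)[OF j] in \<open>auto simp: axis_def\<close>)
 show "weq l (ywd j k @ [Yinv i j]) (ywd j (k - axis i 1))"
  by (rule step) (use j ypw_step(2)[OF j] in \<open>auto simp: axis_def\<close>)
qed

lemma ywd_ypw:
 fixes k :: "int ^ 'm::finite"
 assumes j: "j < l"
 shows "weq l (ywd j k @ ypw i j p) (ywd j (k + axis i p))"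
proof -
 have ax0: "axis i (0 :: int) = (0 :: int ^ 'm)" by (simp add: vec_eq_iff axis_def)
 have ax: "axis i (int (Suc n)) = axis i (int n) + axis i (1 :: int)"
  "axis i (- int (Suc n)) = axis i (- int n) - axis i (1 :: int)" for n by (auto simp: vec_eq_iff axis_def)
 have pos: "weq l (ywd j k @ replicate n (Y i j)) (ywd j (k + axis i (int n)))" for n
 proof (induction n)
  case 0
  show ?case by (simp add: weq_refl ywd_vw[OF j] ax0)
 next
  case (Suc n)
  have "weq l ((ywd j k @ replicate n (Y i j)) @ [Y i j]) (ywd j (k + axis i (int n)) @ [Y i j])"
  by (rule weq_app_r[OF Suc]) (use j in simp)
  also have "weq l (ywd j (k + axis i (int n)) @ [Y i j]) (ywd j (k + axis i (int (Suc n))))"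
  unfolding ax add.assoc[symmetric] by (rule ywd_step(1)[OF j])
  finally show ?case by (simp add: replicate_append_same)
 qed
 have neg: "weq l (ywd j k @ replicate n (Yinv i j)) (ywd j (k + axis i (- int n)))" for n
 proof (induction n)
  case 0
  show ?case by (simp add: weq_refl ywd_vw[OF j] ax0)
 next
  case (Suc n)
  have "weq l ((ywd j k @ replicate n (Yinv i j)) @ [Yinv i j]) (ywd j (k + axis i (- int n)) @ [Yinv i j])"
  by (rule weq_app_r[OF Suc]) (use j in simp)
  also have "weq l (ywd j (k + axis i (- int n)) @ [Yinv i j]) (ywd j (k + axis i (- int (Suc n))))"
  unfolding ax add_diff_eq by (rule ywd_step(2)[OF j])
  finally show ?case by (simp add: replicate_append_same)
 qed
 show ?thesis
 proof (cases "p \<ge> 0")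
  case True
  thus ?thesis using pos[of "nat p"] by (simp add: ypw_def)
 next
  case False
  thus ?thesis using neg[of "nat (- p)"] by (simp add: ypw_def)
 qed
qed

lemma ywd_zero: "ywd j 0 = []" by (simp add: ywd_def ypw_def)

lemma ywd_axis:
 assumes j: "j < l"
 shows "weq l (ypw i j p) (ywd j (axis i p))" using ywd_ypw[OF j, of 0 i p] by (simp add: ywd_zero)

lemma ywd_add:
 fixes k k' :: "int ^ 'm::finite"
 assumes j: "j < l"
 shows "weq l (ywd j k @ ywd j k') (ywd j (k + k'))"
proof -
 have *: "weq l (ywd j k @ concat (map (%i. ypw i j (k' $ i)) xs)) (ywd j (k + (\<Sum>i\<leftarrow>xs. axis i (k' $ i))))"
  for xs and k :: "int ^ 'm"
 proof (induction xs arbitrary: k)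
  case Nil
  thus ?case by (simp add: weq_refl ywd_vw[OF j])
 next
  case (Cons i xs)
  have "vw l (concat (map (%i. ypw i j (k' $ i)) xs))" by (induction xs) (auto simp: ypw_vw[OF j])
  hence "weq l ((ywd j k @ ypw i j (k' $ i)) @ concat (map (%i. ypw i j (k' $ i)) xs))
  (ywd j (k + axis i (k' $ i)) @ concat (map (%i. ypw i j (k' $ i)) xs))" by (rule weq_app_r[OF ywd_ypw[OF j]])
  also note Cons.IH
  finally show ?case by (simp add: add.assoc)
 qed
 have s: "(\<Sum>i\<leftarrow>mlist. axis i (k' $ i)) = k'"
 proof -
  have "(\<Sum>i\<leftarrow>mlist. axis i (k' $ i)) = (\<Sum>i\<in>UNIV. axis i (k' $ i))"
  unfolding sum_list_distinct_conv_sum_set[OF mlist(2)] mlist(1) ..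
  also have "... = k'" by (simp add: vec_eq_iff sum_component axis_def if_distrib cong: if_cong)
  finally show ?thesis .
 qed
 show ?thesis using *[of k mlist] unfolding s ywd_def[of j k', symmetric] .
qed

lemma sig_ywd:
 assumes k: "k + 1 < l" and j: "j < l"
 shows "weq l ([Sig k] @ ywd j e) (ywd (tr k j) e @ [Sig k])"
proof -
 define f where "f g = (case g of Y i s => Y i (tr k s) | Yinv i s => Yinv i (tr k s) | Sig s => Sig s)" for g :: "'a gen"
 have "weq l ([Sig k] @ u) (map f u @ [Sig k])" if "!!g. g \<in> set u ==> ylet g" "vw l u" for u using that
 proof (induction u)
  case Nil
  thus ?case using k by (simp add: weq_refl)
 next
  case (Cons g u)
  have g: "weq l [Sig k, g] [f g, Sig k]"
  using Cons.prems(1)[of g] Cons.prems(2) by (cases g) (auto simp: f_def intro: sig_Y[OF k] sig_Yinv[OF k])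
  have "weq l ([Sig k, g] @ u) ([f g] @ ([Sig k] @ u))" using weq_app_r[OF g, of u] Cons by simp
  also have "weq l ([f g] @ ([Sig k] @ u)) ([f g] @ (map f u @ [Sig k]))"
  by (rule weq_app_l) (use Cons weq_vw(2)[OF g] in auto)
  finally show ?case by simp
 qed
 moreover have "map f (ywd j e) = ywd (tr k j) e" by (simp add: ywd_def ypw_def map_concat f_def o_def)
 moreover have "ylet g" if "g \<in> set (ywd j e)" for g using ywd_letters[OF that] by auto
 ultimately show ?thesis using ywd_vw[OF j] by metis
qed

lemma y_el_pow:
 assumes j: "j < l"
 shows "y_el l i j [^]\<^bsub>Aff l\<^esub> (p :: int) = aff_class l (word (ypw i j p))"
proof -
 interpret A: ring "Aff l" by (rule Aff_ring)
 have w1: "word [Y i j] \<in> FA l" "word [Yinv i j] \<in> FA l" using j by auto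
 have nat: "aff_class l (word [g]) [^]\<^bsub>Aff l\<^esub> (n :: nat) = aff_class l (word (replicate n g))" if "valid_gen l g" for n g
 proof (induction n)
  case 0
  show ?case by (simp add: word_Nil aff_class_one)
 next
  case (Suc n)
  have "word (replicate (Suc n) g) = word (replicate n g) * word [g]"
  by (simp add: word_append[symmetric] replicate_append_same)
  thus ?case using Suc that by (simp add: aff_class_mult vw_def)
 qed
 have inv: "inv\<^bsub>Aff l\<^esub> aff_class l (word (replicate n (Y i j))) = aff_class l (word (replicate n (Yinv i j)))" for n
 proof -
  have 1: "weq l (replicate n (Y i j) @ replicate n (Yinv i j)) []" for n
  proof (induction n)
  case (Suc n)
  have "weq l (replicate n (Y i j) @ ([Y i j] @ [Yinv i j]) @ replicate n (Yinv i j)) (replicate n (Y i j) @ [] @ replicate n (Yinv i j))"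
  by (rule weq_mid[OF Y_inv(1)[OF j]]) (use j in \<open>auto simp: vw_def\<close>)
  moreover have "replicate (Suc n) (Y i j) @ replicate (Suc n) (Yinv i j) =
  replicate n (Y i j) @ ([Y i j] @ [Yinv i j]) @ replicate n (Yinv i j)" by (simp add: replicate_append_same)
  ultimately have "weq l (replicate (Suc n) (Y i j) @ replicate (Suc n) (Yinv i j)) (replicate n (Y i j) @ replicate n (Yinv i j))"
  by (simp only: append_Nil)
  thus ?case using Suc by (rule weq_trans)
  qed (simp add: weq_refl)
  have c: "commw l (replicate n (Y i j)) (replicate n (Yinv i j))"
  by (rule commw_yw) (use j in \<open>auto simp: vw_def split: if_splits\<close>)
  have 2: "weq l (replicate n (Yinv i j) @ replicate n (Y i j)) []"
  using weq_trans[OF weq_sym[OF c[unfolded commw_def]] 1[of n]] .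
  have v: "vw l (replicate n (Y i j))" "vw l (replicate n (Yinv i j))" using j by (auto simp: vw_def)
  show ?thesis by (rule A.inv_unique'[symmetric])
  (use 1[of n] 2 v in \<open>auto simp: weq_def word_append aff_class_mult word_Nil aff_class_one\<close>)
 qed
 show ?thesis
 proof (cases "p < 0")
  case True
  hence "ypw i j p = replicate (nat (- p)) (Yinv i j)" by (simp add: ypw_def)
  moreover have "y_el l i j [^]\<^bsub>Aff l\<^esub> p = inv\<^bsub>Aff l\<^esub> (y_el l i j [^]\<^bsub>Aff l\<^esub> nat (- p))"
  using True by (simp only: int_pow_def2 if_True)
  ultimately show ?thesis using nat[of "Y i j" "nat (- p)"] j unfolding y_el_def by (simp only: valid_gen.simps inv simp_thms)
 next
  case False
  hence "ypw i j p = replicate (nat p) (Y i j)" by (simp add: ypw_def)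
  moreover have "y_el l i j [^]\<^bsub>Aff l\<^esub> p = y_el l i j [^]\<^bsub>Aff l\<^esub> nat p"
  using False by (simp only: int_pow_def2 if_False)
  ultimately show ?thesis using nat[of "Y i j" "nat p"] j unfolding y_el_def by (simp only: valid_gen.simps simp_thms)
 qed
qed

section \<open>Generation of the loop algebra\<close>

lemma keys_induct [case_names zero single add]:
 fixes p :: "'k \<Rightarrow>\<^sub>0 'b::comm_monoid_add"
 assumes zero: "P 0" and single: "!!k c. k \<in> psupp p ==> P (pmono k c)"
  and add: "!!p q. P p ==> P q ==> P (p + q)"
 shows "P p"
proof -
 have 1: "P (\<Sum>k\<in>K. pmono k (pcoef p k))"
  if "finite K" "K <= psupp p" for K using that by (induction K) (auto intro: zero single add)
 have "p = (\<Sum>k\<in>psupp p. pmono k (pcoef p k))"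
 proof (rule poly_mapping_eqI)
  fix k
  have "(\<Sum>k'\<in>psupp p. pcoef (pmono k' (pcoef p k')) k)
  = (\<Sum>k'\<in>psupp p. if k' = k then pcoef p k else 0)" by (intro sum.cong) (auto simp: lookup_single)
  thus "pcoef p k =
  pcoef (\<Sum>k\<in>psupp p. pmono k (pcoef p k)) k" by (simp add: lookup_sum in_keys_iff)
 qed
 moreover have "P (\<Sum>k\<in>psupp p. pmono k (pcoef p k))" by (rule 1) auto
 ultimately show ?thesis by simp
qed

lemma axis_zero: "axis i (0 :: int) = (0 :: int ^ 'm::finite)" by (simp add: vec_eq_iff axis_def)

lemma loop_simps [simp]: "A \<oplus>\<^bsub>loop_alg\<^esub> B = A + B" "A \<otimes>\<^bsub>loop_alg\<^esub> B = A ** B - B ** A"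
  "c \<odot>\<^bsub>loop_alg\<^esub> A = (\<chi> a b. pmono 0 c * A $ a $ b)" "\<zero>\<^bsub>loop_alg\<^esub> = 0"
  "A \<in> carrier loop_alg \<longleftrightarrow> trace A = 0" by (simp_all add: loop_alg_def)

definition eL :: "'n => 'n => 'm::finite laurent => ('m, 'n::finite) loop"
 where "eL a b f = (\<chi> p q. if p = a & q = b then f else 0)"

lemma eL_mult: "eL a b f ** eL c d g = (if b = c then eL a d (f * g) else 0)"
proof -
 have "(\<Sum>k\<in>UNIV. (if p = a & k = b then f else 0) * (if k = c & q = d then g else 0)) =
  (\<Sum>k\<in>UNIV. if k = b then if p = a & b = c & q = d then f * g else 0 else 0)" for p q by (intro sum.cong) auto
 thus ?thesis by (simp add: vec_eq_iff eL_def matrix_matrix_mult_def)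
qed

lemma loop_diff_distrib:
 fixes A B C :: "('m::finite, 'n::finite) loop"
 shows "(A - B) ** C = A ** C - B ** C" "A ** (B - C) = A ** B - A ** C"
 by (simp_all add: matrix_matrix_mult_def vec_eq_iff left_diff_distrib right_diff_distrib sum_subtractf)

lemma trace_eL: "trace (eL a b f) = (if a = b then f else 0)"
proof -
 have "(\<Sum>i\<in>UNIV. if i = a & i = b then f else 0) = (\<Sum>i\<in>UNIV. if i = a then if a = b then f else 0 else 0)"
  by (intro sum.cong) auto
 thus ?thesis by (simp add: trace_def eL_def)
qed

lemma trace_loop: "trace (A + B) = trace A + trace (B :: ('m::finite, 'n::finite) loop)"
  "trace (A - B) = trace A - trace B" "trace (0 :: ('m, 'n) loop) = 0"
  "trace (\<chi> a b. f * A $ a $ b) = f * trace A" by (simp_all add: trace_def sum.distrib sum_subtractf sum_distrib_left)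

lemma trace_loop_bracket: "trace (A ** B - B ** A :: ('m::finite, 'n::finite) loop) = 0"
proof -
 have "trace (A ** B) = trace (B ** A)" unfolding trace_def matrix_matrix_mult_def vec_lambda_beta
  by (subst sum.swap) (simp add: mult.commute)
 thus ?thesis by (simp add: trace_loop)
qed

lemma eL_scale: "(\<chi> a b. c * eL p q f $ a $ b) = eL p q (c * f)"
 and eL_add: "eL p q (f + g) = eL p q f + eL p q g"
 and eL_zero: "eL p q 0 = 0" by (auto simp: vec_eq_iff eL_def)

text \<open>With \<open>p \<noteq> q\<close>, the element \<open>H = (E\<^sub>p\<^sub>p - E\<^sub>q\<^sub>q) t\<^sub>i\<^sup>a\<close> is a bracket of generators and \<open>[H, E\<^sub>p\<^sub>q f] = 2 E\<^sub>p\<^sub>q t\<^sub>i\<^sup>a f\<close>. So the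
powers of the single variables combine to all monomials off the diagonal, and the diagonal follows from brackets.\<close>

theorem loop_generated [consumes 2, case_names gen add smult bracket]:
 fixes A :: "('m::finite, 'n::finite) loop"
 assumes A: "trace A = 0" and two: "EX p q :: 'n. p ~= q"
  and gen: "!!p q i a. p ~= q ==> P (eL p q (tvar i a))"
  and add: "!!A B. trace A = 0 ==> trace B = 0 ==> P A ==> P B ==> P (A + B)"
  and sm: "!!c A. trace A = 0 ==> P A ==> P (\<chi> a b. pmono 0 c * A $ a $ b)"
  and br: "!!A B. trace A = 0 ==> trace B = 0 ==> P A ==> P B ==> P (A ** B - B ** A)"
 shows "P A"
proof -
 define Q where "Q A \<longleftrightarrow> trace A = 0 & P A" for A
 have Qgen: "Q (eL p q (tvar i a))" if "p ~= q" for p q i a using gen[OF that] that by (simp add: Q_def trace_eL)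
 have Qadd: "Q (A + B)" if "Q A" "Q B" for A B using add that by (simp add: Q_def trace_loop)
 have Qsm: "Q (\<chi> a b. pmono 0 c * A $ a $ b)" if "Q A" for A c using sm that by (simp add: Q_def trace_loop)
 have Qbr: "Q (A ** B - B ** A)" if "Q A" "Q B" for A B using br that trace_loop_bracket by (simp add: Q_def)
 obtain p0 q0 :: 'n where p0: "p0 ~= q0" using two by blast
 have Q0: "Q 0"
 proof -
  have "(\<chi> a b. pmono 0 (0::complex) * eL p0 q0 (tvar undefined 0) $ a $ b) = (0 :: ('m, 'n) loop)"
  by (simp add: vec_eq_iff)
  thus ?thesis using Qsm[OF Qgen[OF p0, of undefined 0], of 0] by simp
 qed
 have Qsum: "Q (\<Sum>i\<in>I. g i)" if "!!i. i \<in> I ==> Q (g i)" for I :: "'i set" and g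
  using that by (induction I rule: infinite_finite_induct) (auto intro: Q0 Qadd)
 have cart: "Q (eL p p f - eL q q f)" if "p ~= q" "Q (eL p q f)" for p q f
 proof -
  have "tvar i 0 = (1 :: 'm laurent)" for i unfolding tvar_def axis_zero by simp
  hence "Q (eL q p 1)" using Qgen[of q p undefined 0] that by simp
  from Qbr[OF that(2) this] show ?thesis by (simp add: eL_mult)
 qed
 have step: "Q (eL p q (tvar i a * f))" if "p ~= q" "Q (eL p q f)" for p q f i a
 proof -
  let ?H = "eL p p (tvar i a) - eL q q (tvar i a)"
  have "Q ?H" by (rule cart[OF that(1) Qgen[OF that(1)]])
  from Qsm[OF Qbr[OF this that(2)], of "1/2"]
  have "Q (\<chi> a' b. pmono 0 (1/2) * (eL p q (tvar i a * f) + eL p q (tvar i a * f)) $ a' $ b)"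
  using that by (simp add: loop_diff_distrib eL_mult mult.commute)
  moreover have "pmono 0 (1/2) * (g + g) = g" for g :: "'m laurent"
  proof -
  have "pmono 0 (1/2) * (g + g) = (pmono 0 (1/2) + pmono 0 (1/2)) * g" by (simp only: distrib_left distrib_right)
  thus ?thesis by (simp add: single_add[symmetric])
  qed
  ultimately have "Q (eL p q (f * tvar i a))" by (simp add: vec_eq_iff eL_add[symmetric] eL_scale)
  thus ?thesis by (simp only: mult.commute)
 qed
 have mon: "Q (eL p q (pmono k 1))" if pq: "p ~= q" for p q k
 proof -
  have "Q (eL p q (pmono (\<Sum>i\<in>I. axis i (k $ i)) 1))" if "finite I" for I using that
  proof (induction I)
  case empty
  have "tvar undefined 0 = (pmono 0 1 :: 'm laurent)" unfolding tvar_def axis_zero by simp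
  thus ?case using Qgen[OF pq, of undefined 0] by simp
  next
  case (insert i I)
  thus ?case using step[OF pq insert.IH, of i "k $ i"] by (simp add: tvar_def mult_single)
  qed
  moreover have "(\<Sum>i\<in>UNIV. axis i (k $ i)) = k"
  by (simp add: vec_eq_iff sum_component axis_def if_distrib cong: if_cong)
  ultimately show ?thesis by (metis finite)
 qed
 have off: "Q (eL p q f)" if pq: "p ~= q" for p q f
 proof (induction f rule: keys_induct)
  case zero
  show ?case using Q0 by (simp add: eL_zero)
 next
  case (single k c)
  have "pmono 0 c * pmono k 1 = (pmono k c :: 'm laurent)" by (simp add: mult_single)
  thus ?case using Qsm[OF mon[OF pq], of c k] by (simp add: eL_scale)
 next
  case (add f g)
  thus ?case using Qadd by (simp add: eL_add)
 qed
 have tr: "(\<Sum>p\<in>UNIV. A $ p $ p) = 0" using A by (simp add: trace_def)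
 have "A = (\<Sum>p\<in>UNIV. \<Sum>q\<in>UNIV. if p ~= q then eL p q (A $ p $ q) else 0) +
  (\<Sum>p\<in>UNIV. if p ~= p0 then eL p p (A $ p $ p) - eL p0 p0 (A $ p $ p) else 0)" (is "A = ?B")
 proof -
  have "A $ r $ s = ?B $ r $ s" for r s
  proof -
  have "(\<Sum>p\<in>UNIV. \<Sum>q\<in>UNIV. if p ~= q then eL p q (A $ p $ q) else 0) $ r $ s =
  (\<Sum>p\<in>UNIV. \<Sum>q\<in>UNIV. if q = s then if p = r then if r ~= s then A $ r $ s else 0 else 0 else 0)"
  unfolding sum_component by (intro sum.cong) (auto simp: eL_def)
  hence 1: "(\<Sum>p\<in>UNIV. \<Sum>q\<in>UNIV. if p ~= q then eL p q (A $ p $ q) else 0) $ r $ s =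
  (if r ~= s then A $ r $ s else 0)" by simp
  have "(\<Sum>p\<in>UNIV. if p ~= p0 then eL p p (A $ p $ p) - eL p0 p0 (A $ p $ p) else 0) $ r $ s =
  (\<Sum>p\<in>UNIV. (if p = r then if r = s then A $ r $ r else 0 else 0) -
  (if r = p0 & s = p0 then A $ p $ p else 0))" unfolding sum_component by (intro sum.cong) (auto simp: eL_def)
  also have "... = (if r = s then A $ r $ r else 0)" by (cases "r = p0"; cases "s = p0"; simp add: sum_subtractf tr)
  finally show ?thesis using 1 by (simp add: vector_add_component)
  qed
  thus ?thesis by (simp add: vec_eq_iff)
 qed
 moreover have "Q ?B" by (intro Qadd Qsum) (auto intro: Q0 off cart)
 ultimately show ?thesis by (simp add: Q_def)
qed

lemma lie_hom_from_generators:
 fixes N :: "(complex, 'v) module" and N' :: "(complex, 'u) module"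
  and \<rho> :: "('m::finite, 'n::finite) loop => 'v => 'v"
 assumes N: "lie_module loop_alg N \<rho>" and N': "lie_module loop_alg N' \<rho>'"
  and two: "EX p q :: 'n. p ~= q"
  and h: "!!v. v \<in> carrier N ==> h v \<in> carrier N'"
  "!!u v. u \<in> carrier N ==> v \<in> carrier N ==> h (u \<oplus>\<^bsub>N\<^esub> v) = h u \<oplus>\<^bsub>N'\<^esub> h v"
  "!!c v. v \<in> carrier N ==> h (c \<odot>\<^bsub>N\<^esub> v) = c \<odot>\<^bsub>N'\<^esub> h v"
  and gen: "!!p q i a v. p ~= q ==> v \<in> carrier N ==>
  h (\<rho> (eL p q (tvar i a)) v) = \<rho>' (eL p q (tvar i a)) (h v)"
  and A: "trace A = 0" and v: "v \<in> carrier N"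
 shows "h (\<rho> A v) = \<rho>' A (h v)"
proof -
 interpret N: lie_module loop_alg N \<rho> by (rule N)
 interpret N': lie_module loop_alg N' \<rho>' by (rule N')
 have hm: "h (x \<ominus>\<^bsub>N\<^esub> y) = h x \<ominus>\<^bsub>N'\<^esub> h y" if "x \<in> carrier N" "y \<in> carrier N" for x y
  using that N.smult_closed[of "-1" y] by (simp add: N.minus_eq N'.minus_eq minus_smult[OF N.m] minus_smult[OF N'.m] h)
 have tb: "trace (A ** B - B ** A) = 0" for A B :: "('m, 'n) loop" by (rule trace_loop_bracket)
 show ?thesis using A two v
 proof (induction A arbitrary: v rule: loop_generated)
  case (gen p q i a)
  thus ?case using assms(7) by blast
 next
  case (add A B)
  thus ?case using N.act_l_add[of A B v] N'.act_l_add[of A B "h v"] by (simp add: h N.act_closed)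
 next
  case (smult c A)
  thus ?case using N.act_l_smult[of A v c] N'.act_l_smult[of A "h v" c] by (simp add: h N.act_closed)
 next
  case (bracket A B)
  thus ?case using N.act_bracket[of A B v] N'.act_bracket[of A B "h v"] by (simp add: h hm N.act_closed)
 qed
qed

section \<open>The balanced tensor product\<close>

definition lsum :: "('k => 'q fvec) => 'k fvec => 'q fvec"
 where "lsum f u = (\<Sum>k\<in>psupp u. psc (pcoef u k) (f k))"

lemma lsum_superset:
 assumes "finite K" "psupp u <= K"
 shows "lsum f u = (\<Sum>k\<in>K. psc (pcoef u k) (f k))" unfolding lsum_def using assms
 by (intro sum.mono_neutral_left) (auto simp: in_keys_iff)

lemma lsum_add: "lsum f (u + v) = lsum f u + lsum f v"
proof -
 let ?K = "psupp u \<union> psupp v"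
 have "lsum f (u + v) = (\<Sum>k\<in>?K. psc (pcoef (u + v) k) (f k))"
  by (rule lsum_superset) (use Poly_Mapping.keys_add[of u v] in auto)
 also have "... = (\<Sum>k\<in>?K. psc (pcoef u k) (f k)) + (\<Sum>k\<in>?K. psc (pcoef v k) (f k))"
  by (simp only: lookup_add psc.scale_left_distrib sum.distrib)
 also have "... = lsum f u + lsum f v" by (intro arg_cong2[of _ _ _ _ "(+)"] lsum_superset[symmetric]) auto
 finally show ?thesis .
qed

lemma lsum_psc: "lsum f (psc c u) = psc c (lsum f u)"
proof -
 have "lsum f (psc c u) = (\<Sum>k\<in>psupp u. psc (pcoef (psc c u) k) (f k))"
  by (rule lsum_superset) (auto simp: in_keys_iff)
 also have "... = psc c (lsum f u)" by (simp only: lookup_psc lsum_def psc.scale_sum_right psc.scale_scale)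
 finally show ?thesis .
qed

lemma lsum_single: "lsum f (pmono k c) = psc c (f k)"
proof -
 have "lsum f (pmono k c) = (\<Sum>i\<in>{k}. psc (pcoef (pmono k c) i) (f i))" by (rule lsum_superset) auto
 thus ?thesis by simp
qed

lemma lsum_zero: "lsum f 0 = 0" by (simp add: lsum_def)

lemma lsum_diff: "lsum f (u - v) = lsum f u - lsum f v" using lsum_add[of f "u - v" v] by simp

lemma lsum_f_add: "lsum (%k. f k + g k) u = lsum f u + lsum g u" by (simp add: lsum_def psc.scale_right_distrib sum.distrib)

lemma lsum_f_psc: "lsum (%k. psc c (f k)) u = psc c (lsum f u)"
 by (simp only: lsum_def psc.scale_sum_right psc.scale_scale mult.commute)

lemma sig_act_add: "sig_act (p + q) v a = sig_act p v a + sig_act q v a"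
proof -
 let ?K = "psupp p \<union> psupp q"
 have *: "sig_act r v a = (\<Sum>u\<in>?K. pcoef r u * foldr gen_op (letters u) v a)"
  if "psupp r <= ?K" for r unfolding sig_act_def using that by (intro sum.mono_neutral_left) (auto simp: in_keys_iff)
 show ?thesis using *[of p] *[of q] *[of "p + q"] Poly_Mapping.keys_add[of p q]
  by (simp add: lookup_add distrib_right sum.distrib)
qed

lemma sig_act_single: "sig_act (pmono u c) v = (%a. c * foldr gen_op (letters u) v a)"
 by (auto simp: sig_act_def fun_eq_iff)

lemma sig_act_zero: "sig_act 0 v = (%a. 0)" by (auto simp: sig_act_def)

lemma swap_closed: "v \<in> TP l ==> swap k v \<in> TP l" by (auto simp: swap_def)

lemma gen_op_closed: "v \<in> TP l ==> gen_op g v \<in> TP l" by (cases g) (simp_all only: gen_op.simps swap_closed)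

lemma foldr_gen_op_closed: "v \<in> TP l ==> foldr gen_op u v \<in> TP l"
 by (induction u) (auto intro: gen_op_closed simp del: tpow_simps(1))

lemma sig_act_closed:
 fixes p :: "'m free_alg"
 shows "v \<in> TP l ==> sig_act p v \<in> TP l"
proof -
 assume v: "v \<in> TP l"
 have "foldr gen_op u v a = 0" if "length a ~= l" for u :: "'m gen list" and a
  using foldr_gen_op_closed[OF v, of u] that by simp
 thus ?thesis by (simp add: sig_act_def)
qed

lemma sig_alg_free: "p \<in> sig_alg l ==> p \<in> FA l" unfolding sig_alg_def free_alg_carrier by fastforce

locale affm =
 fixes l :: nat and E :: "('a, 'm::finite) affmod"
 assumes rm: "right_module (Aff l) (fst E) (snd E)"
begin

sublocale R: right_module "Aff l" "fst E" "snd E" by (rule rm)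

abbreviation M where "M \<equiv> fst E"

definition wact :: "'a => 'm gen list => 'a"
 where "wact w u = snd E w (aff_class l (word u))"

definition csm :: "complex => 'a => 'a"
 where "csm c w = snd E w (aff_class l (pmono (FMon []) c))"

lemma wact_closed: "w \<in> carrier M ==> vw l u ==> wact w u \<in> carrier M"
 unfolding wact_def by (intro R.ract_closed aff_class_closed) auto

lemma csm_closed: "w \<in> carrier M ==> csm c w \<in> carrier M"
 unfolding csm_def by (intro R.ract_closed aff_class_closed free_alg_const)

lemma wact_append: "w \<in> carrier M ==> vw l u ==> vw l v ==> wact w (u @ v) = wact (wact w u) v"
 unfolding wact_def word_append by (simp add: aff_class_mult R.ract_assoc)

lemma wact_Nil: "w \<in> carrier M ==> wact w [] = w" unfolding wact_def word_Nil aff_class_one by (rule R.ract_one)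

lemma wact_weq: "weq l u v ==> wact w u = wact w v" by (simp add: wact_def weq_def)

lemma wact_add: "w \<in> carrier M ==> w' \<in> carrier M ==> vw l u ==>
  wact (w \<oplus>\<^bsub>M\<^esub> w') u = wact w u \<oplus>\<^bsub>M\<^esub> wact w' u"
 unfolding wact_def by (simp add: R.ract_l_distr)

lemma csm_wact:
 assumes "w \<in> carrier M" "vw l u"
 shows "wact (csm c w) u = snd E w (aff_class l (pmono (FMon u) c))"
  "csm c (wact w u) = snd E w (aff_class l (pmono (FMon u) c))"
proof -
 have s: "pmono (FMon u) c = pmono (FMon []) c * word u"
  "pmono (FMon u) c = word u * pmono (FMon []) c" by (simp_all add: word_def mult_single plus_fmon_def)
 show "wact (csm c w) u = snd E w (aff_class l (pmono (FMon u) c))" unfolding s(1) wact_def csm_def using assms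
  by (simp add: aff_class_mult R.ract_assoc free_alg_const(1))
 show "csm c (wact w u) = snd E w (aff_class l (pmono (FMon u) c))" unfolding s(2) wact_def csm_def using assms
  by (simp add: aff_class_mult R.ract_assoc free_alg_const(1))
qed

definition Mv :: "(complex, 'a) module"
 where "Mv = \<lparr>carrier = carrier M, mult = mult M, one = one M, zero = zero M, add = add M,
  Module.module.smult = csm\<rparr>"

lemma Mv_simps [simp]: "carrier Mv = carrier M" "x \<oplus>\<^bsub>Mv\<^esub> y = x \<oplus>\<^bsub>M\<^esub> y" "c \<odot>\<^bsub>Mv\<^esub> x = csm c x"
  "\<zero>\<^bsub>Mv\<^esub> = \<zero>\<^bsub>M\<^esub>" by (simp_all add: Mv_def)

lemma Mv_module: "vsp Mv"
proof (rule moduleI[OF cring_CC])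
 show "abelian_group Mv"
 proof (rule abelian_groupI, goal_cases)
  case (6 x)
  thus ?case by (intro bexI[of _ "\<ominus>\<^bsub>M\<^esub> x"]) (auto simp: R.M.l_neg)
 qed (auto simp: R.M.a_ac)
 note c = free_alg_const(1)
 show "c \<odot>\<^bsub>Mv\<^esub> x \<in> carrier Mv" if "x \<in> carrier Mv" for c x using that csm_closed by simp
 show "(a \<oplus>\<^bsub>CC\<^esub> b) \<odot>\<^bsub>Mv\<^esub> x = a \<odot>\<^bsub>Mv\<^esub> x \<oplus>\<^bsub>Mv\<^esub> b \<odot>\<^bsub>Mv\<^esub> x" if "x \<in> carrier Mv" for a b x
  using that by (simp add: csm_def single_add aff_class_add c R.ract_r_distr)
 show "a \<odot>\<^bsub>Mv\<^esub> (x \<oplus>\<^bsub>Mv\<^esub> y) = a \<odot>\<^bsub>Mv\<^esub> x \<oplus>\<^bsub>Mv\<^esub> a \<odot>\<^bsub>Mv\<^esub> y" if "x \<in> carrier Mv" "y \<in> carrier Mv" for a x y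
  using that by (simp add: csm_def c R.ract_l_distr)
 show "(a \<otimes>\<^bsub>CC\<^esub> b) \<odot>\<^bsub>Mv\<^esub> x = a \<odot>\<^bsub>Mv\<^esub> (b \<odot>\<^bsub>Mv\<^esub> x)" if "x \<in> carrier Mv" for a b x
 proof -
  have "pmono (FMon []) (a * b) = pmono (FMon []) b * (pmono (FMon []) a :: 'm free_alg)"
  by (simp add: mult_single plus_fmon_def mult.commute)
  thus ?thesis using that by (simp add: csm_def c aff_class_mult R.ract_assoc)
 qed
 show "\<one>\<^bsub>CC\<^esub> \<odot>\<^bsub>Mv\<^esub> x = x" if "x \<in> carrier Mv" for x
 proof -
  have "pmono (FMon []) 1 = (1 :: 'm free_alg)" by (simp flip: fmon_zero)
  thus ?thesis using that R.ract_one by (simp add: csm_def aff_class_one)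
 qed
qed

lemma free_tensor_simps [simp]: "u \<oplus>\<^bsub>free_tensor l M\<^esub> v = u + v" "\<zero>\<^bsub>free_tensor l M\<^esub> = 0"
  "c \<odot>\<^bsub>free_tensor l M\<^esub> u = psc c u" by (simp_all add: free_tensor_def)

lemma free_tensor_carrier: "u \<in> carrier (free_tensor l M) \<longleftrightarrow>
  psupp u <= carrier M \<times> TP l" by (simp add: free_tensor_def)

lemma free_tensor_closed:
 assumes "u \<in> carrier (free_tensor l M)"
 shows "v \<in> carrier (free_tensor l M) ==> u + v \<in> carrier (free_tensor l M)"
  "psc c u \<in> carrier (free_tensor l M)" "- u \<in> carrier (free_tensor l M)"
  "v \<in> carrier (free_tensor l M) ==> u - v \<in> carrier (free_tensor l M)"
proof -
 show "v \<in> carrier (free_tensor l M) ==> u + v \<in> carrier (free_tensor l M)"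
  using assms Poly_Mapping.keys_add[of u v] unfolding free_tensor_carrier by blast
 show "psc c u \<in> carrier (free_tensor l M)" "- u \<in> carrier (free_tensor l M)"
  using assms unfolding free_tensor_carrier by (auto simp: in_keys_iff subset_iff)
 show "v \<in> carrier (free_tensor l M) ==> u - v \<in> carrier (free_tensor l M)"
  using assms Poly_Mapping.keys_diff[of u v] unfolding free_tensor_carrier by blast
qed

lemma free_tensor_single: "w \<in> carrier M ==> v \<in> TP l ==>
  pmono (w, v) c \<in> carrier (free_tensor l M)"
 by (auto simp: free_tensor_carrier simp del: tpow_simps(1) split: if_splits)

lemma free_tensor_zero: "0 \<in> carrier (free_tensor l M)" by (simp add: free_tensor_carrier)

lemma free_tensor_module: "vsp (free_tensor l M)"
proof (rule moduleI[OF cring_CC])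
 show "abelian_group (free_tensor l M)"
 proof (rule abelian_groupI, goal_cases)
  case (6 x)
  thus ?case by (intro bexI[of _ "- x"]) (auto intro: free_tensor_closed)
 qed (auto intro: free_tensor_closed free_tensor_zero simp: add_ac)
qed (auto simp only: free_tensor_simps CC_simps psc.scale_left_distrib psc.scale_right_distrib psc.scale_scale
 psc.scale_one intro: free_tensor_closed)

lemma free_tensor_minus: "v \<in> carrier (free_tensor l M) ==> u \<ominus>\<^bsub>free_tensor l M\<^esub> v = u - v"
 using minus_smult[OF free_tensor_module, of v] psc.scale_minus_left[of 1 v]
 by (simp only: a_minus_def free_tensor_simps psc.scale_one) simp

lemma tensor_null_carrier: "u \<in> tensor_null l E ==> u \<in> carrier (free_tensor l M)"
proof (induction rule: tensor_null.induct)
 case (balanced w v p)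
 hence "snd E w (aff_class l p) \<in> carrier M" by (intro R.ract_closed aff_class_closed sig_alg_free)
 thus ?case using balanced by (intro free_tensor_closed free_tensor_single sig_act_closed)
qed (auto intro!: free_tensor_closed free_tensor_single free_tensor_zero simp del: map_single)

lemma tensor_null_submodule: "submodule (tensor_null l E) CC (free_tensor l M)" by (rule submoduleI'[OF free_tensor_module])
  (auto intro: tensor_null_carrier tensor_null.zero tensor_null.add tensor_null.smult)

abbreviation "FS \<equiv> F_space l E"

lemma FS_module: "vsp FS" unfolding F_space_def by (rule quot_module[OF free_tensor_module tensor_null_submodule])

definition cls :: "('a, 'n) free_tensor => ('a, 'n) bal_tensor"
 where "cls u = tensor_null l E +>\<^bsub>free_tensor l M\<^esub> u"

lemma tens_cls: "tens l E w v = cls (elt w v)" by (simp add: tens_def cls_def)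

lemma cls_carrier: "carrier FS = cls ` carrier (free_tensor l M)"
 unfolding F_space_def cls_def[abs_def] by (rule quot_carrier[OF free_tensor_module tensor_null_submodule])

lemma cls_eq: "u \<in> carrier (free_tensor l M) ==> v \<in> carrier (free_tensor l M) ==>
  cls u = cls v \<longleftrightarrow> u - v \<in> tensor_null l E"
 unfolding cls_def using coset_eq_iff[OF free_tensor_module tensor_null_submodule, of u v] by (simp add: free_tensor_minus)

lemma cls_add: "u \<in> carrier (free_tensor l M) ==> v \<in> carrier (free_tensor l M) ==>
  cls (u + v) = cls u \<oplus>\<^bsub>FS\<^esub> cls v"
 unfolding cls_def F_space_def using quot_add[OF free_tensor_module tensor_null_submodule, of u v] by simp

lemma cls_psc: "u \<in> carrier (free_tensor l M) ==> cls (psc c u) = c \<odot>\<^bsub>FS\<^esub> cls u"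
 unfolding cls_def F_space_def using quot_smult[OF free_tensor_module tensor_null_submodule, of u c] by simp

lemma cls_zero: "cls 0 = \<zero>\<^bsub>FS\<^esub>"
 unfolding cls_def F_space_def using quot_zero[OF free_tensor_module tensor_null_submodule] by simp

lemma tens_closed: "w \<in> carrier M ==> v \<in> TP l ==> tens l E w v \<in> carrier FS"
 unfolding tens_cls cls_carrier by (intro imageI free_tensor_single)

lemma FS_induct [consumes 1, case_names zero tens add]:
 assumes x: "x \<in> carrier FS" and zero: "P \<zero>\<^bsub>FS\<^esub>"
  and tens: "!!w v. w \<in> carrier M ==> v \<in> TP l ==> P (tens l E w v)"
  and add: "!!x y. x \<in> carrier FS ==> y \<in> carrier FS ==> P x ==> P y ==> P (x \<oplus>\<^bsub>FS\<^esub> y)"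
 shows "P x"
proof -
 obtain u where u: "u \<in> carrier (free_tensor l M)" "x = cls u" using x cls_carrier by blast
 have "u \<in> carrier (free_tensor l M) & P (cls u)"
 proof (induction u rule: keys_induct)
  case zero
  show ?case using assms(2) by (simp add: cls_zero free_tensor_zero)
 next
  case (single k c)
  obtain w v where k: "k = (w, v)" "w \<in> carrier M" "v \<in> TP l"
  using single u(1) unfolding free_tensor_carrier by blast
  have cv: "c \<odot>\<^bsub>tpow l\<^esub> v \<in> TP l" using k by simp
  have "cls (elt w (c \<odot>\<^bsub>tpow l\<^esub> v)) = cls (pmono k c)"
  unfolding k(1) using k tensor_null.scalar[of w E v l c]
  by (subst cls_eq) (auto intro!: free_tensor_single cv simp del: tpow_simps)
  thus ?case using tens[OF k(2) cv] free_tensor_single[OF k(2,3)] k(1) by (simp add: tens_cls)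
 next
  case (add u v)
  thus ?case using assms(4)[of "cls u" "cls v"] cls_carrier by (auto simp: cls_add intro: free_tensor_closed)
 qed
 thus ?thesis using u by simp
qed

definition tn :: "'a => 'n tensor => ('a, 'n) bal_tensor fvec"
 where "tn w v = sect FS (tens l E w v)"

lemma tens_rel:
 assumes w: "w \<in> carrier M" and v: "v \<in> TP l"
 shows "w' \<in> carrier M ==> tens l E (w \<oplus>\<^bsub>M\<^esub> w') v = tens l E w v \<oplus>\<^bsub>FS\<^esub> tens l E w' v"
  "v' \<in> TP l ==> tens l E w (%a. v a + v' a) = tens l E w v \<oplus>\<^bsub>FS\<^esub> tens l E w v'"
  "tens l E w (%a. c * v a) = c \<odot>\<^bsub>FS\<^esub> tens l E w v"
  "p \<in> sig_alg l ==> tens l E (snd E w (aff_class l p)) v = tens l E w (sig_act p v)"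
proof -
 note f = free_tensor_single free_tensor_closed
 show "tens l E (w \<oplus>\<^bsub>M\<^esub> w') v = tens l E w v \<oplus>\<^bsub>FS\<^esub> tens l E w' v" if "w' \<in> carrier M"
  unfolding tens_cls using tensor_null.add_l[OF w that v] w v that
  by (subst cls_add[symmetric]) (auto simp: cls_eq f diff_diff_eq simp del: tpow_simps)
 show "tens l E w (%a. v a + v' a) = tens l E w v \<oplus>\<^bsub>FS\<^esub> tens l E w v'" if v': "v' \<in> TP l"
 proof -
  have "(%a. v a + v' a) \<in> TP l" using v v' by simp
  thus ?thesis unfolding tens_cls using tensor_null.add_r[OF w v v'] w v v'
  by (subst cls_add[symmetric]) (auto simp: cls_eq f diff_diff_eq simp del: tpow_simps(1))
 qed
 show "tens l E w (%a. c * v a) = c \<odot>\<^bsub>FS\<^esub> tens l E w v"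
 proof -
  have cv: "(%a. c * v a) \<in> TP l" using v by simp
  have "elt w (%a. c * v a) - psc c (elt w v) \<in> tensor_null l E" using tensor_null.scalar[OF w v, of c] by simp
  thus ?thesis unfolding tens_cls cls_psc[OF f(1)[OF w v], symmetric]
  by (subst cls_eq) (auto intro!: f w v cv simp del: tpow_simps map_single)
 qed
 show "tens l E (snd E w (aff_class l p)) v = tens l E w (sig_act p v)" if p: "p \<in> sig_alg l"
  unfolding tens_cls using tensor_null.balanced[OF w v p]
  by (subst cls_eq) (auto intro!: f w v R.ract_closed aff_class_closed sig_alg_free p sig_act_closed
  simp del: tpow_simps)
qed

lemma tn_add_l: "w \<in> carrier M ==> w' \<in> carrier M ==> v \<in> TP l ==>
  tn (w \<oplus>\<^bsub>M\<^esub> w') v = tn w v + tn w' v"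
 and tn_add_r: "w \<in> carrier M ==> v \<in> TP l ==> v' \<in> TP l ==>
  tn w (%a. v a + v' a) = tn w v + tn w v'"
 and tn_scale: "w \<in> carrier M ==> v \<in> TP l ==> tn w (%a. c * v a) = psc c (tn w v)" unfolding tn_def
 by (simp_all add: tens_rel(1) tens_rel(2)[of w v v'] tens_rel(3)[of w v c] sect_add[OF FS_module]
  sect_smult[OF FS_module] tens_closed del: tpow_simps)

lemma tn_csm:
 assumes "w \<in> carrier M" "v \<in> TP l"
 shows "tn (csm c w) v = psc c (tn w v)"
proof -
 have "pmono (FMon []) c \<in> sig_alg l" by (auto simp: sig_alg_def split: if_splits)
 from tens_rel(4)[OF assms this] have "tn (csm c w) v = tn w (%a. c * v a)" by (simp add: tn_def csm_def sig_act_single)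
 thus ?thesis using tn_scale[OF assms] by simp
qed

lemma tn_sig:
 assumes "w \<in> carrier M" "v \<in> TP l" "k + 1 < l"
 shows "tn (wact w [Sig k]) v = tn w (swap k v)"
proof -
 have "word [Sig k] \<in> sig_alg l" using assms by (auto simp: sig_alg_def word_def)
 from tens_rel(4)[OF assms(1,2) this] show ?thesis by (simp add: tn_def wact_def word_def sig_act_single)
qed

lemma tn_zero: "w \<in> carrier M ==> tn w (%a. 0) = 0" using tn_scale[of w "%a. 0" 0] by simp

lemma tn_sum:
 assumes "w \<in> carrier M" "!!i. i \<in> I ==> f i \<in> TP l"
 shows "tn w (%a. \<Sum>i\<in>I. f i a) = (\<Sum>i\<in>I. tn w (f i))" using assms(2)
proof (induction I rule: infinite_finite_induct)
 case (insert i I)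
 have "(%a. \<Sum>i\<in>I. f i a) \<in> TP l" using insert by (auto intro!: sum.neutral)
 thus ?case using insert tn_add_r[of w "f i" "%a. \<Sum>i\<in>I. f i a"] assms(1) by simp
qed (use tn_zero assms in auto)

lemma lin_agree:
 assumes f: "!!x y. f (x + y) = f x + f y" and g: "!!x y. g (x + y) = g x + (g y :: 'q :: ab_group_add)"
  and eq: "!!w v. w \<in> carrier M ==> v \<in> TP l ==> f (tn w v) = g (tn w v)"
  and x: "x \<in> carrier FS"
 shows "f (sect FS x) = g (sect FS x)" using x
proof (induction x rule: FS_induct)
 case zero
 have "f 0 = 0" "g 0 = 0" using f[of 0 0] g[of 0 0] by auto
 thus ?case by (simp add: sect_zero[OF FS_module])
next
 case (tens w v)
 thus ?case using eq by (simp add: tn_def)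
next
 case (add x y)
 thus ?case by (simp add: sect_add[OF FS_module] f g)
qed

text \<open>The universal property. Balancing is only required for single \<open>\<sigma>\<^sub>k\<close> and for scalars; the general case follows
along words and linear combinations.\<close>

theorem tens_ext:
 fixes \<beta> :: "'a => 'n::finite tensor => 'q fvec"
 assumes add_l: "!!w w' v. w \<in> carrier M ==> w' \<in> carrier M ==> v \<in> TP l ==>
  \<beta> (w \<oplus>\<^bsub>M\<^esub> w') v = \<beta> w v + \<beta> w' v"
  and add_r: "!!w v v'. w \<in> carrier M ==> v \<in> TP l ==> v' \<in> TP l ==>
  \<beta> w (%a. v a + v' a) = \<beta> w v + \<beta> w v'"
  and scale: "!!w v c. w \<in> carrier M ==> v \<in> TP l ==> \<beta> w (%a. c * v a) = psc c (\<beta> w v)"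
  and csm: "!!w v c. w \<in> carrier M ==> v \<in> TP l ==> \<beta> (csm c w) v = psc c (\<beta> w v)"
  and sig: "!!w v k. w \<in> carrier M ==> v \<in> TP l ==> k + 1 < l ==>
  \<beta> (wact w [Sig k]) v = \<beta> w (swap k v)"
 shows "EX h. (ALL x y. h (x + y) = h x + h y) & (ALL c x. h (psc c x) = psc c (h x)) &
  (ALL w:carrier M. ALL v:TP l. h (tn w v) = \<beta> w v)"
proof -
 have words: "\<beta> (wact w u) v = \<beta> w (foldr gen_op u v)"
  if "w \<in> carrier M" "v \<in> TP l" "ALL g:set u. EX k. k + 1 < l & g = Sig k" for w v u using that
 proof (induction u arbitrary: w)
  case Nil
  thus ?case by (simp add: wact_Nil)
 next
  case (Cons g u)
  obtain k where k: "k + 1 < l" "g = Sig k" using Cons.prems by auto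
  have u: "vw l u" using Cons.prems(3) by (fastforce simp: vw_def)
  have "\<beta> (wact w (g # u)) v = \<beta> (wact (wact w [Sig k]) u) v"
  using wact_append[of w "[Sig k]" u] Cons.prems k u by simp
  also have "... = \<beta> (wact w [Sig k]) (foldr gen_op u v)"
  using Cons.prems wact_closed[of w "[Sig k]"] k by (intro Cons.IH) auto
  also have "... = \<beta> w (foldr gen_op (g # u) v)"
  using sig[OF Cons.prems(1) foldr_gen_op_closed[OF Cons.prems(2)] k(1)] k by simp
  finally show ?case .
 qed
 have zl: "\<beta> \<zero>\<^bsub>M\<^esub> v = 0" if "v \<in> TP l" for v
  using add_l[of "\<zero>\<^bsub>M\<^esub>" "\<zero>\<^bsub>M\<^esub>" v] that by simp
 have zr: "\<beta> w (%a. 0) = 0" if "w \<in> carrier M" for w using scale[of w "%a. 0" 0] that by simp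
 have bal: "\<beta> (snd E w (aff_class l p)) v = \<beta> w (sig_act p v)"
  if w: "w \<in> carrier M" and v: "v \<in> TP l" and p: "p \<in> sig_alg l" for w v p
 proof -
  have "p \<in> FA l & \<beta> (snd E w (aff_class l p)) v = \<beta> w (sig_act p v)"
  proof (induction p rule: keys_induct)
  case zero
  have "aff_class l 0 = (\<zero>\<^bsub>Aff l\<^esub> :: 'm aff)"
  proof -
  interpret A: ring "Aff l :: 'm aff ring" by (rule Aff_ring)
  have z: "(0 :: 'm free_alg) \<in> FA l" by (rule free_alg_const)
  show ?thesis using aff_class_add[OF z z] aff_class_closed[OF z] by simp
  qed
  moreover have "snd E w \<zero>\<^bsub>Aff l\<^esub> = \<zero>\<^bsub>M\<^esub>"
  using R.ract_r_distr[OF w, of "\<zero>\<^bsub>Aff l\<^esub>" "\<zero>\<^bsub>Aff l\<^esub>"] R.ract_closed[OF w, of "\<zero>\<^bsub>Aff l\<^esub>"] by simp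
  ultimately show ?case using zl[OF v] zr[OF w] free_alg_const(2) by (simp add: sig_act_zero)
  next
  case (single u c)
  have u: "ALL g:set (letters u). EX k. k + 1 < l & g = Sig k" using p single unfolding sig_alg_def by auto
  hence vu: "vw l (letters u)" by (fastforce simp: vw_def)
  have "\<beta> (snd E w (aff_class l (pmono u c))) v = psc c (\<beta> (wact w (letters u)) v)"
  using csm_wact(2)[OF w vu, of c] csm[OF wact_closed[OF w vu] v, of c] by (simp del: map_single)
  also have "... = \<beta> w (sig_act (pmono u c) v)"
  unfolding words[OF w v u] sig_act_single by (rule scale[OF w foldr_gen_op_closed[OF v], symmetric])
  finally show ?case using vu by (auto simp: free_alg_carrier vw_def)
  next
  case (add p q)
  thus ?case using add_l[OF R.ract_closed[OF w] R.ract_closed[OF w] v, of "aff_class l p" "aff_class l q"]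
  add_r[OF w sig_act_closed[OF v] sig_act_closed[OF v], of p q] w
  by (simp add: aff_class_add R.ract_r_distr sig_act_add[abs_def] free_alg_closed)
  qed
  thus ?thesis by blast
 qed
 define g0 where "g0 = lsum (%(w, v). \<beta> w v)"
 have null: "g0 u = 0" if "u \<in> tensor_null l E" for u using that unfolding g0_def
  by (induction rule: tensor_null.induct)
  (auto simp add: lsum_add lsum_diff lsum_psc lsum_single lsum_zero add_l add_r scale bal simp del: map_single)
 define g where "g C = g0 (SOME u. u \<in> carrier (free_tensor l M) & C = cls u)" for C
 have g: "g (cls u) = g0 u" if u: "u \<in> carrier (free_tensor l M)" for u
 proof -
  define u' where "u' = (SOME u'. u' \<in> carrier (free_tensor l M) & cls u = cls u')"
  have "EX u'. u' \<in> carrier (free_tensor l M) & cls u = cls u'" using u by blast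
  hence u': "u' \<in> carrier (free_tensor l M)" "cls u = cls u'" unfolding u'_def by (metis (mono_tags, lifting) someI_ex)+
  have "g0 (u - u') = 0" by (rule null) (use u' u in \<open>simp add: cls_eq\<close>)
  thus ?thesis unfolding g_def u'_def[symmetric] by (simp add: g0_def lsum_diff)
 qed
 define h where "h x = g (ev FS x)" for x
 have "h (x + y) = h x + h y" for x y
 proof -
  obtain u v where u: "u \<in> carrier (free_tensor l M)" "ev FS x = cls u"
  and v: "v \<in> carrier (free_tensor l M)" "ev FS y = cls v"
  using ev_closed[OF FS_module, of x] ev_closed[OF FS_module, of y] unfolding cls_carrier by blast
  have "ev FS (x + y) = cls (u + v)" using u v by (simp add: ev_add[OF FS_module] cls_add)
  thus ?thesis using u v free_tensor_closed(1)[OF u(1) v(1)] by (simp add: h_def g) (simp add: g0_def lsum_add)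
 qed
 moreover have "h (psc c x) = psc c (h x)" for c x
 proof -
  obtain u where u: "u \<in> carrier (free_tensor l M)" "ev FS x = cls u"
  using ev_closed[OF FS_module, of x] unfolding cls_carrier by blast
  have "ev FS (psc c x) = cls (psc c u)" using u by (simp add: ev_psc[OF FS_module] cls_psc)
  thus ?thesis using u free_tensor_closed(2)[OF u(1), of c] by (simp add: h_def g) (simp add: g0_def lsum_psc)
 qed
 moreover have "h (tn w v) = \<beta> w v" if "w \<in> carrier M" "v \<in> TP l" for w v
 proof -
  have "ev FS (tn w v) = cls (elt w v)" using ev_sect[OF FS_module tens_closed[OF that]] by (simp only: tn_def tens_cls)
  hence "h (tn w v) = g0 (elt w v)" by (simp only: h_def g[OF free_tensor_single[OF that]])
  thus ?thesis by (simp add: g0_def lsum_single del: map_single)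
 qed
 ultimately show ?thesis by blast
qed

end

section \<open>The action of the loop algebra\<close>

lemma ev_finsum:
 fixes N :: "(complex, 'v) module"
 assumes N: "vsp N" and f: "!!j. j \<in> I ==> f j \<in> carrier N"
 shows "ev N (\<Sum>j\<in>I. sect N (f j)) = (\<Oplus>\<^bsub>N\<^esub>j\<in>I. f j)"
proof -
 interpret Module.module CC N by (rule N)
 show ?thesis using f by (induction I rule: infinite_finite_induct)
  (auto simp: ev_zero[OF N] ev_add[OF N] ev_sect[OF N] Pi_def)
qed

lemma single0_mult: "pmono 0 c * f = psc c (f :: 'm::finite laurent)"
proof (induction f rule: keys_induct)
 case (add f g)
 thus ?case by (simp only: distrib_left psc.scale_right_distrib)
qed (simp_all add: mult_single)

lemma loop_add_induct [case_names zero unit add]: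
 fixes A :: "('m::finite, 'n::finite) loop"
 assumes "P 0" "!!a b k c. P (eL a b (pmono k c))"
  "!!A B. P A ==> P B ==> P (A + B)"
 shows "P A"
proof -
 have 1: "P (eL a b f)" for a b f by (induction f rule: keys_induct) (auto simp: eL_zero eL_add assms)
 have s: "P (\<Sum>i\<in>I. g i)" if "!!i. P (g i)" for I :: "'i set" and g
  using that by (induction I rule: infinite_finite_induct) (auto intro: assms)
 have "A = (\<Sum>p\<in>UNIV. \<Sum>q\<in>UNIV. eL p q (A $ p $ q))"
 proof -
  have "(\<Sum>p\<in>UNIV. \<Sum>q\<in>UNIV. eL p q (A $ p $ q)) $ r $ s =
  (\<Sum>p\<in>UNIV. \<Sum>q\<in>UNIV. if q = s then if p = r then A $ r $ s else 0 else 0)" for r s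
  unfolding sum_component by (intro sum.cong) (auto simp: eL_def)
  thus ?thesis by (simp add: vec_eq_iff)
 qed
 moreover have "P (\<Sum>p\<in>UNIV. \<Sum>q\<in>UNIV. eL p q (A $ p $ q))" by (intro s 1)
 ultimately show ?thesis by simp
qed

lemma loop_tensor_eu: "loop_tensor (eu a b) f = eL a b f" by (auto simp: loop_tensor_def eu_def eL_def vec_eq_iff)

lemma trace_loop_tensor: "trace x = 0 ==> trace (loop_tensor x f :: ('m::finite, 'n::finite) loop) = 0"
 by (simp add: trace_def loop_tensor_def sum_distrib_right[symmetric] single_0_sum[symmetric])

lemma trace_eu: "p ~= q ==> trace (eu p q :: complex ^ 'n ^ 'n::finite) = 0"
 by (auto simp: trace_def eu_def intro!: sum.neutral)

lemma slot_expand: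
 fixes x :: "complex ^ 'n ^ 'n::finite"
 shows "slot x j v = (%c. \<Sum>a\<in>UNIV. \<Sum>b\<in>UNIV. x $ a $ b * slot (eu a b) j v c)"
proof
 fix c
 have "(\<Sum>a\<in>UNIV. \<Sum>b\<in>UNIV. x $ a $ b * slot (eu a b) j v c) =
  (\<Sum>a\<in>UNIV. if a = c ! j then \<Sum>b\<in>UNIV. x $ a $ b * v (c[j := b]) else 0)"
  by (intro sum.cong) (auto simp: slot_eu)
 thus "slot x j v c = (\<Sum>a\<in>UNIV. \<Sum>b\<in>UNIV. x $ a $ b * slot (eu a b) j v c)" by (simp add: slot_def)
qed

lemma swap_swp: "swap k v a = v (swp k a)" by (simp add: swap_def swp_def)

lemma swap_slot:
 assumes v: "v \<in> TP l" and k: "k + 1 < l" and j: "j < l"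
 shows "swap k (slot x j v) = slot x (tr k j) (swap k v)"
proof
 fix a
 have t: "tr k j < l" using k j by (rule tr_less)
 show "swap k (slot x j v) a = slot x (tr k j) (swap k v) a"
 proof (cases "length a = l")
  case True
  thus ?thesis using k j t by (simp add: swap_swp slot_def nth_swp swp_update del: One_nat_def)
 next
  case False
  have "swap k (slot x j v) \<in> TP l" "slot x (tr k j) (swap k v) \<in> TP l" by (intro swap_closed slot_closed v)+
  thus ?thesis using False by simp
 qed
qed

lemma slot_mult:
 assumes v: "v \<in> TP l" and j: "j < l"
 shows "slot x j (slot y j v) = slot (x ** y) j v"
proof
 fix a
 show "slot x j (slot y j v) a = slot (x ** y) j v a"
 proof (cases "length a = l")
  case True
  thus ?thesis using j by (intro slot_slot_same) simp
 next
  case False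
  have "slot x j (slot y j v) \<in> TP l" "slot (x ** y) j v \<in> TP l" by (intro slot_closed v)+
  thus ?thesis using False by simp
 qed
qed

context affm
begin

definition opb :: "complex ^ 'n ^ 'n => int ^ 'm => 'a => 'n::finite tensor => ('a, 'n) bal_tensor fvec"
 where "opb x k w v = (\<Sum>j<l. tn (wact w (ywd j k)) (slot x j v))"

definition opx :: "complex ^ 'n ^ 'n => int ^ 'm => (('a, 'n::finite) bal_tensor \<Rightarrow>\<^sub>0 complex) => ('a, 'n) bal_tensor fvec"
 where "opx x k = (SOME h. (ALL x y. h (x + y) = h x + h y) & (ALL c x. h (psc c x) = psc c (h x)) &
  (ALL w:carrier M. ALL v:TP l. h (tn w v) = opb x k w v))"

lemma wact_ywd: "w \<in> carrier M ==> j < l ==> wact w (ywd j k) \<in> carrier M" by (intro wact_closed ywd_vw)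

lemma opx_ex: "EX h. (ALL x y. h (x + y) = h x + h y) & (ALL c x. h (psc c x) = psc c (h x)) &
  (ALL w:carrier M. ALL v:TP l. h (tn w v) = opb (x :: complex ^ 'n ^ 'n::finite) e w v)"
proof (rule tens_ext, goal_cases)
 case (1 w w' v)
 thus ?case unfolding opb_def sum.distrib[symmetric]
  by (intro sum.cong refl) (simp add: wact_add ywd_vw tn_add_l wact_ywd slot_closed del: tpow_simps)
next
 case (2 w v v')
 thus ?case unfolding opb_def sum.distrib[symmetric] slot_lin
  by (intro sum.cong refl) (simp add: tn_add_r wact_ywd slot_closed del: tpow_simps)
next
 case (3 w v c)
 thus ?case unfolding opb_def psc.scale_sum_right slot_lin
  by (intro sum.cong refl) (simp add: tn_scale wact_ywd slot_closed del: tpow_simps)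
next
 case (4 w v c)
 thus ?case unfolding opb_def psc.scale_sum_right by (intro sum.cong refl)
  (simp add: csm_wact(1) csm_wact(2)[symmetric] ywd_vw tn_csm wact_ywd slot_closed del: tpow_simps)
next
 case (5 w v k)
 have "tn (wact (wact w [Sig k]) (ywd j e)) (slot x j v) =
  tn (wact w (ywd (tr k j) e)) (slot x (tr k j) (swap k v))" if j: "j < l" for j
 proof -
  have t: "tr k j < l" using 5 j by (intro tr_less)
  have "wact (wact w [Sig k]) (ywd j e) = wact w ([Sig k] @ ywd j e)"
  using wact_append[of w "[Sig k]" "ywd j e"] 5 by (simp add: ywd_vw[OF j])
  also have "... = wact w (ywd (tr k j) e @ [Sig k])" by (rule wact_weq[OF sig_ywd[OF 5(3) j]])
  also have "... = wact (wact w (ywd (tr k j) e)) [Sig k]"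
  using wact_append[of w "ywd (tr k j) e" "[Sig k]"] 5 by (simp add: ywd_vw[OF t])
  finally show ?thesis using tn_sig[OF wact_ywd[OF 5(1) t] slot_closed[OF 5(2)] 5(3)] swap_slot[OF 5(2,3) j] by simp
 qed
 hence "opb x e (wact w [Sig k]) v = (\<Sum>j<l. tn (wact w (ywd (tr k j) e)) (slot x (tr k j) (swap k v)))"
  unfolding opb_def by (intro sum.cong) auto
 also have "... = opb x e w (swap k v)" unfolding opb_def using 5(3)
  by (intro sum.reindex_bij_witness[of _ "tr k" "tr k"]) (auto intro: tr_less)
 finally show ?case .
qed

lemma opx_add: "opx x k (s + t) = opx x k s + opx x k t"
 and opx_psc: "opx x k (psc c s) = psc c (opx x k s)"
 and opx_tn: "w \<in> carrier M ==> v \<in> TP l ==> opx x k (tn w v) = opb x k w v"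
 unfolding opx_def using someI_ex[OF opx_ex[of x k]] by blast+

lemma opx_sum: "opx x k (\<Sum>i\<in>I. f i) = (\<Sum>i\<in>I. opx x k (f i))"
proof -
 have "opx x k 0 = 0" using opx_add[of x k 0 0] by simp
 thus ?thesis by (induction I rule: infinite_finite_induct) (auto simp: opx_add)
qed

text \<open>Terms at different positions cancel, because the monomials commute in the algebra; at equal positions the matrices
and the monomials multiply.\<close>

lemma opx_comm_tn:
 assumes w: "w \<in> carrier M" and v: "v \<in> TP l"
 shows "opx x k (opx y k' (tn w v)) - opx y k' (opx x k (tn w v)) =
  opx (x ** y) (k + k') (tn w v) - opx (y ** x) (k + k') (tn w v)"
proof -
 have two: "opx x k (opx y k' (tn w v)) =
  (\<Sum>j<l. \<Sum>i<l. tn (wact w (ywd j k' @ ywd i k)) (slot x i (slot y j v)))" for x y k k'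
  unfolding opx_tn[OF w v] opb_def[of y] opx_sum
 proof (intro sum.cong refl)
  fix j assume "j \<in> {..<l}"
  hence j: "j < l" by simp
  have "opx x k (tn (wact w (ywd j k')) (slot y j v)) = opb x k (wact w (ywd j k')) (slot y j v)"
  by (intro opx_tn wact_ywd slot_closed w v j)
  also have "... = (\<Sum>i<l. tn (wact w (ywd j k' @ ywd i k)) (slot x i (slot y j v)))"
  unfolding opb_def by (intro sum.cong refl) (simp add: wact_append w ywd_vw j)
  finally show "opx x k (tn (wact w (ywd j k')) (slot y j v)) =
  (\<Sum>i<l. tn (wact w (ywd j k' @ ywd i k)) (slot x i (slot y j v)))" .
 qed
 let ?A = "%i j. tn (wact w (ywd j k' @ ywd i k)) (slot x i (slot y j v))"
 let ?B = "%i j. tn (wact w (ywd i k @ ywd j k')) (slot y j (slot x i v))"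
 have "opx x k (opx y k' (tn w v)) - opx y k' (opx x k (tn w v)) = (\<Sum>j<l. \<Sum>i<l. ?A i j) - (\<Sum>i<l. \<Sum>j<l. ?B i j)"
  by (simp only: two)
 also have "... = (\<Sum>j<l. \<Sum>i<l. ?A i j - ?B i j)" by (subst (2) sum.swap) (simp only: sum_subtractf)
 also have "... = (\<Sum>j<l. \<Sum>i<l. if i = j then tn (wact w (ywd j (k + k'))) (slot (x ** y) j v) -
  tn (wact w (ywd j (k + k'))) (slot (y ** x) j v) else 0)"
 proof (intro sum.cong refl)
  fix i j assume "j \<in> {..<l}" "i \<in> {..<l}"
  hence j: "j < l" and i: "i < l" by auto
  have c: "wact w (ywd j k' @ ywd i k) = wact w (ywd i k @ ywd j k')" by (rule wact_weq[OF ywd_comm[OF j i]])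
  show "?A i j - ?B i j = (if i = j then tn (wact w (ywd j (k + k'))) (slot (x ** y) j v) -
  tn (wact w (ywd j (k + k'))) (slot (y ** x) j v) else 0)"
  proof (cases "i = j")
  case True
  have "wact w (ywd j k @ ywd j k') = wact w (ywd j (k + k'))" by (rule wact_weq[OF ywd_add[OF j]])
  thus ?thesis using True c by (simp add: slot_mult[OF v j])
  next
  case False
  have "slot x i (slot y j v) = slot y j (slot x i v)" using False by (intro ext slot_slot_comm)
  thus ?thesis using False c by simp
  qed
 qed
 also have "... = opx (x ** y) (k + k') (tn w v) - opx (y ** x) (k + k') (tn w v)"
  by (simp add: opx_tn[OF w v] opb_def sum_subtractf)
 finally show ?thesis .
qed

lemma opx_comm:
 assumes "s \<in> carrier FS"
 shows "opx x k (opx y k' (sect FS s)) - opx y k' (opx x k (sect FS s)) =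
  opx (x ** y) (k + k') (sect FS s) - opx (y ** x) (k + k') (sect FS s)"
 by (rule lin_agree[where f = "%t. opx x k (opx y k' t) - opx y k' (opx x k t)"])
  (auto simp: opx_add opx_comm_tn assms simp del: tpow_simps)

lemma opx_zero_mat:
 assumes "s \<in> carrier FS"
 shows "opx 0 k (sect FS s) = 0" by (rule lin_agree[where g = "%t. 0"])
  (auto simp: opx_add opx_tn opb_def slot_lin tn_zero wact_ywd assms simp del: tpow_simps)

text \<open>The action of a matrix over the Laurent polynomials, trace zero or not.\<close>

definition Rp :: "('m, 'n::finite) loop => ('a, 'n) bal_tensor fvec => ('a, 'n) bal_tensor fvec"
 where "Rp A s = (\<Sum>a\<in>UNIV. \<Sum>b\<in>UNIV. lsum (%k. opx (eu a b) k s) (A $ a $ b))"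

lemma Rp_add: "Rp A (s + t) = Rp A s + Rp A t" by (simp add: Rp_def opx_add lsum_f_add sum.distrib)

lemma Rp_psc: "Rp A (psc c s) = psc c (Rp A s)" by (simp only: Rp_def opx_psc lsum_f_psc psc.scale_sum_right)

lemma Rp_l_add: "Rp (A + B) s = Rp A s + Rp B s" by (simp add: Rp_def lsum_add sum.distrib)

lemma Rp_l_diff: "Rp (A - B) s = Rp A s - Rp B s" by (simp add: Rp_def lsum_diff sum_subtractf)

lemma Rp_l_zero: "Rp 0 s = 0" by (simp add: Rp_def lsum_zero)

lemma Rp_l_scale: "Rp (\<chi> a b. pmono 0 c * A $ a $ b) s = psc c (Rp A s)"
 by (simp only: Rp_def vec_lambda_beta single0_mult lsum_psc psc.scale_sum_right)

lemma Rp_eL: "Rp (eL a b (pmono k c)) s = psc c (opx (eu a b) k s)"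
proof -
 have "Rp (eL a b (pmono k c)) s =
  (\<Sum>p\<in>UNIV. \<Sum>q\<in>UNIV. if q = b then if p = a then psc c (opx (eu a b) k s) else 0 else 0)"
  unfolding Rp_def by (intro sum.cong) (auto simp: eL_def lsum_zero lsum_single)
 thus ?thesis by simp
qed

lemma Rp_bracket:
 fixes A B :: "('m, 'n::finite) loop"
 assumes s: "s \<in> carrier FS"
 shows "Rp (A ** B - B ** A) (sect FS s) = Rp A (Rp B (sect FS s)) - Rp B (Rp A (sect FS s))"
proof (induction A rule: loop_add_induct)
 case zero
 have "Rp B 0 = 0" using Rp_psc[of B 0 0] by simp
 moreover have "0 ** B - B ** 0 = 0" by (simp add: matrix_matrix_mult_def vec_eq_iff)
 ultimately show ?case by (simp add: Rp_l_zero)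
next
 case (add A A')
 have "(A + A') ** B - B ** (A + A') = (A ** B - B ** A) + (A' ** B - B ** A')"
  by (simp add: matrix_matrix_mult_def vec_eq_iff distrib_left distrib_right sum.distrib)
 thus ?case using add by (simp add: Rp_l_add Rp_add)
next
 case (unit a b k c)
 show ?case
 proof (induction B rule: loop_add_induct)
  case zero
  have "Rp (eL a b (pmono k c)) 0 = 0" using Rp_psc[of _ 0 0] by simp
  moreover have "A ** 0 - 0 ** A = 0" for A :: "('m, 'n) loop" by (simp add: matrix_matrix_mult_def vec_eq_iff)
  ultimately show ?case by (simp add: Rp_l_zero)
 next
  case (add B B')
  have "A ** (B + B') - (B + B') ** A = (A ** B - B ** A) + (A ** B' - B' ** A)" for A
  by (simp add: matrix_matrix_mult_def vec_eq_iff distrib_left distrib_right sum.distrib)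
  thus ?case using add by (simp add: Rp_l_add Rp_add)
 next
  case (unit a' b' k' c')
  let ?t = "sect FS s"
  have e: "eL a b (pmono k c) ** eL a' b' (pmono k' c') =
  (if b = a' then eL a b' (pmono (k + k') (c * c')) else 0)" for a b a' b' :: 'n and k k' :: "int ^ 'm" and c c'
  by (simp add: eL_mult mult_single)
  have z: "opx 0 (k + k') ?t = 0" by (rule opx_zero_mat[OF s])
  have "Rp (eL a b (pmono k c) ** eL a' b' (pmono k' c') -
  eL a' b' (pmono k' c') ** eL a b (pmono k c)) ?t =
  psc (c * c') (opx (eu a b ** eu a' b') (k + k') ?t - opx (eu a' b' ** eu a b) (k + k') ?t)"
  unfolding e Rp_l_diff psc.scale_right_diff_distrib eu_mult
  by (auto simp: Rp_eL Rp_l_zero z add.commute[of k'] mult.commute[of c'])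
  also have "... = Rp (eL a b (pmono k c)) (Rp (eL a' b' (pmono k' c')) ?t) -
  Rp (eL a' b' (pmono k' c')) (Rp (eL a b (pmono k c)) ?t)"
  unfolding Rp_eL opx_psc psc.scale_scale opx_comm[OF s, symmetric] psc.scale_right_diff_distrib
  by (simp only: mult.commute[of c'])
  finally show ?case .
 qed
qed

lemma tn_S: "w \<in> carrier M ==> v \<in> TP l ==> tn w v \<in> sect FS ` carrier FS"
 unfolding tn_def by (intro imageI tens_closed)

lemma subspace_S: "psc.subspace (sect FS ` carrier FS)" by (rule subspace_sect[OF FS_module submodule_self[OF FS_module]])

lemma opx_S:
 assumes "s \<in> carrier FS"
 shows "opx x k (sect FS s) \<in> sect FS ` carrier FS" using assms
proof (induction s rule: FS_induct)
 case zero
 have "opx x k 0 = 0" using opx_add[of x k 0 0] by simp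
 thus ?case using psc.subspace_0[OF subspace_S] by (simp add: sect_zero[OF FS_module])
next
 case (tens w v)
 hence "opx x k (sect FS (tens l E w v)) = opb x k w v" using opx_tn by (simp add: tn_def)
 moreover have "opb x k w v \<in> sect FS ` carrier FS"
  unfolding opb_def by (intro psc.subspace_sum[OF subspace_S] tn_S wact_ywd slot_closed tens) auto
 ultimately show ?case by simp
next
 case (add s t)
 thus ?case using psc.subspace_add[OF subspace_S] by (simp add: sect_add[OF FS_module] opx_add)
qed

lemma Rp_S:
 assumes "s \<in> carrier FS"
 shows "Rp A (sect FS s) \<in> sect FS ` carrier FS" unfolding Rp_def lsum_def
 by (intro psc.subspace_sum[OF subspace_S] psc.subspace_scale[OF subspace_S] opx_S assms)

lemma sect_ev_S: "t \<in> sect FS ` carrier FS ==> sect FS (ev FS t) = t" by (auto simp: ev_sect[OF FS_module])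

lemma Rp_tensor:
 assumes w: "w \<in> carrier M" and v: "v \<in> TP l"
 shows "Rp (loop_tensor x (pmono k 1)) (tn w v) = opb x k w v"
proof -
 have "Rp (loop_tensor x (pmono k 1)) (tn w v) =
  (\<Sum>a\<in>UNIV. \<Sum>b\<in>UNIV. psc (x $ a $ b) (opb (eu a b) k w v))"
  unfolding Rp_def by (simp add: loop_tensor_def mult_single lsum_single opx_tn[OF w v] del: map_single)
 also have "... = (\<Sum>a\<in>UNIV. \<Sum>b\<in>UNIV. \<Sum>j<l. tn (wact w (ywd j k)) (%c. x $ a $ b * slot (eu a b) j v c))"
  unfolding opb_def psc.scale_sum_right
  by (intro sum.cong refl) (simp add: tn_scale wact_ywd w slot_closed[OF v] del: tpow_simps)
 also have "... = (\<Sum>j<l. \<Sum>a\<in>UNIV. \<Sum>b\<in>UNIV. tn (wact w (ywd j k)) (%c. x $ a $ b * slot (eu a b) j v c))"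
  by (subst sum.swap[of _ "{..<l}"], subst sum.swap) (rule refl)
 also have "... = opb x k w v" unfolding opb_def
 proof (intro sum.cong refl)
  fix j assume "j \<in> {..<l}"
  hence W: "wact w (ywd j k) \<in> carrier M" by (intro wact_ywd w) auto
  have s0: "slot (eu a b) j v c = 0" if "length c ~= l" for a b c using slot_closed[OF v, of "eu a b" j] that by simp
  have 1: "(%c. x $ a $ b * slot (eu a b) j v c) \<in> TP l" for a b by (simp add: s0)
  have 2: "(%c. \<Sum>b\<in>UNIV. x $ a $ b * slot (eu a b) j v c) \<in> TP l" for a by (simp add: s0)
  show "(\<Sum>a\<in>UNIV. \<Sum>b\<in>UNIV. tn (wact w (ywd j k)) (%c. x $ a $ b * slot (eu a b) j v c)) =
  tn (wact w (ywd j k)) (slot x j v)" unfolding slot_expand[of x] tn_sum[OF W 2] tn_sum[OF W 1] ..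
 qed
 finally show ?thesis .
qed

definition rho0 :: "('m, 'n::finite) loop => ('a, 'n) bal_tensor => ('a, 'n) bal_tensor"
 where "rho0 = (\<lambda>A\<in>carrier loop_alg. \<lambda>s\<in>carrier FS. ev FS (Rp A (sect FS s)))"

lemma rho0: "trace A = 0 ==> s \<in> carrier FS ==> rho0 A s = ev FS (Rp A (sect FS s))" by (simp add: rho0_def)

lemma sect_rho0: "trace A = 0 ==> s \<in> carrier FS ==> sect FS (rho0 A s) = Rp A (sect FS s)"
 by (simp add: rho0 sect_ev_S Rp_S)

lemma rho0_structure: "loop_structure l E (rho0 :: ('m, 'n::finite) loop => _)" unfolding loop_structure_def
proof (intro conjI allI ballI)
 let ?FS = "FS :: (complex, ('a, 'n) bal_tensor) module"
 interpret Module.module CC ?FS by (rule FS_module)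
 note ec = ev_closed[OF FS_module]
 show "rho0 \<in> carrier loop_alg \<rightarrow>\<^sub>E carrier ?FS \<rightarrow>\<^sub>E carrier FS"
  unfolding rho0_def by (auto simp: PiE_def intro: ec)
 show "lie_module loop_alg FS (rho0 :: ('m, 'n::finite) loop => _)"
 proof (unfold_locales, goal_cases)
  case (1 x v)
  thus ?case by (simp add: rho0 ec)
 next
  case (2 x u v)
  thus ?case by (simp add: rho0 sect_add[OF FS_module] Rp_add ev_add[OF FS_module])
 next
  case (3 x v c)
  thus ?case by (simp add: rho0 sect_smult[OF FS_module] Rp_psc ev_psc[OF FS_module])
 next
  case (4 x y v)
  thus ?case by (simp add: rho0 Rp_l_add ev_add[OF FS_module] trace_loop)
 next
  case (5 x v c)
  thus ?case by (simp add: rho0 Rp_l_scale ev_psc[OF FS_module] trace_loop)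
 next
  case (6 x y v)
  hence "rho0 (x ** y - y ** x) v = ev FS (Rp x (Rp y (sect FS v))) \<ominus>\<^bsub>FS\<^esub> ev FS (Rp y (Rp x (sect FS v)))"
  by (simp add: rho0 trace_loop_bracket Rp_bracket ev_diff[OF FS_module])
  also have "ev FS (Rp x (Rp y (sect FS v))) = rho0 x (rho0 y v)" using 6 by (simp add: rho0 ec sect_ev_S Rp_S)
  also have "ev FS (Rp y (Rp x (sect FS v))) = rho0 y (rho0 x v)" using 6 by (simp add: rho0 ec sect_ev_S Rp_S)
  finally show ?case by simp
 qed
 fix i :: 'm and x :: "complex ^ 'n ^ 'n" and p :: int and w v
 assume x: "x \<in> carrier sl" and w: "w \<in> carrier M" and v: "v \<in> carrier (tpow l :: (complex, 'n tensor) module)"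
 have "rho0 (loop_tensor x (tvar i p)) (tens l E w v) = ev FS (opb x (axis i p) w v)"
  using x Rp_tensor[OF w v, of x "axis i p"] tens_closed[OF w v] by (simp add: rho0 trace_loop_tensor tvar_def tn_def)
 also have "opb x (axis i p) w v = (\<Sum>j<l. sect FS (tens l E (snd E w (y_el l i j [^]\<^bsub>Aff l\<^esub> p)) (slot x j v)))"
  unfolding opb_def tn_def
 proof (intro sum.cong refl)
  fix j assume "j \<in> {..<l}"
  hence j: "j < l" by simp
  have "wact w (ywd j (axis i p)) = snd E w (y_el l i j [^]\<^bsub>Aff l\<^esub> p)"
  using wact_weq[OF ywd_axis[OF j], of w i p] by (simp only: y_el_pow[OF j] wact_def)
  thus "sect FS (tens l E (wact w (ywd j (axis i p))) (slot x j v)) =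
  sect FS (tens l E (snd E w (y_el l i j [^]\<^bsub>Aff l\<^esub> p)) (slot x j v))" by simp
 qed
 also have "ev FS ... = (\<Oplus>\<^bsub>FS\<^esub>j\<in>{..<l}. tens l E (snd E w (y_el l i j [^]\<^bsub>Aff l\<^esub> p)) (slot x j v))"
 proof (rule ev_finsum[OF FS_module])
  fix j assume "j \<in> {..<l}"
  hence j: "j < l" by simp
  have "snd E w (y_el l i j [^]\<^bsub>Aff l\<^esub> p) \<in> carrier M"
  unfolding y_el_pow[OF j] using ypw_vw[OF j] by (intro R.ract_closed w aff_class_closed) simp
  thus "tens l E (snd E w (y_el l i j [^]\<^bsub>Aff l\<^esub> p)) (slot x j v) \<in> carrier FS"
  by (intro tens_closed slot_closed v)
 qed
 finally show "rho0 (loop_tensor x (tvar i p)) (tens l E w v) =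
  (\<Oplus>\<^bsub>FS\<^esub>j\<in>{..<l}. tens l E (snd E w (y_el l i j [^]\<^bsub>Aff l\<^esub> p)) (slot x j v))" .
qed

lemma loop_structure_unique:
 fixes \<rho> :: "('m, 'n::finite) loop => ('a, 'n) bal_tensor => ('a, 'n) bal_tensor"
 assumes two: "EX p q :: 'n. p ~= q" and \<rho>: "loop_structure l E \<rho>" and \<sigma>: "loop_structure l E \<sigma>"
 shows "\<rho> = \<sigma>"
proof -
 have R: "\<rho> \<in> carrier loop_alg \<rightarrow>\<^sub>E carrier FS \<rightarrow>\<^sub>E carrier FS" "lie_module loop_alg FS \<rho>"
  and S: "\<sigma> \<in> carrier loop_alg \<rightarrow>\<^sub>E carrier FS \<rightarrow>\<^sub>E carrier FS" "lie_module loop_alg FS \<sigma>"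
  using \<rho> \<sigma> unfolding loop_structure_def by blast+
 interpret R: lie_module loop_alg FS \<rho> by (rule R)
 interpret S: lie_module loop_alg FS \<sigma> by (rule S)
 have gen: "\<rho> (eL p q (tvar i a)) v = \<sigma> (eL p q (tvar i a)) v" if pq: "p ~= q" and v: "v \<in> carrier FS" for p q i a v
 proof -
  have t: "trace (eu p q :: complex ^ 'n ^ 'n) = 0" by (rule trace_eu[OF pq])
  have A: "eL p q (tvar i a) \<in> carrier loop_alg" using pq by (simp add: trace_eL)
  show ?thesis using v
  proof (induction v rule: FS_induct)
  case zero
  have "\<rho> (eL p q (tvar i a)) \<zero>\<^bsub>FS\<^esub> = \<zero>\<^bsub>FS\<^esub>" "\<sigma> (eL p q (tvar i a)) \<zero>\<^bsub>FS\<^esub> = \<zero>\<^bsub>FS\<^esub>"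
  using R.act_r_add[OF A, of "\<zero>\<^bsub>FS\<^esub>" "\<zero>\<^bsub>FS\<^esub>"] S.act_r_add[OF A, of "\<zero>\<^bsub>FS\<^esub>" "\<zero>\<^bsub>FS\<^esub>"]
  R.act_closed[OF A, of "\<zero>\<^bsub>FS\<^esub>"] S.act_closed[OF A, of "\<zero>\<^bsub>FS\<^esub>"] by simp_all
  thus ?case by simp
  next
  case (tens w v)
  thus ?case using \<rho> \<sigma> t unfolding loop_structure_def loop_tensor_eu[symmetric] by auto
  next
  case (add x y)
  thus ?case using R.act_r_add[OF A, of x y] S.act_r_add[OF A, of x y] by simp
  qed
 qed
 have eq: "\<rho> A v = \<sigma> A v" if "trace A = 0" "v \<in> carrier FS" for A v
  using lie_hom_from_generators[OF R(2) S(2) two, of "%v. v", OF _ _ _ gen that] by blast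
 show ?thesis
 proof (rule PiE_ext[OF R(1) S(1)])
  fix A :: "('m, 'n) loop" assume A: "A \<in> carrier loop_alg"
  show "\<rho> A = \<sigma> A" by (rule PiE_ext[OF PiE_mem[OF R(1) A] PiE_mem[OF S(1) A]]) (use eq A in auto)
 qed
qed

lemma F_obj_eq:
 assumes two: "EX p q :: 'n::finite. p ~= q"
 shows "F_obj l E = (FS, rho0 :: ('m, 'n) loop => _)"
 unfolding F_obj_def using loop_structure_unique[OF two _ rho0_structure] by (auto intro!: the_equality rho0_structure)

end

section \<open>Sorting words and the Coxeter relations\<close>

text \<open>The positions of the adjacent transpositions that move the letter \<open>c\<close> of \<open>a\<close> to the end, and then sort the rest.
The target is the reversal of \<open>c # cs\<close>.\<close>

fun srt :: "'n list => 'n list => nat list" where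
 "srt [] a = []"
| "srt (c # cs) a = [length (takeWhile (%x. x ~= c) a)..<length cs] @ srt cs (remove1 c a)"

lemma srt_split:
 assumes "c \<notin> set xs"
 shows "srt (c # cs) (xs @ c # ys) = [length xs..<length cs] @ srt cs (xs @ ys)"
proof -
 have "takeWhile (%x. x ~= c) (xs @ c # ys) = xs" using assms by (induction xs) auto
 thus ?thesis using assms by (simp add: remove1_append)
qed

lemma swp_split: "swp (length us) (us @ x # y # vs) = us @ y # x # vs" by (simp add: swp_def nth_append list_update_append)

lemma split_at:
 assumes "k + 1 < length a"
 obtains us x y vs where "a = us @ x # y # vs" "length us = k"
proof
 show "a = take k a @ a ! k # a ! Suc k # drop (Suc (Suc k)) a" using assms by (simp add: Cons_nth_drop_Suc)
 show "length (take k a) = k" using assms by simp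
qed

lemma far_commw:
 assumes "!!i j. i \<in> set us ==> j \<in> set vs ==> (i + 1 < j & j + 1 < l) \<or> (j + 1 < i & i + 1 < l)"
  and "vw l (map Sig us :: 'm gen list)" "vw l (map Sig vs :: 'm gen list)"
 shows "weq l (map Sig us @ map Sig vs) (map Sig vs @ map Sig us :: 'm gen list)"
proof -
 have "commw l (map Sig us) (map Sig vs :: 'm gen list)"
 proof (rule commw_letters)
  fix g h :: "'m gen" assume "g \<in> set (map Sig us)" "h \<in> set (map Sig vs)"
  then obtain i j where g: "g = Sig i" "i \<in> set us" and h: "h = Sig j" "j \<in> set vs" by auto
  from assms(1)[OF g(2) h(2)] show "commw l [g] [h]"
  proof
  assume "i + 1 < j & j + 1 < l"
  thus ?thesis using weq_rel[OF aff_rel.far[of i j l]] by (simp add: commw_def g h)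
  next
  assume "j + 1 < i & i + 1 < l"
  thus ?thesis using weq_sym[OF weq_rel[OF aff_rel.far[of j i l]]] by (simp add: commw_def g h)
  qed
 qed (use assms in auto)
 thus ?thesis by (simp add: commw_def)
qed

lemma vw_Sig: "vw l (map Sig ks) \<longleftrightarrow> (ALL k:set ks. k + 1 < l)" by (simp add: vw_def)

lemma braid_move:
 assumes p: "p <= k" "k + 1 < n" "n < l"
 shows "weq l (map Sig (Suc k # [p..<n])) (map Sig ([p..<n] @ [k]) :: 'm gen list)"
proof -
 have "[p..<n] = [p..<k] @ [k..<n]" using p upt_add_eq_append[of p k "n - k"] by simp
 moreover have "[k..<n] = k # Suc k # [Suc (Suc k)..<n]" using p by (simp add: upt_conv_Cons)
 ultimately have u: "[p..<n] = [p..<k] @ [k, Suc k] @ [Suc (Suc k)..<n]" by simp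
 let ?A = "map Sig [p..<k] :: 'm gen list" and ?B = "map Sig [Suc (Suc k)..<n] :: 'm gen list"
 have v: "vw l ?A" "vw l ?B" "vw l (map Sig [Suc k] :: 'm gen list)" "vw l (map Sig [k] :: 'm gen list)"
  using p by (auto simp: vw_Sig)
 have "weq l ((map Sig [Suc k] @ ?A) @ [Sig k, Sig (Suc k)] @ ?B) ((?A @ map Sig [Suc k]) @ [Sig k, Sig (Suc k)] @ ?B)"
  by (rule weq_app_r[OF far_commw]) (use v p in auto)
 also have "weq l ((?A @ map Sig [Suc k]) @ [Sig k, Sig (Suc k)] @ ?B) (?A @ [Sig k, Sig (Suc k), Sig k] @ ?B)"
 proof -
  have "weq l [Sig (Suc k), Sig k, Sig (Suc k)] ([Sig k, Sig (Suc k), Sig k] :: 'm gen list)"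
  using weq_sym[OF weq_rel[OF aff_rel.braid[of k l]]] p by simp
  from weq_mid[OF this v(1,2)] show ?thesis by simp
 qed
 also have "weq l (?A @ [Sig k, Sig (Suc k), Sig k] @ ?B) ((?A @ [Sig k, Sig (Suc k)]) @ (?B @ map Sig [k]))"
 proof -
  have "weq l (map Sig [k] @ ?B) (?B @ map Sig [k])" by (rule far_commw) (use v p in auto)
  from weq_app_l[OF this, of "?A @ [Sig k, Sig (Suc k)]"] show ?thesis using v p by simp
 qed
 finally show ?thesis unfolding u by simp
qed

lemma srt_vw: "length cs <= l ==> vw l (map Sig (srt cs a))" by (induction cs arbitrary: a) (auto simp: vw_Sig)

lemma srt_letters: "k \<in> set (srt cs a) ==> Suc k < length cs" using srt_vw[of cs "length cs" a] by (simp add: vw_Sig)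

text \<open>The words \<open>srt cs a\<close> form a normal form of the symmetric group. The four cases are the positions of the
last letter \<open>c\<close> of the target: to the left of the exchanged letters (braid relation), one of them (cancellation or nothing), and
to their right (distant transpositions commute).\<close>

theorem srt_swp:
 assumes "distinct cs" "distinct a" "set a = set cs" "k + 1 < length cs" "length cs <= l"
 shows "weq l (map Sig (k # srt cs a)) (map Sig (srt cs (swp k a)) :: 'm gen list)" using assms
proof (induction cs arbitrary: a k)
 case (Cons c cs)
 let ?S = "map Sig :: nat list => 'm gen list"
 let ?n = "length cs"
 have len: "length a = Suc ?n" using Cons.prems distinct_card by (metis length_Cons)
 have n: "?n < l" and k: "k < ?n" using Cons.prems by auto
 obtain us x y vs where a: "a = us @ x # y # vs" and us: "length us = k"
 proof -
  have "k + 1 < length a" using len k by simp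
  then show thesis using that by (rule split_at)
 qed
 have sw: "swp k a = us @ y # x # vs" using swp_split[of us x y vs] us a by simp
 have d: "distinct (us @ x # y # vs)" using Cons.prems a by simp
 have "c \<in> set a" using Cons.prems by simp
 then consider "c \<in> set us" | "x = c" | "y = c" | "c \<in> set vs" using a by auto
 thus ?case
 proof cases
  case 1
  then obtain u1 u2 where u: "us = u1 @ c # u2" by (meson split_list)
  let ?b = "u1 @ u2 @ x # y # vs" and ?k = "length (u1 @ u2)"
  have c: "c \<notin> set u1" using d u by auto
  have k': "k = Suc ?k" using us u by simp
  have S1: "srt (c # cs) a = [length u1..<?n] @ srt cs ?b" using srt_split[OF c, of cs "u2 @ x # y # vs"] a u by simp
  have S2: "srt (c # cs) (swp k a) = [length u1..<?n] @ srt cs (swp ?k ?b)"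
  using srt_split[OF c, of cs "u2 @ y # x # vs"] sw u swp_split[of "u1 @ u2" x y vs] by simp
  have b: "distinct ?b" "set ?b = set cs" using d u a Cons.prems by auto
  have IH: "weq l (?S (?k # srt cs ?b)) (?S (srt cs (swp ?k ?b)))" using Cons.prems b k k' by (intro Cons.IH) auto
  have "weq l (?S (Suc ?k # [length u1..<?n]) @ ?S (srt cs ?b))
  (?S ([length u1..<?n] @ [?k]) @ ?S (srt cs ?b))"
  by (rule weq_app_r[OF braid_move]) (use k k' n in \<open>auto simp: vw_Sig dest: srt_letters\<close>)
  also have "weq l (?S ([length u1..<?n] @ [?k]) @ ?S (srt cs ?b))
  (?S [length u1..<?n] @ ?S (srt cs (swp ?k ?b)))" using weq_app_l[OF IH, of "?S [length u1..<?n]"] n by (simp add: vw_Sig)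
  finally show ?thesis unfolding S1 S2 by (simp add: k')
 next
  case 2
  have c: "c \<notin> set us" "c \<notin> set (us @ [y])" using d 2 by auto
  have S1: "srt (c # cs) a = k # [Suc k..<?n] @ srt cs (us @ y # vs)"
  using srt_split[OF c(1), of cs "y # vs"] a 2 us k by (simp add: upt_conv_Cons)
  have S2: "srt (c # cs) (swp k a) = [Suc k..<?n] @ srt cs (us @ y # vs)" using srt_split[OF c(2), of cs vs] sw 2 us by simp
  have "weq l ([Sig k, Sig k] @ ?S ([Suc k..<?n] @ srt cs (us @ y # vs))) ([] @ ?S ([Suc k..<?n] @ srt cs (us @ y # vs)))"
  by (rule weq_app_r[OF weq_rel[OF aff_rel.invol]])
  (use n k in \<open>auto simp: vw_Sig dest: srt_letters\<close>)
  thus ?thesis unfolding S1 S2 by simp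
 next
  case 3
  have c: "c \<notin> set us" "c \<notin> set (us @ [x])" using d 3 by auto
  have S1: "srt (c # cs) a = [Suc k..<?n] @ srt cs (us @ x # vs)" using srt_split[OF c(2), of cs vs] a 3 us by simp
  have S2: "srt (c # cs) (swp k a) = k # [Suc k..<?n] @ srt cs (us @ x # vs)"
  using srt_split[OF c(1), of cs "x # vs"] sw 3 us k by (simp add: upt_conv_Cons)
  show ?thesis unfolding S1 S2 by (rule weq_refl) (use n k in \<open>auto simp: vw_Sig dest: srt_letters\<close>)
 next
  case 4
  then obtain v1 v2 where v: "vs = v1 @ c # v2" by (meson split_list)
  let ?b = "us @ x # y # v1 @ v2"
  have c: "c \<notin> set (us @ x # y # v1)" "c \<notin> set (us @ y # x # v1)" using d v by auto
  let ?p = "length us + Suc (Suc (length v1))"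
  have S1: "srt (c # cs) a = [?p..<?n] @ srt cs ?b" using srt_split[OF c(1), of cs v2] a v by simp
  have S2: "srt (c # cs) (swp k a) = [?p..<?n] @ srt cs (swp k ?b)"
  using srt_split[OF c(2), of cs v2] sw v swp_split[of us x y "v1 @ v2"] us by simp
  have b: "distinct ?b" "set ?b = set cs" using d v a Cons.prems by auto
  have p: "k + 2 <= ?p" "?p <= ?n" using us len a v by auto
  have IH: "weq l (?S (k # srt cs ?b)) (?S (srt cs (swp k ?b)))" using Cons.prems b p by (intro Cons.IH) auto
  have "weq l ((?S [k] @ ?S [?p..<?n]) @ ?S (srt cs ?b)) ((?S [?p..<?n] @ ?S [k]) @ ?S (srt cs ?b))"
  by (rule weq_app_r[OF far_commw]) (use p n in \<open>auto simp: vw_Sig dest: srt_letters\<close>)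
  also have "weq l ((?S [?p..<?n] @ ?S [k]) @ ?S (srt cs ?b)) (?S [?p..<?n] @ ?S (srt cs (swp k ?b)))"
  using weq_app_l[OF IH, of "?S [?p..<?n]"] n by (simp add: vw_Sig)
  finally show ?thesis unfolding S1 S2 by simp
 qed
qed simp

lemma srt_self: "distinct cs ==> srt cs (rev cs) = []"
proof (induction cs)
 case (Cons c cs)
 thus ?case using srt_split[of c "rev cs" cs "[]"] by simp
qed simp

lemma foldr_swp_move: "foldr swp [length xs..<length xs + length ys] (xs @ ys @ c # zs) = xs @ c # ys @ zs"
proof (induction ys arbitrary: zs rule: rev_induct)
 case (snoc y ys)
 have "swp (length (xs @ ys)) ((xs @ ys) @ y # c # zs) = (xs @ ys) @ c # y # zs" by (rule swp_split)
 thus ?case using snoc[of "y # zs"] by simp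
qed simp

lemma foldr_swp_append:
 assumes "ALL k:set ks. k + 1 < length a"
 shows "length (foldr swp ks a) = length a" "foldr swp ks (a @ zs) = foldr swp ks a @ zs" using assms
proof (induction ks)
 case (Cons k ks)
 { case 1 thus ?case using Cons by simp }
 { case 2
  hence "length (foldr swp ks a) = length a" "k + 1 < length a" using Cons by auto
  thus ?case using Cons 2 by (simp add: swp_def nth_append list_update_append) }
qed simp_all

lemma foldr_swp_srt:
 assumes "distinct cs" "distinct a" "set a = set cs"
 shows "foldr swp (srt cs a) (rev cs) = a" using assms
proof (induction cs arbitrary: a)
 case (Cons c cs)
 have "c \<in> set a" using Cons.prems by simp
 then obtain xs ys where a: "a = xs @ c # ys" by (meson split_list)
 have c: "c \<notin> set xs" using Cons.prems a by auto
 have len: "length a = Suc (length cs)" using Cons.prems distinct_card by (metis length_Cons)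
 have "set (xs @ ys) = set cs" "distinct (xs @ ys)" using Cons.prems a by auto
 hence IH: "foldr swp (srt cs (xs @ ys)) (rev cs) = xs @ ys" using Cons by simp
 have "ALL k:set (srt cs (xs @ ys)). k + 1 < length (rev cs)" by (auto dest: srt_letters)
 from foldr_swp_append(2)[OF this] have "foldr swp (srt cs (xs @ ys)) (rev (c # cs)) = xs @ ys @ c # []" by (simp add: IH)
 thus ?case using foldr_swp_move[of xs ys c "[]"] len unfolding a srt_split[OF c] foldr_append by simp
qed simp

definition bv :: "'n list => 'n tensor"
 where "bv a = (%c. if c = a then 1 else 0)"

lemma bv_closed: "length a = l ==> bv a \<in> TP l" by (auto simp: bv_def)

lemma swap_bv: "k + 1 < length a ==> swap k (bv a) = bv (swp k a)"
proof
 fix c assume k: "k + 1 < length a"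
 have "swp k c = a \<longleftrightarrow> c = swp k a" using k by (metis length_swp swp_swp)
 thus "swap k (bv a) c = bv (swp k a) c" by (simp add: swap_swp bv_def)
qed

lemma foldr_swap_bv:
 assumes "ALL k:set ks. k + 1 < length a"
 shows "foldr swap ks (bv a) = bv (foldr swp ks a)" using assms
proof (induction ks)
 case (Cons k ks)
 have "length (foldr swp ks a) = length a" by (rule foldr_swp_append(1)) (use Cons.prems in auto)
 thus ?case using Cons by (simp add: swap_bv)
qed simp

context affm
begin

lemma tn_words:
 assumes "w \<in> carrier M" "v \<in> TP l" "ALL k:set ks. k + 1 < l"
 shows "tn (wact w (map Sig ks)) v = tn w (foldr swap ks v)" using assms
proof (induction ks arbitrary: w)
 case Nil
 thus ?case by (simp add: wact_Nil)
next
 case (Cons k ks)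
 have cl: "foldr swap ks v \<in> TP l" using Cons.prems(2) by (induction ks) (auto intro: swap_closed simp del: tpow_simps)
 have "wact w (map Sig (k # ks)) = wact (wact w [Sig k]) (map Sig ks)"
  using wact_append[of w "[Sig k]" "map Sig ks"] Cons.prems by (simp add: vw_Sig)
 moreover have "wact w [Sig k] \<in> carrier M" using Cons.prems by (intro wact_closed) auto
 ultimately show ?case using Cons tn_sig[OF Cons.prems(1) cl, of k] by simp
qed

context
 fixes b :: "'n::finite list"
 assumes b: "distinct b" "length b = l"
begin

lemma tn_perm:
 assumes w: "w \<in> carrier M" and a: "length a = l" "set a = set b"
 shows "tn w (bv a) = tn (wact w (map Sig (srt (rev b) a))) (bv b)"
proof -
 have "distinct a" using a b card_distinct distinct_card by metis
 hence f: "foldr swp (srt (rev b) a) b = a" using foldr_swp_srt[of "rev b" a] b a by simp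
 have "ALL k:set (srt (rev b) a). k + 1 < l" using b by (auto dest: srt_letters)
 thus ?thesis using tn_words[OF w bv_closed[OF b(2)]] foldr_swap_bv[of "srt (rev b) a" b] f b by simp
qed

text \<open>The map \<open>w \<otimes> e\<^sub>a \<mapsto> w \<sigma>\<close>, with \<open>\<sigma>\<close> sorting \<open>a\<close> if \<open>a\<close> is a permutation of \<open>b\<close> and zero otherwise, is balanced by
\<open>srt_swp\<close> and sends \<open>w \<otimes> e\<^sub>b\<close> to \<open>w\<close>.\<close>

theorem tens_basis_inj:
 assumes w: "w \<in> carrier M" "w' \<in> carrier M" and eq: "tens l E w (bv b) = tens l E w' (bv b)"
 shows "w = w'"
proof -
 define P where "P = {a. length a = l & set a = set b}"
 have "finite P" unfolding P_def by (rule finite_subset[OF _ finite_words[of l]]) auto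
 define g where "g w a = sect Mv (wact w (map Sig (srt (rev b) a)))" for w a
 have vs: "vw l (map Sig (srt (rev b) a) :: 'm gen list)" for a using b by (intro srt_vw) simp
 have "EX h. (ALL x y. h (x + y) = h x + h y) & (ALL c x. h (psc c x) = psc c (h x)) &
  (ALL w:carrier M. ALL v:TP l. h (tn w v) = (\<Sum>a\<in>P. psc (v a) (g w a)))"
 proof (rule tens_ext, goal_cases)
  case (1 w w' v)
  thus ?case unfolding g_def sum.distrib[symmetric] psc.scale_right_distrib[symmetric]
  using sect_add[OF Mv_module] by (simp add: wact_add vs wact_closed)
 next
  case (2 w v v')
  thus ?case by (simp add: psc.scale_left_distrib sum.distrib)
 next
  case (3 w v c)
  thus ?case by (simp only: psc.scale_scale[symmetric] psc.scale_sum_right)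
 next
  case (4 w v c)
  have "g (csm c w) a = psc c (g w a)" for a
  unfolding g_def using 4 sect_smult[OF Mv_module, of "wact w (map Sig (srt (rev b) a))" c]
  by (simp add: csm_wact(1) csm_wact(2)[symmetric] vs wact_closed)
  thus ?case by (simp only: psc.scale_sum_right psc.scale_scale mult.commute)
 next
  case (5 w v k)
  have s: "g (wact w [Sig k]) a = g w (swp k a)" if "a \<in> P" for a
  proof -
  have "distinct a" using that b card_distinct distinct_card unfolding P_def by (metis (mono_tags) mem_Collect_eq)
  hence "weq l (map Sig (k # srt (rev b) a)) (map Sig (srt (rev b) (swp k a)) :: 'm gen list)"
  using that b 5 by (intro srt_swp) (auto simp: P_def)
  from wact_weq[OF this] show ?thesis using wact_append[of w "[Sig k]" "map Sig (srt (rev b) a)"] 5 vs by (simp add: g_def)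
  qed
  have sP: "swp k a \<in> P" "swp k (swp k a) = a" if "a \<in> P" for a using that 5 by (auto simp: P_def)
  have "(\<Sum>a\<in>P. psc (v a) (g (wact w [Sig k]) a)) = (\<Sum>a\<in>P. psc (v a) (g w (swp k a)))"
  using s by (intro sum.cong) auto
  also have "... = (\<Sum>a\<in>P. psc (swap k v a) (g w a))"
  by (rule sum.reindex_bij_witness[of _ "swp k" "swp k"]) (auto simp: sP swap_swp)
  finally show ?case .
 qed
 then obtain h where h: "!!w v. w \<in> carrier M ==> v \<in> TP l ==> h (tn w v) = (\<Sum>a\<in>P. psc (v a) (g w a))"
  by blast
 have "h (tn w (bv b)) = sect Mv w" if w: "w \<in> carrier M" for w
 proof -
  have bP: "b \<in> P" using b by (simp add: P_def)
  have "srt (rev b) b = []" using srt_self[of "rev b"] b by simp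
  hence gb: "g w b = sect Mv w" by (simp add: g_def wact_Nil w)
  have "h (tn w (bv b)) = (\<Sum>a\<in>P. psc (bv b a) (g w a))" by (rule h[OF w bv_closed[OF b(2)]])
  also have "... = (\<Sum>a\<in>P. if a = b then g w b else 0)" by (intro sum.cong refl) (auto simp: bv_def psc.scale_one)
  finally show ?thesis using bP \<open>finite P\<close> gb by simp
 qed
 hence "sect Mv w = sect Mv w'" using w eq by (metis tn_def)
 thus ?thesis using sect_inj[OF Mv_module] w by simp
qed

end

end

section \<open>The right module of weight vectors\<close>

lemma loop_tensor_lin: "loop_tensor (x + y) f = loop_tensor x f + loop_tensor y f"
  "loop_tensor (x - y) f = loop_tensor x f - loop_tensor y f"
  "loop_tensor 0 f = 0"
  "loop_tensor (\<chi> a b. c * x $ a $ b) f = (\<chi> a b. pmono 0 c * loop_tensor x f $ a $ b)"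
 by (simp_all add: loop_tensor_def vec_eq_iff single_add single_diff distrib_right left_diff_distrib
  mult_single mult.assoc[symmetric])

lemma res_sl_module:
 fixes \<rho> :: "('m::finite, 'n::finite) loop => 'v => 'v"
 assumes "lie_module loop_alg N \<rho>"
 shows "lie_module sl N (%x. \<rho> (loop_tensor x 1))"
proof -
 interpret lie_module loop_alg N \<rho> by (rule assms)
 show ?thesis
 proof (unfold_locales, goal_cases)
  case (6 x y v)
  have "loop_tensor x (1 :: 'm laurent) \<otimes>\<^bsub>loop_alg\<^esub> loop_tensor y 1 = loop_tensor (x \<otimes>\<^bsub>sl\<^esub> y) (1 * 1)"
  by (rule loop_bracket_tensor)
  thus ?case using act_bracket[of "loop_tensor x 1" "loop_tensor y 1" v] 6 by (simp add: trace_loop_tensor)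
 next
  case (4 x y v)
  thus ?case using act_l_add[of "loop_tensor x 1" "loop_tensor y 1" v] by (simp add: trace_loop_tensor loop_tensor_lin)
 next
  case (5 x v c)
  thus ?case using act_l_smult[of "loop_tensor x 1" v c] by (simp add: trace_loop_tensor loop_tensor_lin)
 qed (auto simp: trace_loop_tensor act_closed act_r_add act_r_smult)
qed

locale loop_mod = lie_module loop_alg N \<rho>
 for N :: "(complex, 'v) module" (structure)
  and \<rho> :: "('m::finite, 'n::finite) loop => 'v => 'v" +
 fixes l :: nat and b :: "'n list" and z :: 'n
 assumes level: "level l (res_sl (N, \<rho>))"
  and b: "distinct b" "length b = l" and z: "z \<notin> set b"
begin

lemma res: "res_sl (N, \<rho>) = (N, %x. \<rho> (loop_tensor x 1))" by (simp add: res_sl_def)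

sublocale SL: sl_level N "%x. \<rho> (loop_tensor x 1)" l using res_sl_module[OF lie_module_axioms] level
 by (simp add: sl_level_def sl_module_def sl_level_axioms_def res)

definition Z :: "'n => 'n => int ^ 'm => 'v fvec => 'v fvec"
 where "Z p q k = T (loop_tensor (tl0 p q) (pmono k 1))"

lemma tlL: "loop_tensor (tl0 p q) f \<in> carrier loop_alg" by (simp add: trace_loop_tensor trace_tl0)

lemma T_zero_loop: "T 0 y = 0" using T_l_add[of 0 0 y] by (simp add: trace_loop)

lemma T_l_diff:
 assumes "A \<in> carrier loop_alg" "B \<in> carrier loop_alg"
 shows "T (A - B) y = T A y - T B y" using T_l_add[of "A - B" B y] assms by (simp add: trace_loop)

lemma Z_commute: "Z p q k (Z c d k' x) - Z c d k' (Z p q k x) =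
  (if q = c then Z p d (k + k') x else 0) - (if d = p then Z c q (k + k') x else 0)"
proof -
 let ?f = "pmono k 1 :: 'm laurent" and ?g = "pmono k' 1 :: 'm laurent"
 have fg: "?f * ?g = pmono (k + k') 1" by (simp add: mult_single)
 have "Z p q k (Z c d k' x) - Z c d k' (Z p q k x) =
  T (loop_tensor (tl0 p q) ?f \<otimes>\<^bsub>loop_alg\<^esub> loop_tensor (tl0 c d) ?g) x"
  unfolding Z_def by (rule T_bracket[symmetric]) (rule tlL)+
 also have "loop_tensor (tl0 p q) ?f \<otimes>\<^bsub>loop_alg\<^esub> loop_tensor (tl0 c d) ?g =
  loop_tensor ((if q = c then tl0 p d else 0) - (if d = p then tl0 c q else 0)) (pmono (k + k') 1)"
  unfolding loop_bracket_tensor fg using tl0_bracket[of p q c d] by simp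
 also have "T ... x = (if q = c then Z p d (k + k') x else 0) - (if d = p then Z c q (k + k') x else 0)"
  unfolding loop_tensor_lin Z_def
  by (subst T_l_diff) (auto simp: loop_tensor_lin T_zero_loop trace_loop trace_loop_tensor trace_tl0)
 finally show ?thesis .
qed

lemma loop_level_Z: "loop_level psc SL.eop (sect N ` carrier N) l Z SL.rr"
proof (unfold_locales, goal_cases)
 case (1 a b k x y)
 show ?case unfolding Z_def by (rule T_add[OF tlL])
next
 case (2 a b k t x)
 show ?case unfolding Z_def by (rule T_psc[OF tlL])
next
 case (3 x a b k)
 show ?case unfolding Z_def T_def by (intro imageI act_closed tlL) (rule ev_closed[OF m])
next
 case (4 a b k c d k' x)
 show ?case by (rule Z_commute)
next
 case (5 a b x)
 show ?case unfolding Z_def SL.eop_def SL.T_def T_def by simp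
qed

sublocale LL: loop_level psc SL.eop "sect N ` carrier N" l Z SL.rr by (rule loop_level_Z)

abbreviation "JJ \<equiv> SL.G.J b"

definition W where "W = wsp l (res_sl (N, \<rho>)) b"

lemma J_W: "JJ = sect N ` W" unfolding W_def res by (rule SL.J_sect)

lemma W_carrier: "u \<in> W ==> u \<in> carrier N" by (simp add: W_def wsp_def res)

lemma sect_W: "u \<in> W ==> sect N u \<in> JJ" unfolding J_W by (rule imageI)

lemma ev_JJ: "x \<in> JJ ==> ev N x \<in> W" "x \<in> JJ ==> sect N (ev N x) = x"
 unfolding J_W using ev_sect[OF m W_carrier] by auto

text \<open>The action of the generators on the weight space; words act from left to right, as for a right module.\<close>

fun gop :: "'m gen => 'v fvec => 'v fvec" where
 "gop (Sig k) u = SL.G.sg b k u"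
| "gop (gen.Y i j) u = LL.Y b z j (axis i 1) u"
| "gop (Yinv i j) u = LL.Y b z j (axis i (-1)) u"

definition wop :: "'m gen list => 'v fvec => 'v fvec"
 where "wop us u = fold gop us u"

lemma wop_simps: "wop [] u = u" "wop (g # us) u = wop us (gop g u)" "wop (us @ vs) u = wop vs (wop us u)"
 by (simp_all add: wop_def)

lemma gop_add: "gop g (u + v) = gop g u + gop g v" by (cases g) (simp_all add: SL.G.sg_def SL.E.e_add LL.Y_def LL.Z_add)

lemma gop_psc: "gop g (psc c u) = psc c (gop g u)"
 by (cases g) (simp_all only: gop.simps SL.G.sg_def SL.E.e_scale LL.Y_def LL.Z_scale psc.scale_right_diff_distrib)

lemma wop_add: "wop us (u + v) = wop us u + wop us v" by (induction us arbitrary: u v) (simp_all add: wop_simps gop_add)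

lemma wop_psc: "wop us (psc c u) = psc c (wop us u)" by (induction us arbitrary: u) (simp_all only: wop_simps gop_psc)

lemma gop_J: "u \<in> JJ ==> valid_gen l g ==> gop g u \<in> JJ" using SL.G.sg_J[OF b] LL.Y_J[OF b z] by (cases g) auto

lemma wop_J: "u \<in> JJ ==> vw l us ==> wop us u \<in> JJ" by (induction us arbitrary: u) (auto simp: wop_simps gop_J)

lemma wop_rel:
 assumes "aff_rel l us vs" and u: "u \<in> JJ"
 shows "wop us u = wop vs u" using assms(1)
proof (cases rule: aff_rel.cases)
 case (braid k)
 thus ?thesis using SL.G.sg_braid[OF b u, of k] by (simp add: wop_simps)
next
 case (far k j)
 thus ?thesis using SL.G.sg_far[OF b u, of k j] by (simp add: wop_simps)
next
 case (invol k)
 thus ?thesis using SL.G.sg_sg[OF b u, of k] by (simp add: wop_simps)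
next
 case (y_inv_r s i)
 have "axis i (-1) + axis i 1 = (0 :: int ^ 'm)" by (simp add: vec_eq_iff axis_def)
 thus ?thesis using y_inv_r LL.Y_mult[OF b z u, of s "axis i (-1)" "axis i 1"] LL.Y_zero[OF b z u, of s]
  by (simp add: wop_simps)
next
 case (y_inv_l s i)
 have "axis i 1 + axis i (-1) = (0 :: int ^ 'm)" by (simp add: vec_eq_iff axis_def)
 thus ?thesis using y_inv_l LL.Y_mult[OF b z u, of s "axis i 1" "axis i (-1)"] LL.Y_zero[OF b z u, of s]
  by (simp add: wop_simps)
next
 case (y_comm s p i)
 thus ?thesis by (simp add: wop_simps LL.Y_comm)
next
 case (y_sig_far s k i)
 thus ?thesis using LL.Y_sg[OF b z u, of k s] by (simp add: wop_simps tr_def)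
next
 case (y_sig k i)
 have "LL.Y b z (k + 1) (axis i 1) u \<in> JJ" by (rule LL.Y_J[OF b z u])
 thus ?thesis using y_sig LL.Y_sg[OF b z u, of k k] SL.G.sg_sg[OF b, of "LL.Y b z (k + 1) (axis i 1) u" k]
  by (simp add: wop_simps tr_def)
next
 case (y_prod i i')
 have "wop (map (gen.Y i) xs) (gop (gen.Y i' 0) u) = gop (gen.Y i' 0) (wop (map (gen.Y i) xs) u)" for xs u
 proof (induction xs arbitrary: u)
  case (Cons a xs)
  have "gop (gen.Y i a) (gop (gen.Y i' 0) u) = gop (gen.Y i' 0) (gop (gen.Y i a) u)" unfolding gop.simps by (rule LL.Y_comm)
  thus ?case using Cons.IH[of "gop (gen.Y i a) u"] by (simp only: list.map wop_simps)
 qed (simp add: wop_simps)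
 thus ?thesis using y_prod by (simp add: wop_simps)
next
 case (y_mixed i' i)
 thus ?thesis by (simp add: wop_simps LL.Y_comm)
qed

definition pact :: "'m free_alg => 'v fvec => 'v fvec"
 where "pact p u = lsum (%us. wop (letters us) u) p"

lemma pact_add: "pact (p + q) u = pact p u + pact q u"
 and pact_diff: "pact (p - q) u = pact p u - pact q u"
 and pact_zero: "pact 0 u = 0"
 and pact_single: "pact (pmono us c) u = psc c (wop (letters us) u)"
 by (simp_all add: pact_def lsum_add lsum_diff lsum_zero lsum_single)

lemma pact_r_add: "pact p (u + v) = pact p u + pact p v" by (simp add: pact_def wop_add lsum_f_add)

lemma pact_r_psc: "pact p (psc c u) = psc c (pact p u)" by (simp only: pact_def wop_psc lsum_f_psc)

lemma pact_word: "pact (word us) u = wop us u" by (simp add: word_def pact_single)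

lemma pact_mult: "pact (p * q) u = pact q (pact p u)"
proof (induction p rule: keys_induct)
 case zero
 have "pact q 0 = 0" using pact_r_psc[of q 0 0] by simp
 thus ?case by (simp add: pact_zero)
next
 case (add p p')
 thus ?case by (simp add: distrib_right pact_add pact_r_add)
next
 case (single us c)
 show ?case
 proof (induction q rule: keys_induct)
  case (single vs d)
  show ?case by (simp only: mult_single pact_single letters_plus wop_simps wop_psc psc.scale_scale mult.commute)
 qed (simp_all add: pact_zero distrib_left pact_add)
qed

lemma pact_one: "pact 1 u = u" using pact_word[of "[]" u] by (simp add: word_Nil wop_simps)

lemma pact_J:
 assumes u: "u \<in> JJ" and p: "p \<in> FA l"
 shows "pact p u \<in> JJ" unfolding pact_def lsum_def
 by (intro psc.subspace_sum[OF SL.G.subspace_J] psc.subspace_scale[OF SL.G.subspace_J] wop_J u)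
  (use p in \<open>auto simp: free_alg_carrier vw_def\<close>)

text \<open>The elements that act as zero form an ideal, which contains the relations.\<close>

lemma pact_ideal:
 assumes p: "p \<in> aff_ideal l" and u: "u \<in> JJ"
 shows "pact p u = 0"
proof -
 let ?K = "{p \<in> FA l. ALL u:JJ. pact p u = 0}"
 have "ideal ?K (free_alg l)"
 proof (rule idealI[OF free_alg_ring])
  have "pact (- q) u = - pact q u" for q u using pact_diff[of 0 q u] by (simp add: pact_zero)
  moreover have "\<ominus>\<^bsub>free_alg l\<^esub> q = - q" if "q \<in> FA l" for q :: "'m free_alg"
  proof -
  interpret ring "free_alg l" by (rule free_alg_ring)
  show ?thesis using that by (intro minus_equality) (auto intro: free_alg_closed)
  qed
  ultimately have inv: "\<ominus>\<^bsub>free_alg l\<^esub> q \<in> ?K" if "q \<in> ?K" for q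
  using that by (auto simp: free_alg_closed)
  show "subgroup ?K (add_monoid (free_alg l))"
  proof (rule subgroup.intro)
  fix q assume "q \<in> ?K"
  thus "inv\<^bsub>add_monoid (free_alg l)\<^esub> q \<in> ?K" unfolding a_inv_def[symmetric] by (rule inv)
  qed (auto simp: pact_add pact_zero free_alg_closed free_alg_const)
  fix q x :: "'m free_alg" assume q: "q \<in> ?K" and x: "x \<in> FA l"
  have "pact x 0 = 0" using pact_r_psc[of x 0 0] by simp
  thus "x \<otimes>\<^bsub>free_alg l\<^esub> q \<in> ?K" "q \<otimes>\<^bsub>free_alg l\<^esub> x \<in> ?K"
  using q x pact_J[OF _ x] by (auto simp: pact_mult free_alg_closed)
 qed
 moreover have "{word u - word v | u v. aff_rel l u v} <= ?K"
  using wop_rel aff_rel_vw by (fastforce simp: pact_diff pact_word intro: free_alg_closed(4))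
 ultimately have "aff_ideal l <= ?K" unfolding aff_ideal_def by (rule ring.genideal_minimal[OF free_alg_ring])
 thus ?thesis using p u by auto
qed

definition ract :: "'v => 'm aff => 'v"
 where "ract u A = ev N (pact (SOME p. p \<in> FA l & A = aff_class l p) (sect N u))"

lemma sect_ract:
 assumes u: "u \<in> W" and p: "p \<in> FA l"
 shows "sect N (ract u (aff_class l p)) = pact p (sect N u)" "ract u (aff_class l p) = ev N (pact p (sect N u))"
  "ract u (aff_class l p) \<in> W"
proof -
 define q where "q = (SOME q. q \<in> FA l & aff_class l p = aff_class l q)"
 have "EX q. q \<in> FA l & aff_class l p = aff_class l q" using p by blast
 hence q: "q \<in> FA l" "aff_class l p = aff_class l q" unfolding q_def by (metis (mono_tags, lifting) someI_ex)+
 have "pact (p - q) (sect N u) = 0" by (rule pact_ideal) (use aff_class_eq_iff[OF p q(1)] q sect_W[OF u] in auto)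
 hence "pact q (sect N u) = pact p (sect N u)" by (simp add: pact_diff)
 then show r: "ract u (aff_class l p) = ev N (pact p (sect N u))" by (simp add: ract_def q_def[symmetric])
 show "sect N (ract u (aff_class l p)) = pact p (sect N u)" "ract u (aff_class l p) \<in> W"
  unfolding r by (intro ev_JJ pact_J sect_W u p)+
qed

definition Gring :: "'v ring"
 where "Gring = \<lparr>carrier = W, mult = undefined, one = undefined, zero = \<zero>, add = add N\<rparr>"

lemma Gring_simps [simp]: "carrier Gring = W" "x \<oplus>\<^bsub>Gring\<^esub> y = x \<oplus> y" "\<zero>\<^bsub>Gring\<^esub> = \<zero>"
 by (simp_all add: Gring_def)

lemma W_closed: "\<zero> \<in> W" "u \<in> W ==> v \<in> W ==> u \<oplus> v \<in> W" "u \<in> W ==> \<ominus> u \<in> W" "u \<in> W ==> c \<odot> u \<in> W"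
proof -
 have J: "x \<in> W" if "x \<in> carrier N" "sect N x \<in> JJ" for x
  using ev_JJ(1)[OF that(2)] ev_sect[OF m that(1)] by simp
 show "\<zero> \<in> W" using J[of \<zero>] psc.subspace_0[OF SL.G.subspace_J] by (simp add: sect_zero[OF m])
 show "u \<in> W ==> v \<in> W ==> u \<oplus> v \<in> W"
  using J[of "u \<oplus> v"] psc.subspace_add[OF SL.G.subspace_J sect_W sect_W, of u v]
  by (simp add: sect_add[OF m] W_carrier)
 show s: "u \<in> W ==> c \<odot> u \<in> W" for c u
  using J[of "c \<odot> u"] psc.subspace_scale[OF SL.G.subspace_J sect_W, of u c] by (simp add: sect_smult[OF m] W_carrier)
 show "u \<in> W ==> \<ominus> u \<in> W" using s[of u "-1"] by (simp add: minus_smult[OF m] W_carrier)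
qed

lemma Gring_right_module: "right_module (Aff l) Gring ract"
proof -
 interpret A: ring "Aff l :: 'm aff ring" by (rule Aff_ring)
 have ab: "abelian_group Gring"
 proof (rule abelian_groupI, goal_cases)
  case (6 x)
  thus ?case by (intro bexI[of _ "\<ominus> x"]) (auto simp: W_closed W_carrier l_neg)
 qed (auto simp: W_closed W_carrier a_ac)
 interpret G: abelian_group Gring by (rule ab)
 have in_eq: "u = v" if "u \<in> W" "v \<in> W" "sect N u = sect N v" for u v using that sect_inj[OF m] W_carrier by blast
 show ?thesis
 proof (unfold_locales, goal_cases)
  case (1 w a)
  thus ?case using Aff_carrier[of a l] sect_ract(3) by auto
 next
  case (2 w w' a)
  obtain p where p: "p \<in> FA l" "a = aff_class l p" using Aff_carrier[OF 2(3)] by blast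
  show ?case unfolding p(2)
  by (rule in_eq) (use 2 p in \<open>simp_all add: W_closed sect_ract(1) sect_ract(3) sect_add[OF m] W_carrier pact_r_add\<close>)
 next
  case (3 w a c)
  obtain p q where p: "p \<in> FA l" "a = aff_class l p" and q: "q \<in> FA l" "c = aff_class l q"
  using Aff_carrier 3 by meson
  show ?case unfolding p(2) q(2) aff_class_add[OF p(1) q(1), symmetric]
  by (rule in_eq) (use 3 p q in \<open>simp_all add: W_closed sect_ract(1) sect_ract(3) sect_add[OF m] W_carrier pact_add free_alg_closed\<close>)
 next
  case (4 w a c)
  obtain p q where p: "p \<in> FA l" "a = aff_class l p" and q: "q \<in> FA l" "c = aff_class l q"
  using Aff_carrier 4 by meson
  show ?case unfolding p(2) q(2) aff_class_mult[OF p(1) q(1), symmetric]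
  by (rule in_eq) (use 4 p q in \<open>simp_all add: W_closed sect_ract(1) sect_ract(3) W_carrier pact_mult free_alg_closed\<close>)
 next
  case (5 w)
  have o: "(1 :: 'm free_alg) \<in> FA l" by (rule free_alg_const)
  show ?case unfolding aff_class_one[symmetric]
  by (rule in_eq) (use 5 o in \<open>simp_all add: sect_ract(1) sect_ract(3) pact_one\<close>)
 qed
qed

end

section \<open>The unit\<close>

lemma slot_bv:
 assumes "j < length a"
 shows "slot (eu c d) j (bv a) = (%x. if a ! j = d then bv (a[j := c]) x else 0)"
proof
 fix x
 have "x ! j = c & x[j := d] = a \<longleftrightarrow> a ! j = d & x = a[j := c]"
  using assms by (metis length_list_update list_update_id list_update_overwrite nth_list_update_eq)
 thus "slot (eu c d) j (bv a) x = (if a ! j = d then bv (a[j := c]) x else 0)" by (auto simp: slot_eu bv_def)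
qed

lemma tensor_basis:
 fixes v :: "'n::finite tensor"
 assumes "v \<in> TP l"
 shows "v = (%x. \<Sum>a | length a = l. v a * bv a x)"
proof
 fix x
 have "(\<Sum>a | length a = l. v a * bv a x) = (\<Sum>a | length a = l. if a = x then v a else 0)"
  by (intro sum.cong) (auto simp: bv_def)
 thus "v x = (\<Sum>a | length a = l. v a * bv a x)" using assms by simp
qed

lemma (in affm) tn_expand:
 fixes v :: "'n::finite tensor"
 assumes w: "w \<in> carrier M" and v: "v \<in> TP l"
 shows "tn w v = (\<Sum>a | length a = l. psc (v a) (tn w (bv a)))"
proof -
 have "tn w v = tn w (%x. \<Sum>a | length a = l. v a * bv a x)" by (rule arg_cong[OF tensor_basis[OF v]])
 also have "... = (\<Sum>a | length a = l. tn w (%x. v a * bv a x))" by (rule tn_sum[OF w]) (auto simp: bv_def)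
 also have "... = (\<Sum>a | length a = l. psc (v a) (tn w (bv a)))" by (intro sum.cong refl tn_scale w bv_closed) simp
 finally show ?thesis .
qed

text \<open>The level axioms are inherited by invariant subspaces.\<close>

lemma (in gl_level) J_trivial_sub:
 assumes b: "distinct b" "length b = l"
  and K: "subspace K" "K <= S" "!!p q x. x \<in> K ==> e p q x \<in> K" and J: "J b \<inter> K <= {0}"
 shows "K <= {0}"
proof -
 interpret K: gl_level scale e K l using K S_sum S_weights by unfold_locales auto
 have "K.J b <= {0}" using J K(2) by (auto simp: K.J_def J_def)
 thus ?thesis by (rule K.J_trivial[OF b])
qed

locale aff_unit = affm l E for l :: nat and E :: "('a, 'm::finite) affmod" +
 fixes b :: "'n::finite list" and z :: 'n
 assumes b: "distinct b" "length b = l" and z: "z \<notin> set b" and l0: "0 < l"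
begin

lemma two: "EX p q :: 'n. p ~= q" using z b l0 nth_mem[of 0 b] by metis

abbreviation FSn :: "(complex, ('a, 'n) bal_tensor) module" where "FSn \<equiv> F_space l E"
abbreviation rho :: "('m, 'n) loop => ('a, 'n) bal_tensor => ('a, 'n) bal_tensor" where "rho \<equiv> rho0"
abbreviation res where "res \<equiv> (%x. rho (loop_tensor x 1))"

lemma rho_lie: "lie_module loop_alg FSn rho" using rho0_structure unfolding loop_structure_def by blast

lemma res_lie: "lie_module sl FSn res" by (rule res_sl_module[OF rho_lie])

lemma res_tens:
 assumes w: "w \<in> carrier M" and v: "v \<in> TP l" and x: "trace x = 0"
 shows "res x (tens l E w v) = tens l E w (tact l x v)"
proof -
 interpret lie_module sl FSn res by (rule res_lie)
 have "sect FSn (res x (tens l E w v)) = Rp (loop_tensor x (pmono 0 1)) (tn w v)"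
  using x tens_closed[OF w v] by (simp add: sect_rho0 trace_loop_tensor tn_def)
 also have "... = tn w (tact l x v)" unfolding Rp_tensor[OF w v] opb_def tact_def
  by (subst tn_sum) (auto simp: w ywd_zero wact_Nil slot_closed[OF v] simp del: tpow_simps)
 finally show ?thesis unfolding tn_def using w v x tact_closed[OF v, of x]
  by (subst (asm) sect_inj[OF FS_module]) (auto intro!: act_closed tens_closed simp del: tpow_simps)
qed

lemma lhom_tens:
 assumes w: "w \<in> carrier M"
 shows "lhom sl (tpow l, tact l) (TP l) (FSn, res) (tens l E w)" unfolding lhom_def
 by (auto simp: tens_closed[OF w] tens_rel(2)[OF w] tens_rel(3)[OF w] res_tens[OF w] simp del: tpow_simps(1))

lemma tens_null:
 assumes w: "w \<in> carrier M"
 shows "tens l E w (%a. 0) = \<zero>\<^bsub>FSn\<^esub>"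
proof -
 interpret F: Module.module CC FSn by (rule FS_module)
 have z: "(%a. 0) \<in> carrier (tpow l :: (complex, 'n tensor) module)" by simp
 show ?thesis using tens_rel(3)[OF w z, of 0] F.smult_l_null[OF tens_closed[OF w z]] by simp
qed

lemma opl_FS:
 assumes xs: "fst ` set xs <= carrier sl"
  and kill: "!!v. v \<in> TP l ==> opl (tpow l, tact l) xs v = (%a. 0)" and s: "s \<in> carrier FSn"
 shows "opl (FSn, res) xs s = \<zero>\<^bsub>FSn\<^esub>"
proof -
 interpret SM: sl_module FSn res l using res_lie by (simp add: sl_module_def)
 have "SM.Top xs (sect FSn s) = 0"
 proof (rule lin_agree[where g = "%x. 0", OF _ _ _ s])
  fix w v assume w: "w \<in> carrier M" and v: "v \<in> carrier (tpow l :: (complex, 'n tensor) module)"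
  have "SM.Top xs (tn w v) = sect FSn (opl (FSn, res) xs (tens l E w v))"
  unfolding tn_def SM.Top_def by (rule SM.sect_op[OF xs tens_closed[OF w v], symmetric])
  also have "opl (FSn, res) xs (tens l E w v) = tens l E w (opl (tpow l, tact l) xs v)"
  using opl_lhom[OF tensor_lie_module _ lie_submodule_carrier[OF tensor_lie_module] lhom_tens[OF w] xs v] res_lie by simp
  finally show "SM.Top xs (tn w v) = 0" using kill[OF v] tens_null[OF w] sect_zero[OF FS_module] by simp
 qed (simp_all add: SM.Top_add[OF xs])
 hence "sect FSn (opl (FSn, res) xs s) = sect FSn \<zero>\<^bsub>FSn\<^esub>"
  unfolding SM.Top_def SM.sect_op[OF xs s, symmetric] by (simp add: sect_zero[OF FS_module])
 thus ?thesis using SM.op_closed[OF xs s] by (simp add: sect_inj[OF FS_module])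
qed

lemma level_FS: "level l (res_sl (FSn, rho))"
 unfolding level_def res_sl_def using opl_FS[OF lists_sl(1) tensor_wlist] by simp

sublocale FM: loop_mod FSn rho l b z using rho_lie level_FS b z by (simp add: loop_mod_def loop_mod_axioms_def)

lemma eop_tn:
 assumes w: "w \<in> carrier M" and v: "v \<in> TP l"
 shows "FM.SL.eop c d (tn w v) = tn w (%a. \<Sum>j<l. slot (eu c d) j v a)"
proof -
 have "FM.SL.T (tl0 c d) (tn w v) = tn w (tact l (tl0 c d) v)"
  unfolding tn_def using FM.SL.T_sect[OF tens_closed[OF w v]] res_tens[OF w v trace_tl0] by simp
 moreover have "(%a. \<Sum>j<l. slot (eu c d) j v a) = (%a. tact l (tl0 c d) v a + (if c = d then FM.SL.rr * v a else 0))"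
  by (auto simp: tact_tl0 FM.SL.rr_def)
 moreover have "(%a. FM.SL.rr * v a) \<in> TP l" using v by simp
 ultimately show ?thesis using tn_add_r[OF w tact_closed[OF v], of "%a. FM.SL.rr * v a"] tn_scale[OF w v]
  by (cases "c = d") (simp_all add: FM.SL.eop_def del: tpow_simps)
qed

lemma equiv:
 assumes w: "w \<in> carrier M"
 shows "equivariant l FM.SL.eop (%a. tn w (bv a))" unfolding equivariant_def
proof (intro allI impI)
 fix a :: "'n list" and c d assume a: "length a = l"
 have "(%x. \<Sum>j<l. slot (eu c d) j (bv a) x) = (%x. \<Sum>j<l. if a ! j = d then bv (a[j := c]) x else 0)"
  using a by (intro ext sum.cong) (auto simp: slot_bv)
 moreover have "(%x. if a ! j = d then bv (a[j := c]) x else 0) \<in> TP l" for j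
  using a bv_closed[of "a[j := c]" l] by simp
 hence "tn w (%x. \<Sum>j<l. if a ! j = d then bv (a[j := c]) x else 0) = (\<Sum>j<l. tn w (%x. if a ! j = d then bv (a[j := c]) x else 0))"
  by (rule tn_sum[OF w])
 moreover have "tn w (%x. if P then f x else 0) = (if P then tn w f else 0)" for P and f :: "'n tensor"
  using tn_zero[OF w] by auto
 ultimately show "FM.SL.eop c d (tn w (bv a)) = (\<Sum>j<l. if a ! j = d then tn w (bv (a[j := c])) else 0)"
  unfolding eop_tn[OF w bv_closed[OF a]] by simp
qed

lemma bvb: "bv b \<in> TP l" by (rule bv_closed[OF b(2)])

lemma tn_J: "w \<in> carrier M ==> tn w (bv b) \<in> FM.JJ" by (rule FM.SL.G.J_of_equivariant[OF equiv tn_S[OF _ bvb] b])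

lemma sg_tn:
 assumes w: "w \<in> carrier M" and k: "k + 1 < l"
 shows "FM.SL.G.sg b k (tn w (bv b)) = tn (wact w [Sig k]) (bv b)"
proof -
 have "FM.SL.G.sg b k (tn w (bv b)) = wordop FM.SL.eop b (swp k b) (tn w (bv b))" by (rule FM.SL.G.sg_eq[OF b tn_J[OF w] k])
 also have "... = tn w (bv (swp k b))"
  using b by (intro FM.SL.G.equivariant_determined[OF equiv[OF w] tn_S[OF w bvb] b, symmetric]) simp
 also have "... = tn (wact w [Sig k]) (bv b)" using tn_sig[OF w bvb k] swap_bv[of k b] k b by simp
 finally show ?thesis .
qed

lemma Z_tn:
 assumes w: "w \<in> carrier M" and v: "v \<in> TP l"
 shows "FM.Z p q k (tn w v) = opb (tl0 p q) k w v"
proof -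
 have "FM.Z p q k (tn w v) = Rp (loop_tensor (tl0 p q) (pmono k 1)) (tn w v)"
  unfolding FM.Z_def tn_def using tens_closed[OF w v] by (simp add: FM.T_sect sect_rho0 trace_loop_tensor trace_tl0)
 thus ?thesis by (simp only: Rp_tensor[OF w v])
qed

lemma Y_tn:
 assumes w: "w \<in> carrier M" and j: "j < l"
 shows "FM.LL.Y b z j k (tn w (bv b)) = tn (wact w (ywd j k)) (bv b)"
proof -
 have "FM.LL.Y b z j k (tn w (bv b)) =
  (\<Sum>i<l. tn (wact w (ywd i k)) (slot (tl0 (b ! j) (b ! j)) i (bv b)) - tn (wact w (ywd i k)) (slot (tl0 z z) i (bv b)))"
  by (simp add: FM.LL.Y_def Z_tn[OF w bvb] opb_def sum_subtractf)
 also have "... = (\<Sum>i<l. if i = j then tn (wact w (ywd j k)) (bv b) else 0)"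
 proof (intro sum.cong refl)
  fix i assume "i \<in> {..<l}"
  hence i: "i < l" by simp
  have e1: "slot (eu z z) i (bv b) = (%x. 0)" 
  proof -
  have "b ! i ~= z" using z b i nth_mem[of i b] by auto
  thus ?thesis using slot_bv[of i b z z] b i by simp
  qed
  have e2: "slot (eu (b ! j) (b ! j)) i (bv b) = (%x. if i = j then bv b x else 0)"
  using slot_bv[of i b "b ! j" "b ! j"] b i j by (auto simp: nth_eq_iff_index_eq)
  have s: "slot (tl0 p p) i (bv b) = (%x. slot (eu p p) i (bv b) x - 1 / of_nat CARD('n) * bv b x)" for p
  unfolding tl0_eu slot_lin by (simp add: slot_mat)
  have "slot (tl0 (b ! j) (b ! j)) i (bv b) = (%x. slot (tl0 z z) i (bv b) x + (if i = j then bv b x else 0))"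
  unfolding s e1 e2 by auto
  moreover have "(%x. if i = j then bv b x else 0) \<in> TP l" using bvb by simp
  ultimately have "tn (wact w (ywd i k)) (slot (tl0 (b ! j) (b ! j)) i (bv b)) =
  tn (wact w (ywd i k)) (slot (tl0 z z) i (bv b)) + tn (wact w (ywd i k)) (%x. if i = j then bv b x else 0)"
  using tn_add_r[OF wact_ywd[OF w i] slot_closed[OF bvb]] by simp
  thus "tn (wact w (ywd i k)) (slot (tl0 (b ! j) (b ! j)) i (bv b)) - tn (wact w (ywd i k)) (slot (tl0 z z) i (bv b))
  = (if i = j then tn (wact w (ywd j k)) (bv b) else 0)" by (simp add: tn_zero[OF wact_ywd[OF w i]])
 qed
 finally show ?thesis using j by simp
qed

lemma gop_tn:
 assumes w: "w \<in> carrier M" and g: "valid_gen l g"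
 shows "FM.gop g (tn w (bv b)) = tn (wact w [g]) (bv b)"
proof (cases g)
 case (Sig k)
 thus ?thesis using sg_tn[OF w, of k] g by simp
next
 case (Y i j)
 hence j: "j < l" using g by simp
 have "wact w (ypw i j 1) = wact w (ywd j (axis i 1))" by (rule wact_weq[OF ywd_axis[OF j]])
 thus ?thesis using Y_tn[OF w j] Y by (simp add: ypw_def)
next
 case (Yinv i j)
 hence j: "j < l" using g by simp
 have "wact w (ypw i j (-1)) = wact w (ywd j (axis i (-1)))" by (rule wact_weq[OF ywd_axis[OF j]])
 thus ?thesis using Y_tn[OF w j] Yinv by (simp add: ypw_def)
qed

lemma wop_tn:
 assumes "w \<in> carrier M" "vw l us"
 shows "FM.wop us (tn w (bv b)) = tn (wact w us) (bv b)" using assms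
proof (induction us arbitrary: w)
 case Nil
 thus ?case by (simp add: FM.wop_simps wact_Nil)
next
 case (Cons g us)
 have "wact w (g # us) = wact (wact w [g]) us" using wact_append[of w "[g]" us] Cons.prems by simp
 moreover have "wact w [g] \<in> carrier M" using Cons.prems by (intro wact_closed) auto
 ultimately show ?case using Cons gop_tn[of w g] by (simp add: FM.wop_simps)
qed

lemma pact_tn:
 assumes w: "w \<in> carrier M" and p: "p \<in> FA l"
 shows "FM.pact p (tn w (bv b)) = tn (snd E w (aff_class l p)) (bv b)"
proof -
 have "p \<in> FA l & FM.pact p (tn w (bv b)) = tn (snd E w (aff_class l p)) (bv b)"
 proof (induction p rule: keys_induct)
  case zero
  have z: "(pmono (FMon []) 0 :: 'm free_alg) \<in> FA l" by (rule free_alg_const)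
  have "tn (csm 0 w) (bv b) = 0" using tn_csm[OF w bvb, of 0] by simp
  thus ?case using z by (simp add: csm_def FM.pact_zero)
 next
  case (single u c)
  have vu: "vw l (letters u)" using p single unfolding free_alg_carrier vw_def by blast
  hence "FM.pact (pmono u c) (tn w (bv b)) = psc c (tn (wact w (letters u)) (bv b))"
  by (simp only: FM.pact_single wop_tn[OF w])
  also have "... = tn (snd E w (aff_class l (pmono u c))) (bv b)"
  using csm_wact(2)[OF w vu, of c] tn_csm[OF wact_closed[OF w vu] bvb, of c] by simp
  finally show ?case using vu by (auto simp: free_alg_carrier vw_def)
 next
  case (add p q)
  thus ?case using w bvb
  by (simp add: FM.pact_add free_alg_closed aff_class_add R.ract_r_distr tn_add_l R.ract_closed del: tpow_simps)
 qed
 thus ?thesis by blast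
qed

definition eta :: "'a => ('a, 'n) bal_tensor"
 where "eta w = tens l E w (bv b)"

lemma sect_eta: "sect FSn (eta w) = tn w (bv b)" by (simp add: eta_def tn_def)

lemma eta_carrier: "w \<in> carrier M ==> eta w \<in> carrier FSn" unfolding eta_def by (rule tens_closed[OF _ bvb])

lemma eta_W:
 assumes w: "w \<in> carrier M"
 shows "eta w \<in> FM.W" using FM.ev_JJ(1)[OF tn_J[OF w]] ev_sect[OF FS_module eta_carrier[OF w]] sect_eta by simp

lemma eta_ract:
 assumes w: "w \<in> carrier M" and A: "A \<in> carrier (Aff l)"
 shows "FM.ract (eta w) A = eta (snd E w A)"
proof -
 obtain p where p: "p \<in> FA l" "A = aff_class l p" using Aff_carrier[OF A] by blast
 have "sect FSn (FM.ract (eta w) A) = sect FSn (eta (snd E w A))"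
  unfolding p(2) FM.sect_ract(1)[OF eta_W[OF w] p(1)] sect_eta by (rule pact_tn[OF w p(1)])
 moreover have "FM.ract (eta w) A \<in> carrier FSn" "eta (snd E w A) \<in> carrier FSn"
  using FM.sect_ract(3)[OF eta_W[OF w] p(1)] p(2) FM.W_carrier eta_carrier[OF R.ract_closed[OF w A]] by auto
 ultimately show ?thesis by (simp add: sect_inj[OF FS_module])
qed

lemma eta_add: "w \<in> carrier M ==> w' \<in> carrier M ==> eta (w \<oplus>\<^bsub>M\<^esub> w') = eta w \<oplus>\<^bsub>FSn\<^esub> eta w'"
 unfolding eta_def by (rule tens_rel(1)[OF _ bvb])

lemma eta_inj: "inj_on eta (carrier M)" unfolding eta_def by (intro inj_onI tens_basis_inj[OF b])

text \<open>The product \<open>Q\<close> of the diagonal operators for the letters of \<open>b\<close> fixes the weight space. It multiplies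
\<open>w \<otimes> e\<^sub>a\<close> by the product of the multiplicities of these letters in \<open>a\<close>, which is zero unless \<open>a\<close> is a permutation of \<open>b\<close>.\<close>

lemma eta_surj: "eta ` carrier M = FM.W"
proof (rule equalityI)
 show "eta ` carrier M <= FM.W" using eta_W by blast
 define I where "I = (%w. tn w (bv b)) ` carrier M"
 have I: "psc.subspace I" unfolding psc.subspace_def
 proof (intro conjI ballI allI)
  show "0 \<in> I" unfolding I_def using tn_csm[OF R.M.zero_closed bvb, of 0] csm_closed[OF R.M.zero_closed, of 0]
  by (metis imageI psc.scale_zero_left)
  fix x assume "x \<in> I"
  then obtain w where w: "w \<in> carrier M" "x = tn w (bv b)" unfolding I_def by blast
  show "psc c x \<in> I" for c using w tn_csm[OF w(1) bvb, of c] csm_closed[OF w(1)] unfolding I_def by (metis imageI)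
  fix y assume "y \<in> I"
  then obtain w' where w': "w' \<in> carrier M" "y = tn w' (bv b)" unfolding I_def by blast
  thus "x + y \<in> I" using w tn_add_l[OF w(1) w'(1) bvb] unfolding I_def by (metis imageI R.M.add.m_closed)
 qed
 define Q where "Q cs = foldr (%c y. FM.SL.eop c c y) cs" for cs :: "'n list"
 have Q_add: "Q cs (x + y) = Q cs x + Q cs y" and Q_psc: "Q cs (psc c x) = psc c (Q cs x)" for cs x y c
  by (induction cs) (simp_all add: Q_def FM.SL.E.e_add FM.SL.E.e_scale)
 have Q_sum: "Q cs (\<Sum>i\<in>K. f i) = (\<Sum>i\<in>K. Q cs (f i))" for cs K and f :: "'i => _"
  using Q_psc[of cs 0 0] by (induction K rule: infinite_finite_induct) (simp_all add: Q_add)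
 have QJ: "Q cs x = x" if "x \<in> FM.JJ" "set cs <= set b" for cs x
  using that by (induction cs) (auto simp: Q_def FM.SL.G.J_def)
 have Qbv: "Q cs (tn w (bv a)) = psc (\<Prod>c\<leftarrow>cs. of_nat (count_list a c)) (tn w (bv a))"
  if w: "w \<in> carrier M" and a: "length a = l" for cs w a
 proof (induction cs)
  case (Cons c cs)
  have "FM.SL.eop c c (tn w (bv a)) = (\<Sum>i<l. psc (if a ! i = c then 1 else 0) (tn w (bv a)))"
  unfolding equivariantD[OF equiv[OF w] a] by (intro sum.cong refl) (auto simp: psc.scale_one)
  also have "... = psc (of_nat (count_list a c)) (tn w (bv a))" unfolding psc.scale_sum_left[symmetric] sum_count[OF a] ..
  finally have e: "FM.SL.eop c c (tn w (bv a)) = psc (of_nat (count_list a c)) (tn w (bv a))" .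
  let ?P = "\<Prod>c\<leftarrow>cs. of_nat (count_list a c) :: complex"
  have "Q (c # cs) (tn w (bv a)) = FM.SL.eop c c (psc ?P (tn w (bv a)))" using Cons by (simp add: Q_def)
  also have "... = psc (of_nat (count_list a c) * ?P) (tn w (bv a))"
  unfolding FM.SL.E.e_scale e psc.scale_scale by (simp only: mult.commute[of ?P "of_nat (count_list a c)"])
  finally show ?case by simp
 qed (simp only: Q_def foldr.simps id_apply list.map prod_list.Nil psc.scale_one)
 have QI0: "Q b (tn w (bv a)) \<in> I" if w: "w \<in> carrier M" and a: "length a = l" for w a
 proof (cases "set b <= set a")
  case True
  have "card (set a) <= card (set b)" using a b card_length[of a] distinct_card[of b] by simp
  hence "set a = set b" using True card_seteq[of "set a" "set b"] by simp
  hence "tn w (bv a) = tn (wact w (map Sig (srt (rev b) a))) (bv b)" using tn_perm[OF b w a] by simp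
  moreover have "wact w (map Sig (srt (rev b) a)) \<in> carrier M" using w b by (intro wact_closed srt_vw) auto
  ultimately have "tn w (bv a) \<in> I" by (simp add: I_def)
  thus ?thesis unfolding Qbv[OF w a] by (rule psc.subspace_scale[OF I])
 next
  case False
  then obtain c where c: "c \<in> set b" "c \<notin> set a" by blast
  hence "(0 :: complex) \<in> set (map (%c. of_nat (count_list a c)) b)"
  using count_list_0_iff[of a c] by (auto simp: image_iff intro!: bexI[of _ c])
  hence "(\<Prod>c\<leftarrow>b. of_nat (count_list a c)) = (0 :: complex)" by (simp only: prod_list_zero_iff)
  thus ?thesis using psc.subspace_0[OF I] by (simp add: Qbv[OF w a])
 qed
 have QI: "Q b (sect FSn s) \<in> I" if "s \<in> carrier FSn" for s using that
 proof (induction s rule: FS_induct)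
  case zero
  have "Q b 0 = 0" using Q_psc[of b 0 0] by simp
  thus ?case using psc.subspace_0[OF I] by (simp add: sect_zero[OF FS_module])
 next
  case (add x y)
  thus ?case using psc.subspace_add[OF I] by (simp add: sect_add[OF FS_module] Q_add)
 next
  case (tens w v)
  have "tn w v = (\<Sum>a | length a = l. psc (v a) (tn w (bv a)))" by (rule tn_expand[OF tens])
  hence "Q b (tn w v) = (\<Sum>a | length a = l. psc (v a) (Q b (tn w (bv a))))" by (simp add: Q_sum Q_psc)
  also have "... \<in> I" by (intro psc.subspace_sum[OF I] psc.subspace_scale[OF I] QI0 tens(1)) simp
  finally show ?case by (simp add: tn_def)
 qed
 show "FM.W <= eta ` carrier M"
 proof
  fix u assume u: "u \<in> FM.W"
  have "sect FSn u \<in> I" using QI[OF FM.W_carrier[OF u]] QJ[OF FM.sect_W[OF u]] by simp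
  then obtain w where w: "w \<in> carrier M" "sect FSn u = sect FSn (eta w)" unfolding I_def sect_eta by blast
  hence "u = eta w" using sect_inj[OF FS_module FM.W_carrier[OF u] eta_carrier[OF w(1)]] by simp
  thus "u \<in> eta ` carrier M" using w by blast
 qed
qed

lemma locally_finite_FS: "locally_finite_dim sl (res_sl (FSn, rho))"
proof -
 interpret S: lie_module sl FSn res by (rule res_lie)
 have tensU: "EX U. lie_submodule sl (FSn, res) U & finite_dim FSn U & tens l E w v \<in> U"
  if w: "w \<in> carrier M" and v: "v \<in> TP l" for w v
 proof (intro exI conjI)
  let ?U = "tens l E w ` TP l"
  show sub: "lie_submodule sl (FSn, res) ?U" by (rule lhom_image[OF tensor_lie_module res_lie lhom_tens[OF w]])
  show "tens l E w v \<in> ?U" using v by (rule imageI)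
  let ?B = "(%a. tens l E w (bv a)) ` {a. length a = l}"
  have "sect FSn (tens l E w v) \<in> psc.span (sect FSn ` ?B)" if v: "v \<in> TP l" for v
  proof -
  have "tn w v = (\<Sum>a | length a = l. psc (v a) (tn w (bv a)))" by (rule tn_expand[OF w v])
  also have "... \<in> psc.span (sect FSn ` ?B)" by (intro psc.span_sum psc.span_scale psc.span_base) (auto simp: tn_def)
  finally show ?thesis by (simp add: tn_def)
  qed
  moreover have "?U <= carrier FSn" using tens_closed[OF w] by blast
  moreover have "?B <= ?U" using bv_closed by blast
  ultimately show "finite_dim FSn ?U" unfolding span_finite_dim[OF FS_module \<open>?U <= carrier FSn\<close>]
  by (intro exI[of _ ?B]) auto
 qed
 have "EX U. lie_submodule sl (FSn, res) U & finite_dim FSn U & s \<in> U" if "s \<in> carrier FSn" for s using that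
 proof (induction s rule: FS_induct)
  case zero
  show ?case using tensU[OF R.M.zero_closed, of "%a. 0"] tens_null[OF R.M.zero_closed] by simp
 next
  case (tens w v)
  thus ?case by (rule tensU)
 next
  case (add s t)
  obtain U where U: "lie_submodule sl (FSn, res) U" "finite_dim FSn U" "s \<in> U" using add by blast
  obtain V where V: "lie_submodule sl (FSn, res) V" "finite_dim FSn V" "t \<in> V" using add by blast
  note cU = submodule_closed[OF FS_module lie_submoduleD(1)[OF U(1)]]
  note cV = submodule_closed[OF FS_module lie_submoduleD(1)[OF V(1)]]
  let ?W = "{u \<oplus>\<^bsub>FSn\<^esub> v | u v. u \<in> U & v \<in> V}"
  obtain B where B: "finite B" "B <= U" "sect FSn ` U <= psc.span (sect FSn ` B)"
  using U(2) unfolding span_finite_dim[OF FS_module cU(5)] by blast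
  obtain C where C: "finite C" "C <= V" "sect FSn ` V <= psc.span (sect FSn ` C)"
  using V(2) unfolding span_finite_dim[OF FS_module cV(5)] by blast
  have sub: "lie_submodule sl (FSn, res) ?W" by (rule FM.SL.sub_sum[OF U(1) V(1)])
  have W: "?W <= carrier FSn" using submodule_closed(5)[OF FS_module lie_submoduleD(1)[OF sub]] .
  have "B \<union> C <= ?W"
  proof
  fix x assume "x \<in> B \<union> C"
  thus "x \<in> ?W"
  proof
  assume "x \<in> B"
  hence "x \<in> U" "x = x \<oplus>\<^bsub>FSn\<^esub> \<zero>\<^bsub>FSn\<^esub>" using B cU(5) by auto
  thus ?thesis using cV(3) by blast
  next
  assume "x \<in> C"
  hence "x \<in> V" "x = \<zero>\<^bsub>FSn\<^esub> \<oplus>\<^bsub>FSn\<^esub> x" using C cV(5) by auto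
  thus ?thesis using cU(3) by blast
  qed
  qed
  moreover have "sect FSn ` ?W <= psc.span (sect FSn ` (B \<union> C))"
  proof
  fix y assume "y \<in> sect FSn ` ?W"
  then obtain u v where uv: "u \<in> U" "v \<in> V" "y = sect FSn (u \<oplus>\<^bsub>FSn\<^esub> v)" by blast
  have "u \<in> carrier FSn" "v \<in> carrier FSn" using uv cU(5) cV(5) by auto
  hence "y = sect FSn u + sect FSn v" using uv(3) by (simp add: sect_add[OF FS_module])
  moreover have "sect FSn u \<in> psc.span (sect FSn ` (B \<union> C))"
  using B(3) uv(1) psc.span_mono[of "sect FSn ` B" "sect FSn ` (B \<union> C)"] by blast
  moreover have "sect FSn v \<in> psc.span (sect FSn ` (B \<union> C))"
  using C(3) uv(2) psc.span_mono[of "sect FSn ` C" "sect FSn ` (B \<union> C)"] by blast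
  ultimately show "y \<in> psc.span (sect FSn ` (B \<union> C))" using psc.span_add by simp
  qed
  ultimately have "finite_dim FSn ?W"
  unfolding span_finite_dim[OF FS_module W] using B(1) C(1) by (intro exI[of _ "B \<union> C"]) simp
  moreover have "s \<oplus>\<^bsub>FSn\<^esub> t \<in> ?W" using U(3) V(3) by blast
  ultimately show ?case using sub by blast
 qed
 thus ?thesis unfolding locally_finite_dim_def res_sl_def by simp
qed

text \<open>A simple subquotient of a module of level \<open>l\<close> is again of level \<open>l\<close>.\<close>

lemma composition_factor_FS:
 assumes S: "composition_factor sl S (res_sl (FSn, rho))"
 shows "composition_factor sl S (nat_tensor_module l :: (complex ^ 'n ^ 'n, 'n tensor) lmod)"
proof -
 have S': "composition_factor sl S (FSn, res)" using S by (simp add: res_sl_def)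
 obtain U g where U: "lie_submodule sl (FSn, res) U" and g: "lhom sl (FSn, res) U S g" "g ` U = carrier (fst S)"
  using composition_factor_surj[OF lie_closed_sl res_lie S'] by blast
 have sS: "lie_simple sl S" using S by (simp add: composition_factor_def)
 hence mS: "lie_module sl (fst S) (snd S)" by (cases S) (simp add: lie_simple_def)
 note cl = submodule_closed[OF FS_module lie_submoduleD(1)[OF U]]
 have "level l (fst S, snd S)" unfolding level_def
 proof (intro allI ballI)
  fix p s assume "s \<in> carrier (fst (fst S, snd S))"
  then obtain u where u: "u \<in> U" "s = g u" using g(2) by auto
  have "opl S (wlist l p) s = g (opl (FSn, res) (wlist l p) u)"
  unfolding u(2) by (rule opl_lhom[OF res_lie mS U g(1) lists_sl(1) u(1), symmetric])
  also have "opl (FSn, res) (wlist l p) u = \<zero>\<^bsub>FSn\<^esub>"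
  using opl_FS[OF lists_sl(1) tensor_wlist] u(1) cl(5) by blast
  also have "g \<zero>\<^bsub>FSn\<^esub> = \<zero>\<^bsub>fst S\<^esub>"
  using lhom_zero[of "(FSn, res)" S U sl g, simplified, OF FS_module lie_module.m[OF mS]
  lie_submoduleD(1)[OF U] g(1)] by simp
  finally show "opl (fst S, snd S) (wlist l p) s = \<zero>\<^bsub>fst (fst S, snd S)\<^esub>" by simp
 qed
 then interpret S: sl_level "fst S" "snd S" l using mS by (simp add: sl_level_def sl_module_def sl_level_axioms_def)
 show ?thesis unfolding nat_tensor_module using S.simple_composition_factor[OF b] sS by simp
qed

lemma F_obj_level: "(FSn, rho) \<in> Ob (loop_cat_level l)" unfolding loop_cat_level_def loop_cat_def
 using rho_lie locally_finite_FS composition_factor_FS by auto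

end

context loop_mod
begin

section \<open>The counit\<close>

lemma wop_replicate:
 assumes u: "u \<in> JJ" and j: "j < l"
 shows "wop (replicate n (gen.Y i j)) u = LL.Y b z j (axis i (int n)) u"
  "wop (replicate n (Yinv i j)) u = LL.Y b z j (axis i (- int n)) u"
proof -
 have a: "axis i (int (Suc n)) = axis i (int n) + axis i (1 :: int)"
  "axis i (- int (Suc n)) = axis i (- int n) + axis i (-1 :: int)" for n by (auto simp: vec_eq_iff axis_def)
 show "wop (replicate n (gen.Y i j)) u = LL.Y b z j (axis i (int n)) u" using u
 proof (induction n arbitrary: u)
  case 0
  thus ?case using LL.Y_zero[OF b z 0 j] by (simp add: wop_simps axis_zero)
 next
  case (Suc n)
  have "LL.Y b z j (axis i 1) u \<in> JJ" by (rule LL.Y_J[OF b z Suc.prems])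
  thus ?case using Suc.IH LL.Y_mult[OF b z Suc.prems j] unfolding a by (simp add: wop_simps)
 qed
 show "wop (replicate n (Yinv i j)) u = LL.Y b z j (axis i (- int n)) u" using u
 proof (induction n arbitrary: u)
  case 0
  thus ?case using LL.Y_zero[OF b z 0 j] by (simp add: wop_simps axis_zero)
 next
  case (Suc n)
  have "LL.Y b z j (axis i (-1)) u \<in> JJ" by (rule LL.Y_J[OF b z Suc.prems])
  thus ?case using Suc.IH LL.Y_mult[OF b z Suc.prems j] unfolding a by (simp add: wop_simps)
 qed
qed

lemma wop_ypw:
 assumes u: "u \<in> JJ" and j: "j < l"
 shows "wop (ypw i j p) u = LL.Y b z j (axis i p) u"
proof (cases "p \<ge> 0")
 case True
 thus ?thesis using wop_replicate(1)[OF u j, of "nat p" i] by (simp add: ypw_def)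
next
 case False
 thus ?thesis using wop_replicate(2)[OF u j, of "nat (- p)" i] by (simp add: ypw_def)
qed

abbreviation "GM \<equiv> (Gring, ract)"

sublocale GA: affm l GM using Gring_right_module by (simp add: affm_def)

lemma sect_wact:
 assumes "u \<in> W" "vw l us"
 shows "sect N (GA.wact u us) = wop us (sect N u)" using assms by (simp add: GA.wact_def sect_ract(1) pact_word)

lemma csm_W: "u \<in> W ==> GA.csm c u = c \<odot> u"
 using sect_ract(2)[of u "pmono (FMon []) c"] free_alg_const(1)[of c l] ev_psc[OF m] ev_sect[OF m W_carrier]
 by (simp add: GA.csm_def pact_single wop_simps)

lemma sect_phi: "u \<in> W ==> sect N (SL.phi b u v) = SL.E.wsum l v (%a. wordop SL.eop b a (sect N u))"
proof -
 assume u: "u \<in> W"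
 have "SL.E.wsum l v (%a. wordop SL.eop b a (sect N u)) \<in> sect N ` carrier N" unfolding SL.E.wsum_def
  by (intro SL.G.S_sum_closed SL.G.S_closed SL.G.wordop_S) (use W_carrier[OF u] in auto)
 thus ?thesis unfolding SL.phi_def using ev_sect[OF m] by auto
qed

lemma counit_ex: "EX h. (ALL x y. h (x + y) = h x + h y) & (ALL c x. h (psc c x) = psc c (h x)) &
  (ALL u:carrier Gring. ALL v:TP l. h (GA.tn u v) = sect N (SL.phi b u v))"
proof (rule GA.tens_ext[simplified fst_conv], goal_cases)
 case (1 w w' v)
 thus ?case by (simp add: SL.phi_add_u W_carrier sect_add[OF m] SL.phi_closed)
next
 case (2 w v v')
 thus ?case by (simp add: SL.phi_add sect_add[OF m] SL.phi_closed)
next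
 case (3 w v c)
 thus ?case by (simp add: SL.phi_scale sect_smult[OF m] SL.phi_closed)
next
 case (4 w v c)
 thus ?case by (simp add: csm_W SL.phi_scale_u W_carrier sect_smult[OF m] SL.phi_closed)
next
 case (5 w v k)
 hence w: "w \<in> W" and k: "k + 1 < l" by auto
 have "GA.wact w [Sig k] \<in> W" using GA.wact_closed[of w "[Sig k]"] w k by simp
 hence "sect N (SL.phi b (GA.wact w [Sig k]) v) =
  SL.E.wsum l v (%a. wordop SL.eop b a (SL.G.sg b k (sect N w)))"
  using sect_wact[OF w, of "[Sig k]"] k by (simp add: sect_phi wop_simps)
 also have "... = SL.E.wsum l v (%a. wordop SL.eop b (swp k a) (sect N w))"
  by (rule SL.E.wsum_cong) (rule SL.G.wordop_sg[OF b sect_W[OF w] k])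
 also have "... = sect N (SL.phi b w (swap k v))" unfolding sect_phi[OF w] SL.E.wsum_swap[OF k] ..
 finally show ?case .
qed

definition eps0 where "eps0 = (SOME h. (ALL x y. h (x + y) = h x + h y) & (ALL c x. h (psc c x) = psc c (h x)) &
  (ALL u:carrier Gring. ALL v:TP l. h (GA.tn u v) = sect N (SL.phi b u v)))"

lemma eps0_add: "eps0 (x + y) = eps0 x + eps0 y"
 and eps0_psc: "eps0 (psc c x) = psc c (eps0 x)"
 and eps0_tn: "u \<in> W ==> v \<in> TP l ==> eps0 (GA.tn u v) = sect N (SL.phi b u v)"
 unfolding eps0_def using someI_ex[OF counit_ex] by auto

abbreviation FG :: "(complex, ('v, 'n) bal_tensor) module" where "FG \<equiv> F_space l GM"

lemma FG_module: "vsp FG" by (rule GA.FS_module)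

lemma eps0_sum: "eps0 (\<Sum>i\<in>I. f i) = (\<Sum>i\<in>I. eps0 (f i))"
proof -
 have "eps0 0 = 0" using eps0_add[of 0 0] by simp
 thus ?thesis by (induction I rule: infinite_finite_induct) (auto simp: eps0_add)
qed

definition eps :: "('v, 'n) bal_tensor => 'v"
 where "eps s = ev N (eps0 (sect FG s))"

lemma eps_closed: "eps s \<in> carrier N" unfolding eps_def by (rule ev_closed[OF m])

lemma eps_add: "s \<in> carrier FG ==> t \<in> carrier FG ==> eps (s \<oplus>\<^bsub>FG\<^esub> t) = eps s \<oplus> eps t"
 by (simp add: eps_def sect_add[OF FG_module] eps0_add ev_add[OF m])

lemma eps_smult: "s \<in> carrier FG ==> eps (c \<odot>\<^bsub>FG\<^esub> s) = c \<odot> eps s"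
 by (simp add: eps_def sect_smult[OF FG_module] eps0_psc ev_psc[OF m])

lemma eps_tens: "u \<in> W ==> v \<in> TP l ==> eps (tens l GM u v) = SL.phi b u v"
 using eps0_tn[of u v] ev_sect[OF m SL.phi_closed[of b u v]] by (simp add: eps_def GA.tn_def)

lemma sect_eps:
 assumes "s \<in> carrier FG"
 shows "sect N (eps s) = eps0 (sect FG s)"
proof -
 have "eps0 (sect FG s) \<in> sect N ` carrier N" using assms
 proof (induction s rule: GA.FS_induct)
  case zero
  have "eps0 0 = 0" using eps0_add[of 0 0] by simp
  thus ?case using sect_zero[OF m] by (simp add: sect_zero[OF FG_module])
 next
  case (tens w v)
  thus ?case using eps0_tn[of w v] SL.phi_closed by (simp add: GA.tn_def)
 next
  case (add s t)
  thus ?case by (simp add: sect_add[OF FG_module] eps0_add SL.G.S_closed(2))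
 qed
 thus ?thesis unfolding eps_def using ev_sect[OF m] by auto
qed

text \<open>Both sides are the formula \<open>Z_wordop\<close>, summed over the words with the coefficients of \<open>v\<close>.\<close>

lemma eps_gen_tn:
 assumes u: "u \<in> W" and v: "v \<in> TP l" and pq: "p ~= q"
 shows "eps0 (GA.Rp (eL p q (tvar i a)) (GA.tn u v)) = T (eL p q (tvar i a)) (sect N (SL.phi b u v))"
proof -
 let ?k = "axis i a :: int ^ 'm"
 have tl: "tl0 p q = eu p q" using pq by (simp add: tl0_eu)
 have uc: "u \<in> carrier (fst GM)" using u by simp
 have Yu: "sect N (GA.wact u (ywd j ?k)) = LL.Y b z j ?k (sect N u)" "GA.wact u (ywd j ?k) \<in> W" if j: "j < l" for j
 proof -
  have "GA.wact u (ypw i j a) = GA.wact u (ywd j ?k)" by (rule GA.wact_weq[OF ywd_axis[OF j]])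
  thus "sect N (GA.wact u (ywd j ?k)) = LL.Y b z j ?k (sect N u)"
  using sect_wact[OF u ypw_vw[OF j]] wop_ypw[OF sect_W[OF u] j] by metis
  show "GA.wact u (ywd j ?k) \<in> W" using GA.wact_ywd[OF uc j] by simp
 qed
 have "eps0 (GA.Rp (eL p q (tvar i a)) (GA.tn u v)) = eps0 (GA.opb (eu p q) ?k u v)"
  using GA.Rp_tensor[OF uc v, of "eu p q" ?k] by (simp add: loop_tensor_eu tvar_def)
 also have "... = (\<Sum>j<l. sect N (SL.phi b (GA.wact u (ywd j ?k)) (slot (eu p q) j v)))" unfolding GA.opb_def eps0_sum
  by (intro sum.cong refl eps0_tn Yu slot_closed v) auto
 also have "... = (\<Sum>j<l. SL.E.wsum l (slot (eu p q) j v) (%c. wordop SL.eop b c (LL.Y b z j ?k (sect N u))))"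
  by (intro sum.cong refl) (simp add: sect_phi Yu)
 also have "... = (\<Sum>j<l. SL.E.wsum l v (%c. if c ! j = q then wordop SL.eop b (c[j := p]) (LL.Y b z j ?k (sect N u)) else 0))"
  by (intro sum.cong refl SL.E.wsum_slot) auto
 also have "... = SL.E.wsum l v (%c. \<Sum>j<l. if c ! j = q then wordop SL.eop b (c[j := p]) (LL.Y b z j ?k (sect N u)) else 0)"
  unfolding SL.E.wsum_def psc.scale_sum_right by (rule sum.swap)
 also have "... = SL.E.wsum l v (%c. Z p q ?k (wordop SL.eop b c (sect N u)))"
  by (rule SL.E.wsum_cong) (rule LL.Z_wordop[OF b z sect_W[OF u] _ pq, symmetric])
 also have "... = Z p q ?k (SL.E.wsum l v (%c. wordop SL.eop b c (sect N u)))"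
  unfolding SL.E.wsum_def LL.Z_sum LL.Z_scale ..
 also have "... = T (eL p q (tvar i a)) (sect N (SL.phi b u v))"
  unfolding sect_phi[OF u] Z_def tl loop_tensor_eu tvar_def ..
 finally show ?thesis .
qed

context
 assumes l0: "0 < l"
begin

interpretation U: aff_unit l GM b z using l0 b z GA.affm_axioms by (simp add: aff_unit_def aff_unit_axioms_def)

lemma eps_hom:
 assumes A: "trace A = 0" and s: "s \<in> carrier FG"
 shows "eps (GA.rho0 A s) = \<rho> A (eps s)"
proof (rule lie_hom_from_generators[OF U.rho_lie lie_module_axioms U.two _ _ _ _ A s])
 fix p q :: 'n and i :: 'm and a :: int and s :: "('v, 'n) bal_tensor"
 assume pq: "p ~= q" and s: "s \<in> carrier FG"
 let ?A = "eL p q (tvar i a) :: ('m, 'n) loop"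
 have tr: "trace ?A = 0" using pq by (simp add: trace_eL)
 have "eps0 (GA.Rp ?A (sect FG s)) = T ?A (eps0 (sect FG s))"
  by (rule GA.lin_agree[where f = "%x. eps0 (GA.Rp ?A x)" and g = "%x. T ?A (eps0 x)", OF _ _ _ s])
  (use tr pq in \<open>auto simp: GA.Rp_add eps0_add T_add eps_gen_tn eps0_tn simp del: tpow_simps\<close>)
 hence "sect N (eps (GA.rho0 ?A s)) = sect N (\<rho> ?A (eps s))"
  using s tr sect_eps[OF U.FM.act_closed[of ?A s]] GA.sect_rho0[OF tr s] T_sect[OF eps_closed, of ?A s] sect_eps[OF s]
  by simp
 thus "eps (GA.rho0 ?A s) = \<rho> ?A (eps s)" using sect_inj[OF m] eps_closed act_closed tr by simp
qed (auto intro: eps_closed eps_add eps_smult)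

text \<open>The image contains the weight vectors, which generate. The kernel contains no weight vector of the
source, because these are the \<open>u \<otimes> e\<^sub>b\<close>, with image \<open>u\<close>.\<close>

lemma eps_bij: "bij_betw eps (carrier FG) (carrier N)"
proof -
 have lh: "lhom sl (FG, %x. GA.rho0 (loop_tensor x 1)) (carrier FG) (N, %x. \<rho> (loop_tensor x 1)) eps"
  unfolding lhom_def using eps_closed eps_add eps_smult eps_hom by (simp add: trace_loop_tensor)
 have im: "lie_submodule sl (N, %x. \<rho> (loop_tensor x 1)) (eps ` carrier FG)"
  by (rule lhom_image[OF U.res_lie SL.lie_module_axioms lh])
 have surj: "eps ` carrier FG = carrier N"
 proof (rule SL.generated_by_wsp[OF b im])
  show "wsp l (N, %x. \<rho> (loop_tensor x 1)) b <= eps ` carrier FG"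
  proof
  fix u assume u: "u \<in> wsp l (N, %x. \<rho> (loop_tensor x 1)) b"
  hence uW: "u \<in> W" by (simp add: W_def res)
  have "eps (tens l GM u (bv b)) = u" using eps_tens[OF uW U.bvb] SL.phi_basis[OF b u] by (simp add: bv_def)
  moreover have "tens l GM u (bv b) \<in> carrier FG" using GA.tens_closed[OF _ U.bvb] uW by simp
  ultimately show "u \<in> eps ` carrier FG" by (metis imageI)
  qed
 qed
 let ?K = "{s \<in> carrier FG. eps s = \<zero>}"
 have eps0z: "eps \<zero>\<^bsub>FG\<^esub> = \<zero>" using lhom_zero[OF _ _ _ lh] FG_module m submodule_self[OF FG_module] by simp
 have Ksub: "submodule ?K CC FG" by (rule submoduleI'[OF FG_module]) (auto simp: eps_add eps_smult eps0z U.FM.smult_closed)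
 have "sect FG ` ?K <= {0}"
 proof (rule U.FM.SL.G.J_trivial_sub[OF b subspace_sect[OF FG_module Ksub]])
  show "sect FG ` ?K <= sect FG ` carrier FG" by blast
  fix p q x assume "x \<in> sect FG ` ?K"
  then obtain s where s: "s \<in> carrier FG" "eps s = \<zero>" "x = sect FG s" by blast
  let ?x = "GA.rho0 (loop_tensor (tl0 p q) 1) s"
  have t: "trace (loop_tensor (tl0 p q) 1 :: ('m, 'n) loop) = 0" by (intro trace_loop_tensor trace_tl0)
  have c: "?x \<in> carrier FG" using U.FM.act_closed[of "loop_tensor (tl0 p q) 1" s] t s by simp
  have "\<rho> (loop_tensor (tl0 p q) 1) \<zero> = \<zero>"
  using act_r_smult[of "loop_tensor (tl0 p q) 1" \<zero> 0] act_closed[of "loop_tensor (tl0 p q) 1" \<zero>] t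
  smult_l_null[of \<zero>] smult_l_null[of "\<rho> (loop_tensor (tl0 p q) 1) \<zero>"] by simp
  hence K1: "?x \<in> ?K" using eps_hom[OF t s(1)] s c by simp
  have K2: "(if p = q then U.FM.SL.rr \<odot>\<^bsub>FG\<^esub> s else \<zero>\<^bsub>FG\<^esub>) \<in> ?K"
  using s by (auto simp: eps_smult eps0z U.FM.smult_closed)
  have "U.FM.SL.eop p q x = sect FG (?x \<oplus>\<^bsub>FG\<^esub> (if p = q then U.FM.SL.rr \<odot>\<^bsub>FG\<^esub> s else \<zero>\<^bsub>FG\<^esub>))"
  unfolding s(3) by (rule U.FM.SL.eop_sect[OF s(1)])
  thus "U.FM.SL.eop p q x \<in> sect FG ` ?K" using submodule_closed(1)[OF FG_module Ksub K1 K2] by blast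
 next
  show "U.FM.JJ \<inter> sect FG ` ?K <= {0}"
  proof
  fix x assume x: "x \<in> U.FM.JJ \<inter> sect FG ` ?K"
  then obtain s where s: "s \<in> carrier FG" "eps s = \<zero>" "x = sect FG s" by blast
  obtain s' where s': "s' \<in> U.FM.W" "x = sect FG s'" using x unfolding U.FM.J_W by blast
  have "s = s'" using sect_inj[OF FG_module s(1) U.FM.W_carrier[OF s'(1)]] s s' by simp
  then obtain u where u: "u \<in> W" "s = U.eta u" using U.eta_surj s'(1) by auto
  have "eps s = u" unfolding u(2) U.eta_def
  using eps_tens[OF u(1) U.bvb] SL.phi_basis[OF b] u(1) by (simp add: bv_def W_def res)
  hence "u = \<zero>" using s by simp
  hence "s = \<zero>\<^bsub>FG\<^esub>"
  proof -
  have z: "\<zero> \<in> carrier (fst GM)" using W_closed(1) by simp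
  have "\<zero> = GA.csm 0 \<zero>" using csm_W[OF W_closed(1), of 0] by simp
  hence "GA.tn \<zero> (bv b) = 0" using GA.tn_csm[OF z U.bvb, of 0] by simp
  hence "sect FG s = sect FG \<zero>\<^bsub>FG\<^esub>" unfolding u(2) \<open>u = \<zero>\<close> U.sect_eta by (simp add: sect_zero[OF FG_module])
  thus ?thesis using s(1) by (simp add: sect_inj[OF FG_module])
  qed
  thus "x \<in> {0}" using s(3) by (simp add: sect_zero[OF FG_module])
  qed
 qed
 hence K0: "s = \<zero>\<^bsub>FG\<^esub>" if "s \<in> carrier FG" "eps s = \<zero>" for s
  using that sect_inj[OF FG_module that(1) U.FM.zero_closed] by (auto simp: sect_zero[OF FG_module])
 have "inj_on eps (carrier FG)"
 proof (rule inj_onI)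
  fix s t assume st: "s \<in> carrier FG" "t \<in> carrier FG" "eps s = eps t"
  have "eps (s \<ominus>\<^bsub>FG\<^esub> t) = eps s \<ominus> eps t"
  using lhom_minus[OF _ _ _ lh st(1,2)] FG_module m submodule_self[OF FG_module] by simp
  hence "eps (s \<ominus>\<^bsub>FG\<^esub> t) = \<zero>" using st(3) eps_closed by (simp add: minus_eq r_neg)
  hence "s \<ominus>\<^bsub>FG\<^esub> t = \<zero>\<^bsub>FG\<^esub>" using K0 st U.FM.minus_closed by blast
  thus "s = t" using st minus_zero_iff[OF U.FM.abelian_group_axioms] by blast
 qed
 thus ?thesis using surj by (simp add: bij_betw_def)
qed

end

end

section \<open>Naturality\<close>

lemma lie_homD:
 assumes "h \<in> lie_hom L (N, \<rho>) (N', \<rho>')"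
 shows "h \<in> carrier N \<rightarrow>\<^sub>E carrier N'" "v \<in> carrier N ==> h v \<in> carrier N'"
  "u \<in> carrier N ==> v \<in> carrier N ==> h (u \<oplus>\<^bsub>N\<^esub> v) = h u \<oplus>\<^bsub>N'\<^esub> h v"
  "v \<in> carrier N ==> h (c \<odot>\<^bsub>N\<^esub> v) = c \<odot>\<^bsub>N'\<^esub> h v"
  "x \<in> carrier L ==> v \<in> carrier N ==> h (\<rho> x v) = \<rho>' x (h v)" using assms by (auto simp: lie_hom_def)

lemma lie_homI:
 assumes "h \<in> carrier N \<rightarrow>\<^sub>E carrier N'"
  "!!u v. u \<in> carrier N ==> v \<in> carrier N ==> h (u \<oplus>\<^bsub>N\<^esub> v) = h u \<oplus>\<^bsub>N'\<^esub> h v"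
  "!!c v. v \<in> carrier N ==> h (c \<odot>\<^bsub>N\<^esub> v) = c \<odot>\<^bsub>N'\<^esub> h v"
  "!!x v. x \<in> carrier L ==> v \<in> carrier N ==> h (\<rho> x v) = \<rho>' x (h v)"
 shows "h \<in> lie_hom L (N, \<rho>) (N', \<rho>')" using assms by (simp add: lie_hom_def)

lemma lie_hom_compose:
 assumes h: "h \<in> lie_hom L (N, \<rho>) (N', \<rho>')" and g: "g \<in> lie_hom L (N', \<rho>') (N'', \<rho>'')"
  and N: "lie_module L N \<rho>"
 shows "compose (carrier N) g h \<in> lie_hom L (N, \<rho>) (N'', \<rho>'')"
proof -
 interpret N: lie_module L N \<rho> by (rule N)
 note h' = lie_homD[OF h] and g' = lie_homD[OF g]
 show ?thesis by (rule lie_homI) (auto simp: compose_def h' g' N.act_closed)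
qed

context loop_mod
begin

text \<open>The weight vectors generate already over \<open>sl\<close>.\<close>

lemma hom_eq_on_W:
 assumes g: "g \<in> lie_hom loop_alg (N, \<rho>) (N', \<rho>')" and h: "h \<in> lie_hom loop_alg (N, \<rho>) (N', \<rho>')"
  and N': "lie_module loop_alg N' \<rho>'" and eq: "!!u. u \<in> W ==> g u = h u"
 shows "g = h"
proof -
 interpret N': lie_module loop_alg N' \<rho>' by (rule N')
 note g' = lie_homD[OF g] and h' = lie_homD[OF h]
 let ?U = "{v \<in> carrier N. g v = h v}"
 have "lie_submodule sl (N, %x. \<rho> (loop_tensor x 1)) ?U" unfolding lie_submodule_def prod.case
 proof (intro conjI ballI)
  have "\<zero> = 0 \<odot> \<zero>" by simp
  hence "g \<zero> = h \<zero>"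
  using g'(4)[of \<zero> 0] h'(4)[of \<zero> 0] N'.smult_l_null[OF g'(2)] N'.smult_l_null[OF h'(2)] by simp
  thus "submodule ?U CC N" by (intro submoduleI'[OF m]) (auto simp: g' h' smult_closed)
  fix x :: "complex ^ 'n ^ 'n" and u assume "x \<in> carrier sl" "u \<in> ?U"
  thus "\<rho> (loop_tensor x 1) u \<in> ?U" by (simp add: g' h' trace_loop_tensor act_closed)
 qed
 moreover have "wsp l (N, %x. \<rho> (loop_tensor x 1)) b <= ?U" using eq W_carrier by (auto simp: W_def res)
 ultimately have U: "?U = carrier N" by (rule SL.generated_by_wsp[OF b])
 show ?thesis
 proof (rule PiE_ext[OF g'(1) h'(1)])
  fix v assume "v \<in> carrier N"
  thus "g v = h v" using U by blast
 qed
qed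

end

text \<open>A homomorphism commutes with the operators that define the right module, hence restricts to a homomorphism of
right modules.\<close>

locale loop_hom = A: loop_mod N \<rho> l b z + B: loop_mod N' \<rho>' l b z
 for N :: "(complex, 'v) module" and \<rho> :: "('m::finite, 'n::finite) loop => 'v => 'v"
  and N' :: "(complex, 'u) module" and \<rho>' :: "('m, 'n) loop => 'u => 'u"
  and l :: nat and b :: "'n list" and z :: 'n +
 fixes h
 assumes h: "h \<in> lie_hom loop_alg (N, \<rho>) (N', \<rho>')"
begin

lemmas h' = lie_homD[OF h]

definition H :: "'v fvec => 'u fvec"
 where "H x = sect N' (h (ev N x))"

lemma H_add: "H (x + y) = H x + H y" by (simp add: H_def ev_add[OF A.m] ev_closed[OF A.m] h' sect_add[OF B.m])

lemma H_psc: "H (psc c x) = psc c (H x)" by (simp add: H_def ev_psc[OF A.m] ev_closed[OF A.m] h' sect_smult[OF B.m])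

lemma H_diff: "H (x - y) = H x - H y" using H_add[of "x - y" y] by simp

lemma H_zero: "H 0 = 0" using H_add[of 0 0] by simp

lemma H_sum: "H (\<Sum>i\<in>I. f i) = (\<Sum>i\<in>I. H (f i))"
 by (induction I rule: infinite_finite_induct) (auto simp: H_add H_zero)

lemma H_T: "trace x = 0 ==> H (A.T x y) = B.T x (H y)" by (simp add: H_def A.ev_T B.T_sect h' ev_closed[OF A.m])

lemma H_sect: "u \<in> carrier N ==> H (sect N u) = sect N' (h u)" by (simp add: H_def ev_sect[OF A.m])

lemma H_Z: "H (A.Z p q k y) = B.Z p q k (H y)"
 unfolding A.Z_def B.Z_def by (rule H_T) (rule trace_loop_tensor[OF trace_tl0])

lemma H_eop: "H (A.SL.eop p q y) = B.SL.eop p q (H y)"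
proof -
 have "H (A.Z p q 0 y + (if p = q then psc A.SL.rr y else 0)) =
  B.Z p q 0 (H y) + (if p = q then psc B.SL.rr (H y) else 0)" by (simp add: H_add H_Z H_psc H_zero)
 thus ?thesis by (simp only: A.LL.e_Z B.LL.e_Z)
qed

lemma H_gop: "H (A.gop g y) = B.gop g (H y)"
 by (cases g) (simp_all add: A.SL.G.sg_def B.SL.G.sg_def A.LL.Y_def B.LL.Y_def H_diff H_eop H_Z)

lemma H_wop: "H (A.wop us y) = B.wop us (H y)" by (induction us arbitrary: y) (simp_all add: A.wop_simps B.wop_simps H_gop)

lemma H_pact: "H (A.pact p y) = B.pact p (H y)" by (simp add: A.pact_def B.pact_def lsum_def H_sum H_psc H_wop)

lemma h_W:
 assumes u: "u \<in> A.W"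
 shows "h u \<in> B.W"
proof -
 have uc: "u \<in> carrier N" by (rule A.W_carrier[OF u])
 have "\<rho>' (loop_tensor (tl0 c c) 1) (h u) =
  ((if c \<in> set b then 1 else 0) - of_nat l / of_nat CARD('n)) \<odot>\<^bsub>N'\<^esub> h u" for c
 proof -
  have "\<rho> (loop_tensor (tl0 c c) 1) u = ((if c \<in> set b then 1 else 0) - of_nat l / of_nat CARD('n)) \<odot>\<^bsub>N\<^esub> u"
  using u unfolding A.W_def wsp_def A.res by simp
  hence "h (\<rho> (loop_tensor (tl0 c c) 1) u) =
  ((if c \<in> set b then 1 else 0) - of_nat l / of_nat CARD('n)) \<odot>\<^bsub>N'\<^esub> h u"
  by (simp only: h'(4)[OF uc])
  thus ?thesis using h'(5)[of "loop_tensor (tl0 c c) 1" u] uc by (simp add: trace_loop_tensor trace_tl0)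
 qed
 thus ?thesis unfolding B.W_def wsp_def B.res using h'(2)[OF uc] by simp
qed

lemma h_ract:
 assumes u: "u \<in> A.W" and a: "a \<in> carrier (Aff l)"
 shows "h (A.ract u a) = B.ract (h u) a"
proof -
 obtain p where p: "p \<in> FA l" "a = aff_class l p" using Aff_carrier[OF a] by blast
 have "sect N' (h (A.ract u a)) = H (A.pact p (sect N u))" unfolding p(2) A.sect_ract(1)[OF u p(1), symmetric]
  by (rule H_sect[symmetric]) (rule A.W_carrier[OF A.sect_ract(3)[OF u p(1)]])
 also have "... = sect N' (B.ract (h u) a)"
  unfolding H_pact H_sect[OF A.W_carrier[OF u]] p(2) B.sect_ract(1)[OF h_W[OF u] p(1)] ..
 finally show ?thesis
  using p h'(2)[OF A.W_carrier[OF A.sect_ract(3)[OF u p(1)]]] B.W_carrier[OF B.sect_ract(3)[OF h_W[OF u] p(1)]]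
  by (simp add: sect_inj[OF B.m])
qed

lemma restrict_hom: "restrict h A.W \<in> rmod_hom (Aff l) (A.Gring, A.ract) (B.Gring, B.ract)"
 unfolding rmod_hom_def prod.case using h_W h_ract A.W_closed(2) A.W_carrier A.Gring_right_module
 by (auto simp: h' right_module.ract_closed[OF A.Gring_right_module, simplified])

end

section \<open>The morphisms \<open>f \<otimes> 1\<close>\<close>

locale aff_hom = A: aff_unit l E b z + B: aff_unit l E' b z
 for l :: nat and E :: "('a, 'm::finite) affmod" and E' :: "('c, 'm) affmod"
  and b :: "'n::finite list" and z :: 'n +
 fixes f
 assumes f: "f \<in> rmod_hom (Aff l) E E'"
begin

lemma fD: "f \<in> carrier (fst E) \<rightarrow>\<^sub>E carrier (fst E')" "w \<in> carrier (fst E) ==> f w \<in> carrier (fst E')"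
  "w \<in> carrier (fst E) ==> w' \<in> carrier (fst E) ==> f (w \<oplus>\<^bsub>fst E\<^esub> w') = f w \<oplus>\<^bsub>fst E'\<^esub> f w'"
  "w \<in> carrier (fst E) ==> a \<in> carrier (Aff l) ==> f (snd E w a) = snd E' (f w) a"
 using f by (auto simp: rmod_hom_def case_prod_beta)

lemma f_wact: "w \<in> carrier (fst E) ==> vw l u ==> f (A.wact w u) = B.wact (f w) u"
 by (simp add: A.wact_def B.wact_def fD)

lemma f_csm: "w \<in> carrier (fst E) ==> f (A.csm c w) = B.csm c (f w)"
 by (simp add: A.csm_def B.csm_def fD free_alg_const)

lemma mor_ex: "EX g. (ALL x y. g (x + y) = g x + g y) & (ALL c x. g (psc c x) = psc c (g x)) &
  (ALL w:carrier (fst E). ALL v:carrier (tpow l :: (complex, 'n tensor) module). g (A.tn w v) = B.tn (f w) v)"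
 by (rule A.tens_ext)
  (simp_all add: fD f_wact f_csm B.tn_add_l B.tn_add_r B.tn_scale B.tn_csm B.tn_sig del: tpow_simps)

definition mor0 :: "('a, 'n) bal_tensor fvec => ('c, 'n) bal_tensor fvec"
 where "mor0 = (SOME g. (ALL x y. g (x + y) = g x + g y) & (ALL c x. g (psc c x) = psc c (g x)) &
  (ALL w:carrier (fst E). ALL v:carrier (tpow l :: (complex, 'n tensor) module). g (A.tn w v) = B.tn (f w) v))"

lemma mor0_add: "mor0 (x + y) = mor0 x + mor0 y"
 and mor0_psc: "mor0 (psc c x) = psc c (mor0 x)"
 and mor0_tn: "w \<in> carrier (fst E) ==> v \<in> TP l ==> mor0 (A.tn w v) = B.tn (f w) v"
 unfolding mor0_def using someI_ex[OF mor_ex] by blast+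

definition mor :: "('a, 'n) bal_tensor => ('c, 'n) bal_tensor"
 where "mor = (\<lambda>s\<in>carrier (F_space l E). ev (F_space l E') (mor0 (sect (F_space l E) s)))"

lemma mor_closed: "s \<in> carrier A.FSn ==> mor s \<in> carrier B.FSn" by (simp add: mor_def ev_closed[OF B.FS_module])

lemma mor_add: "s \<in> carrier A.FSn ==> t \<in> carrier A.FSn ==> mor (s \<oplus>\<^bsub>A.FSn\<^esub> t) = mor s \<oplus>\<^bsub>B.FSn\<^esub> mor t"
 by (simp add: mor_def sect_add[OF A.FS_module] mor0_add ev_add[OF B.FS_module])

lemma mor_smult: "s \<in> carrier A.FSn ==> mor (c \<odot>\<^bsub>A.FSn\<^esub> s) = c \<odot>\<^bsub>B.FSn\<^esub> mor s"
 by (simp add: mor_def sect_smult[OF A.FS_module] mor0_psc ev_psc[OF B.FS_module])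

lemma mor_tens:
 assumes "w \<in> carrier (fst E)" "v \<in> TP l"
 shows "mor (tens l E w v) = tens l E' (f w) v"
 using mor0_tn[OF assms] A.tens_closed[OF assms] ev_sect[OF B.FS_module B.tens_closed[OF fD(2)[OF assms(1)] assms(2)]]
 by (simp add: mor_def A.tn_def B.tn_def)

lemma sect_mor:
 assumes "s \<in> carrier A.FSn"
 shows "sect B.FSn (mor s) = mor0 (sect A.FSn s)" using assms
proof (induction s rule: A.FS_induct)
 case zero
 have "mor0 0 = 0" using mor0_add[of 0 0] by simp
 thus ?case by (simp add: mor_def sect_zero[OF A.FS_module] ev_zero[OF B.FS_module] sect_zero[OF B.FS_module])
next
 case (tens w v)
 thus ?case using mor_tens[OF tens] mor0_tn[OF tens] by (simp add: A.tn_def B.tn_def)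
next
 case (add s t)
 thus ?case by (simp add: mor_add mor_closed sect_add[OF A.FS_module] sect_add[OF B.FS_module] mor0_add)
qed

lemma F_mor_eq: "F_mor l E E' f = mor" unfolding F_mor_def
proof (rule the_equality)
 show "mor \<in> carrier A.FSn \<rightarrow>\<^sub>E carrier B.FSn &
  (ALL u:carrier A.FSn. ALL v:carrier A.FSn. mor (u \<oplus>\<^bsub>A.FSn\<^esub> v) = mor u \<oplus>\<^bsub>B.FSn\<^esub> mor v) &
  (ALL w:carrier (fst E). ALL v:TP l. mor (tens l E w v) = tens l E' (f w) v)"
  using mor_closed mor_add mor_tens by (auto simp: PiE_def mor_def extensional_def simp del: tpow_simps)
 fix g assume g: "g \<in> carrier A.FSn \<rightarrow>\<^sub>E carrier B.FSn &
  (ALL u:carrier A.FSn. ALL v:carrier A.FSn. g (u \<oplus>\<^bsub>A.FSn\<^esub> v) = g u \<oplus>\<^bsub>B.FSn\<^esub> g v) &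
  (ALL w:carrier (fst E). ALL v:TP l. g (tens l E w v) = tens l E' (f w) v)"
 have g1: "g \<in> carrier A.FSn \<rightarrow>\<^sub>E carrier B.FSn" using g by blast
 have m1: "mor \<in> carrier A.FSn \<rightarrow>\<^sub>E carrier B.FSn"
  using mor_closed by (auto simp: PiE_def mor_def extensional_def)
 show "g = mor"
 proof (rule PiE_ext[OF g1 m1])
  fix s assume "s \<in> carrier A.FSn"
  thus "g s = mor s"
  proof (induction s rule: A.FS_induct)
  case zero
  have "\<zero>\<^bsub>A.FSn\<^esub> = tens l E \<zero>\<^bsub>fst E\<^esub> (%a. 0)" using A.tens_null[OF A.R.M.zero_closed] by simp
  moreover have "(%a. 0) \<in> carrier (tpow l :: (complex, 'n tensor) module)" by simp
  ultimately show ?case using g mor_tens[OF A.R.M.zero_closed] A.R.M.zero_closed by metis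
  next
  case (tens w v)
  thus ?case using g mor_tens by metis
  next
  case (add s t)
  thus ?case using g mor_add by metis
  qed
 qed
qed

lemma mor_hom: "mor \<in> lie_hom loop_alg (A.FSn, A.rho0) (B.FSn, B.rho0)"
proof (rule lie_homI)
 show "mor \<in> carrier A.FSn \<rightarrow>\<^sub>E carrier B.FSn"
  using mor_closed by (auto simp: PiE_def mor_def extensional_def)
 fix x v assume x: "x \<in> carrier (loop_alg :: (complex, ('m, 'n) loop) module)" and v: "v \<in> carrier A.FSn"
 have tr: "trace x = 0" using x by simp
 show "mor (A.rho0 x v) = B.rho0 x (mor v)"
 proof (rule lie_hom_from_generators[OF A.rho_lie B.rho_lie A.two mor_closed mor_add mor_smult _ tr v])
  fix p q :: 'n and i :: 'm and a :: int and s assume pq: "p ~= q" and s: "s \<in> carrier A.FSn"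
  let ?X = "eL p q (tvar i a) :: ('m, 'n) loop"
  have t: "trace ?X = 0" using pq by (simp add: trace_eL)
  have eX: "?X = loop_tensor (eu p q) (pmono (axis i a) 1)" by (simp add: loop_tensor_eu tvar_def)
  have "mor0 (A.Rp ?X (A.tn w v)) = B.Rp ?X (mor0 (A.tn w v))"
  if w: "w \<in> carrier (fst E)" and v: "v \<in> carrier (tpow l :: (complex, 'n tensor) module)" for w v
  proof -
  have z: "mor0 0 = 0" using mor0_add[of 0 0] by simp
  have ms: "mor0 (\<Sum>i\<in>I. g i) = (\<Sum>i\<in>I. mor0 (g i))" for I :: "nat set" and g
  by (induction I rule: infinite_finite_induct) (auto simp: mor0_add z)
  have "mor0 (A.opb (eu p q) (axis i a) w v) = B.opb (eu p q) (axis i a) (f w) v" unfolding A.opb_def B.opb_def ms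
  by (intro sum.cong refl) (simp add: mor0_tn A.wact_ywd w slot_closed[OF v] f_wact ywd_vw del: tpow_simps)
  thus ?thesis unfolding eX A.Rp_tensor[OF w v] mor0_tn[OF w v] B.Rp_tensor[OF fD(2)[OF w] v] .
  qed
  hence "mor0 (A.Rp ?X (sect A.FSn s)) = B.Rp ?X (mor0 (sect A.FSn s))"
  by (intro A.lin_agree[where f = "%y. mor0 (A.Rp ?X y)" and g = "%y. B.Rp ?X (mor0 y)", OF _ _ _ s])
  (simp_all add: A.Rp_add B.Rp_add mor0_add del: tpow_simps)
  hence "sect B.FSn (mor (A.rho0 ?X s)) = sect B.FSn (B.rho0 ?X (mor s))"
  using s t A.FM.act_closed[of ?X s] by (simp add: sect_mor A.sect_rho0 B.sect_rho0 mor_closed)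
  thus "mor (A.rho0 ?X s) = B.rho0 ?X (mor s)" using s t A.FM.act_closed[of ?X s] B.FM.act_closed[of ?X "mor s"]
  by (simp add: sect_inj[OF B.FS_module] mor_closed)
 qed
qed (simp_all add: mor_add mor_smult)

lemma mor_eta: "w \<in> carrier (fst E) ==> mor (A.eta w) = B.eta (f w)"
 unfolding A.eta_def B.eta_def by (rule mor_tens[OF _ A.bvb])

lemma F_mor_hom: "F_mor l E E' f \<in> lie_hom loop_alg (F_obj l E) (F_obj l E' :: (('m, 'n) loop, ('c, 'n) bal_tensor) lmod)"
 unfolding F_mor_eq A.F_obj_eq[OF A.two] B.F_obj_eq[OF B.two] by (rule mor_hom)

lemma F_mor_eta: "w \<in> carrier (fst E) ==> F_mor l E E' f (A.eta w) = B.eta (f w)" unfolding F_mor_eq by (rule mor_eta)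

end

section \<open>The equivalence\<close>

lemma rmod_homI:
 assumes "f \<in> carrier (fst E) \<rightarrow>\<^sub>E carrier (fst E')"
  "!!u w. u \<in> carrier (fst E) ==> w \<in> carrier (fst E) ==> f (u \<oplus>\<^bsub>fst E\<^esub> w) = f u \<oplus>\<^bsub>fst E'\<^esub> f w"
  "!!w a. w \<in> carrier (fst E) ==> a \<in> carrier A ==> f (snd E w a) = snd E' (f w) a"
 shows "f \<in> rmod_hom A E E'" using assms by (simp add: rmod_hom_def case_prod_beta)

lemma rmod_homD:
 assumes "f \<in> rmod_hom A E E'"
 shows "f \<in> carrier (fst E) \<rightarrow>\<^sub>E carrier (fst E')" "w \<in> carrier (fst E) ==> f w \<in> carrier (fst E')"
  "u \<in> carrier (fst E) ==> w \<in> carrier (fst E) ==> f (u \<oplus>\<^bsub>fst E\<^esub> w) = f u \<oplus>\<^bsub>fst E'\<^esub> f w"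
  "w \<in> carrier (fst E) ==> a \<in> carrier A ==> f (snd E w a) = snd E' (f w) a"
 using assms by (auto simp: rmod_hom_def case_prod_beta)

lemma aff_cat_simps: "E \<in> Ob (aff_cat l) \<longleftrightarrow> right_module (Aff l) (fst E) (snd E)"
  "Hom (aff_cat l) = rmod_hom (Aff l)" "Ident (aff_cat l) E = (\<lambda>w\<in>carrier (fst E). w)"
  "Comp (aff_cat l) E E' E'' g f = compose (carrier (fst E)) g f" by (simp_all add: aff_cat_def case_prod_beta)

lemma loop_cat_simps: "P \<in> Ob loop_cat \<longleftrightarrow> lie_module loop_alg (fst P) (snd P)"
  "Hom loop_cat = lie_hom loop_alg" "Ident loop_cat P = (\<lambda>w\<in>carrier (fst P). w)"
  "Comp loop_cat P P' P'' g f = compose (carrier (fst P)) g f" by (simp_all add: loop_cat_def case_prod_beta)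

lemma loop_cat_level_simps: "P \<in> Ob (loop_cat_level l) ==> P \<in> Ob loop_cat"
  "Hom (loop_cat_level l) = lie_hom loop_alg" "Ident (loop_cat_level l) P = (\<lambda>w\<in>carrier (fst P). w)"
  "Comp (loop_cat_level l) P P' P'' g f = compose (carrier (fst P)) g f" by (simp_all add: loop_cat_level_def loop_cat_def)

text \<open>The quasi-inverse functor.\<close>

definition wt_mod :: "nat => 'n::finite list => 'n => (('m::finite, 'n) loop, 'v) lmod => ('v, 'm) affmod"
 where "wt_mod l b z P = (loop_mod.Gring (fst P) (snd P) l b, loop_mod.ract (fst P) (snd P) l b z)"

definition wt_mor :: "nat => 'n::finite list => 'n => (('m::finite, 'n) loop, 'v) lmod =>
  (('m, 'n) loop, 'v) lmod => ('v => 'v) => 'v => 'v"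
 where "wt_mor l b z P Q h = restrict h (carrier (fst (wt_mod l b z P)))"

locale level_setup =
 fixes l :: nat and b :: "'n::finite list" and z :: 'n
 assumes b: "distinct b" "length b = l" and z: "z \<notin> set b" and l0: "0 < l"
begin

abbreviation Fo :: "('x, 'm::finite) affmod => (('m, 'n) loop, ('x, 'n) bal_tensor) lmod"
 where "Fo \<equiv> F_obj l"

lemma aff_unitI: "E \<in> Ob (aff_cat l) ==> aff_unit l E b z"
 by (simp add: aff_unit_def affm_def aff_unit_axioms_def b z l0 aff_cat_simps)

lemma aff_homI: "E \<in> Ob (aff_cat l) ==> E' \<in> Ob (aff_cat l) ==> f \<in> rmod_hom (Aff l) E E' ==> aff_hom l E E' b z f"
 by (simp add: aff_hom_def aff_hom_axioms_def aff_unitI)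

lemma loop_modI:
 fixes P :: "(('m::finite, 'n) loop, 'v) lmod"
 assumes P: "P \<in> Ob (loop_cat_level l)"
 shows "loop_mod (fst P) (snd P) l b z"
proof -
 obtain N \<rho> where P_eq: "P = (N, \<rho>)" by (cases P)
 have N: "lie_module loop_alg N \<rho>" and lf: "locally_finite_dim sl (N, %x. \<rho> (loop_tensor x 1))"
  and cf: "!!S :: (complex ^ 'n ^ 'n, 'v set) lmod. composition_factor sl S (N, %x. \<rho> (loop_tensor x 1)) ==>
  composition_factor sl S (tpow l, tact l)"
  using P unfolding P_eq loop_cat_level_def loop_cat_def res_sl_def by (auto simp: nat_tensor_module)
 interpret S: sl_module N "%x. \<rho> (loop_tensor x 1)" l using res_sl_module[OF N] by (simp add: sl_module_def)
 have "level l (N, %x. \<rho> (loop_tensor x 1))" by (rule S.level_of_good) (rule S.all_good[OF lf cf])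
 thus ?thesis using N b z by (simp add: P_eq loop_mod_def loop_mod_axioms_def res_sl_def)
qed

lemma loop_homI:
 assumes "P \<in> Ob (loop_cat_level l)" "Q \<in> Ob (loop_cat_level l)" "h \<in> lie_hom loop_alg P Q"
 shows "loop_hom (fst P) (snd P) (fst Q) (snd Q) l b z h"
 using assms by (simp add: loop_hom_def loop_hom_axioms_def loop_modI)

lemma F_Ob_level:
 fixes E :: "('a, 'm::finite) affmod"
 assumes E: "E \<in> Ob (aff_cat l)"
 shows "(Fo E) \<in> Ob (loop_cat_level l)"
proof -
 interpret aff_unit l E b z by (rule aff_unitI[OF E])
 show ?thesis unfolding F_obj_eq[OF two] by (rule F_obj_level)
qed

text \<open>All identities between morphisms out of \<open>\<F>(M)\<close> are checked on the vectors \<open>w \<otimes> e\<^sub>b\<close>.\<close>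

lemma F_eq_on_eta:
 fixes E :: "('a, 'm::finite) affmod" and h :: "('a, 'n) bal_tensor => 'v"
 assumes E: "E \<in> Ob (aff_cat l)" and P: "lie_module loop_alg (fst P) (snd P)"
  and g: "g \<in> lie_hom loop_alg (Fo E) P"
  and h: "h \<in> lie_hom loop_alg (F_obj l E) P"
  and eq: "!!w. w \<in> carrier (fst E) ==> g (aff_unit.eta l E b w) = h (aff_unit.eta l E b w)"
 shows "g = h"
proof -
 interpret A: aff_unit l E b z by (rule aff_unitI[OF E])
 have eq': "g u = h u" if "u \<in> A.FM.W" for u using that eq unfolding A.eta_surj[symmetric] by auto
 have g': "g \<in> lie_hom loop_alg (A.FSn, A.rho0) (fst P, snd P)" and h': "h \<in> lie_hom loop_alg (A.FSn, A.rho0) (fst P, snd P)"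
  using g h by (simp_all add: A.F_obj_eq[OF A.two])
 show ?thesis by (rule A.FM.hom_eq_on_W[OF g' h' P eq'])
qed

lemma F_lie:
 fixes E :: "('a, 'm::finite) affmod"
 assumes E: "E \<in> Ob (aff_cat l)"
 shows "lie_module loop_alg (fst (F_obj l E)) (snd (Fo E))"
 using loop_cat_level_simps(1)[OF F_Ob_level[OF E]] by (simp add: loop_cat_simps)

lemma F_hom:
 fixes E :: "('a, 'm::finite) affmod" and E' :: "('c, 'm) affmod"
 assumes "E \<in> Ob (aff_cat l)" "E' \<in> Ob (aff_cat l)" "f \<in> rmod_hom (Aff l) E E'"
 shows "F_mor l E E' f \<in> lie_hom loop_alg (F_obj l E) (Fo E')" by (rule aff_hom.F_mor_hom[OF aff_homI[OF assms]])

lemma F_mor_on_eta: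
 fixes E :: "('a, 'm::finite) affmod" and E' :: "('c, 'm) affmod"
 assumes "E \<in> Ob (aff_cat l)" "E' \<in> Ob (aff_cat l)" "f \<in> rmod_hom (Aff l) E E'" "w \<in> carrier (fst E)"
 shows "F_mor l E E' f (aff_unit.eta l E b w) = aff_unit.eta l E' b (f w)"
 by (rule aff_hom.F_mor_eta[OF aff_homI[OF assms(1-3)] assms(4)])

lemma eta_in_F:
 fixes E :: "('a, 'm::finite) affmod"
 assumes E: "E \<in> Ob (aff_cat l)" and w: "w \<in> carrier (fst E)"
 shows "aff_unit.eta l E b w \<in> carrier (fst (Fo E))"
proof -
 interpret A: aff_unit l E b z by (rule aff_unitI[OF E])
 show ?thesis unfolding A.F_obj_eq[OF A.two] fst_conv by (rule A.eta_carrier[OF w])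
qed

lemma id_hom:
 assumes "lie_module L (fst P) (snd P)"
 shows "(\<lambda>v\<in>carrier (fst P). v) \<in> lie_hom L P P"
proof -
 interpret lie_module L "fst P" "snd P" by (rule assms)
 show ?thesis using lie_homI[of "\<lambda>v\<in>carrier (fst P). v" "fst P" "fst P" L "snd P" "snd P"]
  by (simp add: act_closed smult_closed)
qed

lemma F_ident:
 fixes E :: "('a, 'm::finite) affmod"
 assumes E: "E \<in> Ob (aff_cat l)"
 shows "F_mor l E E (\<lambda>w\<in>carrier (fst E). w) = (\<lambda>v\<in>carrier (fst (Fo E)). v)"
proof -
 have i: "(\<lambda>w\<in>carrier (fst E). w) \<in> rmod_hom (Aff l) E E"
 proof -
  interpret right_module "Aff l" "fst E" "snd E" using E by (simp add: aff_cat_simps)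
  show ?thesis by (rule rmod_homI) (auto simp: ract_closed)
 qed
 show ?thesis
 proof (rule F_eq_on_eta[OF E F_lie[OF E] F_hom[OF E E i] id_hom[OF F_lie[OF E]]])
  fix w assume w: "w \<in> carrier (fst E)"
  show "F_mor l E E (\<lambda>w\<in>carrier (fst E). w) (aff_unit.eta l E b w) =
  (\<lambda>v\<in>carrier (fst (Fo E)). v) (aff_unit.eta l E b w)" using F_mor_on_eta[OF E E i w] eta_in_F[OF E w] w by simp
 qed
qed

lemma rmod_hom_compose:
 assumes E: "right_module A (fst E) (snd E)" and f: "f \<in> rmod_hom A E E'" and g: "g \<in> rmod_hom A E' E''"
 shows "compose (carrier (fst E)) g f \<in> rmod_hom A E E''"
proof -
 interpret right_module A "fst E" "snd E" by (rule E)
 note f' = rmod_homD[OF f] and g' = rmod_homD[OF g]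
 show ?thesis by (rule rmod_homI) (auto simp: compose_def f' g' ract_closed)
qed

lemma F_comp:
 fixes E :: "('a, 'm::finite) affmod" and E' :: "('a, 'm) affmod" and E'' :: "('a, 'm) affmod"
 assumes E: "E \<in> Ob (aff_cat l)" "E' \<in> Ob (aff_cat l)" "E'' \<in> Ob (aff_cat l)"
  and f: "f \<in> rmod_hom (Aff l) E E'" and g: "g \<in> rmod_hom (Aff l) E' E''"
 shows "F_mor l E E'' (compose (carrier (fst E)) g f) =
  compose (carrier (fst (Fo E))) (F_mor l E' E'' g) (F_mor l E E' f)"
proof -
 have gf: "compose (carrier (fst E)) g f \<in> rmod_hom (Aff l) E E''"
  using E f g by (intro rmod_hom_compose) (auto simp: aff_cat_simps)
 have c: "compose (carrier (fst (F_obj l E))) (F_mor l E' E'' g) (F_mor l E E' f) \<in>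
  lie_hom loop_alg (F_obj l E) (Fo E'')"
  using lie_hom_compose[of "F_mor l E E' f" loop_alg "fst (F_obj l E)" "snd (F_obj l E)" "fst (F_obj l E')"
  "snd (F_obj l E')" "F_mor l E' E'' g" "fst (F_obj l E'')" "snd (F_obj l E'')"]
  F_hom[OF E(1,2) f] F_hom[OF E(2,3) g] F_lie[OF E(1)] by simp
 show ?thesis
 proof (rule F_eq_on_eta[OF E(1) F_lie[OF E(3)] F_hom[OF E(1,3) gf] c])
  fix w assume w: "w \<in> carrier (fst E)"
  show "F_mor l E E'' (compose (carrier (fst E)) g f) (aff_unit.eta l E b w) =
  compose (carrier (fst (Fo E))) (F_mor l E' E'' g) (F_mor l E E' f) (aff_unit.eta l E b w)"
  using F_mor_on_eta[OF E(1,3) gf w] F_mor_on_eta[OF E(1,2) f w] F_mor_on_eta[OF E(2,3) g rmod_homD(2)[OF f w]]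
  eta_in_F[OF E(1) w] w by (simp add: compose_def)
 qed
qed

text \<open>A homomorphism \<open>g\<close> preserves the weight spaces, which the unit identifies with the given right modules.\<close>

lemma F_full_faithful:
 fixes E :: "('a, 'm::finite) affmod" and E' :: "('c, 'm) affmod"
 assumes E: "E \<in> Ob (aff_cat l)" "E' \<in> Ob (aff_cat l)"
 shows "bij_betw (F_mor l E E') (rmod_hom (Aff l) E E')
  (lie_hom loop_alg (F_obj l E) (Fo E'))"
proof -
 interpret A: aff_unit l E b z by (rule aff_unitI[OF E(1)])
 interpret B: aff_unit l E' b z by (rule aff_unitI[OF E(2)])
 note Fe = F_mor_on_eta[OF E]
 have inj: "inj_on (F_mor l E E' :: _ => ('a, 'n) bal_tensor => ('c, 'n) bal_tensor) (rmod_hom (Aff l) E E')"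
 proof (rule inj_onI)
  fix f g assume f: "f \<in> rmod_hom (Aff l) E E'" and g: "g \<in> rmod_hom (Aff l) E E'"
  and eq: "(F_mor l E E' f :: ('a, 'n) bal_tensor => ('c, 'n) bal_tensor) = F_mor l E E' g"
  show "f = g"
  proof (rule PiE_ext[OF rmod_homD(1)[OF f] rmod_homD(1)[OF g]])
  fix w assume w: "w \<in> carrier (fst E)"
  have "B.eta (f w) = B.eta (g w)" using Fe[OF f w] Fe[OF g w] eq by simp
  thus "f w = g w" by (rule inj_onD[OF B.eta_inj _ rmod_homD(2)[OF f w] rmod_homD(2)[OF g w]])
  qed
 qed
 have surj: "EX f:rmod_hom (Aff l) E E'. F_mor l E E' f = g"
  if g: "g \<in> lie_hom loop_alg (F_obj l E) (Fo E')" for g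
 proof -
  have g': "g \<in> lie_hom loop_alg (A.FSn, A.rho0) (B.FSn, B.rho0)"
  using g by (simp add: A.F_obj_eq[OF A.two] B.F_obj_eq[OF B.two])
  interpret G: loop_hom A.FSn A.rho0 B.FSn B.rho0 l b z g
  using g' A.FM.loop_mod_axioms B.FM.loop_mod_axioms by (simp add: loop_hom_def loop_hom_axioms_def)
  define f where "f = (\<lambda>w\<in>carrier (fst E). inv_into (carrier (fst E')) B.eta (g (A.eta w)))"
  have im: "g (A.eta w) \<in> B.eta ` carrier (fst E')" if w: "w \<in> carrier (fst E)" for w
  unfolding B.eta_surj by (rule G.h_W[OF A.eta_W[OF w]])
  have fe: "B.eta (f w) = g (A.eta w)" and fc: "f w \<in> carrier (fst E')" if w: "w \<in> carrier (fst E)" for w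
  using f_inv_into_f[OF im[OF w]] inv_into_into[OF im[OF w]] w by (simp_all add: f_def)
  have f: "f \<in> rmod_hom (Aff l) E E'"
  proof (rule rmod_homI)
  show "f \<in> carrier (fst E) \<rightarrow>\<^sub>E carrier (fst E')" using fc by (auto simp: f_def PiE_def extensional_def)
  fix u w assume u: "u \<in> carrier (fst E)" and w: "w \<in> carrier (fst E)"
  have uw: "u \<oplus>\<^bsub>fst E\<^esub> w \<in> carrier (fst E)" using u w by simp
  have "B.eta (f (u \<oplus>\<^bsub>fst E\<^esub> w)) = B.eta (f u \<oplus>\<^bsub>fst E'\<^esub> f w)"
  unfolding fe[OF uw] A.eta_add[OF u w] B.eta_add[OF fc[OF u] fc[OF w]] fe[OF u] fe[OF w]
  by (rule G.h'(3)[OF A.eta_carrier[OF u] A.eta_carrier[OF w]])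
  thus "f (u \<oplus>\<^bsub>fst E\<^esub> w) = f u \<oplus>\<^bsub>fst E'\<^esub> f w"
  by (rule inj_onD[OF B.eta_inj _ fc[OF uw] B.R.M.add.m_closed[OF fc[OF u] fc[OF w]]])
  next
  fix w a assume w: "w \<in> carrier (fst E)" and a: "a \<in> carrier (Aff l :: 'm aff ring)"
  have wa: "snd E w a \<in> carrier (fst E)" by (rule A.R.ract_closed[OF w a])
  have "B.eta (f (snd E w a)) = g (A.FM.ract (A.eta w) a)" unfolding fe[OF wa] A.eta_ract[OF w a] ..
  also have "... = B.eta (snd E' (f w) a)"
  unfolding G.h_ract[OF A.eta_W[OF w] a] fe[OF w, symmetric] by (rule B.eta_ract[OF fc[OF w] a])
  finally show "f (snd E w a) = snd E' (f w) a" by (rule inj_onD[OF B.eta_inj _ fc[OF wa] B.R.ract_closed[OF fc[OF w] a]])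
  qed
  have "F_mor l E E' f = g" by (rule F_eq_on_eta[OF E(1) F_lie[OF E(2)] F_hom[OF E f] g]) (simp add: Fe[OF f] fe)
  thus ?thesis using f by blast
 qed
 show ?thesis unfolding bij_betw_def
 proof (intro conjI inj equalityI subsetI)
  fix g assume "g \<in> (F_mor l E E' :: _ => ('a, 'n) bal_tensor => ('c, 'n) bal_tensor) ` rmod_hom (Aff l) E E'"
  then obtain f where f: "f \<in> rmod_hom (Aff l) E E'" "g = F_mor l E E' f" by (rule imageE) simp
  show "g \<in> lie_hom loop_alg (F_obj l E) (Fo E')" unfolding f(2) by (rule F_hom[OF E f(1)])
 next
  fix g assume "g \<in> lie_hom loop_alg (F_obj l E) (Fo E')"
  from surj[OF this] show "g \<in> F_mor l E E' ` rmod_hom (Aff l) E E'" by (elim bexE) (rule image_eqI[OF sym])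
 qed
qed

abbreviation "Go \<equiv> wt_mod l b z"
abbreviation "Gm \<equiv> wt_mor l b z"

lemma Go_Ob:
 assumes P: "P \<in> Ob (loop_cat_level l)"
 shows "Go P \<in> Ob (aff_cat l)"
 using loop_mod.Gring_right_module[OF loop_modI[OF P]] by (simp add: wt_mod_def aff_cat_simps)

lemma Go_carrier:
 assumes P: "P \<in> Ob (loop_cat_level l)"
 shows "carrier (fst (Go P)) = loop_mod.W (fst P) (snd P) l b" "u \<in> carrier (fst (Go P)) ==> u \<in> carrier (fst P)"
 using loop_mod.Gring_simps(1)[OF loop_modI[OF P]] loop_mod.W_carrier[OF loop_modI[OF P], of u]
 by (simp_all add: wt_mod_def)

lemma Gm_hom:
 assumes "P \<in> Ob (loop_cat_level l)" "Q \<in> Ob (loop_cat_level l)" "h \<in> lie_hom loop_alg P Q"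
 shows "Gm P Q h \<in> rmod_hom (Aff l) (Go P) (Go Q)" "u \<in> carrier (fst (Go P)) ==> h u \<in> carrier (fst (Go Q))"
 using loop_hom.restrict_hom[OF loop_homI[OF assms]] loop_hom.h_W[OF loop_homI[OF assms], of u]
  Go_carrier(1)[OF assms(1)] Go_carrier(1)[OF assms(2)] by (simp_all add: wt_mor_def) (simp add: wt_mod_def)

lemma G_functor:
 "is_functor (loop_cat_level l :: ((('m::finite, 'n) loop, 'v) lmod, _) category)
  (aff_cat l :: (('v, 'm) affmod, _) category) Go Gm" unfolding is_functor_def loop_cat_level_simps aff_cat_simps(2,3,4)
proof (intro conjI ballI)
 fix P Q T :: "(('m, 'n) loop, 'v) lmod" and f g
 assume P: "P \<in> Ob (loop_cat_level l)"
 show "Go P \<in> Ob (aff_cat l)" by (rule Go_Ob[OF P])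
 show "Gm P P (\<lambda>w\<in>carrier (fst P). w) = (\<lambda>w\<in>carrier (fst (Go P)). w)"
  using Go_carrier(2)[OF P] by (auto simp: wt_mor_def fun_eq_iff)
 assume Q: "Q \<in> Ob (loop_cat_level l)" and f: "f \<in> lie_hom loop_alg P Q"
 show "Gm P Q f \<in> rmod_hom (Aff l) (Go P) (Go Q)" by (rule Gm_hom(1)[OF P Q f])
 show "Gm P T (compose (carrier (fst P)) g f) = compose (carrier (fst (Go P))) (Gm Q T g) (Gm P Q f)"
  using Go_carrier(2)[OF P] Gm_hom(2)[OF P Q f] by (auto simp: wt_mor_def compose_def fun_eq_iff)
qed

definition unit_at where "unit_at E = (\<lambda>w\<in>carrier (fst E). aff_unit.eta l E b w)"

definition counit_at where "counit_at P = (\<lambda>s\<in>carrier (F_space l (Go P)). loop_mod.eps (fst P) (snd P) l b z s)"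

lemma Go_F:
 fixes E :: "('a, 'm::finite) affmod"
 assumes E: "E \<in> Ob (aff_cat l)"
 shows "Go (Fo E) =
  (loop_mod.Gring (F_space l E) (affm.rho0 l E) l b, loop_mod.ract (F_space l E) (affm.rho0 l E) l b z)"
proof -
 interpret A: aff_unit l E b z by (rule aff_unitI[OF E])
 show ?thesis by (simp add: wt_mod_def A.F_obj_eq[OF A.two])
qed

lemma unit_iso:
 fixes E :: "('a, 'm::finite) affmod"
 assumes E: "E \<in> Ob (aff_cat l)"
 shows "unit_at E \<in> rmod_iso (Aff l) E (Go (Fo E))"
proof -
 interpret A: aff_unit l E b z by (rule aff_unitI[OF E])
 have "unit_at E \<in> rmod_hom (Aff l) E (A.FM.Gring, A.FM.ract)"
  by (rule rmod_homI) (auto simp: unit_at_def A.eta_W A.eta_add A.eta_ract A.R.ract_closed)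
 moreover have "bij_betw (unit_at E) (carrier (fst E)) A.FM.W"
  unfolding bij_betw_def unit_at_def using A.eta_inj A.eta_surj by (simp add: inj_on_restrict_eq image_restrict_eq)
 ultimately show ?thesis by (simp add: rmod_iso_def Go_F[OF E])
qed

lemma unit_natural:
 fixes E E' :: "('a, 'm::finite) affmod"
 assumes E: "E \<in> Ob (aff_cat l)" "E' \<in> Ob (aff_cat l)" and f: "f \<in> rmod_hom (Aff l) E E'"
 shows "compose (carrier (fst E)) (unit_at E') f =
  compose (carrier (fst E)) (Gm (Fo E) (F_obj l E') (F_mor l E E' f)) (unit_at E)"
proof -
 have "unit_at E w \<in> carrier (fst (Go (Fo E)))"
  if "w \<in> carrier (fst E)" for w using unit_iso[OF E(1)] that by (auto simp: rmod_iso_def dest: rmod_homD(2))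
 thus ?thesis using F_mor_on_eta[OF E f] rmod_homD(2)[OF f]
  by (auto simp: compose_def fun_eq_iff wt_mor_def) (auto simp: unit_at_def)
qed

lemma counit_iso:
 fixes P :: "(('m::finite, 'n) loop, 'v) lmod"
 assumes P: "P \<in> Ob (loop_cat_level l)"
 shows "counit_at P \<in> lie_iso loop_alg (F_obj l (Go P)) P"
proof -
 interpret N: loop_mod "fst P" "snd P" l b z by (rule loop_modI[OF P])
 interpret U: aff_unit l "Go P" b z by (rule aff_unitI[OF Go_Ob[OF P]])
 have G: "Go P = (N.Gring, N.ract)" by (simp add: wt_mod_def)
 have "counit_at P \<in> lie_hom loop_alg (F_space l (Go P), affm.rho0 l (Go P)) (fst P, snd P)"
 proof (rule lie_homI)
  show "counit_at P \<in> carrier (F_space l (Go P)) \<rightarrow>\<^sub>E carrier (fst P)"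
  using N.eps_closed by (simp add: counit_at_def)
  fix u v :: "('v, 'n) bal_tensor" assume "u \<in> carrier (F_space l (Go P))" "v \<in> carrier (F_space l (Go P))"
  thus "counit_at P (u \<oplus>\<^bsub>F_space l (Go P)\<^esub> v) = counit_at P u \<oplus>\<^bsub>fst P\<^esub> counit_at P v"
  using N.eps_add[of u v] U.FM.add.m_closed[of u v] by (simp add: counit_at_def G)
 next
  fix c and v :: "('v, 'n) bal_tensor" assume "v \<in> carrier (F_space l (Go P))"
  thus "counit_at P (c \<odot>\<^bsub>F_space l (Go P)\<^esub> v) = c \<odot>\<^bsub>fst P\<^esub> counit_at P v"
  using N.eps_smult[of v c] U.FM.smult_closed[of c v] by (simp add: counit_at_def G)
 next
  fix x :: "('m, 'n) loop" and v :: "('v, 'n) bal_tensor" assume "x \<in> carrier loop_alg" "v \<in> carrier (F_space l (Go P))"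
  thus "counit_at P (affm.rho0 l (Go P) x v) = snd P x (counit_at P v)"
  using N.eps_hom[OF l0, of x v] U.FM.act_closed[of x v] by (simp add: counit_at_def G)
 qed
 moreover have "bij_betw (counit_at P) (carrier (F_space l (Go P))) (carrier (fst P))"
  using N.eps_bij[OF l0] bij_betw_cong[of "carrier (F_space l (Go P))" "counit_at P" N.eps "carrier (fst P)"]
  by (simp add: counit_at_def G)
 ultimately show ?thesis by (simp add: lie_iso_def U.F_obj_eq[OF U.two])
qed

lemma counit_eta:
 fixes P :: "(('m::finite, 'n) loop, 'v) lmod"
 assumes P: "P \<in> Ob (loop_cat_level l)" and u: "u \<in> carrier (fst (Go P))"
 shows "counit_at P (aff_unit.eta l (Go P) b u) = u"
proof -
 interpret N: loop_mod "fst P" "snd P" l b z by (rule loop_modI[OF P])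
 interpret U: aff_unit l "Go P" b z by (rule aff_unitI[OF Go_Ob[OF P]])
 have G: "Go P = (N.Gring, N.ract)" by (simp add: wt_mod_def)
 have uW: "u \<in> N.W" using u by (simp add: G)
 have "counit_at P (U.eta u) = N.eps (U.eta u)" using U.eta_carrier[OF u] by (simp add: counit_at_def)
 also have "... = N.SL.phi b u (bv b)" unfolding U.eta_def unfolding G by (rule N.eps_tens[OF uW U.bvb])
 also have "... = u" using N.SL.phi_basis[OF b, of u] uW unfolding N.W_def N.res bv_def by simp
 finally show ?thesis .
qed

lemma counit_natural:
 fixes P Q :: "(('m::finite, 'n) loop, 'v) lmod"
 assumes P: "P \<in> Ob (loop_cat_level l)" "Q \<in> Ob (loop_cat_level l)" and h: "h \<in> lie_hom loop_alg P Q"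
 shows "compose (carrier (fst (Fo (Go P)))) (counit_at Q) (F_mor l (Go P) (Go Q) (Gm P Q h)) =
  compose (carrier (fst (Fo (Go P)))) h (counit_at P)"
proof -
 note G = Go_Ob[OF P(1)] Go_Ob[OF P(2)] and g = Gm_hom[OF P h]
 have lP: "lie_module loop_alg (fst P) (snd P)" "lie_module loop_alg (fst Q) (snd Q)"
  using loop_cat_level_simps(1)[OF P(1)] loop_cat_level_simps(1)[OF P(2)] by (simp_all add: loop_cat_simps)
 let ?F = "Fo (Go P)"
 let ?F' = "Fo (Go Q)"
 have cP: "counit_at P \<in> lie_hom loop_alg ?F P" and cQ: "counit_at Q \<in> lie_hom loop_alg ?F' Q"
  using counit_iso[OF P(1)] counit_iso[OF P(2)] by (simp_all add: lie_iso_def)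
 have 1: "compose (carrier (fst ?F)) (counit_at Q) (F_mor l (Go P) (Go Q) (Gm P Q h)) \<in> lie_hom loop_alg ?F Q"
  using lie_hom_compose[of "F_mor l (Go P) (Go Q) (Gm P Q h)" loop_alg "fst ?F" "snd ?F" "fst ?F'" "snd ?F'" "counit_at Q" "fst Q" "snd Q"]
  F_hom[OF G g(1)] cQ F_lie[OF G(1)] by simp
 have 2: "compose (carrier (fst ?F)) h (counit_at P) \<in> lie_hom loop_alg ?F Q"
  using lie_hom_compose[of "counit_at P" loop_alg "fst ?F" "snd ?F" "fst P" "snd P" h "fst Q" "snd Q"]
  cP h F_lie[OF G(1)] by simp
 show ?thesis
 proof (rule F_eq_on_eta[OF G(1) lP(2) 1 2])
  fix u assume u: "u \<in> carrier (fst (Go P))"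
  have "Gm P Q h u = h u" using u by (simp add: wt_mor_def)
  thus "compose (carrier (fst ?F)) (counit_at Q) (F_mor l (Go P) (Go Q) (Gm P Q h)) (aff_unit.eta l (Go P) b u) =
  compose (carrier (fst ?F)) h (counit_at P) (aff_unit.eta l (Go P) b u)"
  using eta_in_F[OF G(1) u] F_mor_on_eta[OF G g(1) u] counit_eta[OF P(1) u] counit_eta[OF P(2) g(2)[OF u]]
  by (simp add: compose_def)
 qed
qed

end

theorem theorem13:
  fixes l m n :: nat
  assumes "CARD('m::finite) = m" and "CARD('n::finite) = n + 1"
    and "1 \<le> l" and "1 \<le> m" and "l \<le> n"
  shows
    "(\<forall>M :: ('a, 'm) affmod. right_module (Aff l) (fst M) (snd M) \<longrightarrow>
        (\<exists>!\<rho> :: ('m, 'n) loop \<Rightarrow> ('a, 'n) bal_tensor \<Rightarrow> ('a, 'n) bal_tensor.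
          loop_structure l M \<rho>)) \<and>
     is_functor (aff_cat l :: (('a, 'm) affmod, _) category)
        (loop_cat :: ((('m, 'n) loop, ('a, 'n) bal_tensor) lmod, _) category)
        (F_obj l) (F_mor l) \<and>
     fully_faithful (aff_cat l :: (('a, 'm) affmod, _) category)
        (loop_cat :: ((('m, 'n) loop, ('a, 'n) bal_tensor) lmod, _) category)
        (F_obj l) (F_mor l) \<and>
     is_functor (aff_cat l :: (('a, 'm) affmod, _) category)
        (loop_cat_level l :: ((('m, 'n) loop, ('a, 'n) bal_tensor) lmod, _) category)
        (F_obj l) (F_mor l) \<and>
     (\<forall>N \<in> Ob (loop_cat_level l :: ((('m, 'n) loop, 'c) lmod, _) category).
        \<exists>M \<in> Ob (aff_cat l :: (('c, 'm) affmod, _) category).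
          lie_iso loop_alg (F_obj l M) N \<noteq> {}) \<and>
     (\<exists>Go Gm \<eta> \<epsilon>.
        is_functor
          (loop_cat_level l :: ((('m, 'n) loop, ('a, 'n) bal_tensor) lmod, _) category)
          (aff_cat l :: ((('a, 'n) bal_tensor, 'm) affmod, _) category) Go Gm \<and>
        (\<forall>M \<in> Ob (aff_cat l :: (('a, 'm) affmod, _) category).
          \<eta> M \<in> rmod_iso (Aff l) M (Go (F_obj l M))) \<and>
        (\<forall>M \<in> Ob (aff_cat l). \<forall>M' \<in> Ob (aff_cat l). \<forall>f \<in> Hom (aff_cat l) M M'.
          compose (carrier (fst M)) (\<eta> M') f =
          compose (carrier (fst M)) (Gm (F_obj l M) (F_obj l M') (F_mor l M M' f)) (\<eta> M)) \<and>
        (\<forall>N \<in> Ob (loop_cat_level l). \<epsilon> N \<in> lie_iso loop_alg (F_obj l (Go N)) N) \<and>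
        (\<forall>N \<in> Ob (loop_cat_level l). \<forall>N' \<in> Ob (loop_cat_level l).
          \<forall>h \<in> Hom (loop_cat_level l) N N'.
          compose (carrier (fst (F_obj l (Go N)))) (\<epsilon> N') (F_mor l (Go N) (Go N') (Gm N N' h)) =
          compose (carrier (fst (F_obj l (Go N)))) h (\<epsilon> N)))"
proof -
 have "\<exists>b :: 'n list. \<exists>z. distinct b & length b = l & z \<notin> set b"
 proof -
  obtain xs :: "'n list" where xs: "set xs = UNIV" "distinct xs" using finite_distinct_list[of "UNIV :: 'n set"] by auto
  have len: "length xs = n + 1" using distinct_card[OF xs(2)] xs(1) assms(2) by simp
  have "xs ! l \<notin> set (take l xs)" using xs(2) len assms(5) by (auto simp: in_set_conv_nth nth_eq_iff_index_eq)
  thus ?thesis using xs(2) len assms(5) by (intro exI[of _ "take l xs"] exI[of _ "xs ! l"]) auto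
 qed
 then obtain b :: "'n list" and z where bz: "distinct b" "length b = l" "z \<notin> set b" by blast
 interpret level_setup l b z using bz assms(3) by unfold_locales auto
 note simps = aff_cat_simps(2-) loop_cat_simps(2-) loop_cat_level_simps(2-)
 have a: "\<exists>!\<rho> :: ('m, 'n) loop => ('a, 'n) bal_tensor => ('a, 'n) bal_tensor. loop_structure l E \<rho>"
  if "right_module (Aff l) (fst E) (snd E)" for E :: "('a, 'm) affmod"
 proof -
  interpret A: aff_unit l E b z using that by (intro aff_unitI) (simp add: aff_cat_simps)
  show ?thesis using A.rho0_structure A.loop_structure_unique[OF A.two] by blast
 qed
 have F: "is_functor (aff_cat l :: (('a, 'm) affmod, _) category) D
  (F_obj l :: _ => (('m, 'n) loop, ('a, 'n) bal_tensor) lmod) (F_mor l)"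
  if D: "!!E :: ('a, 'm) affmod. E \<in> Ob (aff_cat l) ==> (F_obj l E :: (('m, 'n) loop, ('a, 'n) bal_tensor) lmod) \<in> Ob D"
  "Hom D = lie_hom loop_alg" "!!P. Ident D P = (\<lambda>w\<in>carrier (fst P). w)"
  "!!P P' P'' g f. Comp D P P' P'' g f = compose (carrier (fst P)) g f"
  for D :: "((('m, 'n) loop, ('a, 'n) bal_tensor) lmod, _) category" unfolding is_functor_def D(2,3,4) aff_cat_simps(2-)
  by (intro conjI ballI D(1) F_hom F_ident F_comp)
 have F1: "is_functor (aff_cat l :: (('a, 'm) affmod, _) category)
  (loop_cat :: ((('m, 'n) loop, ('a, 'n) bal_tensor) lmod, _) category) (F_obj l) (F_mor l)"
  by (rule F) (auto intro: loop_cat_level_simps(1)[OF F_Ob_level] simp: simps)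
 have F2: "is_functor (aff_cat l :: (('a, 'm) affmod, _) category)
  (loop_cat_level l :: ((('m, 'n) loop, ('a, 'n) bal_tensor) lmod, _) category) (F_obj l) (F_mor l)"
  by (rule F) (auto intro: F_Ob_level simp: simps)
 have ff: "fully_faithful (aff_cat l :: (('a, 'm) affmod, _) category)
  (loop_cat :: ((('m, 'n) loop, ('a, 'n) bal_tensor) lmod, _) category) (F_obj l) (F_mor l)"
  unfolding fully_faithful_def simps by (intro ballI F_full_faithful)
 have es: "\<exists>M \<in> Ob (aff_cat l :: (('c, 'm) affmod, _) category). lie_iso loop_alg (F_obj l M) P ~= {}"
  if P: "P \<in> Ob (loop_cat_level l :: ((('m, 'n) loop, 'c) lmod, _) category)" for P
  using Go_Ob[OF P] counit_iso[OF P] by blast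
 show ?thesis
 proof (intro conjI)
  show "\<forall>M :: ('a, 'm) affmod. right_module (Aff l) (fst M) (snd M) -->
  (\<exists>!\<rho> :: ('m, 'n) loop => ('a, 'n) bal_tensor => ('a, 'n) bal_tensor. loop_structure l M \<rho>)"
  by (intro allI impI a)
  show "\<forall>N \<in> Ob (loop_cat_level l :: ((('m, 'n) loop, 'c) lmod, _) category).
  \<exists>M \<in> Ob (aff_cat l :: (('c, 'm) affmod, _) category). lie_iso loop_alg (F_obj l M) N ~= {}"
  by (intro ballI es)
 qed (rule F1 ff F2, rule F1 ff F2, rule F1 ff F2, rule exI[of _ Go], rule exI[of _ Gm],
  rule exI[of _ unit_at], rule exI[of _ counit_at], intro conjI ballI,
  rule G_functor,
  rule unit_iso, assumption,
  rule unit_natural, assumption, assumption, simp only: aff_cat_simps(2),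
  rule counit_iso, assumption,
  rule counit_natural, assumption, assumption, simp only: loop_cat_level_simps(2))
qed

end
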